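(* Suppose that $b:\mathbb{R}^n\times\mathbb{R}^n\to\mathbb{R}^n$ and $\sigma:\mathbb{R}^n\times\mathbb{R}^n\to\mathbb{R}^{n\times m}$ satisfy the following, for some constants $L_1,L_2>0$ and some functions $V_1,V_2:\mathbb{R}^n\times\mathbb{R}^n\to\mathbb{R}_+$: for all $x_1,x_2,y_1,y_2\in\mathbb{R}^n$, $$|b(x_1,y_1)-b(x_2,y_2)|\le L_1|x_1-x_2|+V_1(y_1,y_2)|y_1-y_2|,$$ $$\|\sigma(x_1,y_1)-\sigma(x_2,y_2)\|\le L_2|x_1-x_2|+V_2(y_1,y_2)|y_1-y_2|,$$ where, for $i=1,2$, there are $K_i>0$, $q_i\ge1$ with $V_i(x,y)\le K_i(1+|x|^{q_i}+|y|^{q_i})$ for all $x,y\in\mathbb{R}^n$. Let $\xi\in C^b_{\mathcal{F}_0}([-\tau,0];\mathbb{R}^n)$, let $X$ be the solution of $$dX(t)=b(X(t),X(t-\tau))\,dt+\sigma(X(t),X(t-\tau))\,dW(t),\quad t\in[0,T],\qquad X(\theta)=\xi(\theta),\ \theta\in[-\tau,0],$$ and let $Y$ be the continuous Euler-Maruyama scheme with stepsize $\triangle$. Then for any $p\ge2$ there exists $C>0$, independent of $\triangle$, such that $$\mathbb{E}\Big(\sup_{0\le s\le T}|X(s)-Y(s)|^p\Big)\le C\triangle^{p/2},$$ that is, the rate of convergence of the Euler-Maruyama scheme is $\frac12$.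
   Context: $T>0$ and $\tau>0$ are fixed. $W(t)$ is an $m$-dimensional Brownian motion on a complete filtered probability space $(\Omega,\mathcal{F},\mathbb{P},\{\mathcal{F}_t\}_{t\ge0})$. $|\cdot|$ is the Euclidean norm on $\mathbb{R}^n$ and $\|A\|=\sqrt{\mathrm{trace}(A^*A)}$ is the Hilbert-Schmidt norm. $C^b_{\mathcal{F}_0}([-\tau,0];\mathbb{R}^n)$ denotes the family of bounded, $\mathcal{F}_0$-measurable random variables with values in $C([-\tau,0];\mathbb{R}^n)$. Under the stated hypotheses the delay equation has a unique global strong solution on $[0,T]$. Stepsize: $\triangle=\tau/N=T/M\in(0,1)$ for (sufficiently large) integers $N,M>0$; it is assumed that such integers exist. Euler-Maruyama scheme: $Y(\theta)=\bar Y(\theta)=\xi(\theta)$ for $\theta\in[-\tau,0]$, and for $t\in[0,T]$ $$dY(t)=b(\bar Y(t),\bar Y(t-\tau))\,dt+\sigma(\bar Y(t),\bar Y(t-\tau))\,dW(t),$$ where $\bar Y(t):=Y(k\triangle)$ for $t\in[k\triangle,(k+1)\triangle)$, $k=0,1,\dots,M-1$. *)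

theory Defs
  imports "HOL-Probability.Probability"
begin

text \<open>
  The library has no Brownian motion and no stochastic integral; both are introduced here in the
  generality needed for stochastic delay equations on a finite horizon \<open>[0, T]\<close>.
  Filtrations are indexed by \<open>real\<close>; only the \<open>\<sigma>\<close>-algebras \<open>F t\<close> with \<open>t \<ge> 0\<close> ever matter, and any
  filtration on \<open>[0, \<infinity>)\<close> extends to negative indices by \<open>F 0\<close>.
\<close>

locale complete_filtered_prob_space =
  prob_space M + complete_measure M + filtration "space M" F
  for M :: "'a measure" and F :: "real \<Rightarrow> 'a measure" +
  assumes subalgebra_F: "\<And>t. subalgebra M (F t)"
    and null_sets_F: "null_sets M \<subseteq> sets (F 0)"

text \<open>
  The last two assumptions say that \<open>W t - W s\<close> is independent of \<open>F s\<close> and is centred Gaussian with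
  covariance matrix \<open>(t - s)\<close> times the identity.
\<close>

locale brownian_motion = complete_filtered_prob_space M F
  for M :: "'a measure" and F :: "real \<Rightarrow> 'a measure" +
  fixes W :: "real \<Rightarrow> 'a \<Rightarrow> real ^ 'm"
  assumes adapted_W: "\<And>t. 0 \<le> t \<Longrightarrow> W t \<in> borel_measurable (F t)"
    and W_0: "AE \<omega> in M. W 0 \<omega> = 0"
    and continuous_W: "AE \<omega> in M. continuous_on {0..} (\<lambda>t. W t \<omega>)"
    and indep_increments: "\<And>s t. 0 \<le> s \<Longrightarrow> s < t \<Longrightarrow>
      indep_set (sets (F s)) (sets (vimage_algebra (space M) (\<lambda>\<omega>. W t \<omega> - W s \<omega>) borel))"
    and indep_components: "\<And>s t. 0 \<le> s \<Longrightarrow> s < t \<Longrightarrow>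
      indep_vars (\<lambda>_. borel) (\<lambda>i \<omega>. (W t \<omega> - W s \<omega>) $ i) UNIV"
    and normal_increments: "\<And>s t i. 0 \<le> s \<Longrightarrow> s < t \<Longrightarrow>
      distributed M lborel (\<lambda>\<omega>. (W t \<omega> - W s \<omega>) $ i) (normal_density 0 (sqrt (t - s)))"

definition hs_norm :: "real ^ 'm ^ 'n \<Rightarrow> real" where
  "hs_norm A = sqrt (trace (transpose A ** A))"

definition tendsto_zero_in_prob :: "'a measure \<Rightarrow> (nat \<Rightarrow> 'a \<Rightarrow> ennreal) \<Rightarrow> bool" where
  "tendsto_zero_in_prob M Z \<longleftrightarrow>
     (\<forall>j. Z j \<in> borel_measurable M) \<and>
     (\<forall>\<epsilon>>0. (\<lambda>j. measure M {\<omega> \<in> space M. ennreal \<epsilon> < Z j \<omega>}) \<longlonglongrightarrow> 0)"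

definition progressively_measurable ::
  "(real \<Rightarrow> 'a measure) \<Rightarrow> real \<Rightarrow> (real \<Rightarrow> 'a \<Rightarrow> 'b :: topological_space) \<Rightarrow> bool" where
  "progressively_measurable F T H \<longleftrightarrow>
     (\<forall>t\<in>{0..T}. (\<lambda>(s, \<omega>). H s \<omega>) \<in> borel_measurable (restrict_space borel {0..t} \<Otimes>\<^sub>M F t))"

text \<open>
  An elementary integrand is given by a partition \<open>0 = u 0 < \<dots> < u k = T\<close> and bounded
  \<open>F (u i)\<close>-measurable matrices \<open>h i\<close>; it takes the value \<open>h i\<close> on \<open>(u i, u (i + 1)]\<close>.
\<close>

definition elementary_integrand :: "'a measure \<Rightarrow> (real \<Rightarrow> 'a measure) \<Rightarrow> real \<Rightarrow>
    nat \<Rightarrow> (nat \<Rightarrow> real) \<Rightarrow> (nat \<Rightarrow> 'a \<Rightarrow> real ^ 'm ^ 'n) \<Rightarrow> bool" where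
  "elementary_integrand M F T k u h \<longleftrightarrow>
     u 0 = 0 \<and> u k = T \<and> (\<forall>i<k. u i < u (Suc i)) \<and>
     (\<forall>i<k. h i \<in> borel_measurable (F (u i)) \<and> bounded (h i ` space M))"

definition elementary_process ::
  "nat \<Rightarrow> (nat \<Rightarrow> real) \<Rightarrow> (nat \<Rightarrow> 'a \<Rightarrow> real ^ 'm ^ 'n) \<Rightarrow> real \<Rightarrow> 'a \<Rightarrow> real ^ 'm ^ 'n" where
  "elementary_process k u h t \<omega> = (\<Sum>i<k. indicator {u i<..u (Suc i)} t *\<^sub>R h i \<omega>)"

definition elementary_integral :: "(real \<Rightarrow> 'a \<Rightarrow> real ^ 'm) \<Rightarrow>
    nat \<Rightarrow> (nat \<Rightarrow> real) \<Rightarrow> (nat \<Rightarrow> 'a \<Rightarrow> real ^ 'm ^ 'n) \<Rightarrow> real \<Rightarrow> 'a \<Rightarrow> real ^ 'n" where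
  "elementary_integral W k u h t \<omega> =
     (\<Sum>i<k. h i \<omega> *v (W (min (u (Suc i)) t) \<omega> - W (min (u i) t) \<omega>))"

text \<open>
  \<open>I\<close> is a version of the Ito integral process \<open>t \<mapsto> \<integral>\<^sub>0\<^sup>t H dW\<close> on \<open>[0, T]\<close>, for progressively
  measurable \<open>H\<close> with almost surely square-integrable paths: the continuous adapted process obtained
  as the limit, uniformly on \<open>[0, T]\<close> in probability, of the integrals of elementary integrands
  which converge to \<open>H\<close> in \<open>L\<^sup>2([0, T])\<close> in probability.  Formulating it as a relation reflects that
  the integral is determined only up to indistinguishability.
\<close>

definition has_ito_integral :: "'a measure \<Rightarrow> (real \<Rightarrow> 'a measure) \<Rightarrow> (real \<Rightarrow> 'a \<Rightarrow> real ^ 'm) \<Rightarrow> real \<Rightarrow>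
    (real \<Rightarrow> 'a \<Rightarrow> real ^ 'm ^ 'n) \<Rightarrow> (real \<Rightarrow> 'a \<Rightarrow> real ^ 'n) \<Rightarrow> bool" where
  "has_ito_integral M F W T H I \<longleftrightarrow>
     progressively_measurable F T H \<and>
     (AE \<omega> in M. (\<integral>\<^sup>+s\<in>{0..T}. ennreal ((hs_norm (H s \<omega>))\<^sup>2) \<partial>lborel) < \<infinity>) \<and>
     (\<forall>t\<in>{0..T}. I t \<in> borel_measurable (F t)) \<and>
     (AE \<omega> in M. continuous_on {0..T} (\<lambda>t. I t \<omega>)) \<and>
     (\<exists>k u h. (\<forall>j. elementary_integrand M F T (k j) (u j) (h j)) \<and>
        tendsto_zero_in_prob M (\<lambda>j \<omega>. \<integral>\<^sup>+s\<in>{0..T}.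
          ennreal ((hs_norm (elementary_process (k j) (u j) (h j) s \<omega> - H s \<omega>))\<^sup>2) \<partial>lborel) \<and>
        tendsto_zero_in_prob M (\<lambda>j \<omega>. SUP t\<in>{0..T}.
          ennreal (norm (elementary_integral W (k j) (u j) (h j) t \<omega> - I t \<omega>))))"

text \<open>
  \<open>dZ(t) = f(t) dt + H(t) dW(t)\<close> on \<open>[0, T]\<close> with \<open>Z(\<theta>) = \<xi>(\<theta>)\<close> on \<open>[-\<tau>, 0]\<close>, where \<open>Z\<close> is a
  continuous process that is \<open>F 0\<close>-measurable on \<open>[-\<tau>, 0]\<close> and adapted on \<open>[0, T]\<close>.
\<close>

definition ito_process :: "'a measure \<Rightarrow> (real \<Rightarrow> 'a measure) \<Rightarrow> (real \<Rightarrow> 'a \<Rightarrow> real ^ 'm) \<Rightarrow>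
    real \<Rightarrow> real \<Rightarrow> (real \<Rightarrow> 'a \<Rightarrow> real ^ 'n) \<Rightarrow> (real \<Rightarrow> 'a \<Rightarrow> real ^ 'n) \<Rightarrow>
    (real \<Rightarrow> 'a \<Rightarrow> real ^ 'm ^ 'n) \<Rightarrow> (real \<Rightarrow> 'a \<Rightarrow> real ^ 'n) \<Rightarrow> bool" where
  "ito_process M F W \<tau> T \<xi> f H Z \<longleftrightarrow>
     (\<forall>t\<in>{-\<tau>..T}. Z t \<in> borel_measurable (F (max 0 t))) \<and>
     (AE \<omega> in M. continuous_on {-\<tau>..T} (\<lambda>t. Z t \<omega>)) \<and>
     (AE \<omega> in M. \<forall>\<theta>\<in>{-\<tau>..0}. Z \<theta> \<omega> = \<xi> \<theta> \<omega>) \<and>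
     (AE \<omega> in M. set_integrable lborel {0..T} (\<lambda>s. f s \<omega>)) \<and>
     (\<exists>I. has_ito_integral M F W T H I \<and>
        (AE \<omega> in M. \<forall>t\<in>{0..T}.
           Z t \<omega> = \<xi> 0 \<omega> + (LINT s:{0..t}|lborel. f s \<omega>) + I t \<omega>))"

text \<open>The class \<open>C\<^sup>b\<^bsub>F 0\<^esub>([-\<tau>, 0]; \<real>\<^sup>n)\<close>.  Since the Borel \<open>\<sigma>\<close>-algebra of \<open>C([-\<tau>, 0]; \<real>\<^sup>n)\<close> with the
  supremum norm is generated by the point evaluations, measurability is required pointwise in \<open>\<theta>\<close>.\<close>

definition bounded_initial_segment ::
  "'a measure \<Rightarrow> (real \<Rightarrow> 'a measure) \<Rightarrow> real \<Rightarrow> (real \<Rightarrow> 'a \<Rightarrow> real ^ 'n) \<Rightarrow> bool" where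
  "bounded_initial_segment M F \<tau> \<xi> \<longleftrightarrow>
     (\<forall>\<theta>\<in>{-\<tau>..0}. \<xi> \<theta> \<in> borel_measurable (F 0)) \<and>
     (\<forall>\<omega>\<in>space M. continuous_on {-\<tau>..0} (\<lambda>\<theta>. \<xi> \<theta> \<omega>)) \<and>
     (\<exists>B. \<forall>\<omega>\<in>space M. \<forall>\<theta>\<in>{-\<tau>..0}. norm (\<xi> \<theta> \<omega>) \<le> B)"

definition sdde_solution :: "'a measure \<Rightarrow> (real \<Rightarrow> 'a measure) \<Rightarrow> (real \<Rightarrow> 'a \<Rightarrow> real ^ 'm) \<Rightarrow>
    real \<Rightarrow> real \<Rightarrow> (real ^ 'n \<Rightarrow> real ^ 'n \<Rightarrow> real ^ 'n) \<Rightarrow>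
    (real ^ 'n \<Rightarrow> real ^ 'n \<Rightarrow> real ^ 'm ^ 'n) \<Rightarrow> (real \<Rightarrow> 'a \<Rightarrow> real ^ 'n) \<Rightarrow>
    (real \<Rightarrow> 'a \<Rightarrow> real ^ 'n) \<Rightarrow> bool" where
  "sdde_solution M F W \<tau> T b \<sigma> \<xi> X \<longleftrightarrow>
     ito_process M F W \<tau> T \<xi>
       (\<lambda>t \<omega>. b (X t \<omega>) (X (t - \<tau>) \<omega>)) (\<lambda>t \<omega>. \<sigma> (X t \<omega>) (X (t - \<tau>) \<omega>)) X"

text \<open>
  The step process equal to \<open>\<xi>\<close> on \<open>[-\<tau>, 0]\<close> and to \<open>Y(k \<delta>)\<close> on \<open>[k \<delta>, (k + 1) \<delta>)\<close>.  At the end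
  point \<open>t = T = M \<delta>\<close>, which has Lebesgue measure zero, it takes the value \<open>Y(T)\<close>.
\<close>

definition em_step ::
  "real \<Rightarrow> (real \<Rightarrow> 'a \<Rightarrow> real ^ 'n) \<Rightarrow> (real \<Rightarrow> 'a \<Rightarrow> real ^ 'n) \<Rightarrow> real \<Rightarrow> 'a \<Rightarrow> real ^ 'n" where
  "em_step \<delta> \<xi> Y t \<omega> = (if t \<le> 0 then \<xi> t \<omega> else Y (of_int \<lfloor>t / \<delta>\<rfloor> * \<delta>) \<omega>)"

definition euler_maruyama :: "'a measure \<Rightarrow> (real \<Rightarrow> 'a measure) \<Rightarrow> (real \<Rightarrow> 'a \<Rightarrow> real ^ 'm) \<Rightarrow>
    real \<Rightarrow> real \<Rightarrow> (real ^ 'n \<Rightarrow> real ^ 'n \<Rightarrow> real ^ 'n) \<Rightarrow>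
    (real ^ 'n \<Rightarrow> real ^ 'n \<Rightarrow> real ^ 'm ^ 'n) \<Rightarrow> (real \<Rightarrow> 'a \<Rightarrow> real ^ 'n) \<Rightarrow>
    real \<Rightarrow> (real \<Rightarrow> 'a \<Rightarrow> real ^ 'n) \<Rightarrow> bool" where
  "euler_maruyama M F W \<tau> T b \<sigma> \<xi> \<delta> Y \<longleftrightarrow>
     ito_process M F W \<tau> T \<xi>
       (\<lambda>t \<omega>. b (em_step \<delta> \<xi> Y t \<omega>) (em_step \<delta> \<xi> Y (t - \<tau>) \<omega>))
       (\<lambda>t \<omega>. \<sigma> (em_step \<delta> \<xi> Y t \<omega>) (em_step \<delta> \<xi> Y (t - \<tau>) \<omega>)) Y"

end

theory Submission
  imports Defs
begin

text \<open>The error \<open>e = X - Y\<close> is estimated in \<open>L\<^sup>2\<^sup>r\<close> for even \<open>r\<close>; a real exponent \<open>p\<close> follows by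
interpolation (\<open>em_error\<close>).  The delay is what makes the polynomial growth of \<open>V\<^sub>1\<close> and \<open>V\<^sub>2\<close> harmless.
Up to time \<open>(i + 1) \<tau>\<close> the delayed arguments are values of the path up to time \<open>i \<tau>\<close>, so that with
respect to the present state the coefficients are Lipschitz with the constants \<open>L\<^sub>1\<close>, \<open>L\<^sub>2\<close>, up to a forcing term which is already under control.
All estimates are therefore proved by induction over the horizons \<open>min T (i \<tau>)\<close>.  Each step uses the
estimate on the previous horizon for a larger exponent, which is why every induction hypothesis is about all
\<open>r\<close> at once, and each step is a Gronwall argument (\<open>moment_bound\<close>).

This scheme is run twice.  First it bounds the moments of \<open>X\<close> and of all \<open>Y\<close>, uniformly in the step size
(\<open>admissible_moments\<close>), and hence the increments, \<open>E |Z t - Z s|\<^sup>2\<^sup>r \<le> C (t - s)\<^sup>r\<close>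
(\<open>admissible_increments\<close>).  The distance between \<open>Y\<close> and its step process is then of order
\<open>\<delta>\<^sup>1\<^sup>/\<^sup>2\<close> at each fixed time.  This is all that is available, as the supremum over time
is larger by a logarithmic factor; but it suffices, since this distance enters only through an integral over time,
to which Fubini applies.  The second run is for \<open>e\<close> (\<open>em_error_horizon\<close>).  Its forcing term contains the product of a
polynomial weight \<open>\<Gamma>\<close> with the delayed error; the inequality \<open>x y \<le> \<delta>\<^sup>r x\<^sup>2 + \<delta>\<^sup>-\<^sup>r y\<^sup>2\<close> separates the two factors
without losing the order.

The Gronwall argument needs a maximal inequality
\<open>E sup |\<integral> H dW|\<^sup>2\<^sup>r \<le> C h\<^sup>r\<^sup>-\<^sup>1 E \<integral> |H|\<^sup>2\<^sup>r\<close> on an interval of length \<open>h\<close>.  On a grid it follows from the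
moments of the normal distribution (\<open>msum_moment_le\<close>) and a pathwise form of Doob's inequality
(\<open>pathwise_doob\<close>).  It passes to the limit of elementary integrals for an integrand which is switched off, at an
adapted random time, before it becomes large (\<open>stopped_maximal_finite\<close>).  The stopping cannot be avoided at first, because \<open>X\<close> is
not known to have moments; it keeps the quantity in the Gronwall argument finite and is removed by monotone convergence.\<close>

section \<open>Random variables with moments of all orders\<close>

text \<open>The class is closed under sums and products.  It contains bounded random variables and Brownian increments, hence all
polynomials in them, which settles every integrability question about discrete stochastic integrals.\<close>

definition all_moments :: "'a measure \<Rightarrow> ('a \<Rightarrow> real) \<Rightarrow> bool" where
  "all_moments M Z \<longleftrightarrow> Z \<in> borel_measurable M \<and> (\<forall>k::nat. integrable M (\<lambda>\<omega>. \<bar>Z \<omega>\<bar> ^ k))"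

lemma all_moments_integrable:
  assumes "all_moments M Z" shows "integrable M Z"
  using assms integrable_abs_cancel[of M Z] spec[of "\<lambda>k. integrable M (\<lambda>\<omega>. \<bar>Z \<omega>\<bar> ^ k)" 1]
  by (simp add: all_moments_def)

lemma all_moments_mono:
  assumes "all_moments M Y" "Z \<in> borel_measurable M" "\<And>\<omega>. \<omega> \<in> space M \<Longrightarrow> \<bar>Z \<omega>\<bar> \<le> \<bar>Y \<omega>\<bar>"
  shows "all_moments M Z"
  unfolding all_moments_def
proof (intro conjI allI)
  fix k :: nat
  have "integrable M (\<lambda>\<omega>. \<bar>Y \<omega>\<bar> ^ k)" using assms(1) by (simp add: all_moments_def)
  then show "integrable M (\<lambda>\<omega>. \<bar>Z \<omega>\<bar> ^ k)"
    by (rule Bochner_Integration.integrable_bound)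
       (use assms in \<open>auto intro!: power_mono simp: power_abs\<close>)
qed (fact assms)

lemma (in finite_measure) all_moments_bounded:
  assumes "Z \<in> borel_measurable M" "\<And>\<omega>. \<omega> \<in> space M \<Longrightarrow> \<bar>Z \<omega>\<bar> \<le> B"
  shows "all_moments M Z"
proof (rule all_moments_mono[of _ "\<lambda>_. B"])
  show "all_moments M (\<lambda>_. B)" by (auto simp: all_moments_def)
qed (use assms in force)+

lemma all_moments_add:
  assumes "all_moments M Y" "all_moments M Z"
  shows "all_moments M (\<lambda>\<omega>. Y \<omega> + Z \<omega>)"
  unfolding all_moments_def
proof (intro conjI allI)
  show "(\<lambda>\<omega>. Y \<omega> + Z \<omega>) \<in> borel_measurable M" using assms by (auto simp: all_moments_def)
next
  fix k :: nat
  have *: "\<bar>x + y\<bar> ^ k \<le> 2 ^ k * (\<bar>x\<bar> ^ k + \<bar>y\<bar> ^ k)" for x y :: real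
  proof -
    have "\<bar>x + y\<bar> ^ k \<le> (2 * max \<bar>x\<bar> \<bar>y\<bar>) ^ k" by (intro power_mono) auto
    also have "\<dots> = 2 ^ k * max \<bar>x\<bar> \<bar>y\<bar> ^ k" by (simp add: power_mult_distrib)
    also have "\<dots> \<le> 2 ^ k * (\<bar>x\<bar> ^ k + \<bar>y\<bar> ^ k)" by (intro mult_left_mono) (auto simp: max_def)
    finally show ?thesis .
  qed
  have "integrable M (\<lambda>\<omega>. 2 ^ k * (\<bar>Y \<omega>\<bar> ^ k + \<bar>Z \<omega>\<bar> ^ k))"
    using assms by (auto simp: all_moments_def)
  then show "integrable M (\<lambda>\<omega>. \<bar>Y \<omega> + Z \<omega>\<bar> ^ k)"
    by (rule Bochner_Integration.integrable_bound)
       (use assms * in \<open>auto simp: all_moments_def\<close>)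
qed

lemma all_moments_mult:
  assumes "all_moments M Y" "all_moments M Z"
  shows "all_moments M (\<lambda>\<omega>. Y \<omega> * Z \<omega>)"
  unfolding all_moments_def
proof (intro conjI allI)
  show "(\<lambda>\<omega>. Y \<omega> * Z \<omega>) \<in> borel_measurable M" using assms by (auto simp: all_moments_def)
next
  fix k :: nat
  have *: "\<bar>x * y\<bar> ^ k \<le> \<bar>x\<bar> ^ (2 * k) + \<bar>y\<bar> ^ (2 * k)" for x y :: real
  proof -
    have "\<bar>x\<bar> ^ k * \<bar>y\<bar> ^ k \<le> (\<bar>x\<bar> ^ k)\<^sup>2 + (\<bar>y\<bar> ^ k)\<^sup>2"
      using sum_squares_bound[of "\<bar>x\<bar> ^ k" "\<bar>y\<bar> ^ k"] zero_le_power2[of "\<bar>x\<bar> ^ k"]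
        mult_nonneg_nonneg[of "\<bar>x\<bar> ^ k" "\<bar>y\<bar> ^ k"] zero_le_power[of "\<bar>x\<bar>" k] zero_le_power[of "\<bar>y\<bar>" k]
      by linarith
    moreover have "(\<bar>z\<bar> ^ k)\<^sup>2 = \<bar>z\<bar> ^ (2 * k)" for z :: real
      by (metis mult.commute power_mult)
    ultimately show ?thesis by (simp only: abs_mult power_mult_distrib)
  qed
  have "integrable M (\<lambda>\<omega>. \<bar>Y \<omega>\<bar> ^ (2 * k) + \<bar>Z \<omega>\<bar> ^ (2 * k))"
    using assms unfolding all_moments_def by (intro Bochner_Integration.integrable_add) blast+
  then show "integrable M (\<lambda>\<omega>. \<bar>Y \<omega> * Z \<omega>\<bar> ^ k)"
    by (rule Bochner_Integration.integrable_bound)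
       (use assms * in \<open>auto simp: all_moments_def\<close>)
qed

lemma (in finite_measure) all_moments_const: "all_moments M (\<lambda>_. c)"
  by (rule all_moments_bounded[of _ "\<bar>c\<bar>"]) auto

lemma (in finite_measure) all_moments_power:
  "all_moments M Z \<Longrightarrow> all_moments M (\<lambda>\<omega>. Z \<omega> ^ k)"
  by (induction k) (auto intro: all_moments_mult all_moments_const)

lemma (in finite_measure) all_moments_sum:
  "(\<And>a. a \<in> A \<Longrightarrow> all_moments M (Z a)) \<Longrightarrow> all_moments M (\<lambda>\<omega>. \<Sum>a\<in>A. Z a \<omega>)"
  by (induction A rule: infinite_finite_induct) (auto intro: all_moments_add all_moments_const)

section \<open>Brownian increments\<close>

text \<open>The moments of the standard normal distribution.\<close>

definition gauss_moment :: "nat \<Rightarrow> real" where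
  "gauss_moment l = (if even l then fact l / (2 ^ (l div 2) * fact (l div 2)) else 0)"

lemma gauss_moment_nonneg: "0 \<le> gauss_moment l"
  by (simp add: gauss_moment_def)

context brownian_motion
begin

lemma measurable_F:
  assumes "Z \<in> borel_measurable (F s)" shows "Z \<in> borel_measurable M"
  using subalgebra_F[of s] assms by (rule measurable_from_subalg)

lemma measurable_F_mono:
  assumes "Z \<in> borel_measurable (F s)" "s \<le> t" shows "Z \<in> borel_measurable (F t)"
proof -
  have "subalgebra (F t) (F s)"
    using space_F sets_F_mono[OF assms(2)] by (auto simp: subalgebra_def)
  then show ?thesis using assms(1) by (rule measurable_from_subalg)
qed

lemma measurable_vec_nth:
  fixes Z :: "'b \<Rightarrow> ('c :: real_normed_vector) ^ 'k"
  assumes "Z \<in> borel_measurable N" shows "(\<lambda>\<omega>. Z \<omega> $ i) \<in> borel_measurable N"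
  by (rule borel_measurable_continuous_on[OF _ assms]) (intro continuous_intros)

abbreviation incr :: "real \<Rightarrow> real \<Rightarrow> 'm \<Rightarrow> 'a \<Rightarrow> real" where
  "incr s t i \<omega> \<equiv> W t \<omega> $ i - W s \<omega> $ i"

lemma incr_measurable_F:
  assumes "0 \<le> s" "s \<le> t" shows "incr s t i \<in> borel_measurable (F t)"
proof -
  have "0 \<le> t" using assms by simp
  have "W t \<in> borel_measurable (F t)" "W s \<in> borel_measurable (F t)"
    by (rule adapted_W[OF \<open>0 \<le> t\<close>]) (rule measurable_F_mono[OF adapted_W[OF assms(1)] assms(2)])
  then show ?thesis
    by (intro borel_measurable_diff; intro measurable_vec_nth)
qed

lemma indep_incr:
  assumes st: "0 \<le> s" "s < t" and Z: "Z \<in> borel_measurable (F s)"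
  shows "indep_var borel Z borel (incr s t i)"
proof -
  let ?V = "vimage_algebra (space M) (\<lambda>\<omega>. W t \<omega> - W s \<omega>) borel"
  have ZM: "Z \<in> borel_measurable M" using Z by (rule measurable_F)
  have wM: "incr s t i \<in> borel_measurable M"
    using incr_measurable_F[of s t i] st by (auto intro: measurable_F)
  have wV: "incr s t i \<in> borel_measurable ?V"
  proof -
    have "(\<lambda>\<omega>. W t \<omega> - W s \<omega>) \<in> measurable ?V borel"
      by (rule measurable_vimage_algebra1) auto
    then have "(\<lambda>\<omega>. (W t \<omega> - W s \<omega>) $ i) \<in> borel_measurable ?V" by (rule measurable_vec_nth)
    then show ?thesis by simp
  qed
  have 1: "sigma_sets (space M) {Z -` A \<inter> space M |A. A \<in> sets borel} \<subseteq> sets (F s)"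
    using measurable_sets[OF Z] space_F[of s]
    by (intro sets.sigma_sets_subset[of _ "F s", unfolded space_F]) auto
  have 2: "sigma_sets (space M) {incr s t i -` A \<inter> space M |A. A \<in> sets borel} \<subseteq> sets ?V"
    using measurable_sets[OF wV]
    by (intro sets.sigma_sets_subset[of _ ?V, unfolded space_vimage_algebra]) auto
  have "indep_set (sets (F s)) (sets ?V)" by (rule indep_increments[OF st])
  then have "indep_set (sigma_sets (space M) {Z -` A \<inter> space M |A. A \<in> sets borel})
      (sigma_sets (space M) {incr s t i -` A \<inter> space M |A. A \<in> sets borel})"
    unfolding indep_set_def
  proof (rule indep_sets_mono_sets)
    fix j :: bool
    show "case_bool (sigma_sets (space M) {Z -` A \<inter> space M |A. A \<in> sets borel})
      (sigma_sets (space M) {incr s t i -` A \<inter> space M |A. A \<in> sets borel}) j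
      \<subseteq> case_bool (sets (F s)) (sets ?V) j"
      using 1 2 by (cases j) simp_all
  qed
  then show ?thesis
    unfolding indep_var_eq using ZM wM by (intro conjI)
qed

lemma distributed_incr:
  assumes "0 \<le> s" "s < t"
  shows "distributed M lborel (incr s t i) (normal_density 0 (sqrt (t - s)))"
  using normal_increments[OF assms, of i] unfolding vector_minus_component .

lemma all_moments_incr:
  assumes "0 \<le> s" "s < t" shows "all_moments M (incr s t i)"
  unfolding all_moments_def
proof (intro conjI allI)
  show "incr s t i \<in> borel_measurable M"
    by (rule measurable_F[OF incr_measurable_F]) (use assms in auto)
next
  fix k :: nat
  have "0 < sqrt (t - s)" using assms by simp
  then have 1: "integrable lborel (\<lambda>x. normal_density 0 (sqrt (t - s)) x * \<bar>x\<bar> ^ k)"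
    using integrable_normal_moment_abs[of "sqrt (t - s)" 0 k] by (simp only: diff_zero)
  show "integrable M (\<lambda>\<omega>. \<bar>incr s t i \<omega>\<bar> ^ k)"
    by (subst distributed_integrable[OF distributed_incr[OF assms, of i], of "\<lambda>x. \<bar>x\<bar> ^ k", symmetric])
       (use 1 in auto)
qed

lemma integral_incr_power:
  assumes "0 \<le> s" "s < t"
  shows "(\<integral>\<omega>. incr s t i \<omega> ^ l \<partial>M) = gauss_moment l * (t - s) ^ (l div 2)"
proof -
  have *: "(\<integral>\<omega>. incr s t i \<omega> ^ l \<partial>M) = (\<integral>x. normal_density 0 (sqrt (t - s)) x * x ^ l \<partial>lborel)"
    by (subst distributed_integral[OF distributed_incr[OF assms, of i], of "\<lambda>x. x ^ l", symmetric]) auto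
  have pos: "0 < sqrt (t - s)" using assms by simp
  show ?thesis
  proof (cases "even l")
    case True
    then obtain k where "l = 2 * k" by auto
    moreover have "(2 / (sqrt (t - s))\<^sup>2) ^ k = 2 ^ k / (t - s) ^ k"
      using assms by (simp add: power_divide)
    ultimately show ?thesis
      using * integral_normal_moment_even[OF pos, of 0 k] by (simp add: gauss_moment_def)
  next
    case False
    then obtain k where "l = 2 * k + 1" by (auto elim: oddE)
    then show ?thesis
      using * integral_normal_moment_odd[OF pos, of 0 k] by (simp add: gauss_moment_def)
  qed
qed

lemma integral_mult_incr_power:
  assumes st: "0 \<le> s" "s < t" and Z: "Z \<in> borel_measurable (F s)" "integrable M Z"
  shows "(\<integral>\<omega>. Z \<omega> * incr s t i \<omega> ^ l \<partial>M) = (\<integral>\<omega>. Z \<omega> \<partial>M) * (gauss_moment l * (t - s) ^ (l div 2))"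
proof -
  have "indep_var borel ((\<lambda>x. x) \<circ> Z) borel ((\<lambda>x. x ^ l) \<circ> incr s t i)"
    using indep_incr[OF st Z(1)] by (rule indep_var_compose) auto
  then have "indep_var borel Z borel (\<lambda>\<omega>. incr s t i \<omega> ^ l)" by (simp add: comp_def)
  moreover have "integrable M (\<lambda>\<omega>. incr s t i \<omega> ^ l)"
    by (intro all_moments_integrable all_moments_power all_moments_incr st)
  ultimately show ?thesis
    using indep_var_lebesgue_integral[of Z "\<lambda>\<omega>. incr s t i \<omega> ^ l"] Z(2) integral_incr_power[OF st]
    by simp
qed

end

section \<open>Discrete stochastic integrals\<close>

text \<open>The coefficients of \<open>E (x + y Z)\<^sup>2\<^sup>r\<close>, with \<open>Z\<close> standard normal, other than that of \<open>x\<^sup>2\<^sup>r\<close>.\<close>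

definition binom_gauss :: "nat \<Rightarrow> real" where
  "binom_gauss r = (\<Sum>l\<in>{1..2 * r}. real ((2 * r) choose l) * gauss_moment l)"

definition moment_const :: "nat \<Rightarrow> real" where
  "moment_const r = binom_gauss r * exp (binom_gauss r)"

lemma binom_gauss_nonneg: "0 \<le> binom_gauss r"
  unfolding binom_gauss_def by (intro sum_nonneg mult_nonneg_nonneg gauss_moment_nonneg) auto

lemma moment_const_nonneg: "0 \<le> moment_const r"
  unfolding moment_const_def by (intro mult_nonneg_nonneg binom_gauss_nonneg) auto

lemma power_mixed_le:
  fixes x y :: real
  assumes "0 \<le> x" "0 \<le> y" "k \<le> r"
  shows "x ^ (r - k) * y ^ k \<le> x ^ r + y ^ r"
proof -
  have "x ^ (r - k) * y ^ k \<le> max x y ^ (r - k) * max x y ^ k"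
    using assms by (intro mult_mono power_mono) auto
  also have "\<dots> = max x y ^ r" using assms(3) by (simp flip: power_add)
  also have "\<dots> \<le> x ^ r + y ^ r" using assms by (auto simp: max_def)
  finally show ?thesis .
qed

text \<open>The higher powers of the step length \<open>\<Delta>\<close> in the expansion of a moment are reduced to the first power by means of the total
length \<open>h\<close>; the resulting bound can be summed over the steps of any grid, however coarse or irregular.\<close>

lemma power_mixed_step_le:
  fixes x y \<Delta> h :: real
  assumes \<Delta>: "0 < \<Delta>" "\<Delta> \<le> h" and k: "1 \<le> k" "k \<le> r"
  shows "x ^ (2 * r - 2 * k) * y ^ (2 * k) * \<Delta> ^ k \<le> \<Delta> / h * (x ^ (2 * r) + h ^ r * y ^ (2 * r))"
proof -
  have h: "0 < h" using \<Delta> by simp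
  have "x ^ (2 * r - 2 * k) * y ^ (2 * k) * \<Delta> ^ k = (\<Delta> / h) ^ k * ((x\<^sup>2) ^ (r - k) * (h * y\<^sup>2) ^ k)"
    using h by (simp add: power_mult_distrib power_divide flip: power_mult diff_mult_distrib2)
  also have "\<dots> \<le> (\<Delta> / h) * ((x\<^sup>2) ^ r + (h * y\<^sup>2) ^ r)"
  proof (rule mult_mono)
    have "(\<Delta> / h) ^ k \<le> (\<Delta> / h) ^ 1" using \<Delta> h k by (intro power_decreasing) auto
    then show "(\<Delta> / h) ^ k \<le> \<Delta> / h" by simp
    show "(x\<^sup>2) ^ (r - k) * (h * y\<^sup>2) ^ k \<le> (x\<^sup>2) ^ r + (h * y\<^sup>2) ^ r"
      using h k by (intro power_mixed_le) auto
  qed (use \<Delta> h in auto)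
  also have "\<dots> = \<Delta> / h * (x ^ (2 * r) + h ^ r * y ^ (2 * r))"
    by (simp add: power_mult_distrib flip: power_mult)
  finally show ?thesis .
qed

primrec run_max :: "(nat \<Rightarrow> real) \<Rightarrow> nat \<Rightarrow> real" where
  "run_max s 0 = s 0"
| "run_max s (Suc n) = max (run_max s n) (s (Suc n))"

lemma le_run_max: "a \<le> b \<Longrightarrow> s a \<le> run_max s b"
  by (induction b) (auto simp: le_Suc_eq max_def)

lemma run_max_nonneg: "(\<And>a. 0 \<le> s a) \<Longrightarrow> 0 \<le> run_max s b"
  by (induction b) (auto simp: max_def)

lemma run_max_le_sum: "(\<And>a. 0 \<le> s a) \<Longrightarrow> run_max s b \<le> (\<Sum>a\<le>b. s a)"
  by (induction b) (auto simp: max_def intro: add_increasing sum_nonneg add_increasing2)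

text \<open>A pathwise form of Doob's \<open>L\<^sup>2\<close> inequality: the sum on the left is a submartingale transform,
  so its expectation is nonnegative when \<open>s\<close> is a submartingale.\<close>

lemma pathwise_doob:
  assumes "\<And>a. 0 \<le> s a"
  shows "(run_max s n)\<^sup>2 + 4 * (\<Sum>a<n. run_max s a * (s (Suc a) - s a)) \<le> 4 * (s n)\<^sup>2"
proof -
  have *: "2 * (\<Sum>a<n. run_max s a * (s (Suc a) - s a)) \<le> 2 * run_max s n * s n - (run_max s n)\<^sup>2"
  proof (induction n)
    case 0
    then show ?case using assms[of 0] by (simp add: power2_eq_square)
  next
    case (Suc n)
    show ?case
    proof (cases "s (Suc n) \<le> run_max s n")
      case True
      then have "run_max s (Suc n) = run_max s n" by simp
      then show ?thesis using Suc by (simp add: algebra_simps)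
    next
      case False
      then have e: "run_max s (Suc n) = s (Suc n)" by simp
      have "0 \<le> (s (Suc n) - run_max s n)\<^sup>2" by simp
      then show ?thesis using Suc unfolding e by (simp add: algebra_simps power2_eq_square)
    qed
  qed
  have "0 \<le> (2 * s n - run_max s n)\<^sup>2" by simp
  then show ?thesis using * by (simp add: algebra_simps power2_eq_square)
qed

text \<open>The tangent at \<open>x\<close> lies below the graph; this turns even powers of a martingale into a submartingale.\<close>

lemma even_power_convex:
  fixes x y :: real
  assumes "even r"
  shows "real r * x ^ (r - 1) * (y - x) \<le> y ^ r - x ^ r"
proof (cases "r = 0")
  case False
  have cvx: "convex_on UNIV (\<lambda>x::real. x ^ r)" by (rule convex_power_even[OF assms])
  have d: "((\<lambda>x::real. x ^ r) has_real_derivative real r * x ^ (r - 1)) (at x within UNIV)"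
    by (auto intro!: derivative_eq_intros)
  show ?thesis
    using convex_on_imp_above_tangent[OF cvx, of x y, OF _ _ _ d] by (simp add: connected_UNIV)
qed simp

locale grid_integrand = brownian_motion M F W
  for M :: "'a measure" and F and W :: "real \<Rightarrow> 'a \<Rightarrow> real ^ 'm" +
  fixes v :: "nat \<Rightarrow> real" and K :: nat and g :: "nat \<Rightarrow> 'a \<Rightarrow> real" and i :: 'm
  assumes v_nonneg: "0 \<le> v 0"
    and v_less: "\<And>a. a < K \<Longrightarrow> v a < v (Suc a)"
    and g_measurable: "\<And>a. a < K \<Longrightarrow> g a \<in> borel_measurable (F (v a))"
    and g_bounded: "\<And>a. a < K \<Longrightarrow> \<exists>B. \<forall>\<omega>\<in>space M. \<bar>g a \<omega>\<bar> \<le> B"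
begin

definition msum :: "nat \<Rightarrow> 'a \<Rightarrow> real" where
  "msum b \<omega> = (\<Sum>a<b. g a \<omega> * incr (v a) (v (Suc a)) i \<omega>)"

lemma v_mono: "a \<le> b \<Longrightarrow> b \<le> K \<Longrightarrow> v a \<le> v b"
proof (induction b)
  case (Suc b)
  then show ?case using v_less[of b] by (cases "a = Suc b") force+
qed simp

lemma v_ge_0: "a \<le> K \<Longrightarrow> 0 \<le> v a"
  using v_mono[of 0 a] v_nonneg by simp

lemma msum_measurable: "b \<le> K \<Longrightarrow> msum b \<in> borel_measurable (F (v b))"
proof (induction b)
  case 0
  then show ?case by (simp add: msum_def)
next
  case (Suc b)
  then have b: "b < K" "b \<le> K" by simp_all
  have le: "v b \<le> v (Suc b)" using v_less[OF b(1)] by simp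
  have "(\<lambda>\<omega>. msum b \<omega> + g b \<omega> * incr (v b) (v (Suc b)) i \<omega>) \<in> borel_measurable (F (v (Suc b)))"
    by (intro borel_measurable_add borel_measurable_times measurable_F_mono[OF Suc.IH[OF b(2)] le]
        measurable_F_mono[OF g_measurable[OF b(1)] le] incr_measurable_F v_ge_0 b le)
  then show ?case by (simp add: msum_def)
qed

lemma all_moments_g: assumes "a < K" shows "all_moments M (g a)"
proof -
  obtain B where "\<forall>\<omega>\<in>space M. \<bar>g a \<omega>\<bar> \<le> B" using g_bounded[OF assms] by blast
  then show ?thesis
    by (intro all_moments_bounded[of _ B] measurable_F[OF g_measurable[OF assms]]) blast
qed

lemma all_moments_msum: assumes "b \<le> K" shows "all_moments M (msum b)"
proof -
  have "all_moments M (\<lambda>\<omega>. \<Sum>a<b. g a \<omega> * incr (v a) (v (Suc a)) i \<omega>)"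
  proof (rule all_moments_sum)
    fix a assume "a \<in> {..<b}"
    then have a: "a < K" "a \<le> K" using assms by simp_all
    show "all_moments M (\<lambda>\<omega>. g a \<omega> * incr (v a) (v (Suc a)) i \<omega>)"
      by (rule all_moments_mult[OF all_moments_g[OF a(1)] all_moments_incr[OF v_ge_0[OF a(2)] v_less[OF a(1)]]])
  qed
  then show ?thesis by (simp add: msum_def[abs_def])
qed

text \<open>In the binomial expansion of \<open>(S + g w)\<^sup>2\<^sup>r\<close> the moments of the increment \<open>w\<close> factor out by independence.  The odd ones
vanish, in particular the term of first order in \<open>w\<close>, and the even ones are of order \<open>\<Delta>\<close> by \<open>power_mixed_step_le\<close>.\<close>

lemma msum_moment_step:
  assumes b: "b < K" and h: "v (Suc b) - v b \<le> h" and r: "1 \<le> r"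
  shows "(\<integral>\<omega>. msum (Suc b) \<omega> ^ (2 * r) \<partial>M)
    \<le> (\<integral>\<omega>. msum b \<omega> ^ (2 * r) \<partial>M) + binom_gauss r * ((v (Suc b) - v b) / h) *
        ((\<integral>\<omega>. msum b \<omega> ^ (2 * r) \<partial>M) + h ^ r * (\<integral>\<omega>. g b \<omega> ^ (2 * r) \<partial>M))"
proof -
  define \<Delta> where "\<Delta> = v (Suc b) - v b"
  have \<Delta>: "0 < \<Delta>" "\<Delta> \<le> h" using v_less[OF b] h by (simp_all add: \<Delta>_def)
  have bK: "b \<le> K" using b by simp
  let ?w = "incr (v b) (v (Suc b)) i"
  let ?R = "(\<integral>\<omega>. msum b \<omega> ^ (2 * r) \<partial>M) + h ^ r * (\<integral>\<omega>. g b \<omega> ^ (2 * r) \<partial>M)"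
  define Z where "Z l \<omega> = msum b \<omega> ^ (2 * r - l) * g b \<omega> ^ l" for l \<omega>
  have ZF: "Z l \<in> borel_measurable (F (v b))" for l
    unfolding Z_def[abs_def]
    by (intro borel_measurable_times borel_measurable_power msum_measurable[OF bK] g_measurable[OF b])
  have Zm: "all_moments M (Z l)" for l
    unfolding Z_def[abs_def]
    by (intro all_moments_mult all_moments_power all_moments_msum[OF bK] all_moments_g[OF b])
  have wm: "all_moments M ?w" by (rule all_moments_incr[OF v_ge_0[OF bK] v_less[OF b]])
  have E: "(\<integral>\<omega>. Z l \<omega> * ?w \<omega> ^ l \<partial>M) = (\<integral>\<omega>. Z l \<omega> \<partial>M) * (gauss_moment l * \<Delta> ^ (l div 2))" for l
    unfolding \<Delta>_def
    by (rule integral_mult_incr_power[OF v_ge_0[OF bK] v_less[OF b] ZF all_moments_integrable[OF Zm]])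
  have "msum (Suc b) \<omega> ^ (2 * r) = (\<Sum>l\<le>2 * r. real ((2 * r) choose l) * (Z l \<omega> * ?w \<omega> ^ l))" for \<omega>
  proof -
    have "msum (Suc b) \<omega> = g b \<omega> * ?w \<omega> + msum b \<omega>" by (simp add: msum_def)
    then show ?thesis
      by (simp add: binomial_ring Z_def power_mult_distrib mult_ac)
  qed
  then have "(\<integral>\<omega>. msum (Suc b) \<omega> ^ (2 * r) \<partial>M)
     = (\<integral>\<omega>. (\<Sum>l\<le>2 * r. real ((2 * r) choose l) * (Z l \<omega> * ?w \<omega> ^ l)) \<partial>M)" by simp
  also have "\<dots> = (\<Sum>l\<le>2 * r. real ((2 * r) choose l) * (\<integral>\<omega>. Z l \<omega> * ?w \<omega> ^ l \<partial>M))"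
  proof (subst Bochner_Integration.integral_sum)
    show "integrable M (\<lambda>\<omega>. real ((2 * r) choose l) * (Z l \<omega> * ?w \<omega> ^ l))" for l
      by (intro integrable_mult_right all_moments_integrable all_moments_mult all_moments_power Zm wm)
  qed simp
  also have "\<dots> = (\<Sum>l\<in>insert 0 {1..2 * r}. real ((2 * r) choose l) * (\<integral>\<omega>. Z l \<omega> * ?w \<omega> ^ l \<partial>M))"
    by (rule sum.cong) auto
  also have "\<dots> = (\<integral>\<omega>. msum b \<omega> ^ (2 * r) \<partial>M)
      + (\<Sum>l\<in>{1..2 * r}. real ((2 * r) choose l) * (\<integral>\<omega>. Z l \<omega> * ?w \<omega> ^ l \<partial>M))"
    by (simp add: Z_def)
  finally have expand: "(\<integral>\<omega>. msum (Suc b) \<omega> ^ (2 * r) \<partial>M) = (\<integral>\<omega>. msum b \<omega> ^ (2 * r) \<partial>M)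
      + (\<Sum>l\<in>{1..2 * r}. real ((2 * r) choose l) * (\<integral>\<omega>. Z l \<omega> * ?w \<omega> ^ l \<partial>M))" .
  have "(\<Sum>l\<in>{1..2 * r}. real ((2 * r) choose l) * (\<integral>\<omega>. Z l \<omega> * ?w \<omega> ^ l \<partial>M))
      \<le> (\<Sum>l\<in>{1..2 * r}. real ((2 * r) choose l) * gauss_moment l * (\<Delta> / h * ?R))"
  proof (rule sum_mono)
    fix l assume l: "l \<in> {1..2 * r}"
    show "real ((2 * r) choose l) * (\<integral>\<omega>. Z l \<omega> * ?w \<omega> ^ l \<partial>M)
      \<le> real ((2 * r) choose l) * gauss_moment l * (\<Delta> / h * ?R)"
    proof (cases "even l")
      case False
      then have "gauss_moment l = 0" by (simp add: gauss_moment_def)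
      then show ?thesis by (simp add: E)
    next
      case True
      then obtain k where k: "l = 2 * k" by auto
      with l have k1: "1 \<le> k" "k \<le> r" by auto
      have "(\<integral>\<omega>. Z l \<omega> \<partial>M) * \<Delta> ^ k = (\<integral>\<omega>. Z l \<omega> * \<Delta> ^ k \<partial>M)" by simp
      also have "\<dots> \<le> (\<integral>\<omega>. \<Delta> / h * (msum b \<omega> ^ (2 * r) + h ^ r * g b \<omega> ^ (2 * r)) \<partial>M)"
      proof (rule integral_mono)
        show "integrable M (\<lambda>\<omega>. Z l \<omega> * \<Delta> ^ k)"
          by (intro integrable_mult_left all_moments_integrable Zm)
        show "integrable M (\<lambda>\<omega>. \<Delta> / h * (msum b \<omega> ^ (2 * r) + h ^ r * g b \<omega> ^ (2 * r)))"
          by (intro integrable_mult_right Bochner_Integration.integrable_add all_moments_integrable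
              all_moments_power all_moments_msum[OF bK] all_moments_g[OF b])
        show "Z l \<omega> * \<Delta> ^ k \<le> \<Delta> / h * (msum b \<omega> ^ (2 * r) + h ^ r * g b \<omega> ^ (2 * r))" for \<omega>
          unfolding Z_def k by (rule power_mixed_step_le[OF \<Delta> k1])
      qed
      also have "\<dots> = \<Delta> / h * ?R"
      proof -
        have "integrable M (\<lambda>\<omega>. msum b \<omega> ^ (2 * r))" "integrable M (\<lambda>\<omega>. g b \<omega> ^ (2 * r))"
          by (intro all_moments_integrable all_moments_power all_moments_msum[OF bK] all_moments_g[OF b])+
        then show ?thesis by simp
      qed
      finally have *: "(\<integral>\<omega>. Z l \<omega> \<partial>M) * \<Delta> ^ k \<le> \<Delta> / h * ?R" .
      have "real ((2 * r) choose l) * (\<integral>\<omega>. Z l \<omega> * ?w \<omega> ^ l \<partial>M)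
         = (real ((2 * r) choose l) * gauss_moment l) * ((\<integral>\<omega>. Z l \<omega> \<partial>M) * \<Delta> ^ k)"
        by (simp add: E k)
      also have "\<dots> \<le> (real ((2 * r) choose l) * gauss_moment l) * (\<Delta> / h * ?R)"
        by (rule mult_left_mono[OF *]) (simp add: gauss_moment_nonneg)
      finally show ?thesis .
    qed
  qed
  also have "\<dots> = binom_gauss r * (\<Delta> / h * ?R)"
    unfolding binom_gauss_def sum_distrib_right ..
  also have "\<dots> = binom_gauss r * (\<Delta> / h) * ?R" by (simp only: mult.assoc)
  finally show ?thesis unfolding expand \<Delta>_def by (rule add_left_mono)
qed

text \<open>Discrete Gronwall: a step of length \<open>\<Delta>\<close> multiplies the moment by at most \<open>1 + c \<Delta> / h\<close>, so that all steps together contribute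
the factor \<open>e\<^sup>c\<close>, whatever the grid.\<close>

theorem msum_moment_le:
  assumes r: "1 \<le> r" and K: "0 < K"
  shows "(\<integral>\<omega>. msum K \<omega> ^ (2 * r) \<partial>M)
    \<le> moment_const r * (v K - v 0) ^ (r - 1) * (\<Sum>a<K. (v (Suc a) - v a) * (\<integral>\<omega>. g a \<omega> ^ (2 * r) \<partial>M))"
proof -
  define h where "h = v K - v 0"
  \<comment> \<open>By \<open>msum_moment_step\<close> the moments \<open>x\<close> satisfy \<open>x (b + 1) \<le> x b + c (\<Delta> / h) (x b + h\<^sup>r y b)\<close> and \<open>x 0 = 0\<close>.\<close>
  define c where "c = binom_gauss r"
  define y where "y a = (\<integral>\<omega>. g a \<omega> ^ (2 * r) \<partial>M)" for a
  define x where "x b = (\<integral>\<omega>. msum b \<omega> ^ (2 * r) \<partial>M)" for b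
  have c0: "0 \<le> c" by (simp add: c_def binom_gauss_nonneg)
  have y0: "0 \<le> y a" for a unfolding y_def by (simp add: power_mult)
  have x0: "0 \<le> x b" for b unfolding x_def by (simp add: power_mult)
  have h0: "0 < h" using v_mono[of 1 K] v_less[OF K] K by (simp add: h_def)
  have "x b \<le> exp (c * (v b - v 0) / h) * (c * h ^ (r - 1) * (\<Sum>a<b. (v (Suc a) - v a) * y a))"
    if "b \<le> K" for b
    using that
  proof (induction b)
    case 0
    obtain r' where "r = Suc r'" using r by (cases r) auto
    then show ?case by (simp add: x_def msum_def)
  next
    case (Suc b)
    then have b: "b < K" "b \<le> K" by auto
    define \<Delta> where "\<Delta> = v (Suc b) - v b"
    have \<Delta>: "0 < \<Delta>" "\<Delta> \<le> h"
      using v_less[OF b(1)] v_mono[of "Suc b" K] v_mono[of 0 b] b by (auto simp: \<Delta>_def h_def)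
    let ?A = "c * h ^ (r - 1) * (\<Sum>a<b. (v (Suc a) - v a) * y a)"
    let ?e = "exp (c * (v b - v 0) / h)" and ?e' = "exp (c * (v (Suc b) - v 0) / h)"
    have IH: "x b \<le> ?e * ?A" using Suc.IH b by simp
    have A0: "0 \<le> ?A"
    proof (intro mult_nonneg_nonneg sum_nonneg c0 y0)
      show "0 \<le> v (Suc a) - v a" if "a \<in> {..<b}" for a using v_less[of a] that b by simp
    qed (use h0 in auto)
    have e: "?e' = ?e * exp (c * \<Delta> / h)"
      by (simp add: \<Delta>_def algebra_simps add_divide_distrib diff_divide_distrib flip: exp_add)
    have e1: "1 \<le> ?e'" using c0 h0 v_mono[of 0 "Suc b"] Suc.prems by simp
    have hr: "h ^ r = h * h ^ (r - 1)" using r by (cases r) auto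
    have "x (Suc b) \<le> x b + c * (\<Delta> / h) * (x b + h ^ r * y b)"
      using msum_moment_step[OF b(1) _ r, of h] \<Delta> by (simp add: x_def y_def c_def \<Delta>_def)
    also have "\<dots> = (1 + c * \<Delta> / h) * x b + c * h ^ (r - 1) * (\<Delta> * y b)"
      using h0 by (simp add: hr field_simps)
    also have "\<dots> \<le> exp (c * \<Delta> / h) * (?e * ?A) + ?e' * (c * h ^ (r - 1) * (\<Delta> * y b))"
    proof (rule add_mono)
      show "(1 + c * \<Delta> / h) * x b \<le> exp (c * \<Delta> / h) * (?e * ?A)"
        by (intro mult_mono exp_ge_add_one_self IH x0) auto
      have "0 \<le> c * h ^ (r - 1) * (\<Delta> * y b)" using c0 h0 \<Delta> y0 by simp
      then show "c * h ^ (r - 1) * (\<Delta> * y b) \<le> ?e' * (c * h ^ (r - 1) * (\<Delta> * y b))"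
        using mult_right_mono[OF e1] by fastforce
    qed
    also have "\<dots> = ?e' * (c * h ^ (r - 1) * (\<Sum>a<Suc b. (v (Suc a) - v a) * y a))"
    proof -
      have s: "(\<Sum>a<Suc b. (v (Suc a) - v a) * y a) = (\<Sum>a<b. (v (Suc a) - v a) * y a) + \<Delta> * y b"
        by (simp add: \<Delta>_def)
      show ?thesis unfolding s e by (simp only: distrib_left mult_ac)
    qed
    finally show ?case .
  qed
  from this[of K] show ?thesis
    using h0 by (simp add: x_def y_def moment_const_def flip: c_def h_def) (simp add: mult_ac)
qed

text \<open>The increment of \<open>S\<^sup>r\<close> is at least \<open>r S\<^sup>r\<^sup>-\<^sup>1 g w\<close>, which has mean zero even after multiplication by the running maximum;
so the expectation of the transform in \<open>pathwise_doob\<close> is nonnegative.\<close>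

theorem msum_doob:
  assumes r: "even r"
  shows "(\<integral>\<omega>. (run_max (\<lambda>a. msum a \<omega> ^ r) K)\<^sup>2 \<partial>M) \<le> 4 * (\<integral>\<omega>. msum K \<omega> ^ (2 * r) \<partial>M)"
    and "integrable M (\<lambda>\<omega>. (run_max (\<lambda>a. msum a \<omega> ^ r) K)\<^sup>2)"
proof -
  let ?m = "\<lambda>b \<omega>. run_max (\<lambda>a. msum a \<omega> ^ r) b"
  have s0: "0 \<le> msum a \<omega> ^ r" for a \<omega> using r by (rule zero_le_even_power)
  have mF: "?m b \<in> borel_measurable (F (v b))" if "b \<le> K" for b
    using that
  proof (induction b)
    case 0
    show ?case using borel_measurable_power[OF msum_measurable[OF 0]] by simp
  next
    case (Suc b)
    have le: "v b \<le> v (Suc b)" using v_mono[of b "Suc b"] Suc.prems by simp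
    have bK: "b \<le> K" using Suc.prems by simp
    have "(\<lambda>\<omega>. max (?m b \<omega>) (msum (Suc b) \<omega> ^ r)) \<in> borel_measurable (F (v (Suc b)))"
      by (intro borel_measurable_max borel_measurable_power measurable_F_mono[OF Suc.IH[OF bK] le]
          msum_measurable Suc.prems)
    then show ?case by simp
  qed
  have mm: "all_moments M (?m b)" if b: "b \<le> K" for b
  proof (rule all_moments_mono)
    show "all_moments M (\<lambda>\<omega>. \<Sum>a\<le>b. msum a \<omega> ^ r)"
      using b by (intro all_moments_sum all_moments_power all_moments_msum) simp
    show "?m b \<in> borel_measurable M" by (rule measurable_F[OF mF[OF b]])
    show "\<bar>?m b \<omega>\<bar> \<le> \<bar>\<Sum>a\<le>b. msum a \<omega> ^ r\<bar>" for \<omega>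
    proof -
      have "0 \<le> ?m b \<omega>" "?m b \<omega> \<le> (\<Sum>a\<le>b. msum a \<omega> ^ r)"
        by (rule run_max_nonneg[of "\<lambda>a. msum a \<omega> ^ r" b, OF s0]) (rule run_max_le_sum[of "\<lambda>a. msum a \<omega> ^ r" b, OF s0])
      then show ?thesis by linarith
    qed
  qed
  show "integrable M (\<lambda>\<omega>. (?m K \<omega>)\<^sup>2)"
    by (intro all_moments_integrable all_moments_power mm) simp
  have dm: "all_moments M (\<lambda>\<omega>. ?m a \<omega> * (msum (Suc a) \<omega> ^ r - msum a \<omega> ^ r))" if "a < K" for a
  proof -
    have "all_moments M (\<lambda>\<omega>. msum (Suc a) \<omega> ^ r + (-1) * msum a \<omega> ^ r)"
      using that by (intro all_moments_add all_moments_mult all_moments_power all_moments_const all_moments_msum) auto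
    then have "all_moments M (\<lambda>\<omega>. msum (Suc a) \<omega> ^ r - msum a \<omega> ^ r)" by simp
    then show ?thesis using that by (intro all_moments_mult mm) auto
  qed
  have pos: "0 \<le> (\<integral>\<omega>. ?m a \<omega> * (msum (Suc a) \<omega> ^ r - msum a \<omega> ^ r) \<partial>M)" if a: "a < K" for a
  proof -
    have aK: "a \<le> K" using a by simp
    let ?w = "incr (v a) (v (Suc a)) i"
    let ?Z = "\<lambda>\<omega>. ?m a \<omega> * (real r * msum a \<omega> ^ (r - 1) * g a \<omega>)"
    have ZF: "?Z \<in> borel_measurable (F (v a))"
      by (intro borel_measurable_times borel_measurable_const borel_measurable_power mF[OF aK]
          msum_measurable[OF aK] g_measurable[OF a])
    have Zm: "all_moments M ?Z"
      by (intro all_moments_mult all_moments_power all_moments_const mm[OF aK]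
          all_moments_msum[OF aK] all_moments_g[OF a])
    have wm: "all_moments M ?w" by (rule all_moments_incr[OF v_ge_0[OF aK] v_less[OF a]])
    have "(\<integral>\<omega>. ?Z \<omega> * ?w \<omega> ^ 1 \<partial>M) = 0"
      by (subst integral_mult_incr_power[OF v_ge_0[OF aK] v_less[OF a] ZF all_moments_integrable[OF Zm]])
         (simp add: gauss_moment_def)
    moreover have "(\<integral>\<omega>. ?Z \<omega> * ?w \<omega> ^ 1 \<partial>M) \<le> (\<integral>\<omega>. ?m a \<omega> * (msum (Suc a) \<omega> ^ r - msum a \<omega> ^ r) \<partial>M)"
    proof (rule integral_mono)
      show "integrable M (\<lambda>\<omega>. ?Z \<omega> * ?w \<omega> ^ 1)"
        by (intro all_moments_integrable all_moments_mult[OF Zm] all_moments_power[OF wm])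
      show "integrable M (\<lambda>\<omega>. ?m a \<omega> * (msum (Suc a) \<omega> ^ r - msum a \<omega> ^ r))"
        by (rule all_moments_integrable[OF dm[OF a]])
      fix \<omega>
      have "msum (Suc a) \<omega> - msum a \<omega> = g a \<omega> * ?w \<omega>" by (simp add: msum_def)
      then have "real r * msum a \<omega> ^ (r - 1) * (g a \<omega> * ?w \<omega>) \<le> msum (Suc a) \<omega> ^ r - msum a \<omega> ^ r"
        using even_power_convex[OF r, of "msum a \<omega>" "msum (Suc a) \<omega>"] by simp
      then show "?Z \<omega> * ?w \<omega> ^ 1 \<le> ?m a \<omega> * (msum (Suc a) \<omega> ^ r - msum a \<omega> ^ r)"
        using mult_left_mono[of _ _ "?m a \<omega>"] run_max_nonneg[of "\<lambda>a. msum a \<omega> ^ r" a, OF s0]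
        by (simp add: mult.assoc)
    qed
    ultimately show ?thesis by simp
  qed
  have int4: "integrable M (\<lambda>\<omega>. 4 * (\<Sum>a<K. ?m a \<omega> * (msum (Suc a) \<omega> ^ r - msum a \<omega> ^ r)))"
    by (intro integrable_mult_right Bochner_Integration.integrable_sum all_moments_integrable dm) simp
  have intm: "integrable M (\<lambda>\<omega>. (?m K \<omega>)\<^sup>2)"
    by (intro all_moments_integrable all_moments_power mm) simp
  have intK: "integrable M (\<lambda>\<omega>. msum K \<omega> ^ (2 * r))"
    by (intro all_moments_integrable all_moments_power all_moments_msum) simp
  have "0 \<le> (\<integral>\<omega>. 4 * (\<Sum>a<K. ?m a \<omega> * (msum (Suc a) \<omega> ^ r - msum a \<omega> ^ r)) \<partial>M)"
    by (subst integral_mult_right_zero, subst Bochner_Integration.integral_sum)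
       (auto intro!: all_moments_integrable dm sum_nonneg pos)
  then have "(\<integral>\<omega>. (?m K \<omega>)\<^sup>2 \<partial>M) \<le> (\<integral>\<omega>. (?m K \<omega>)\<^sup>2 + 4 * (\<Sum>a<K. ?m a \<omega> * (msum (Suc a) \<omega> ^ r - msum a \<omega> ^ r)) \<partial>M)"
    using Bochner_Integration.integral_add[OF intm int4] by linarith
  also have "\<dots> \<le> (\<integral>\<omega>. 4 * msum K \<omega> ^ (2 * r) \<partial>M)"
  proof (rule integral_mono)
    fix \<omega>
    have sq: "(msum K \<omega> ^ r)\<^sup>2 = msum K \<omega> ^ (2 * r)" by (metis mult.commute power_mult)
    show "(?m K \<omega>)\<^sup>2 + 4 * (\<Sum>a<K. ?m a \<omega> * (msum (Suc a) \<omega> ^ r - msum a \<omega> ^ r)) \<le> 4 * msum K \<omega> ^ (2 * r)"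
      using pathwise_doob[of "\<lambda>a. msum a \<omega> ^ r" K, OF s0] unfolding sq .
  next
    show "integrable M (\<lambda>\<omega>. (?m K \<omega>)\<^sup>2 + 4 * (\<Sum>a<K. ?m a \<omega> * (msum (Suc a) \<omega> ^ r - msum a \<omega> ^ r)))"
      by (rule Bochner_Integration.integrable_add[OF intm int4])
    show "integrable M (\<lambda>\<omega>. 4 * msum K \<omega> ^ (2 * r))"
      by (rule integrable_mult_right[OF intK])
  qed
  finally show "(\<integral>\<omega>. (?m K \<omega>)\<^sup>2 \<partial>M) \<le> 4 * (\<integral>\<omega>. msum K \<omega> ^ (2 * r) \<partial>M)"
    unfolding integral_mult_right_zero .
qed

end

section \<open>Matrix-valued discrete stochastic integrals\<close>

definition vec_const :: "nat \<Rightarrow> nat \<Rightarrow> real" where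
  "vec_const N r = 4 * real N ^ (2 * r + 1) * moment_const r"

lemma vec_const_nonneg: "0 \<le> vec_const N r"
  by (simp add: vec_const_def moment_const_nonneg)

lemma sum_power_le:
  fixes f :: "'b \<Rightarrow> real"
  assumes "finite A" "A \<noteq> {}" "\<And>x. x \<in> A \<Longrightarrow> 0 \<le> f x"
  shows "(\<Sum>x\<in>A. f x) ^ p \<le> real (card A) ^ p * (\<Sum>x\<in>A. f x ^ p)"
proof -
  define m where "m = Max (f ` A)"
  have m: "\<And>x. x \<in> A \<Longrightarrow> f x \<le> m" "m \<in> f ` A"
    using assms(1,2) by (auto simp: m_def)
  then obtain x where x: "x \<in> A" "m = f x" by auto
  have "(\<Sum>x\<in>A. f x) \<le> real (card A) * m" using sum_bounded_above[of A f m] m(1) by simp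
  then have "(\<Sum>x\<in>A. f x) ^ p \<le> (real (card A) * m) ^ p"
    using assms(3) by (intro power_mono sum_nonneg) auto
  also have "\<dots> = real (card A) ^ p * f x ^ p" by (simp add: power_mult_distrib x)
  also have "\<dots> \<le> real (card A) ^ p * (\<Sum>x\<in>A. f x ^ p)"
    using assms x(1) by (intro mult_left_mono member_le_sum) auto
  finally show ?thesis .
qed

locale matrix_grid_integrand = brownian_motion M F W
  for M :: "'a measure" and F and W :: "real \<Rightarrow> 'a \<Rightarrow> real ^ 'm" +
  fixes v :: "nat \<Rightarrow> real" and K :: nat and h :: "nat \<Rightarrow> 'a \<Rightarrow> real ^ 'm ^ 'n"
  assumes v_nonneg: "0 \<le> v 0"
    and v_less: "\<And>a. a < K \<Longrightarrow> v a < v (Suc a)"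
    and h_measurable: "\<And>a. a < K \<Longrightarrow> h a \<in> borel_measurable (F (v a))"
    and h_bounded: "\<And>a. a < K \<Longrightarrow> \<exists>B. \<forall>\<omega>\<in>space M. norm (h a \<omega>) \<le> B"
begin

definition vsum :: "nat \<Rightarrow> 'a \<Rightarrow> real ^ 'n" where
  "vsum b \<omega> = (\<Sum>a<b. h a \<omega> *v (W (v (Suc a)) \<omega> - W (v a) \<omega>))"

lemma entry: "grid_integrand M F W v K (\<lambda>a \<omega>. h a \<omega> $ i $ j)"
proof
  show "0 \<le> v 0" by (rule v_nonneg)
next
  fix a assume a: "a < K"
  show "v a < v (Suc a)" by (rule v_less[OF a])
  show "(\<lambda>\<omega>. h a \<omega> $ i $ j) \<in> borel_measurable (F (v a))"
    by (intro measurable_vec_nth h_measurable[OF a])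
  obtain B where B: "\<forall>\<omega>\<in>space M. norm (h a \<omega>) \<le> B" using h_bounded[OF a] by blast
  have "\<bar>h a \<omega> $ i $ j\<bar> \<le> B" if "\<omega> \<in> space M" for \<omega>
    using component_le_norm_cart[of "h a \<omega> $ i" j] Finite_Cartesian_Product.norm_nth_le[of "h a \<omega>" i] B that by fastforce
  then show "\<exists>B. \<forall>\<omega>\<in>space M. \<bar>h a \<omega> $ i $ j\<bar> \<le> B" by blast
qed

abbreviation S :: "'n \<Rightarrow> 'm \<Rightarrow> nat \<Rightarrow> 'a \<Rightarrow> real" where
  "S i j \<equiv> grid_integrand.msum W v (\<lambda>a \<omega>. h a \<omega> $ i $ j) j"

text \<open>A matrix integral reduces to the scalar integrals of its entries, one for each pair of indices.\<close>

lemma norm_vsum_power_le: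
  "norm (vsum b \<omega>) ^ p \<le> real (CARD('n) * CARD('m)) ^ p * (\<Sum>(i, j)\<in>UNIV. \<bar>S i j b \<omega>\<bar> ^ p)"
proof -
  have c: "vsum b \<omega> $ i = (\<Sum>j\<in>UNIV. S i j b \<omega>)" for i
  proof -
    have "vsum b \<omega> $ i = (\<Sum>a<b. \<Sum>j\<in>UNIV. h a \<omega> $ i $ j * incr (v a) (v (Suc a)) j \<omega>)"
      by (simp add: vsum_def matrix_vector_mult_def)
    also have "\<dots> = (\<Sum>j\<in>UNIV. \<Sum>a<b. h a \<omega> $ i $ j * incr (v a) (v (Suc a)) j \<omega>)"
      by (rule sum.swap)
    also have "\<dots> = (\<Sum>j\<in>UNIV. S i j b \<omega>)"
      by (simp add: grid_integrand.msum_def[OF entry])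
    finally show ?thesis .
  qed
  have "norm (vsum b \<omega>) \<le> (\<Sum>i\<in>UNIV. \<bar>vsum b \<omega> $ i\<bar>)" by (rule norm_le_l1_cart)
  also have "\<dots> \<le> (\<Sum>i\<in>UNIV. \<Sum>j\<in>UNIV. \<bar>S i j b \<omega>\<bar>)"
    unfolding c by (intro sum_mono sum_abs)
  also have "\<dots> = (\<Sum>(i, j)\<in>UNIV. \<bar>S i j b \<omega>\<bar>)"
    by (simp add: sum.cartesian_product)
  finally have "norm (vsum b \<omega>) ^ p \<le> (\<Sum>(i, j)\<in>UNIV. \<bar>S i j b \<omega>\<bar>) ^ p"
    by (rule power_mono) simp
  also have "\<dots> \<le> real (card (UNIV :: ('n \<times> 'm) set)) ^ p * (\<Sum>x\<in>UNIV. (case x of (i, j) \<Rightarrow> \<bar>S i j b \<omega>\<bar>) ^ p)"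
    by (rule sum_power_le) auto
  also have "(\<lambda>x. (case x of (i, j) \<Rightarrow> \<bar>S i j b \<omega>\<bar>) ^ p) = (\<lambda>(i, j). \<bar>S i j b \<omega>\<bar> ^ p)"
    by auto
  finally show ?thesis by simp
qed

lemma integrable_norm_h: assumes "a < K" shows "integrable M (\<lambda>\<omega>. norm (h a \<omega>) ^ p)"
proof -
  obtain B where B: "\<forall>\<omega>\<in>space M. norm (h a \<omega>) \<le> B" using h_bounded[OF assms] by blast
  have hM: "(\<lambda>\<omega>. norm (h a \<omega>)) \<in> borel_measurable M"
    by (rule measurable_compose[OF measurable_F[OF h_measurable[OF assms]] borel_measurable_norm])
  have "all_moments M (\<lambda>\<omega>. norm (h a \<omega>))"
    by (rule all_moments_bounded[OF hM, of B]) (use B in auto)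
  then show ?thesis by (intro all_moments_integrable all_moments_power)
qed

lemma integral_S_le:
  assumes r: "1 \<le> r" and K: "0 < K"
  shows "(\<integral>\<omega>. S i j K \<omega> ^ (2 * r) \<partial>M)
    \<le> moment_const r * (v K - v 0) ^ (r - 1) * (\<integral>\<omega>. (\<Sum>a<K. (v (Suc a) - v a) * norm (h a \<omega>) ^ (2 * r)) \<partial>M)"
proof -
  interpret g: grid_integrand M F W v K "\<lambda>a \<omega>. h a \<omega> $ i $ j" j by (rule entry)
  have "(\<Sum>a<K. (v (Suc a) - v a) * (\<integral>\<omega>. (h a \<omega> $ i $ j) ^ (2 * r) \<partial>M))
      \<le> (\<Sum>a<K. (v (Suc a) - v a) * (\<integral>\<omega>. norm (h a \<omega>) ^ (2 * r) \<partial>M))"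
  proof (intro sum_mono mult_left_mono)
    fix a assume "a \<in> {..<K}"
    then have a: "a < K" by simp
    show "0 \<le> v (Suc a) - v a" using v_less[OF a] by simp
    show "(\<integral>\<omega>. (h a \<omega> $ i $ j) ^ (2 * r) \<partial>M) \<le> (\<integral>\<omega>. norm (h a \<omega>) ^ (2 * r) \<partial>M)"
    proof (rule integral_mono)
      show "integrable M (\<lambda>\<omega>. (h a \<omega> $ i $ j) ^ (2 * r))"
        by (intro all_moments_integrable all_moments_power g.all_moments_g[OF a])
      show "integrable M (\<lambda>\<omega>. norm (h a \<omega>) ^ (2 * r))" by (rule integrable_norm_h[OF a])
      fix \<omega>
      have "\<bar>h a \<omega> $ i $ j\<bar> \<le> norm (h a \<omega>)"
        using component_le_norm_cart[of "h a \<omega> $ i" j] Finite_Cartesian_Product.norm_nth_le[of "h a \<omega>" i] by linarith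
      then have "\<bar>h a \<omega> $ i $ j\<bar> ^ (2 * r) \<le> norm (h a \<omega>) ^ (2 * r)" by (intro power_mono) auto
      then show "(h a \<omega> $ i $ j) ^ (2 * r) \<le> norm (h a \<omega>) ^ (2 * r)" by (simp add: power_even_abs)
    qed
  qed
  also have "\<dots> = (\<integral>\<omega>. (\<Sum>a<K. (v (Suc a) - v a) * norm (h a \<omega>) ^ (2 * r)) \<partial>M)"
    by (subst Bochner_Integration.integral_sum) (auto intro!: integrable_mult_right integrable_norm_h)
  finally have *: "(\<Sum>a<K. (v (Suc a) - v a) * (\<integral>\<omega>. (h a \<omega> $ i $ j) ^ (2 * r) \<partial>M)) \<le> \<dots>" .
  have "0 \<le> v K - v 0" using g.v_mono[of 0 K] by simp
  then have "moment_const r * (v K - v 0) ^ (r - 1) * (\<Sum>a<K. (v (Suc a) - v a) * (\<integral>\<omega>. (h a \<omega> $ i $ j) ^ (2 * r) \<partial>M))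
    \<le> moment_const r * (v K - v 0) ^ (r - 1) * (\<integral>\<omega>. (\<Sum>a<K. (v (Suc a) - v a) * norm (h a \<omega>) ^ (2 * r)) \<partial>M)"
    by (intro mult_left_mono[OF *] mult_nonneg_nonneg moment_const_nonneg zero_le_power)
  with g.msum_moment_le[OF r K] show ?thesis by (rule order_trans)
qed

lemma nn_integral_le_of_entries:
  fixes Z :: "'n \<Rightarrow> 'm \<Rightarrow> 'a \<Rightarrow> real"
  assumes r: "1 \<le> r" and K: "0 < K"
    and A: "\<And>\<omega>. \<omega> \<in> space M \<Longrightarrow> A \<omega> \<le> ennreal (real (CARD('n) * CARD('m)) ^ (2 * r) * (\<Sum>(i, j)\<in>UNIV. Z i j \<omega>))"
    and Z0: "\<And>i j \<omega>. 0 \<le> Z i j \<omega>"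
    and Zi: "\<And>i j. integrable M (Z i j)"
    and Z: "\<And>i j. (\<integral>\<omega>. Z i j \<omega> \<partial>M) \<le> 4 * (\<integral>\<omega>. S i j K \<omega> ^ (2 * r) \<partial>M)"
  shows "(\<integral>\<^sup>+\<omega>. A \<omega> \<partial>M) \<le> ennreal (vec_const (CARD('n) * CARD('m)) r * (v K - v 0) ^ (r - 1)) *
    (\<integral>\<^sup>+\<omega>. ennreal (\<Sum>a<K. (v (Suc a) - v a) * norm (h a \<omega>) ^ (2 * r)) \<partial>M)"
proof -
  let ?Q = "\<lambda>\<omega>. \<Sum>a<K. (v (Suc a) - v a) * norm (h a \<omega>) ^ (2 * r)"
  let ?c = "moment_const r * (v K - v 0) ^ (r - 1)"
  let ?Z = "\<lambda>\<omega>. \<Sum>(i, j)\<in>UNIV. Z i j \<omega>"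
  interpret g: grid_integrand M F W v K "\<lambda>a \<omega>. h a \<omega> $ i $ j" j for i j by (rule entry)
  have v0: "0 \<le> v K - v 0" using g.v_mono[of 0 K] by simp
  have c0: "0 \<le> ?c" using v0 by (simp add: moment_const_nonneg)
  have Qi: "integrable M ?Q" by (auto intro!: Bochner_Integration.integrable_sum integrable_mult_right integrable_norm_h)
  have Q0: "0 \<le> ?Q \<omega>" for \<omega>
    using v_less by (intro sum_nonneg mult_nonneg_nonneg) (auto simp: less_imp_le)
  have ZI: "integrable M (\<lambda>\<omega>. real (CARD('n) * CARD('m)) ^ (2 * r) * ?Z \<omega>)"
    using Zi by (intro integrable_mult_right Bochner_Integration.integrable_sum) auto
  have "(\<integral>\<^sup>+\<omega>. A \<omega> \<partial>M) \<le> (\<integral>\<^sup>+\<omega>. ennreal (real (CARD('n) * CARD('m)) ^ (2 * r) * ?Z \<omega>) \<partial>M)"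
    by (rule nn_integral_mono[OF A])
  also have "\<dots> = ennreal (\<integral>\<omega>. real (CARD('n) * CARD('m)) ^ (2 * r) * ?Z \<omega> \<partial>M)"
    using Z0 by (intro nn_integral_eq_integral ZI AE_I2 mult_nonneg_nonneg sum_nonneg) auto
  also have "\<dots> \<le> ennreal (vec_const (CARD('n) * CARD('m)) r * (v K - v 0) ^ (r - 1) * (\<integral>\<omega>. ?Q \<omega> \<partial>M))"
  proof (rule ennreal_leI)
    have "(\<integral>\<omega>. real (CARD('n) * CARD('m)) ^ (2 * r) * ?Z \<omega> \<partial>M) = real (CARD('n) * CARD('m)) ^ (2 * r) * (\<integral>\<omega>. ?Z \<omega> \<partial>M)"
      by (rule integral_mult_right_zero)
    also have "(\<integral>\<omega>. ?Z \<omega> \<partial>M) = (\<Sum>x\<in>UNIV. \<integral>\<omega>. (case x of (i, j) \<Rightarrow> Z i j \<omega>) \<partial>M)"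
      by (rule Bochner_Integration.integral_sum) (use Zi in auto)
    also have "real (CARD('n) * CARD('m)) ^ (2 * r) * \<dots> \<le> real (CARD('n) * CARD('m)) ^ (2 * r) * (\<Sum>x\<in>(UNIV :: ('n \<times> 'm) set). 4 * (?c * (\<integral>\<omega>. ?Q \<omega> \<partial>M)))"
    proof (intro mult_left_mono sum_mono)
      fix x :: "'n \<times> 'm"
      obtain i j where x: "x = (i, j)" by (cases x)
      show "(\<integral>\<omega>. (case x of (i, j) \<Rightarrow> Z i j \<omega>) \<partial>M) \<le> 4 * (?c * (\<integral>\<omega>. ?Q \<omega> \<partial>M))"
        using Z[of i j] integral_S_le[OF r K, of i j] by (simp add: x)
    qed simp
    also have "\<dots> = vec_const (CARD('n) * CARD('m)) r * (v K - v 0) ^ (r - 1) * (\<integral>\<omega>. ?Q \<omega> \<partial>M)"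
      by (simp add: vec_const_def)
    finally show "(\<integral>\<omega>. real (CARD('n) * CARD('m)) ^ (2 * r) * ?Z \<omega> \<partial>M) \<le> vec_const (CARD('n) * CARD('m)) r * (v K - v 0) ^ (r - 1) * (\<integral>\<omega>. ?Q \<omega> \<partial>M)" .
  qed
  also have "\<dots> = ennreal (vec_const (CARD('n) * CARD('m)) r * (v K - v 0) ^ (r - 1)) * ennreal (\<integral>\<omega>. ?Q \<omega> \<partial>M)"
    using v0 by (intro ennreal_mult' mult_nonneg_nonneg vec_const_nonneg) simp
  also have "ennreal (\<integral>\<omega>. ?Q \<omega> \<partial>M) = (\<integral>\<^sup>+\<omega>. ennreal (?Q \<omega>) \<partial>M)"
    by (rule nn_integral_eq_integral[symmetric, OF Qi]) (use Q0 in auto)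
  finally show ?thesis .
qed

lemma vsum_L2:
  assumes K: "0 < K"
  shows "(\<integral>\<^sup>+\<omega>. ennreal (norm (vsum K \<omega>) ^ 2) \<partial>M) \<le> ennreal (vec_const (CARD('n) * CARD('m)) 1) *
    (\<integral>\<^sup>+\<omega>. ennreal (\<Sum>a<K. (v (Suc a) - v a) * norm (h a \<omega>) ^ 2) \<partial>M)"
proof -
  interpret g: grid_integrand M F W v K "\<lambda>a \<omega>. h a \<omega> $ i $ j" j for i j by (rule entry)
  have "(\<integral>\<^sup>+\<omega>. ennreal (norm (vsum K \<omega>) ^ 2) \<partial>M) \<le> ennreal (vec_const (CARD('n) * CARD('m)) 1 * (v K - v 0) ^ (1 - 1)) *
    (\<integral>\<^sup>+\<omega>. ennreal (\<Sum>a<K. (v (Suc a) - v a) * norm (h a \<omega>) ^ (2 * 1)) \<partial>M)"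
  proof (rule nn_integral_le_of_entries[where Z = "\<lambda>i j \<omega>. S i j K \<omega> ^ 2"])
    show "ennreal (norm (vsum K \<omega>) ^ 2) \<le> ennreal (real (CARD('n) * CARD('m)) ^ (2 * 1) * (\<Sum>(i, j)\<in>UNIV. S i j K \<omega> ^ 2))" for \<omega>
      using norm_vsum_power_le[of K \<omega> 2] by (intro ennreal_leI) simp
    show "integrable M (\<lambda>\<omega>. S i j K \<omega> ^ 2)" for i j
      by (intro all_moments_integrable all_moments_power g.all_moments_msum) simp
  qed (use K in auto)
  then show ?thesis by simp
qed

theorem vsum_maximal:
  assumes K: "0 < K" and r: "even r" "1 \<le> r"
  shows "(\<integral>\<^sup>+\<omega>. (SUP b\<in>{..K}. ennreal (norm (vsum b \<omega>) ^ (2 * r))) \<partial>M) \<le> ennreal (vec_const (CARD('n) * CARD('m)) r * (v K - v 0) ^ (r - 1)) *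
    (\<integral>\<^sup>+\<omega>. ennreal (\<Sum>a<K. (v (Suc a) - v a) * norm (h a \<omega>) ^ (2 * r)) \<partial>M)"
proof -
  interpret g: grid_integrand M F W v K "\<lambda>a \<omega>. h a \<omega> $ i $ j" j for i j by (rule entry)
  let ?Z = "\<lambda>i j \<omega>. (run_max (\<lambda>a. S i j a \<omega> ^ r) K)\<^sup>2"
  show ?thesis
  proof (rule nn_integral_le_of_entries[where Z = ?Z])
    show "integrable M (?Z i j)" for i j by (rule g.msum_doob(2)[OF r(1)])
    show "(\<integral>\<omega>. ?Z i j \<omega> \<partial>M) \<le> 4 * (\<integral>\<omega>. S i j K \<omega> ^ (2 * r) \<partial>M)" for i j by (rule g.msum_doob(1)[OF r(1)])
    fix \<omega>
    show "(SUP b\<in>{..K}. ennreal (norm (vsum b \<omega>) ^ (2 * r))) \<le> ennreal (real (CARD('n) * CARD('m)) ^ (2 * r) * (\<Sum>(i, j)\<in>UNIV. ?Z i j \<omega>))"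
    proof (intro SUP_least ennreal_leI)
      fix b assume "b \<in> {..K}"
      then have b: "b \<le> K" by simp
      have "\<bar>S i j b \<omega>\<bar> ^ (2 * r) \<le> ?Z i j \<omega>" for i j
      proof -
        have "0 \<le> S i j b \<omega> ^ r" using r(1) by (rule zero_le_even_power)
        moreover have "S i j b \<omega> ^ r \<le> run_max (\<lambda>a. S i j a \<omega> ^ r) K"
          by (rule le_run_max[OF b])
        ultimately have "(S i j b \<omega> ^ r)\<^sup>2 \<le> ?Z i j \<omega>" by (intro power_mono)
        moreover have "\<bar>S i j b \<omega>\<bar> ^ (2 * r) = (S i j b \<omega> ^ r)\<^sup>2"
          by (simp add: power_even_abs power_mult[symmetric] mult.commute)
        ultimately show ?thesis by simp
      qed
      then have "(\<Sum>(i, j)\<in>UNIV. \<bar>S i j b \<omega>\<bar> ^ (2 * r)) \<le> (\<Sum>(i, j)\<in>UNIV. ?Z i j \<omega>)"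
        by (intro sum_mono) auto
      then show "norm (vsum b \<omega>) ^ (2 * r) \<le> real (CARD('n) * CARD('m)) ^ (2 * r) * (\<Sum>(i, j)\<in>UNIV. ?Z i j \<omega>)"
        using norm_vsum_power_le[of b \<omega> "2 * r"]
          mult_left_mono[of "\<Sum>(i, j)\<in>UNIV. \<bar>S i j b \<omega>\<bar> ^ (2 * r)" _ "real (CARD('n) * CARD('m)) ^ (2 * r)"]
        by (meson order_trans zero_le_power of_nat_0_le_iff)
    qed
  qed (use K r in auto)
qed

end

section \<open>Approximation of Ito integrals\<close>

lemma hs_norm_eq_norm: "hs_norm A = norm A"
proof -
  have "trace (transpose A ** A) = (\<Sum>j\<in>UNIV. \<Sum>i\<in>UNIV. A $ i $ j * A $ i $ j)"
    by (simp add: trace_def transpose_def matrix_matrix_mult_def)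
  moreover have "(\<Sum>j\<in>UNIV. \<Sum>i\<in>UNIV. A $ i $ j * A $ i $ j) = (\<Sum>i\<in>UNIV. \<Sum>j\<in>UNIV. A $ i $ j * A $ i $ j)"
    by (rule sum.swap)
  moreover have "A \<bullet> A = (\<Sum>i\<in>UNIV. \<Sum>j\<in>UNIV. A $ i $ j * A $ i $ j)"
    unfolding inner_vec_def inner_real_def ..
  ultimately show ?thesis unfolding hs_norm_def norm_eq_sqrt_inner by (simp only:)
qed

text \<open>Elementary integrands \<open>E\<close> with integrals \<open>S\<close>, described through their behaviour on the intervals which contain none of the
finitely many jump times \<open>D\<close>.  In this form refining a partition, or passing to a common partition for two integrands, only
means enlarging \<open>D\<close>.\<close>

definition simple_ito :: "'a measure \<Rightarrow> (real \<Rightarrow> 'a measure) \<Rightarrow> (real \<Rightarrow> 'a \<Rightarrow> real ^ 'm) \<Rightarrow> real \<Rightarrow>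
    real set \<Rightarrow> (real \<Rightarrow> 'a \<Rightarrow> real ^ 'm ^ 'n) \<Rightarrow> (real \<Rightarrow> 'a \<Rightarrow> real ^ 'n) \<Rightarrow> bool" where
  "simple_ito M F W T D E S \<longleftrightarrow> finite D \<and> (\<forall>\<omega>. (\<lambda>s. E s \<omega>) \<in> borel_measurable borel) \<and>
    (\<forall>s t. 0 \<le> s \<longrightarrow> s < t \<longrightarrow> t \<le> T \<longrightarrow> D \<inter> {s<..<t} = {} \<longrightarrow>
      E t \<in> borel_measurable (F s) \<and> (\<exists>B. \<forall>\<omega>\<in>space M. norm (E t \<omega>) \<le> B) \<and>
      (\<forall>\<omega>. (\<forall>y\<in>{s<..t}. E y \<omega> = E t \<omega>) \<and> S t \<omega> - S s \<omega> = E t \<omega> *v (W t \<omega> - W s \<omega>)))"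

lemma simple_itoD:
  assumes "simple_ito M F W T D E S" "0 \<le> s" "s < t" "t \<le> T" "D \<inter> {s<..<t} = {}"
  shows "E t \<in> borel_measurable (F s)" "\<exists>B. \<forall>\<omega>\<in>space M. norm (E t \<omega>) \<le> B"
    "\<And>y \<omega>. s < y \<Longrightarrow> y \<le> t \<Longrightarrow> E y \<omega> = E t \<omega>"
    "\<And>\<omega>. S t \<omega> - S s \<omega> = E t \<omega> *v (W t \<omega> - W s \<omega>)"
proof -
  have *: "E t \<in> borel_measurable (F s) \<and> (\<exists>B. \<forall>\<omega>\<in>space M. norm (E t \<omega>) \<le> B) \<and>
      (\<forall>\<omega>. (\<forall>y\<in>{s<..t}. E y \<omega> = E t \<omega>) \<and> S t \<omega> - S s \<omega> = E t \<omega> *v (W t \<omega> - W s \<omega>))"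
    using assms unfolding simple_ito_def by blast
  show "E t \<in> borel_measurable (F s)" using * by (rule conjunct1)
  show "\<exists>B. \<forall>\<omega>\<in>space M. norm (E t \<omega>) \<le> B" using * by blast
  have **: "(\<forall>y\<in>{s<..t}. E y \<omega> = E t \<omega>) \<and> S t \<omega> - S s \<omega> = E t \<omega> *v (W t \<omega> - W s \<omega>)" for \<omega>
    using * by (elim conjE) (rule spec)
  show "E y \<omega> = E t \<omega>" if "s < y" "y \<le> t" for y \<omega>
    using conjunct1[OF **[of \<omega>]] that by (meson greaterThanAtMost_iff)
  show "S t \<omega> - S s \<omega> = E t \<omega> *v (W t \<omega> - W s \<omega>)" for \<omega>
    using ** by (rule conjunct2)
qed

lemma simple_ito_measurable: "simple_ito M F W T D E S \<Longrightarrow> (\<lambda>s. E s \<omega>) \<in> borel_measurable borel"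
  unfolding simple_ito_def by blast

lemma simple_ito_diff:
  assumes 1: "simple_ito M F W T D1 E1 S1" and 2: "simple_ito M F W T D2 E2 S2"
  shows "simple_ito M F W T (D1 \<union> D2) (\<lambda>t \<omega>. E1 t \<omega> - E2 t \<omega>) (\<lambda>t \<omega>. S1 t \<omega> - S2 t \<omega>)"
  unfolding simple_ito_def
proof (intro conjI allI impI)
  show "finite (D1 \<union> D2)" using 1 2 by (simp add: simple_ito_def)
  show "(\<lambda>s. E1 s \<omega> - E2 s \<omega>) \<in> borel_measurable borel" for \<omega>
    by (intro borel_measurable_diff simple_ito_measurable[OF 1] simple_ito_measurable[OF 2])
next
  fix s t :: real assume st: "0 \<le> s" "s < t" "t \<le> T" and D: "(D1 \<union> D2) \<inter> {s<..<t} = {}"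
  then have D1: "D1 \<inter> {s<..<t} = {}" and D2: "D2 \<inter> {s<..<t} = {}" by auto
  note d1 = simple_itoD[OF 1 st D1] and d2 = simple_itoD[OF 2 st D2]
  show "(\<lambda>\<omega>. E1 t \<omega> - E2 t \<omega>) \<in> borel_measurable (F s)"
    by (intro borel_measurable_diff d1(1) d2(1))
  obtain B1 B2 where "\<forall>\<omega>\<in>space M. norm (E1 t \<omega>) \<le> B1" "\<forall>\<omega>\<in>space M. norm (E2 t \<omega>) \<le> B2"
    using d1(2) d2(2) by blast
  then have "norm (E1 t \<omega> - E2 t \<omega>) \<le> B1 + B2" if "\<omega> \<in> space M" for \<omega>
    using that norm_triangle_ineq4[of "E1 t \<omega>" "E2 t \<omega>"] by fastforce
  then show "\<exists>B. \<forall>\<omega>\<in>space M. norm (E1 t \<omega> - E2 t \<omega>) \<le> B" by blast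
  fix \<omega>
  show "\<forall>y\<in>{s<..t}. E1 y \<omega> - E2 y \<omega> = E1 t \<omega> - E2 t \<omega>"
  proof
    fix y assume "y \<in> {s<..t}"
    then have y: "s < y" "y \<le> t" by simp_all
    show "E1 y \<omega> - E2 y \<omega> = E1 t \<omega> - E2 t \<omega>" unfolding d1(3)[OF y] d2(3)[OF y] ..
  qed
  have "S1 t \<omega> - S2 t \<omega> - (S1 s \<omega> - S2 s \<omega>) = (S1 t \<omega> - S1 s \<omega>) - (S2 t \<omega> - S2 s \<omega>)"
    by (simp add: algebra_simps)
  then show "S1 t \<omega> - S2 t \<omega> - (S1 s \<omega> - S2 s \<omega>) = (E1 t \<omega> - E2 t \<omega>) *v (W t \<omega> - W s \<omega>)"
    unfolding d1(4) d2(4) matrix_vector_mult_diff_rdistrib .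
qed

lemma square_dist_measurable:
  fixes E H :: "real \<Rightarrow> 'b::euclidean_space"
  assumes E: "E \<in> borel_measurable borel" and H: "(\<lambda>s. indicator {0..T} s *\<^sub>R H s) \<in> borel_measurable borel"
  shows "(\<lambda>s. ennreal ((norm (E s - H s))\<^sup>2) * indicator {0..T} s) \<in> borel_measurable lborel"
proof -
  note [measurable] = E H
  have "(\<lambda>s. ennreal ((norm (E s - indicator {0..T} s *\<^sub>R H s))\<^sup>2) * indicator {0..T} s) \<in> borel_measurable lborel"
    by measurable
  also have "(\<lambda>s. ennreal ((norm (E s - indicator {0..T} s *\<^sub>R H s))\<^sup>2) * indicator {0..T} s)
     = (\<lambda>s. ennreal ((norm (E s - H s))\<^sup>2) * indicator {0..T} s)"
    by (auto simp: indicator_def)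
  finally show ?thesis .
qed

text \<open>Ito integrals as almost sure limits.  The geometric rate makes the second moments of the errors summable over \<open>j\<close>, so that
errors controlled in \<open>L\<^sup>2\<close> tend to zero almost surely.\<close>

definition ito_limit :: "'a measure \<Rightarrow> (real \<Rightarrow> 'a measure) \<Rightarrow> (real \<Rightarrow> 'a \<Rightarrow> real ^ 'm) \<Rightarrow> real \<Rightarrow>
    (real \<Rightarrow> 'a \<Rightarrow> real ^ 'm ^ 'n) \<Rightarrow> (real \<Rightarrow> 'a \<Rightarrow> real ^ 'n) \<Rightarrow> bool" where
  "ito_limit M F W T H I \<longleftrightarrow>
    (\<forall>\<omega>\<in>space M. (\<lambda>s. indicator {0..T} s *\<^sub>R H s \<omega>) \<in> borel_measurable borel) \<and>
    (\<forall>t\<in>{0..T}. I t \<in> borel_measurable M) \<and>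
    (AE \<omega> in M. continuous_on {0..T} (\<lambda>t. I t \<omega>)) \<and>
    (\<exists>D E S c. (\<forall>j. simple_ito M F W T (D j) (E j) (S j)) \<and>
      (AE \<omega> in M. \<forall>\<^sub>F j in sequentially.
        (\<integral>\<^sup>+s\<in>{0..T}. ennreal ((norm (E j s \<omega> - H s \<omega>))\<^sup>2) \<partial>lborel) \<le> ennreal (c * (1 / 4) ^ j)) \<and>
      (AE \<omega> in M. \<forall>t\<in>{0..T}. (\<lambda>j. S j t \<omega>) \<longlonglongrightarrow> I t \<omega>))"

context brownian_motion
begin

lemma simple_ito_elementary:
  assumes "elementary_integrand M F T k u h"
  shows "simple_ito M F W T (u ` {..k}) (elementary_process k u h) (elementary_integral W k u h)"
  unfolding simple_ito_def
proof (intro conjI allI impI)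
  show "finite (u ` {..k})" by simp
  show "(\<lambda>s. elementary_process k u h s \<omega>) \<in> borel_measurable borel" for \<omega>
    unfolding elementary_process_def by measurable
next
  fix s t :: real assume st: "0 \<le> s" "s < t" "t \<le> T" and D: "u ` {..k} \<inter> {s<..<t} = {}"
  have u_less: "u i < u (Suc i)" if "i < k" for i using assms that by (simp add: elementary_integrand_def)
  have hm: "h i \<in> borel_measurable (F (u i))" and hb: "bounded (h i ` space M)" if "i < k" for i
    using assms that by (auto simp: elementary_integrand_def)
  have dich: "u i \<le> s \<or> t \<le> u i" if "i \<le> k" for i
    using D that by fastforce
  have dich_Suc: "u (Suc i) \<le> s \<or> t \<le> u (Suc i)" if "i < k" for i
    using dich[of "Suc i"] that by simp
  define X where "X = {i\<in>{..<k}. u i \<le> s \<and> t \<le> u (Suc i)}"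
  have Et: "elementary_process k u h y \<omega> = (\<Sum>i\<in>X. h i \<omega>)" if "s < y" "y \<le> t" for y \<omega>
  proof -
    have "elementary_process k u h y \<omega> = (\<Sum>i<k. if u i \<le> s \<and> t \<le> u (Suc i) then h i \<omega> else 0)"
      unfolding elementary_process_def
    proof (rule sum.cong)
      fix i assume "i \<in> {..<k}"
      then show "indicator {u i<..u (Suc i)} y *\<^sub>R h i \<omega> = (if u i \<le> s \<and> t \<le> u (Suc i) then h i \<omega> else 0)"
        using dich[of i] dich_Suc[of i] that u_less[of i] by (auto simp: indicator_def)
    qed simp
    also have "\<dots> = (\<Sum>i\<in>X. h i \<omega>)" unfolding X_def by (rule sum.inter_filter[symmetric]) simp
    finally show ?thesis .
  qed
  have Xm: "h i \<in> borel_measurable (F s)" if "i \<in> X" for i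
    using that measurable_F_mono[OF hm[of i], of s] by (simp add: X_def)
  have "elementary_process k u h t = (\<lambda>\<omega>. \<Sum>i\<in>X. h i \<omega>)" using Et[of t] st by auto
  then show "elementary_process k u h t \<in> borel_measurable (F s)"
    using Xm by (auto intro: borel_measurable_sum)
  have "\<exists>B. \<forall>\<omega>\<in>space M. norm (h i \<omega>) \<le> B" if "i \<in> X" for i
    using hb[of i] that by (auto simp: bounded_iff X_def)
  then obtain B where B: "\<And>i \<omega>. i \<in> X \<Longrightarrow> \<omega> \<in> space M \<Longrightarrow> norm (h i \<omega>) \<le> B i" by metis
  have "norm (elementary_process k u h t \<omega>) \<le> (\<Sum>i\<in>X. B i)" if "\<omega> \<in> space M" for \<omega>
    using Et[of t \<omega>] st B that by (simp add: sum_norm_le)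
  then show "\<exists>B. \<forall>\<omega>\<in>space M. norm (elementary_process k u h t \<omega>) \<le> B" by blast
  fix \<omega>
  show "\<forall>y\<in>{s<..t}. elementary_process k u h y \<omega> = elementary_process k u h t \<omega>"
    using Et st by simp
  have "elementary_integral W k u h t \<omega> - elementary_integral W k u h s \<omega>
      = (\<Sum>i<k. h i \<omega> *v (W (min (u (Suc i)) t) \<omega> - W (min (u i) t) \<omega>)
           - h i \<omega> *v (W (min (u (Suc i)) s) \<omega> - W (min (u i) s) \<omega>))"
    by (simp add: elementary_integral_def sum_subtractf)
  also have "\<dots> = (\<Sum>i<k. if u i \<le> s \<and> t \<le> u (Suc i) then h i \<omega> *v (W t \<omega> - W s \<omega>) else 0)"
  proof (rule sum.cong)
    fix i assume "i \<in> {..<k}"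
    then have i: "i < k" by simp
    have lt: "u i < u (Suc i)" by (rule u_less[OF i])
    consider "u i \<le> s" "t \<le> u (Suc i)" | "u (Suc i) \<le> s" "u i \<le> s" | "t \<le> u i" "t \<le> u (Suc i)"
      using dich[of i] dich_Suc[of i] i lt by fastforce
    then show "h i \<omega> *v (W (min (u (Suc i)) t) \<omega> - W (min (u i) t) \<omega>)
           - h i \<omega> *v (W (min (u (Suc i)) s) \<omega> - W (min (u i) s) \<omega>)
       = (if u i \<le> s \<and> t \<le> u (Suc i) then h i \<omega> *v (W t \<omega> - W s \<omega>) else 0)"
    proof cases
      case 1
      then have "min (u (Suc i)) t = t" "min (u i) t = u i" "min (u (Suc i)) s = s" "min (u i) s = u i"
        using st by simp_all
      then show ?thesis using 1 by (simp add: matrix_vector_mult_diff_distrib)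
    next
      case 2
      then have "min (u (Suc i)) t = u (Suc i)" "min (u i) t = u i" "min (u (Suc i)) s = u (Suc i)" "min (u i) s = u i"
        using st by simp_all
      then show ?thesis using 2 st by simp
    next
      case 3
      then have "min (u (Suc i)) t = t" "min (u i) t = t" "min (u (Suc i)) s = s" "min (u i) s = s"
        using st by simp_all
      then show ?thesis using 3 st by simp
    qed
  qed simp
  also have "\<dots> = (\<Sum>i\<in>X. h i \<omega> *v (W t \<omega> - W s \<omega>))"
    unfolding X_def by (rule sum.inter_filter[symmetric]) simp
  also have "\<dots> = (\<Sum>i\<in>X. h i \<omega>) *v (W t \<omega> - W s \<omega>)"
  proof (induction X rule: infinite_finite_induct)
    case (insert x X)
    then show ?case by (simp add: matrix_vector_mult_add_rdistrib)
  qed simp_all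
  finally show "elementary_integral W k u h t \<omega> - elementary_integral W k u h s \<omega>
      = elementary_process k u h t \<omega> *v (W t \<omega> - W s \<omega>)"
    using Et[of t \<omega>] st by simp
qed

text \<open>Borel-Cantelli, for a sequence of indices at which both exceptional probabilities are below \<open>2\<^sup>-\<^sup>j\<close>.\<close>

lemma fast_subsequence:
  assumes "tendsto_zero_in_prob M Z1" "tendsto_zero_in_prob M Z2"
  shows "\<exists>n :: nat \<Rightarrow> nat. (AE \<omega> in M. \<forall>\<^sub>F j in sequentially. Z1 (n j) \<omega> \<le> ennreal ((1 / 4) ^ j)) \<and>
     (AE \<omega> in M. \<forall>\<^sub>F j in sequentially. Z2 (n j) \<omega> \<le> ennreal ((1 / 2) ^ j))"
proof -
  have m: "Z1 j \<in> borel_measurable M" "Z2 j \<in> borel_measurable M" for j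
    using assms by (auto simp: tendsto_zero_in_prob_def)
  let ?A1 = "\<lambda>j n. {\<omega> \<in> space M. ennreal ((1 / 4) ^ j) < Z1 n \<omega>}"
  let ?A2 = "\<lambda>j n. {\<omega> \<in> space M. ennreal ((1 / 2) ^ j) < Z2 n \<omega>}"
  have ex: "\<forall>j. \<exists>n. measure M (?A1 j n) < (1 / 2) ^ j \<and> measure M (?A2 j n) < (1 / 2) ^ j"
  proof
    fix j
    have "(\<lambda>n. measure M (?A1 j n)) \<longlonglongrightarrow> 0" "(\<lambda>n. measure M (?A2 j n)) \<longlonglongrightarrow> 0"
      using assms by (simp_all add: tendsto_zero_in_prob_def)
    then have "\<forall>\<^sub>F n in sequentially. measure M (?A1 j n) < (1 / 2) ^ j \<and> measure M (?A2 j n) < (1 / 2) ^ j"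
      by (intro eventually_conj order_tendstoD(2)) auto
    then show "\<exists>n. measure M (?A1 j n) < (1 / 2) ^ j \<and> measure M (?A2 j n) < (1 / 2) ^ j"
      using eventually_happens' sequentially_bot by blast
  qed
  from choice[OF ex] obtain n
    where n: "\<forall>j. measure M (?A1 j (n j)) < (1 / 2) ^ j \<and> measure M (?A2 j (n j)) < (1 / 2) ^ j" ..
  have s1: "?A1 j (n j) \<in> sets M" for j using m(1)[of "n j"] by measurable
  have s2: "?A2 j (n j) \<in> sets M" for j using m(2)[of "n j"] by measurable
  have sm: "summable (\<lambda>j. (1 / 2 :: real) ^ j)" by (rule summable_geometric) simp
  have "summable (\<lambda>j. measure M (?A1 j (n j)))"
    by (rule summable_comparison_test'[OF sm]) (use n in \<open>simp add: less_imp_le\<close>)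
  then have "AE \<omega> in M. \<forall>\<^sub>F j in sequentially. \<omega> \<in> space M - ?A1 j (n j)"
    by (intro borel_cantelli_AE1 s1) (simp_all add: emeasure_eq_measure)
  then have 1: "AE \<omega> in M. \<forall>\<^sub>F j in sequentially. Z1 (n j) \<omega> \<le> ennreal ((1 / 4) ^ j)"
    by (rule AE_mp, intro AE_I2 impI) (auto elim!: eventually_mono simp: not_less)
  have "summable (\<lambda>j. measure M (?A2 j (n j)))"
    by (rule summable_comparison_test'[OF sm]) (use n in \<open>simp add: less_imp_le\<close>)
  then have "AE \<omega> in M. \<forall>\<^sub>F j in sequentially. \<omega> \<in> space M - ?A2 j (n j)"
    by (intro borel_cantelli_AE1 s2) (simp_all add: emeasure_eq_measure)
  then have 2: "AE \<omega> in M. \<forall>\<^sub>F j in sequentially. Z2 (n j) \<omega> \<le> ennreal ((1 / 2) ^ j)"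
    by (rule AE_mp, intro AE_I2 impI) (auto elim!: eventually_mono simp: not_less)
  show ?thesis using 1 2 by blast
qed

lemma has_ito_integral_imp_limit:
  assumes "has_ito_integral M F W T H I" and T: "0 < T"
  shows "ito_limit M F W T H I"
proof -
  obtain k u h where el: "\<And>j. elementary_integrand M F T (k j) (u j) (h j)"
    and z1: "tendsto_zero_in_prob M (\<lambda>j \<omega>. \<integral>\<^sup>+s\<in>{0..T}.
          ennreal ((norm (elementary_process (k j) (u j) (h j) s \<omega> - H s \<omega>))\<^sup>2) \<partial>lborel)"
    and z2: "tendsto_zero_in_prob M (\<lambda>j \<omega>. SUP t\<in>{0..T}.
          ennreal (norm (elementary_integral W (k j) (u j) (h j) t \<omega> - I t \<omega>)))"
    using assms(1) unfolding has_ito_integral_def hs_norm_eq_norm by blast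
  obtain n where n1: "AE \<omega> in M. \<forall>\<^sub>F j in sequentially. (\<integral>\<^sup>+s\<in>{0..T}.
          ennreal ((norm (elementary_process (k (n j)) (u (n j)) (h (n j)) s \<omega> - H s \<omega>))\<^sup>2) \<partial>lborel) \<le> ennreal ((1 / 4) ^ j)"
    and n2: "AE \<omega> in M. \<forall>\<^sub>F j in sequentially. (SUP t\<in>{0..T}.
          ennreal (norm (elementary_integral W (k (n j)) (u (n j)) (h (n j)) t \<omega> - I t \<omega>))) \<le> ennreal ((1 / 2) ^ j)"
    using fast_subsequence[OF z1 z2] by blast
  have conv: "AE \<omega> in M. \<forall>t\<in>{0..T}. (\<lambda>j. elementary_integral W (k (n j)) (u (n j)) (h (n j)) t \<omega>) \<longlonglongrightarrow> I t \<omega>"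
    using n2
  proof (rule AE_mp, intro AE_I2 impI ballI)
    fix \<omega> t assume t: "t \<in> {0..T}" and ev: "\<forall>\<^sub>F j in sequentially. (SUP t\<in>{0..T}.
          ennreal (norm (elementary_integral W (k (n j)) (u (n j)) (h (n j)) t \<omega> - I t \<omega>))) \<le> ennreal ((1 / 2) ^ j)"
    have "\<forall>\<^sub>F j in sequentially. norm (elementary_integral W (k (n j)) (u (n j)) (h (n j)) t \<omega> - I t \<omega>) \<le> (1 / 2) ^ j"
      using ev
    proof (rule eventually_mono)
      fix j assume "(SUP t\<in>{0..T}. ennreal (norm (elementary_integral W (k (n j)) (u (n j)) (h (n j)) t \<omega> - I t \<omega>))) \<le> ennreal ((1 / 2) ^ j)"
      then have "ennreal (norm (elementary_integral W (k (n j)) (u (n j)) (h (n j)) t \<omega> - I t \<omega>)) \<le> ennreal ((1 / 2) ^ j)"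
        using t by (meson SUP_upper order_trans)
      then show "norm (elementary_integral W (k (n j)) (u (n j)) (h (n j)) t \<omega> - I t \<omega>) \<le> (1 / 2) ^ j"
        by (simp add: ennreal_le_iff)
    qed
    then have "(\<lambda>j. elementary_integral W (k (n j)) (u (n j)) (h (n j)) t \<omega> - I t \<omega>) \<longlonglongrightarrow> 0"
      by (rule Lim_null_comparison) (rule LIMSEQ_power_zero, simp)
    then show "(\<lambda>j. elementary_integral W (k (n j)) (u (n j)) (h (n j)) t \<omega>) \<longlonglongrightarrow> I t \<omega>"
      by (rule LIM_zero_cancel)
  qed
  show ?thesis unfolding ito_limit_def
  proof (intro conjI ballI)
    show "AE \<omega> in M. continuous_on {0..T} (\<lambda>t. I t \<omega>)"
      using assms(1) by (simp add: has_ito_integral_def)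
    show "I t \<in> borel_measurable M" if "t \<in> {0..T}" for t
      using assms(1) that by (intro measurable_F[of _ t]) (simp add: has_ito_integral_def)
    fix \<omega> assume \<omega>: "\<omega> \<in> space M"
    have "(\<lambda>(s, \<omega>). H s \<omega>) \<in> borel_measurable (restrict_space borel {0..T} \<Otimes>\<^sub>M F T)"
      using assms T by (simp add: has_ito_integral_def progressively_measurable_def)
    then have "(\<lambda>s. (\<lambda>(s, \<omega>). H s \<omega>) (s, \<omega>)) \<in> borel_measurable (restrict_space borel {0..T})"
      by (rule measurable_Pair1) (simp add: space_F \<omega>)
    then show "(\<lambda>s. indicator {0..T} s *\<^sub>R H s \<omega>) \<in> borel_measurable borel"
      by (subst (asm) borel_measurable_restrict_space_iff) (auto simp: mult.commute)
  next
    show "\<exists>D E S c. (\<forall>j. simple_ito M F W T (D j) (E j) (S j)) \<and>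
      (AE \<omega> in M. \<forall>\<^sub>F j in sequentially.
        (\<integral>\<^sup>+s\<in>{0..T}. ennreal ((norm (E j s \<omega> - H s \<omega>))\<^sup>2) \<partial>lborel) \<le> ennreal (c * (1 / 4) ^ j)) \<and>
      (AE \<omega> in M. \<forall>t\<in>{0..T}. (\<lambda>j. S j t \<omega>) \<longlonglongrightarrow> I t \<omega>)"
      by (rule exI[of _ "\<lambda>j. u (n j) ` {..k (n j)}"],
          rule exI[of _ "\<lambda>j. elementary_process (k (n j)) (u (n j)) (h (n j))"],
          rule exI[of _ "\<lambda>j. elementary_integral W (k (n j)) (u (n j)) (h (n j))"], rule exI[of _ 1])
         (intro conjI allI simple_ito_elementary el conv, use n1 in simp)
  qed
qed

text \<open>The error of the scheme is driven by the integral of a difference of two integrands, whose approximants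
have unrelated partitions.\<close>

lemma ito_limit_diff:
  assumes 1: "ito_limit M F W T H1 I1" and 2: "ito_limit M F W T H2 I2"
  shows "ito_limit M F W T (\<lambda>t \<omega>. H1 t \<omega> - H2 t \<omega>) (\<lambda>t \<omega>. I1 t \<omega> - I2 t \<omega>)"
proof -
  obtain D1 E1 S1 c1 where s1: "\<And>j. simple_ito M F W T (D1 j) (E1 j) (S1 j)" and
    a1: "AE \<omega> in M. \<forall>\<^sub>F j in sequentially.
        (\<integral>\<^sup>+s\<in>{0..T}. ennreal ((norm (E1 j s \<omega> - H1 s \<omega>))\<^sup>2) \<partial>lborel) \<le> ennreal (c1 * (1 / 4) ^ j)" and
    l1: "AE \<omega> in M. \<forall>t\<in>{0..T}. (\<lambda>j. S1 j t \<omega>) \<longlonglongrightarrow> I1 t \<omega>"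
    using 1 unfolding ito_limit_def by blast
  obtain D2 E2 S2 c2 where s2: "\<And>j. simple_ito M F W T (D2 j) (E2 j) (S2 j)" and
    a2: "AE \<omega> in M. \<forall>\<^sub>F j in sequentially.
        (\<integral>\<^sup>+s\<in>{0..T}. ennreal ((norm (E2 j s \<omega> - H2 s \<omega>))\<^sup>2) \<partial>lborel) \<le> ennreal (c2 * (1 / 4) ^ j)" and
    l2: "AE \<omega> in M. \<forall>t\<in>{0..T}. (\<lambda>j. S2 j t \<omega>) \<longlonglongrightarrow> I2 t \<omega>"
    using 2 unfolding ito_limit_def by blast
  have m1: "\<omega> \<in> space M \<Longrightarrow> (\<lambda>s. indicator {0..T} s *\<^sub>R H1 s \<omega>) \<in> borel_measurable borel" for \<omega>
    using 1 unfolding ito_limit_def by blast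
  have m2: "\<omega> \<in> space M \<Longrightarrow> (\<lambda>s. indicator {0..T} s *\<^sub>R H2 s \<omega>) \<in> borel_measurable borel" for \<omega>
    using 2 unfolding ito_limit_def by blast
  let ?E = "\<lambda>j t \<omega>. E1 j t \<omega> - E2 j t \<omega>" and ?H = "\<lambda>t \<omega>. H1 t \<omega> - H2 t \<omega>"
  let ?c = "2 * \<bar>c1\<bar> + 2 * \<bar>c2\<bar>"
  have a: "AE \<omega> in M. \<forall>\<^sub>F j in sequentially.
        (\<integral>\<^sup>+s\<in>{0..T}. ennreal ((norm (?E j s \<omega> - ?H s \<omega>))\<^sup>2) \<partial>lborel) \<le> ennreal (?c * (1 / 4) ^ j)"
    using AE_space a1 a2
  proof eventually_elim
    fix \<omega> assume \<omega>: "\<omega> \<in> space M"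
      and e1: "\<forall>\<^sub>F j in sequentially.
        (\<integral>\<^sup>+s\<in>{0..T}. ennreal ((norm (E1 j s \<omega> - H1 s \<omega>))\<^sup>2) \<partial>lborel) \<le> ennreal (c1 * (1 / 4) ^ j)"
      and e2: "\<forall>\<^sub>F j in sequentially.
        (\<integral>\<^sup>+s\<in>{0..T}. ennreal ((norm (E2 j s \<omega> - H2 s \<omega>))\<^sup>2) \<partial>lborel) \<le> ennreal (c2 * (1 / 4) ^ j)"
    from e1 e2 show "\<forall>\<^sub>F j in sequentially.
        (\<integral>\<^sup>+s\<in>{0..T}. ennreal ((norm (?E j s \<omega> - ?H s \<omega>))\<^sup>2) \<partial>lborel) \<le> ennreal (?c * (1 / 4) ^ j)"
    proof eventually_elim
      fix j
      assume j1: "(\<integral>\<^sup>+s\<in>{0..T}. ennreal ((norm (E1 j s \<omega> - H1 s \<omega>))\<^sup>2) \<partial>lborel) \<le> ennreal (c1 * (1 / 4) ^ j)"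
        and j2: "(\<integral>\<^sup>+s\<in>{0..T}. ennreal ((norm (E2 j s \<omega> - H2 s \<omega>))\<^sup>2) \<partial>lborel) \<le> ennreal (c2 * (1 / 4) ^ j)"
      have "(\<integral>\<^sup>+s\<in>{0..T}. ennreal ((norm (?E j s \<omega> - ?H s \<omega>))\<^sup>2) \<partial>lborel)
        \<le> (\<integral>\<^sup>+s. 2 * (ennreal ((norm (E1 j s \<omega> - H1 s \<omega>))\<^sup>2) * indicator {0..T} s)
             + 2 * (ennreal ((norm (E2 j s \<omega> - H2 s \<omega>))\<^sup>2) * indicator {0..T} s) \<partial>lborel)"
      proof (rule nn_integral_mono)
        fix s
        let ?x = "norm (E1 j s \<omega> - H1 s \<omega>)" and ?y = "norm (E2 j s \<omega> - H2 s \<omega>)"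
        have "norm (?E j s \<omega> - ?H s \<omega>) = norm ((E1 j s \<omega> - H1 s \<omega>) - (E2 j s \<omega> - H2 s \<omega>))"
          by (simp add: algebra_simps)
        also have "\<dots> \<le> ?x + ?y" by (rule norm_triangle_ineq4)
        finally have "(norm (?E j s \<omega> - ?H s \<omega>))\<^sup>2 \<le> (?x + ?y)\<^sup>2" by (rule power_mono) simp
        also have "\<dots> \<le> 2 * ?x\<^sup>2 + 2 * ?y\<^sup>2"
          using sum_squares_bound[of ?x ?y] by (simp add: power2_sum)
        finally have "ennreal ((norm (?E j s \<omega> - ?H s \<omega>))\<^sup>2) \<le> ennreal (2 * ?x\<^sup>2 + 2 * ?y\<^sup>2)"
          by (rule ennreal_leI)
        also have "\<dots> = 2 * ennreal (?x\<^sup>2) + 2 * ennreal (?y\<^sup>2)" by (simp add: ennreal_mult)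
        finally show "ennreal ((norm (?E j s \<omega> - ?H s \<omega>))\<^sup>2) * indicator {0..T} s
          \<le> 2 * (ennreal (?x\<^sup>2) * indicator {0..T} s) + 2 * (ennreal (?y\<^sup>2) * indicator {0..T} s)"
          by (auto simp: indicator_def)
      qed
      also have "\<dots> = 2 * (\<integral>\<^sup>+s\<in>{0..T}. ennreal ((norm (E1 j s \<omega> - H1 s \<omega>))\<^sup>2) \<partial>lborel)
         + 2 * (\<integral>\<^sup>+s\<in>{0..T}. ennreal ((norm (E2 j s \<omega> - H2 s \<omega>))\<^sup>2) \<partial>lborel)"
        using square_dist_measurable[OF simple_ito_measurable[OF s1] m1[OF \<omega>], of j] square_dist_measurable[OF simple_ito_measurable[OF s2] m2[OF \<omega>], of j]
        by (subst nn_integral_add) (auto simp: nn_integral_cmult intro!: borel_measurable_times_ennreal)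
      also have "\<dots> \<le> 2 * ennreal (\<bar>c1\<bar> * (1 / 4) ^ j) + 2 * ennreal (\<bar>c2\<bar> * (1 / 4) ^ j)"
        by (intro add_mono mult_left_mono order_trans[OF j1] order_trans[OF j2] ennreal_leI mult_right_mono) auto
      also have "\<dots> = ennreal (?c * (1 / 4) ^ j)"
        by (simp add: distrib_right ennreal_mult ennreal_plus flip: mult.assoc)
      finally show "(\<integral>\<^sup>+s\<in>{0..T}. ennreal ((norm (?E j s \<omega> - ?H s \<omega>))\<^sup>2) \<partial>lborel) \<le> ennreal (?c * (1 / 4) ^ j)" .
    qed
  qed
  have l: "AE \<omega> in M. \<forall>t\<in>{0..T}. (\<lambda>j. S1 j t \<omega> - S2 j t \<omega>) \<longlonglongrightarrow> I1 t \<omega> - I2 t \<omega>"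
    using l1 l2 by eventually_elim (auto intro: tendsto_diff)
  show ?thesis unfolding ito_limit_def
  proof (intro conjI ballI)
    show "(\<lambda>s. indicator {0..T} s *\<^sub>R ?H s \<omega>) \<in> borel_measurable borel" if "\<omega> \<in> space M" for \<omega>
      using borel_measurable_diff[OF m1[OF that] m2[OF that]] by (simp add: scaleR_diff_right)
    show "(\<lambda>\<omega>. I1 t \<omega> - I2 t \<omega>) \<in> borel_measurable M" if "t \<in> {0..T}" for t
      using 1 2 that by (intro borel_measurable_diff) (auto simp: ito_limit_def)
    have "AE \<omega> in M. continuous_on {0..T} (\<lambda>t. I1 t \<omega>)" "AE \<omega> in M. continuous_on {0..T} (\<lambda>t. I2 t \<omega>)"
      using 1 2 by (auto simp: ito_limit_def)
    then show "AE \<omega> in M. continuous_on {0..T} (\<lambda>t. I1 t \<omega> - I2 t \<omega>)"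
      by eventually_elim (rule continuous_on_diff)
  next
    show "\<exists>D E S c. (\<forall>j. simple_ito M F W T (D j) (E j) (S j)) \<and>
      (AE \<omega> in M. \<forall>\<^sub>F j in sequentially.
        (\<integral>\<^sup>+s\<in>{0..T}. ennreal ((norm (E j s \<omega> - ?H s \<omega>))\<^sup>2) \<partial>lborel) \<le> ennreal (c * (1 / 4) ^ j)) \<and>
      (AE \<omega> in M. \<forall>t\<in>{0..T}. (\<lambda>j. S j t \<omega>) \<longlonglongrightarrow> I1 t \<omega> - I2 t \<omega>)"
      by (rule exI[of _ "\<lambda>j. D1 j \<union> D2 j"], rule exI[of _ ?E],
          rule exI[of _ "\<lambda>j t \<omega>. S1 j t \<omega> - S2 j t \<omega>"], rule exI[of _ ?c])
         (intro conjI allI simple_ito_diff s1 s2 a l)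
  qed
qed

end

section \<open>Grids\<close>

definition grid :: "real \<Rightarrow> real \<Rightarrow> nat \<Rightarrow> (nat \<Rightarrow> real) \<Rightarrow> bool" where
  "grid s t K v \<longleftrightarrow> 0 < K \<and> v 0 = s \<and> v K = t \<and> (\<forall>a<K. v a < v (Suc a))"

lemma grid_strict_mono:
  assumes "grid s t K v" "a < b" "b \<le> K" shows "v a < v b"
  using assms(2,3)
proof (induction b)
  case (Suc b)
  have "v b < v (Suc b)" using Suc.prems assms(1) by (simp add: grid_def)
  then show ?case using Suc by (cases "a = b") auto
qed simp

lemma grid_mono: "grid s t K v \<Longrightarrow> a \<le> b \<Longrightarrow> b \<le> K \<Longrightarrow> v a \<le> v b"
  using grid_strict_mono[of s t K v a b] by (cases "a = b") auto

lemma exists_grid_avoiding: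
  fixes A :: "real set"
  assumes "finite A" "s < t"
  shows "\<exists>K v. grid s t K v \<and> A \<inter> {s..t} \<subseteq> v ` {..K} \<and> (\<forall>a<K. A \<inter> {v a<..<v (Suc a)} = {})"
proof -
  define B where "B = insert s (insert t (A \<inter> {s..t}))"
  define xs where "xs = sorted_list_of_set B"
  define v where "v a = xs ! a" for a
  define K where "K = length xs - 1"
  have fin: "finite B" using assms by (simp add: B_def)
  have set: "set xs = B" using fin by (simp add: xs_def)
  have sorted: "sorted_wrt (<) xs" by (simp add: xs_def)
  have less: "v a < v b" if "a < b" "b < length xs" for a b
    using sorted_wrt_nth_less[OF sorted that] by (simp add: v_def)
  have len: "2 \<le> length xs"
  proof -
    have "card {s, t} \<le> card B" by (rule card_mono[OF fin]) (simp add: B_def)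
    then show ?thesis using assms by (simp add: xs_def)
  qed
  have mem: "\<exists>i<length xs. v i = x" if "x \<in> B" for x
    using that unfolding set[symmetric] in_set_conv_nth v_def by blast
  have vB: "v i \<in> B" if "i < length xs" for i
    using nth_mem[OF that] by (simp add: v_def set)
  have ran: "s \<le> v i" "v i \<le> t" if "i < length xs" for i
    using vB[OF that] assms by (auto simp: B_def)
  obtain i where i: "i < length xs" "v i = s" using mem[of s] by (auto simp: B_def)
  have v0: "v 0 = s"
  proof (cases "i = 0")
    case False
    then have "v 0 < s" using less[of 0 i] i by simp
    moreover have "s \<le> v 0" using len by (intro ran(1)) linarith
    ultimately show ?thesis by simp
  qed (use i in simp)
  obtain k where k: "k < length xs" "v k = t" using mem[of t] by (auto simp: B_def)
  have vK: "v K = t"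
  proof (cases "k = K")
    case False
    then have "k < K" using k by (simp add: K_def)
    have Kl: "K < length xs" using len by (simp add: K_def)
    show ?thesis using less[OF \<open>k < K\<close> Kl] k ran(2)[OF Kl] by simp
  qed (use k in simp)
  have g: "grid s t K v" using len v0 vK less by (simp add: grid_def K_def)
  have sub: "A \<inter> {s..t} \<subseteq> v ` {..K}"
  proof
    fix x assume "x \<in> A \<inter> {s..t}"
    then obtain i where "i < length xs" "v i = x" using mem[of x] by (auto simp: B_def)
    then show "x \<in> v ` {..K}" by (auto simp: K_def)
  qed
  have "A \<inter> {v a<..<v (Suc a)} = {}" if a: "a < K" for a
  proof (rule ccontr)
    assume "A \<inter> {v a<..<v (Suc a)} \<noteq> {}"
    then obtain x where x: "x \<in> A" "v a < x" "x < v (Suc a)" by auto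
    have l: "a < length xs" "Suc a < length xs" using a by (simp_all add: K_def)
    have "x \<in> {s..t}" using x ran(1)[OF l(1)] ran(2)[OF l(2)] by simp
    then obtain i where i: "i < length xs" "v i = x" using x mem[of x] by (auto simp: B_def)
    have "\<not> i \<le> a" using less[of i a] i x l(1) by (cases "i = a") auto
    moreover have "\<not> Suc a \<le> i" using less[of "Suc a" i] i x by (cases "i = Suc a") auto
    ultimately show False by simp
  qed
  with g sub show ?thesis by blast
qed

text \<open>The equidistant points that are added to \<open>A\<close> make every step of the grid short.\<close>

lemma exists_fine_grid:
  fixes A :: "real set"
  assumes A: "finite A" and st: "s < t" and n: "0 < (n::nat)"
  shows "\<exists>K v. grid s t K v \<and> A \<inter> {s..t} \<subseteq> v ` {..K} \<and> (\<forall>a<K. A \<inter> {v a<..<v (Suc a)} = {}) \<and>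
    (\<forall>a<K. v (Suc a) - v a \<le> (t - s) / real n)"
proof -
  define \<eta> where "\<eta> = (t - s) / real n"
  have \<eta>: "0 < \<eta>" using st n by (simp add: \<eta>_def)
  let ?U = "(\<lambda>l. s + real l * \<eta>) ` {..n}"
  obtain K v where g: "grid s t K v" and sub: "(A \<union> ?U) \<inter> {s..t} \<subseteq> v ` {..K}"
    and avoid: "\<forall>a<K. (A \<union> ?U) \<inter> {v a<..<v (Suc a)} = {}"
    using exists_grid_avoiding[of "A \<union> ?U" s t] A st by auto
  have "v (Suc a) - v a \<le> \<eta>" if a: "a < K" for a
  proof (rule ccontr)
    assume c: "\<not> v (Suc a) - v a \<le> \<eta>"
    have sa: "s \<le> v a" using grid_mono[OF g, of 0 a] g a by (simp add: grid_def)
    have ta: "v (Suc a) \<le> t" using grid_mono[OF g, of "Suc a" K] g a by (simp add: grid_def)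
    define l where "l = nat (\<lfloor>(v a - s) / \<eta>\<rfloor> + 1)"
    have fl: "0 \<le> (v a - s) / \<eta>" using sa \<eta> by simp
    then have l: "real l = of_int \<lfloor>(v a - s) / \<eta>\<rfloor> + 1" by (simp add: l_def)
    have "(v a - s) / \<eta> < real l" "real l \<le> (v a - s) / \<eta> + 1" unfolding l by linarith+
    then have l2: "v a < s + real l * \<eta>" "s + real l * \<eta> \<le> v a + \<eta>" using \<eta> by (simp_all add: field_simps)
    then have l3: "s + real l * \<eta> < v (Suc a)" using c by simp
    then have "real l * \<eta> < real n * \<eta>" using ta n by (simp add: \<eta>_def)
    then have "l \<le> n" using \<eta> by simp
    then have "s + real l * \<eta> \<in> (A \<union> ?U) \<inter> {v a<..<v (Suc a)}" using l2 l3 by auto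
    then show False using avoid a by blast
  qed
  then show ?thesis using g sub avoid unfolding \<eta>_def by blast
qed

lemma grid_sum_le_nn_integral:
  assumes g: "grid s t K v" and b: "b \<le> K"
    and le: "\<And>a y. a < b \<Longrightarrow> v a < y \<Longrightarrow> y \<le> v (Suc a) \<Longrightarrow> ennreal (f a) \<le> \<Phi> y"
    and f0: "\<And>a. 0 \<le> f a"
  shows "ennreal (\<Sum>a<b. (v (Suc a) - v a) * f a) \<le> (\<integral>\<^sup>+y. \<Phi> y \<partial>lborel)"
proof -
  have d: "0 \<le> v (Suc a) - v a" if "a < b" for a
    using grid_mono[OF g, of a "Suc a"] that b by simp
  have "ennreal (\<Sum>a<b. (v (Suc a) - v a) * f a) = (\<Sum>a<b. ennreal ((v (Suc a) - v a) * f a))"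
    using d f0 by (intro sum_ennreal[symmetric]) simp
  also have "\<dots> = (\<Sum>a<b. \<integral>\<^sup>+y. ennreal (f a) * indicator {v a<..v (Suc a)} y \<partial>lborel)"
    using d f0 by (intro sum.cong) (simp_all add: nn_integral_cmult ennreal_mult mult.commute)
  also have "\<dots> = (\<integral>\<^sup>+y. (\<Sum>a<b. ennreal (f a) * indicator {v a<..v (Suc a)} y) \<partial>lborel)"
    by (rule nn_integral_sum[symmetric]) simp
  also have "\<dots> \<le> (\<integral>\<^sup>+y. \<Phi> y \<partial>lborel)"
  proof (rule nn_integral_mono)
    fix y
    show "(\<Sum>a<b. ennreal (f a) * indicator {v a<..v (Suc a)} y) \<le> \<Phi> y"
    proof (cases "\<exists>a<b. v a < y \<and> y \<le> v (Suc a)")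
      case True
      then obtain a where a: "a < b" "v a < y" "y \<le> v (Suc a)" by blast
      have "(\<Sum>a'<b. ennreal (f a') * indicator {v a'<..v (Suc a')} y) = (\<Sum>a'\<in>{a}. ennreal (f a') * indicator {v a'<..v (Suc a')} y)"
      proof (rule sum.mono_neutral_right)
        show "\<forall>i\<in>{..<b} - {a}. ennreal (f i) * indicator {v i<..v (Suc i)} y = 0"
        proof
          fix i assume i: "i \<in> {..<b} - {a}"
          then consider "Suc i \<le> a" | "Suc a \<le> i" by fastforce
          then have "\<not> (v i < y \<and> y \<le> v (Suc i))"
          proof cases
            case 1
            then have "v (Suc i) \<le> v a" using grid_mono[OF g, of "Suc i" a] a b by simp
            then show ?thesis using a by linarith
          next
            case 2
            then have "v (Suc a) \<le> v i" using grid_mono[OF g, of "Suc a" i] i b by simp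
            then show ?thesis using a by linarith
          qed
          then show "ennreal (f i) * indicator {v i<..v (Suc i)} y = 0" by (simp add: indicator_def)
        qed
      qed (use a in auto)
      also have "\<dots> = ennreal (f a)" using a by simp
      also have "\<dots> \<le> \<Phi> y" by (rule le[OF a])
      finally show ?thesis .
    next
      case False
      then have "(\<Sum>a<b. ennreal (f a) * indicator {v a<..v (Suc a)} y) = 0"
        by (intro sum.neutral) (auto simp: indicator_def)
      then show ?thesis by simp
    qed
  qed
  finally show ?thesis .
qed

section \<open>Truncation\<close>

text \<open>The metric projection onto the ball of radius \<open>R\<close>.  It is \<open>1\<close>-Lipschitz, so truncation does not increase the distance
between an approximant and an integrand that is bounded by \<open>R\<close>.\<close>

definition trunc :: "real \<Rightarrow> 'b::euclidean_space \<Rightarrow> 'b" where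
  "trunc R = closest_point (cball 0 R)"

lemma trunc_eq: "norm x \<le> R \<Longrightarrow> trunc R x = x"
  by (simp add: trunc_def closest_point_self)

lemma norm_trunc_le: "0 \<le> R \<Longrightarrow> norm (trunc R x) \<le> R"
  using closest_point_in_set[of "cball 0 R" x] by (simp add: trunc_def)

lemma dist_trunc_le: "0 \<le> R \<Longrightarrow> norm (trunc R x - trunc R y) \<le> norm (x - y)"
  using closest_point_lipschitz[of "cball 0 R" x y] by (simp add: trunc_def dist_norm)

lemma trunc_measurable:
  assumes "0 \<le> R" shows "trunc R \<in> borel_measurable borel"
  unfolding trunc_def using assms
  by (intro borel_measurable_continuous_onI continuous_on_closest_point) auto

lemma power_le_power_add:
  fixes x y R :: real
  assumes "0 \<le> x" "x \<le> R" "0 \<le> y" "y \<le> R" "1 \<le> p"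
  shows "x ^ p \<le> y ^ p + real p * R ^ (p - 1) * \<bar>x - y\<bar>"
proof (cases "x \<le> y")
  case True
  have "x ^ p \<le> y ^ p" using True assms by (intro power_mono)
  moreover have "0 \<le> real p * R ^ (p - 1) * \<bar>x - y\<bar>" using assms by simp
  ultimately show ?thesis by linarith
next
  case False
  have "x ^ p - y ^ p = (x - y) * (\<Sum>i<p. y ^ (p - Suc i) * x ^ i)" by (rule power_diff_sumr2)
  also have "\<dots> \<le> (x - y) * (\<Sum>i<p. R ^ (p - 1))"
  proof (intro mult_left_mono sum_mono)
    fix i assume i: "i \<in> {..<p}"
    have "y ^ (p - Suc i) * x ^ i \<le> R ^ (p - Suc i) * R ^ i"
      using assms by (intro mult_mono power_mono) auto
    also have "\<dots> = R ^ (p - 1)" using i by (simp flip: power_add)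
    finally show "y ^ (p - Suc i) * x ^ i \<le> R ^ (p - 1)" .
  qed (use False in simp)
  finally show ?thesis using False by (simp add: mult_ac)
qed

section \<open>A stopped step integral\<close>

text \<open>A simple integral \<open>S\<close> of \<open>E\<close> on a grid of \<open>[s, t]\<close>, together with an event \<open>alive u\<close> in \<open>F u\<close> for each time, which once lost is never
regained.  The event plays the part of \<open>u \<le> \<rho>\<close> for a stopping time \<open>\<rho>\<close>.\<close>

locale stopped_step = brownian_motion M F W
  for M :: "'a measure" and F and W :: "real \<Rightarrow> 'a \<Rightarrow> real ^ 'm" +
  fixes T R :: real and alive :: "real \<Rightarrow> 'a \<Rightarrow> bool" and s t :: real
    and D :: "real set" and E :: "real \<Rightarrow> 'a \<Rightarrow> real ^ 'm ^ 'n" and S :: "real \<Rightarrow> 'a \<Rightarrow> real ^ 'n"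
    and K :: nat and v :: "nat \<Rightarrow> real"
  assumes s0: "0 \<le> s" and tT: "t \<le> T" and R0: "0 \<le> R"
    and alive_measurable: "\<And>u. 0 \<le> u \<Longrightarrow> Measurable.pred (F u) (alive u)"
    and alive_antimono: "\<And>u u' \<omega>. u \<le> u' \<Longrightarrow> alive u' \<omega> \<Longrightarrow> alive u \<omega>"
    and simple: "simple_ito M F W T D E S"
    and grid: "grid s t K v"
    and avoid: "\<And>a. a < K \<Longrightarrow> D \<inter> {v a<..<v (Suc a)} = {}"
begin

text \<open>On a step that begins alive, \<open>E\<close> is the sum of its truncation and an excess; the truncation is bounded, and the excess is
small when \<open>E\<close> approximates an integrand bounded by \<open>R\<close>.\<close>

definition capped :: "nat \<Rightarrow> 'a \<Rightarrow> real ^ 'm ^ 'n" where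
  "capped a \<omega> = (if alive (v a) \<omega> then trunc R (E (v (Suc a)) \<omega>) else 0)"

definition excess :: "nat \<Rightarrow> 'a \<Rightarrow> real ^ 'm ^ 'n" where
  "excess a \<omega> = (if alive (v a) \<omega> then E (v (Suc a)) \<omega> - trunc R (E (v (Suc a)) \<omega>) else 0)"

text \<open>The excess, switched off for good before its energy exceeds \<open>\<eta>\<close>.  Whether a step is switched off is known at its left end point,
so the gated excess is again a legitimate integrand; its integral is bounded in \<open>L\<^sup>2\<close> by \<open>\<eta>\<close> without any
bound on the expected energy of the excess itself.\<close>

definition gated :: "real \<Rightarrow> nat \<Rightarrow> 'a \<Rightarrow> real ^ 'm ^ 'n" where
  "gated \<eta> a \<omega> = (if (\<Sum>l<Suc a. (v (Suc l) - v l) * (norm (excess l \<omega>))\<^sup>2) \<le> \<eta> then excess a \<omega> else 0)"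

lemma v_less: "a < K \<Longrightarrow> v a < v (Suc a)"
  using grid by (simp add: grid_def)

lemma v_ge: "a \<le> K \<Longrightarrow> s \<le> v a" and v_le: "a \<le> K \<Longrightarrow> v a \<le> t"
  using grid_mono[OF grid, of 0 a] grid_mono[OF grid, of a K] grid by (auto simp: grid_def)

lemma v0: "0 \<le> v 0" using v_ge[of 0] s0 by simp

lemma step:
  assumes a: "a < K"
  shows "E (v (Suc a)) \<in> borel_measurable (F (v a))" "\<exists>B. \<forall>\<omega>\<in>space M. norm (E (v (Suc a)) \<omega>) \<le> B"
    "\<And>y \<omega>. v a < y \<Longrightarrow> y \<le> v (Suc a) \<Longrightarrow> E y \<omega> = E (v (Suc a)) \<omega>"
    "\<And>\<omega>. S (v (Suc a)) \<omega> - S (v a) \<omega> = E (v (Suc a)) \<omega> *v (W (v (Suc a)) \<omega> - W (v a) \<omega>)"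
proof -
  have 1: "0 \<le> v a" using v_ge[of a] a s0 by simp
  have 2: "v (Suc a) \<le> T" using v_le[of "Suc a"] a tT by simp
  note * = simple_itoD[OF simple 1 v_less[OF a] 2 avoid[OF a]]
  show "E (v (Suc a)) \<in> borel_measurable (F (v a))" by (rule *(1))
  show "\<exists>B. \<forall>\<omega>\<in>space M. norm (E (v (Suc a)) \<omega>) \<le> B" by (rule *(2))
  show "E y \<omega> = E (v (Suc a)) \<omega>" if "v a < y" "y \<le> v (Suc a)" for y \<omega> using that by (rule *(3))
  show "S (v (Suc a)) \<omega> - S (v a) \<omega> = E (v (Suc a)) \<omega> *v (W (v (Suc a)) \<omega> - W (v a) \<omega>)" for \<omega> by (rule *(4))
qed

lemma trunc_step_measurable:
  assumes a: "a < K" shows "(\<lambda>\<omega>. trunc R (E (v (Suc a)) \<omega>)) \<in> borel_measurable (F (v a))"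
  by (rule measurable_compose[OF step(1)[OF a] trunc_measurable[OF R0]])

lemma alive_step: assumes a: "a < K" shows "Measurable.pred (F (v a)) (alive (v a))"
  using alive_measurable[of "v a"] v_ge[of a] a s0 by simp

lemma capped_measurable: assumes a: "a < K" shows "capped a \<in> borel_measurable (F (v a))"
  unfolding capped_def[abs_def] by (intro measurable_If alive_step[OF a, unfolded pred_def] trunc_step_measurable[OF a] borel_measurable_const alive_step[OF a])

lemma excess_measurable: assumes a: "a < K" shows "excess a \<in> borel_measurable (F (v a))"
  unfolding excess_def[abs_def]
  by (intro measurable_If borel_measurable_diff step(1)[OF a] alive_step[OF a, unfolded pred_def] trunc_step_measurable[OF a] borel_measurable_const)

lemma norm_capped_le: "norm (capped a \<omega>) \<le> R"
  using norm_trunc_le[OF R0, of "E (v (Suc a)) \<omega>"] R0 by (simp add: capped_def)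

lemma excess_bounded: assumes a: "a < K" shows "\<exists>B. \<forall>\<omega>\<in>space M. norm (excess a \<omega>) \<le> B"
proof -
  obtain B where B: "\<forall>\<omega>\<in>space M. norm (E (v (Suc a)) \<omega>) \<le> B" using step(2)[OF a] by blast
  have "norm (excess a \<omega>) \<le> \<bar>B\<bar> + R" if "\<omega> \<in> space M" for \<omega>
  proof -
    have "norm (E (v (Suc a)) \<omega> - trunc R (E (v (Suc a)) \<omega>)) \<le> norm (E (v (Suc a)) \<omega>) + norm (trunc R (E (v (Suc a)) \<omega>))"
      by (rule norm_triangle_ineq4)
    also have "\<dots> \<le> B + R" using B that norm_trunc_le[OF R0] by (intro add_mono) auto
    also have "\<dots> \<le> \<bar>B\<bar> + R" by simp
    finally show ?thesis using R0 by (simp add: excess_def)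
  qed
  then show ?thesis by blast
qed

lemma gated_measurable: assumes a: "a < K" shows "gated \<eta> a \<in> borel_measurable (F (v a))"
proof -
  have Gl: "(\<lambda>\<omega>. norm (excess l \<omega>)) \<in> borel_measurable (F (v a))" if "l < Suc a" for l
    by (rule measurable_compose[OF measurable_F_mono[OF excess_measurable] borel_measurable_norm])
       (use that a grid_mono[OF grid, of l a] in auto)
  have "(\<lambda>\<omega>. \<Sum>l<Suc a. (v (Suc l) - v l) * (norm (excess l \<omega>))\<^sup>2) \<in> borel_measurable (F (v a))"
    by (intro borel_measurable_sum borel_measurable_times borel_measurable_const borel_measurable_power Gl) simp
  then have "{\<omega> \<in> space (F (v a)). (\<Sum>l<Suc a. (v (Suc l) - v l) * (norm (excess l \<omega>))\<^sup>2) \<le> \<eta>} \<in> sets (F (v a))"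
    by (rule borel_measurable_le) (rule borel_measurable_const)
  then show ?thesis unfolding gated_def[abs_def]
    by (intro measurable_If excess_measurable[OF a] borel_measurable_const)
qed

sublocale capped_grid: matrix_grid_integrand M F W v K capped
proof
  show "0 \<le> v 0" by (rule v0)
  fix a assume a: "a < K"
  show "v a < v (Suc a)" by (rule v_less[OF a])
  show "capped a \<in> borel_measurable (F (v a))" by (rule capped_measurable[OF a])
  show "\<exists>B. \<forall>\<omega>\<in>space M. norm (capped a \<omega>) \<le> B" using norm_capped_le by blast
qed

lemma gated_grid: assumes b: "b \<le> K" shows "matrix_grid_integrand M F W v b (gated \<eta>)"
proof
  show "0 \<le> v 0" by (rule v0)
  fix a assume "a < b"
  then have a: "a < K" using b by simp
  show "v a < v (Suc a)" by (rule v_less[OF a])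
  show "gated \<eta> a \<in> borel_measurable (F (v a))" by (rule gated_measurable[OF a])
  obtain B where B: "\<forall>\<omega>\<in>space M. norm (excess a \<omega>) \<le> B" using excess_bounded[OF a] by blast
  have "\<forall>\<omega>\<in>space M. norm (gated \<eta> a \<omega>) \<le> \<bar>B\<bar>"
  proof
    fix \<omega> assume "\<omega> \<in> space M"
    then have "norm (excess a \<omega>) \<le> \<bar>B\<bar>" using B by fastforce
    then show "norm (gated \<eta> a \<omega>) \<le> \<bar>B\<bar>" by (simp add: gated_def)
  qed
  then show "\<exists>B. \<forall>\<omega>\<in>space M. norm (gated \<eta> a \<omega>) \<le> B" by blast
qed

abbreviation gated_sum :: "real \<Rightarrow> nat \<Rightarrow> 'a \<Rightarrow> real ^ 'n" where
  "gated_sum \<eta> b \<omega> \<equiv> (\<Sum>a<b. gated \<eta> a \<omega> *v (W (v (Suc a)) \<omega> - W (v a) \<omega>))"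

lemma gated_energy: assumes "0 \<le> \<eta>" "b \<le> K"
  shows "(\<Sum>a<b. (v (Suc a) - v a) * (norm (gated \<eta> a \<omega>))\<^sup>2) \<le> \<eta>"
  using assms(2)
proof (induction b)
  case (Suc b)
  show ?case
  proof (cases "(\<Sum>l<Suc b. (v (Suc l) - v l) * (norm (excess l \<omega>))\<^sup>2) \<le> \<eta>")
    case True
    have "(\<Sum>a<Suc b. (v (Suc a) - v a) * (norm (gated \<eta> a \<omega>))\<^sup>2) \<le> (\<Sum>a<Suc b. (v (Suc a) - v a) * (norm (excess a \<omega>))\<^sup>2)"
    proof (rule sum_mono)
      fix a assume "a \<in> {..<Suc b}"
      then have "v a < v (Suc a)" using v_less[of a] Suc.prems by simp
      then show "(v (Suc a) - v a) * (norm (gated \<eta> a \<omega>))\<^sup>2 \<le> (v (Suc a) - v a) * (norm (excess a \<omega>))\<^sup>2"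
        by (intro mult_left_mono) (simp_all add: gated_def)
    qed
    then show ?thesis using True by linarith
  next
    case False
    then have "gated \<eta> b \<omega> = 0" by (simp add: gated_def)
    then show ?thesis using Suc by simp
  qed
qed (use assms in simp)

lemma gated_sum_L2:
  assumes \<eta>: "0 \<le> \<eta>" and b: "b \<le> K"
  shows "(\<integral>\<^sup>+\<omega>. ennreal ((norm (gated_sum \<eta> b \<omega>))\<^sup>2) \<partial>M) \<le> ennreal (vec_const (CARD('n) * CARD('m)) 1 * \<eta>)"
proof (cases "b = 0")
  case False
  interpret g: matrix_grid_integrand M F W v b "gated \<eta>" by (rule gated_grid[OF b])
  let ?c = "vec_const (CARD('n) * CARD('m)) 1"
  have "(\<integral>\<^sup>+\<omega>. ennreal ((norm (gated_sum \<eta> b \<omega>))\<^sup>2) \<partial>M)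
     \<le> ennreal ?c * (\<integral>\<^sup>+\<omega>. ennreal (\<Sum>a<b. (v (Suc a) - v a) * (norm (gated \<eta> a \<omega>))\<^sup>2) \<partial>M)"
    using g.vsum_L2 False unfolding g.vsum_def by simp
  also have "\<dots> \<le> ennreal ?c * (\<integral>\<^sup>+\<omega>. ennreal \<eta> \<partial>M)"
    by (intro mult_left_mono nn_integral_mono ennreal_leI gated_energy \<eta> b) simp
  also have "\<dots> = ennreal (?c * \<eta>)"
    using \<eta> by (simp add: emeasure_space_1 ennreal_mult vec_const_nonneg)
  finally show ?thesis .
qed (simp add: vec_const_nonneg \<eta>)

text \<open>Up to a time at which the process is alive, \<open>H\<close> is bounded by \<open>R\<close>, so that the excess is at most \<open>2 |E - H|\<close>.  Its energy then stays
below \<open>4 \<kappa>\<close> and the gate remains open.\<close>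

lemma decomposition:
  assumes b: "b \<le> K" and al: "alive (v b) \<omega>"
    and H: "\<And>y. y \<in> {0..T} \<Longrightarrow> alive y \<omega> \<Longrightarrow> norm (H y) \<le> R"
    and Hm: "(\<lambda>y. indicator {0..T} y *\<^sub>R H y) \<in> borel_measurable borel"
    and \<kappa>: "(\<integral>\<^sup>+y\<in>{0..T}. ennreal ((norm (E y \<omega> - H y))\<^sup>2) \<partial>lborel) \<le> ennreal \<kappa>" "0 \<le> \<kappa>"
  shows "S (v b) \<omega> - S s \<omega> = capped_grid.vsum b \<omega> + gated_sum (4 * \<kappa>) b \<omega>"
proof -
  have al': "alive (v a) \<omega>" if "a \<le> b" for a
    using alive_antimono[OF grid_mono[OF grid that b] al] .
  have "ennreal (\<Sum>a<b. (v (Suc a) - v a) * (norm (excess a \<omega>))\<^sup>2)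
     \<le> (\<integral>\<^sup>+y. 4 * (ennreal ((norm (E y \<omega> - H y))\<^sup>2) * indicator {0..T} y) \<partial>lborel)"
  proof (rule grid_sum_le_nn_integral[OF grid b])
    fix a y assume a: "a < b" and y: "v a < y" "y \<le> v (Suc a)"
    have aK: "a < K" using a b by simp
    have yT: "y \<in> {0..T}" using v_ge[of a] v_le[of "Suc a"] aK y s0 tT by simp
    have "alive y \<omega>" using alive_antimono[OF y(2)] al'[of "Suc a"] a by simp
    then have tH: "trunc R (H y) = H y" using H[OF yT] by (intro trunc_eq)
    have Ey: "E (v (Suc a)) \<omega> = E y \<omega>" using step(3)[OF aK y] by simp
    have "norm (excess a \<omega>) \<le> norm ((E y \<omega> - H y) - (trunc R (E y \<omega>) - trunc R (H y)))"
      using al'[of a] a by (simp add: excess_def Ey tH)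
    also have "\<dots> \<le> norm (E y \<omega> - H y) + norm (trunc R (E y \<omega>) - trunc R (H y))" by (rule norm_triangle_ineq4)
    also have "\<dots> \<le> 2 * norm (E y \<omega> - H y)" using dist_trunc_le[OF R0, of "E y \<omega>" "H y"] by simp
    finally have "(norm (excess a \<omega>))\<^sup>2 \<le> (2 * norm (E y \<omega> - H y))\<^sup>2" by (rule power_mono) simp
    then have "ennreal ((norm (excess a \<omega>))\<^sup>2) \<le> ennreal (4 * (norm (E y \<omega> - H y))\<^sup>2)"
      by (intro ennreal_leI) (simp add: power_mult_distrib)
    then show "ennreal ((norm (excess a \<omega>))\<^sup>2) \<le> 4 * (ennreal ((norm (E y \<omega> - H y))\<^sup>2) * indicator {0..T} y)"
      using yT by (simp add: ennreal_mult)
  qed simp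
  also have "\<dots> = 4 * (\<integral>\<^sup>+y\<in>{0..T}. ennreal ((norm (E y \<omega> - H y))\<^sup>2) \<partial>lborel)"
    by (rule nn_integral_cmult[OF square_dist_measurable[OF simple_ito_measurable[OF simple] Hm]])
  also have "\<dots> \<le> 4 * ennreal \<kappa>" by (rule mult_left_mono[OF \<kappa>(1)]) simp
  also have "\<dots> = ennreal (4 * \<kappa>)" using \<kappa>(2) by (simp add: ennreal_mult)
  finally have energy: "(\<Sum>a<b. (v (Suc a) - v a) * (norm (excess a \<omega>))\<^sup>2) \<le> 4 * \<kappa>"
    using \<kappa>(2) by (simp add: ennreal_le_iff)
  have geq: "gated (4 * \<kappa>) a \<omega> = excess a \<omega>" if a: "a < b" for a
  proof -
    have "(\<Sum>l<Suc a. (v (Suc l) - v l) * (norm (excess l \<omega>))\<^sup>2) \<le> (\<Sum>l<b. (v (Suc l) - v l) * (norm (excess l \<omega>))\<^sup>2)"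
    proof (rule sum_mono2)
      show "0 \<le> (v (Suc l) - v l) * (norm (excess l \<omega>))\<^sup>2" if "l \<in> {..<b} - {..<Suc a}" for l
        using v_less[of l] that b by simp
    qed (use a in auto)
    then show ?thesis using energy by (simp add: gated_def)
  qed
  have "S (v b) \<omega> - S s \<omega> = (\<Sum>a<b. S (v (Suc a)) \<omega> - S (v a) \<omega>)"
    using sum_lessThan_telescope[of "\<lambda>a. S (v a) \<omega>" b] grid by (simp add: grid_def)
  also have "\<dots> = (\<Sum>a<b. (capped a \<omega> + gated (4 * \<kappa>) a \<omega>) *v (W (v (Suc a)) \<omega> - W (v a) \<omega>))"
  proof (rule sum.cong)
    fix a assume "a \<in> {..<b}"
    then have a: "a < b" "a < K" using b by simp_all
    have "capped a \<omega> + gated (4 * \<kappa>) a \<omega> = E (v (Suc a)) \<omega>"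
      using al'[of a] a by (simp add: geq capped_def excess_def)
    then show "S (v (Suc a)) \<omega> - S (v a) \<omega> = (capped a \<omega> + gated (4 * \<kappa>) a \<omega>) *v (W (v (Suc a)) \<omega> - W (v a) \<omega>)"
      using step(4)[OF a(2), of \<omega>] by simp
  qed simp
  also have "\<dots> = capped_grid.vsum b \<omega> + gated_sum (4 * \<kappa>) b \<omega>"
    unfolding capped_grid.vsum_def by (simp only: matrix_vector_mult_add_rdistrib sum.distrib)
  finally show ?thesis .
qed

text \<open>The capped integrand deviates from the stopped \<open>H\<close> for two reasons: \<open>E\<close> is not \<open>H\<close>, and the process may die inside a
step.  The latter happens on one step only, whence the term with the mesh \<open>m\<close>.\<close>

lemma truncated_energy:
  assumes \<omega>: "\<And>y. y \<in> {0..T} \<Longrightarrow> alive y \<omega> \<Longrightarrow> norm (H y) \<le> R"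
    and Hm: "(\<lambda>y. indicator {0..T} y *\<^sub>R H y) \<in> borel_measurable borel"
    and \<kappa>: "(\<integral>\<^sup>+y\<in>{0..T}. ennreal ((norm (E y \<omega> - H y))\<^sup>2) \<partial>lborel) \<le> ennreal \<kappa>" "0 \<le> \<kappa>"
    and p: "1 \<le> p" and \<epsilon>: "0 < \<epsilon>"
    and mesh: "\<And>a. a < K \<Longrightarrow> v (Suc a) - v a \<le> m"
  shows "ennreal (\<Sum>a<K. (v (Suc a) - v a) * norm (capped a \<omega>) ^ p)
    \<le> (\<integral>\<^sup>+y\<in>{s..t}. indicator {y. alive y \<omega>} y * ennreal (norm (H y) ^ p) \<partial>lborel)
      + ennreal (real p * R ^ (p - 1) * (\<epsilon> * T + \<kappa> / \<epsilon>) + R ^ p * m)"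
proof -
  \<comment> \<open>The decrease of \<open>\<beta>\<close> marks the step on which the process dies; its sum telescopes.\<close>
  define \<beta> :: "nat \<Rightarrow> real" where "\<beta> a = of_bool (alive (v a) \<omega>)" for a
  have \<beta>_mono: "\<beta> (Suc a) \<le> \<beta> a" if a: "a < K" for a
    using alive_antimono[of "v a" "v (Suc a)" \<omega>] v_less[OF a] by (auto simp: \<beta>_def)
  have T0: "0 \<le> T" using v_ge[of 0] v_le[of 0] s0 tT by simp
  define c where "c = real p * R ^ (p - 1)"
  have c0: "0 \<le> c" using R0 by (simp add: c_def)
  \<comment> \<open>What remains of the energy density after a death inside the step has been discounted; it is bounded pointwise by \<open>H\<close> and \<open>E - H\<close>.\<close>
  define f where "f a = max 0 (norm (capped a \<omega>) ^ p - R ^ p * (\<beta> a - \<beta> (Suc a)))" for a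
  have mK: "(\<Sum>a<K. (v (Suc a) - v a) * (R ^ p * (\<beta> a - \<beta> (Suc a)))) \<le> R ^ p * m"
  proof -
    have m0: "0 \<le> m" using mesh[of 0] v_less[of 0] grid by (simp add: grid_def)
    have "(\<Sum>a<K. (v (Suc a) - v a) * (R ^ p * (\<beta> a - \<beta> (Suc a)))) \<le> (\<Sum>a<K. m * (R ^ p * (\<beta> a - \<beta> (Suc a))))"
      by (intro sum_mono mult_right_mono mesh mult_nonneg_nonneg) (use R0 \<beta>_mono in auto)
    also have "\<dots> = R ^ p * m * (\<Sum>a<K. \<beta> a - \<beta> (Suc a))" by (simp add: sum_distrib_left mult_ac)
    also have "(\<Sum>a<K. \<beta> a - \<beta> (Suc a)) = \<beta> 0 - \<beta> K" by (rule sum_lessThan_telescope')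
    also have "R ^ p * m * (\<beta> 0 - \<beta> K) \<le> R ^ p * m * 1"
      using m0 R0 by (intro mult_left_mono) (auto simp: \<beta>_def)
    finally show ?thesis by simp
  qed
  have "(\<Sum>a<K. (v (Suc a) - v a) * norm (capped a \<omega>) ^ p)
    \<le> (\<Sum>a<K. (v (Suc a) - v a) * f a + (v (Suc a) - v a) * (R ^ p * (\<beta> a - \<beta> (Suc a))))"
  proof (rule sum_mono)
    fix a assume "a \<in> {..<K}"
    then have "0 \<le> v (Suc a) - v a" using v_less[of a] by simp
    moreover have "norm (capped a \<omega>) ^ p \<le> f a + R ^ p * (\<beta> a - \<beta> (Suc a))" by (simp add: f_def)
    ultimately have "(v (Suc a) - v a) * norm (capped a \<omega>) ^ p \<le> (v (Suc a) - v a) * (f a + R ^ p * (\<beta> a - \<beta> (Suc a)))"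
      by (intro mult_left_mono)
    then show "(v (Suc a) - v a) * norm (capped a \<omega>) ^ p \<le> (v (Suc a) - v a) * f a + (v (Suc a) - v a) * (R ^ p * (\<beta> a - \<beta> (Suc a)))"
      by (simp only: distrib_left)
  qed
  also have "\<dots> \<le> (\<Sum>a<K. (v (Suc a) - v a) * f a) + R ^ p * m"
    using mK by (simp add: sum.distrib)
  finally have 1: "(\<Sum>a<K. (v (Suc a) - v a) * norm (capped a \<omega>) ^ p) \<le> (\<Sum>a<K. (v (Suc a) - v a) * f a) + R ^ p * m" .
  have f0: "0 \<le> f a" for a by (simp add: f_def)
  let ?A = "\<lambda>y. indicator {y. alive y \<omega>} y * ennreal (norm (H y) ^ p) * indicator {s..t} y"
  let ?N = "\<lambda>y. ennreal ((norm (E y \<omega> - H y))\<^sup>2) * indicator {0..T} y"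
  let ?B = "\<lambda>y. ennreal (c * \<epsilon>) * indicator {0..T} y + ennreal (c / \<epsilon>) * ?N y"
  have "ennreal (\<Sum>a<K. (v (Suc a) - v a) * f a) \<le> (\<integral>\<^sup>+y. ?A y + ?B y \<partial>lborel)"
  proof (rule grid_sum_le_nn_integral[OF grid order_refl _ f0])
    fix a y assume a: "a < K" and y: "v a < y" "y \<le> v (Suc a)"
    have yst: "y \<in> {s..t}" using v_ge[of a] v_le[of "Suc a"] a y by simp
    then have yT: "y \<in> {0..T}" using s0 tT by simp
    have Ey: "E (v (Suc a)) \<omega> = E y \<omega>" using step(3)[OF a y] by simp
    show "ennreal (f a) \<le> ?A y + ?B y"
    proof (cases "alive (v a) \<omega>")
      case False
      then have "capped a \<omega> = 0" "\<beta> a = 0" "\<beta> (Suc a) = 0" using \<beta>_mono[OF a] by (auto simp: capped_def \<beta>_def)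
      then have "f a = 0" using p by (simp add: f_def)
      then show ?thesis by simp
    next
      case al: True
      show ?thesis
      proof (cases "alive y \<omega>")
        case False
        then have "\<not> alive (v (Suc a)) \<omega>" using alive_antimono[OF y(2)] by blast
        then have "\<beta> a - \<beta> (Suc a) = 1" using al by (simp add: \<beta>_def)
        moreover have "norm (capped a \<omega>) ^ p \<le> R ^ p" by (intro power_mono norm_capped_le) simp
        ultimately have "f a = 0" by (simp add: f_def)
        then show ?thesis by simp
      next
        case True
        let ?x = "norm (E y \<omega> - H y)"
        have HR: "norm (H y) \<le> R" by (rule \<omega>[OF yT True])
        have "f a \<le> norm (capped a \<omega>) ^ p"
          using \<beta>_mono[OF a] R0 by (simp add: f_def)
        also have "\<dots> \<le> norm (H y) ^ p + c * \<bar>norm (capped a \<omega>) - norm (H y)\<bar>"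
          unfolding c_def by (rule power_le_power_add) (use norm_capped_le HR p in auto)
        also have "\<bar>norm (capped a \<omega>) - norm (H y)\<bar> \<le> norm (capped a \<omega> - H y)" by (rule norm_triangle_ineq3)
        also have "capped a \<omega> - H y = trunc R (E y \<omega>) - trunc R (H y)"
          using al by (simp add: capped_def Ey trunc_eq[OF HR])
        also have "norm \<dots> \<le> ?x" by (rule dist_trunc_le[OF R0])
        also have "?x \<le> \<epsilon> + ?x\<^sup>2 / \<epsilon>"
        proof -
          have "0 \<le> \<epsilon> * ?x" using \<epsilon> by simp
          then have "\<epsilon> * ?x \<le> \<epsilon>\<^sup>2 + ?x\<^sup>2"
            using sum_squares_bound[of \<epsilon> ?x] by linarith
          then show ?thesis using \<epsilon> by (simp add: field_simps power2_eq_square)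
        qed
        finally have "f a \<le> norm (H y) ^ p + c * (\<epsilon> + ?x\<^sup>2 / \<epsilon>)"
          using c0 by (simp add: mult_left_mono)
        then have "ennreal (f a) \<le> ennreal (norm (H y) ^ p + (c * \<epsilon> + c / \<epsilon> * ?x\<^sup>2))"
          by (intro ennreal_leI) (simp add: algebra_simps)
        also have "\<dots> = ennreal (norm (H y) ^ p) + (ennreal (c * \<epsilon>) + ennreal (c / \<epsilon>) * ennreal (?x\<^sup>2))"
        proof -
          have "0 \<le> c * \<epsilon>" "0 \<le> c / \<epsilon>" using c0 \<epsilon> by simp_all
          then show ?thesis
            by (simp only: ennreal_plus ennreal_mult zero_le_power norm_ge_zero mult_nonneg_nonneg add_nonneg_nonneg)
        qed
        also have "\<dots> = ?A y + ?B y" using True yst yT by simp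
        finally show ?thesis .
      qed
    qed
  qed
  also have "\<dots> = (\<integral>\<^sup>+y. ?A y \<partial>lborel) + (\<integral>\<^sup>+y. ?B y \<partial>lborel)"
  proof (rule nn_integral_add)
    have Nm: "?N \<in> borel_measurable lborel"
      by (rule square_dist_measurable[OF simple_ito_measurable[OF simple] Hm])
    then show "?B \<in> borel_measurable lborel" by measurable
    have "mono (\<lambda>y. - (of_bool (alive y \<omega>) :: real))"
      using alive_antimono by (auto simp: mono_def)
    then have "(\<lambda>y. - (of_bool (alive y \<omega>) :: real)) \<in> borel_measurable borel" by (rule borel_measurable_mono)
    then have "(\<lambda>y. - (- (of_bool (alive y \<omega>) :: real))) \<in> borel_measurable borel" by (rule borel_measurable_uminus)
    then have am: "(\<lambda>y. of_bool (alive y \<omega>) :: real) \<in> borel_measurable borel" by simp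
    note [measurable] = am Hm
    have "(\<lambda>y. ennreal (of_bool (alive y \<omega>) * norm (indicator {0..T} y *\<^sub>R H y) ^ p) * indicator {s..t} y) \<in> borel_measurable lborel"
      by measurable
    moreover have "(\<lambda>y. ennreal (of_bool (alive y \<omega>) * norm (indicator {0..T} y *\<^sub>R H y) ^ p) * indicator {s..t} y) = ?A"
      using s0 tT by (auto simp: indicator_def fun_eq_iff)
    ultimately show "?A \<in> borel_measurable lborel" by simp
  qed
  also have "(\<integral>\<^sup>+y. ?B y \<partial>lborel) \<le> ennreal (c * (\<epsilon> * T + \<kappa> / \<epsilon>))"
  proof -
    have Nm: "?N \<in> borel_measurable lborel"
      by (rule square_dist_measurable[OF simple_ito_measurable[OF simple] Hm])
    have "(\<integral>\<^sup>+y. ?B y \<partial>lborel) = ennreal (c * \<epsilon>) * ennreal T + ennreal (c / \<epsilon>) * (\<integral>\<^sup>+y. ?N y \<partial>lborel)"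
      using T0 Nm by (subst nn_integral_add) (auto simp: nn_integral_cmult)
    also have "\<dots> \<le> ennreal (c * \<epsilon>) * ennreal T + ennreal (c / \<epsilon>) * ennreal \<kappa>"
      by (intro add_left_mono mult_left_mono \<kappa>(1)) simp
    also have "\<dots> = ennreal (c * \<epsilon> * T + c / \<epsilon> * \<kappa>)"
    proof -
      have "0 \<le> c * \<epsilon>" "0 \<le> c / \<epsilon>" using c0 \<epsilon> by simp_all
      then show ?thesis using T0 \<kappa>(2)
        by (simp only: ennreal_plus ennreal_mult mult_nonneg_nonneg)
    qed
    also have "c * \<epsilon> * T + c / \<epsilon> * \<kappa> = c * (\<epsilon> * T + \<kappa> / \<epsilon>)" by (simp add: algebra_simps)
    finally show ?thesis .
  qed
  finally have 2: "ennreal (\<Sum>a<K. (v (Suc a) - v a) * f a) \<le> (\<integral>\<^sup>+y. ?A y \<partial>lborel) + ennreal (c * (\<epsilon> * T + \<kappa> / \<epsilon>))"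
    by (simp add: add_left_mono)
  have sf: "0 \<le> (\<Sum>a<K. (v (Suc a) - v a) * f a)"
    using f0 v_less by (intro sum_nonneg mult_nonneg_nonneg) (auto simp: less_imp_le)
  have Rm: "0 \<le> R ^ p * m" using R0 mesh[of 0] v_less[of 0] grid by (simp add: grid_def)
  have "ennreal (\<Sum>a<K. (v (Suc a) - v a) * norm (capped a \<omega>) ^ p) \<le> ennreal ((\<Sum>a<K. (v (Suc a) - v a) * f a) + R ^ p * m)"
    by (rule ennreal_leI[OF 1])
  also have "\<dots> = ennreal (\<Sum>a<K. (v (Suc a) - v a) * f a) + ennreal (R ^ p * m)"
    by (rule ennreal_plus[OF sf Rm])
  also have "\<dots> \<le> ((\<integral>\<^sup>+y. ?A y \<partial>lborel) + ennreal (c * (\<epsilon> * T + \<kappa> / \<epsilon>))) + ennreal (R ^ p * m)"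
    by (rule add_right_mono[OF 2])
  also have "\<dots> = (\<integral>\<^sup>+y. ?A y \<partial>lborel) + ennreal (c * (\<epsilon> * T + \<kappa> / \<epsilon>) + R ^ p * m)"
    using c0 \<epsilon> T0 \<kappa>(2) Rm by (simp add: ennreal_plus add.assoc)
  finally show ?thesis unfolding c_def .
qed

end

section \<open>The maximal inequality for stopped Ito integrals\<close>

lemma AE_tendsto_zero:
  fixes f :: "nat \<Rightarrow> 'a \<Rightarrow> real"
  assumes m: "\<And>j. f j \<in> borel_measurable M" and f0: "\<And>j \<omega>. 0 \<le> f j \<omega>"
    and le: "\<And>j. (\<integral>\<^sup>+\<omega>. ennreal (f j \<omega>) \<partial>M) \<le> ennreal (c * q ^ j)" and q: "0 \<le> q" "q < 1" and c: "0 \<le> c"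
  shows "AE \<omega> in M. (\<lambda>j. f j \<omega>) \<longlonglongrightarrow> 0"
proof -
  have s: "summable (\<lambda>j. c * q ^ j)" using q by (intro summable_mult summable_geometric) simp
  have "(\<integral>\<^sup>+\<omega>. (\<Sum>j. ennreal (f j \<omega>)) \<partial>M) = (\<Sum>j. \<integral>\<^sup>+\<omega>. ennreal (f j \<omega>) \<partial>M)"
    using m by (intro nn_integral_suminf) simp
  also have "\<dots> \<le> (\<Sum>j. ennreal (c * q ^ j))" by (intro suminf_le le summableI)
  also have "\<dots> = ennreal (\<Sum>j. c * q ^ j)" using c q s by (intro suminf_ennreal2) auto
  finally have fin: "(\<integral>\<^sup>+\<omega>. (\<Sum>j. ennreal (f j \<omega>)) \<partial>M) \<noteq> \<infinity>"
    by (metis ennreal_less_top infinity_ennreal_def leD)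
  have "AE \<omega> in M. (\<Sum>j. ennreal (f j \<omega>)) \<noteq> \<infinity>"
    by (rule nn_integral_PInf_AE[OF _ fin]) (use m in simp)
  then show ?thesis
  proof eventually_elim
    fix \<omega> assume "(\<Sum>j. ennreal (f j \<omega>)) \<noteq> \<infinity>"
    then have "summable (\<lambda>j. f j \<omega>)"
      using f0 by (intro summable_suminf_not_top) auto
    then show "(\<lambda>j. f j \<omega>) \<longlonglongrightarrow> 0" by (rule summable_LIMSEQ_zero)
  qed
qed

lemma measurable_matrix_vector_mult:
  fixes A :: "'b \<Rightarrow> real ^ 'k ^ 'l" and x :: "'b \<Rightarrow> real ^ 'k"
  assumes "A \<in> borel_measurable N" "x \<in> borel_measurable N"
  shows "(\<lambda>\<omega>. A \<omega> *v x \<omega>) \<in> borel_measurable N"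
  by (rule borel_measurable_continuous_Pair[OF assms])
     (unfold matrix_vector_mult_def, intro continuous_intros)

context stopped_step
begin

lemma incr_measurable: assumes "a < K" shows "(\<lambda>\<omega>. W (v (Suc a)) \<omega> - W (v a) \<omega>) \<in> borel_measurable M"
proof -
  have "0 \<le> v a" "0 \<le> v (Suc a)" using v_ge[of a] v_ge[of "Suc a"] assms s0 by simp_all
  then show ?thesis by (intro borel_measurable_diff measurable_F[OF adapted_W])
qed

lemma vsum_measurable: "b \<le> K \<Longrightarrow> capped_grid.vsum b \<in> borel_measurable M"
  unfolding capped_grid.vsum_def[abs_def]
  by (intro borel_measurable_sum measurable_matrix_vector_mult measurable_F[OF capped_measurable] incr_measurable) auto

lemma gated_sum_measurable: "b \<le> K \<Longrightarrow> gated_sum \<eta> b \<in> borel_measurable M"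
  by (intro borel_measurable_sum measurable_matrix_vector_mult measurable_F[OF gated_measurable] incr_measurable) auto

lemma norm_capped_measurable: "a < K \<Longrightarrow> (\<lambda>\<omega>. norm (capped a \<omega>)) \<in> borel_measurable M"
  by (rule measurable_compose[OF measurable_F[OF capped_measurable] borel_measurable_norm])

end

context brownian_motion
begin

text \<open>The maximal inequality on a grid passes to the limit by Fatou's lemma on the left and the reverse Fatou lemma on the right,
where the truncation provides the bound.  The sample points \<open>X\<close> belong to all grids, so that the integrals at these times are partial sums.\<close>

theorem stopped_maximal_finite:
  fixes H :: "real \<Rightarrow> 'a \<Rightarrow> real ^ 'm ^ 'n" and I :: "real \<Rightarrow> 'a \<Rightarrow> real ^ 'n"
  assumes lim: "ito_limit M F W T H I"
    and s0: "0 \<le> s" and st: "s < t" and tT: "t \<le> T" and R0: "0 \<le> R"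
    and alive_measurable: "\<And>u. 0 \<le> u \<Longrightarrow> Measurable.pred (F u) (alive u)"
    and alive_antimono: "\<And>u u' \<omega>. u \<le> u' \<Longrightarrow> alive u' \<omega> \<Longrightarrow> alive u \<omega>"
    and HR: "AE \<omega> in M. \<forall>u\<in>{0..T}. alive u \<omega> \<longrightarrow> norm (H u \<omega>) \<le> R"
    and r: "even r" "1 \<le> r"
    and Jm: "J \<in> borel_measurable M"
    and J: "AE \<omega> in M. (\<integral>\<^sup>+u\<in>{s..t}. indicator {u. alive u \<omega>} u * ennreal (norm (H u \<omega>) ^ (2 * r)) \<partial>lborel) \<le> J \<omega>"
    and X: "finite X" "X \<subseteq> {s..t}"
  shows "(\<integral>\<^sup>+\<omega>. (SUP x\<in>X. indicator {\<omega>. alive x \<omega>} \<omega> * ennreal (norm (I x \<omega> - I s \<omega>) ^ (2 * r))) \<partial>M)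
    \<le> ennreal (vec_const (CARD('n) * CARD('m)) r * (t - s) ^ (r - 1)) * (\<integral>\<^sup>+\<omega>. J \<omega> \<partial>M)"
proof -
  obtain D E S c where si: "\<And>j. simple_ito M F W T (D j) (E j) (S j)"
    and en: "AE \<omega> in M. \<forall>\<^sub>F j in sequentially.
        (\<integral>\<^sup>+u\<in>{0..T}. ennreal ((norm (E j u \<omega> - H u \<omega>))\<^sup>2) \<partial>lborel) \<le> ennreal (c * (1 / 4) ^ j)"
    and conv: "AE \<omega> in M. \<forall>u\<in>{0..T}. (\<lambda>j. S j u \<omega>) \<longlonglongrightarrow> I u \<omega>"
    using lim unfolding ito_limit_def by blast
  have Hm: "(\<lambda>u. indicator {0..T} u *\<^sub>R H u \<omega>) \<in> borel_measurable borel" if "\<omega> \<in> space M" for \<omega>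
    using lim that unfolding ito_limit_def by blast
  define \<kappa> where "\<kappa> j = \<bar>c\<bar> * (1 / 4) ^ j" for j :: nat
  have \<kappa>0: "0 \<le> \<kappa> j" for j by (simp add: \<kappa>_def)
  have en': "AE \<omega> in M. \<forall>\<^sub>F j in sequentially.
        (\<integral>\<^sup>+u\<in>{0..T}. ennreal ((norm (E j u \<omega> - H u \<omega>))\<^sup>2) \<partial>lborel) \<le> ennreal (\<kappa> j)"
    using en
  proof eventually_elim
    fix \<omega> assume "\<forall>\<^sub>F j in sequentially.
        (\<integral>\<^sup>+u\<in>{0..T}. ennreal ((norm (E j u \<omega> - H u \<omega>))\<^sup>2) \<partial>lborel) \<le> ennreal (c * (1 / 4) ^ j)"
    then show "\<forall>\<^sub>F j in sequentially.
        (\<integral>\<^sup>+u\<in>{0..T}. ennreal ((norm (E j u \<omega> - H u \<omega>))\<^sup>2) \<partial>lborel) \<le> ennreal (\<kappa> j)"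
    proof eventually_elim
      fix j assume "(\<integral>\<^sup>+u\<in>{0..T}. ennreal ((norm (E j u \<omega> - H u \<omega>))\<^sup>2) \<partial>lborel) \<le> ennreal (c * (1 / 4) ^ j)"
      also have "\<dots> \<le> ennreal (\<kappa> j)" unfolding \<kappa>_def by (intro ennreal_leI mult_right_mono) auto
      finally show "(\<integral>\<^sup>+u\<in>{0..T}. ennreal ((norm (E j u \<omega> - H u \<omega>))\<^sup>2) \<partial>lborel) \<le> ennreal (\<kappa> j)" .
    qed
  qed
  have "\<forall>j. \<exists>Kv. grid s t (fst Kv) (snd Kv) \<and> (D j \<union> X) \<inter> {s..t} \<subseteq> snd Kv ` {..fst Kv} \<and>
      (\<forall>a<fst Kv. (D j \<union> X) \<inter> {snd Kv a<..<snd Kv (Suc a)} = {}) \<and>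
      (\<forall>a<fst Kv. snd Kv (Suc a) - snd Kv a \<le> (t - s) / real (Suc j))"
  proof
    fix j
    have "finite (D j \<union> X)" using si[of j] X by (simp add: simple_ito_def)
    from exists_fine_grid[OF this st, of "Suc j"] show "\<exists>Kv. grid s t (fst Kv) (snd Kv) \<and> (D j \<union> X) \<inter> {s..t} \<subseteq> snd Kv ` {..fst Kv} \<and>
      (\<forall>a<fst Kv. (D j \<union> X) \<inter> {snd Kv a<..<snd Kv (Suc a)} = {}) \<and>
      (\<forall>a<fst Kv. snd Kv (Suc a) - snd Kv a \<le> (t - s) / real (Suc j))" by simp
  qed
  from choice[OF this] obtain Kv where Kv: "\<forall>j. grid s t (fst (Kv j)) (snd (Kv j)) \<and> (D j \<union> X) \<inter> {s..t} \<subseteq> snd (Kv j) ` {..fst (Kv j)} \<and>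
      (\<forall>a<fst (Kv j). (D j \<union> X) \<inter> {snd (Kv j) a<..<snd (Kv j) (Suc a)} = {}) \<and>
      (\<forall>a<fst (Kv j). snd (Kv j) (Suc a) - snd (Kv j) a \<le> (t - s) / real (Suc j))" ..
  define K where "K j = fst (Kv j)" for j
  define v where "v j = snd (Kv j)" for j
  have g: "grid s t (K j) (v j)" and XV: "X \<subseteq> v j ` {..K j}"
    and av: "\<And>a. a < K j \<Longrightarrow> D j \<inter> {v j a<..<v j (Suc a)} = {}"
    and mesh: "\<And>a. a < K j \<Longrightarrow> v j (Suc a) - v j a \<le> (t - s) / real (Suc j)" for j
    using Kv[rule_format, of j] X(2) unfolding K_def v_def by blast+
  interpret ss: stopped_step M F W T R alive s t "D j" "E j" "S j" "K j" "v j" for j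
    by unfold_locales (fact s0 tT R0 alive_measurable alive_antimono si g av)+
  let ?p = "2 * r"
  let ?C = "vec_const (CARD('n) * CARD('m)) r * (t - s) ^ (r - 1)"
  define V where "V j b \<omega> = ss.capped_grid.vsum j b \<omega>" for j b \<omega>
  define Q where "Q j \<omega> = (\<Sum>a<K j. (v j (Suc a) - v j a) * norm (ss.capped j a \<omega>) ^ ?p)" for j \<omega>
  define U where "U j \<omega> = (SUP b\<in>{..K j}. ennreal (norm (V j b \<omega>) ^ ?p))" for j \<omega>
  have KP: "0 < K j" for j using g[of j] by (simp add: grid_def)
  have ends: "v j (K j) - v j 0 = t - s" for j using g[of j] by (simp add: grid_def)
  have U1: "(\<integral>\<^sup>+\<omega>. U j \<omega> \<partial>M) \<le> ennreal ?C * (\<integral>\<^sup>+\<omega>. ennreal (Q j \<omega>) \<partial>M)" for j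
    using ss.capped_grid.vsum_maximal[OF KP r, of j] unfolding U_def V_def Q_def ends .
  have Vm: "b \<le> K j \<Longrightarrow> V j b \<in> borel_measurable M" for j b
    unfolding V_def[abs_def] by (rule ss.vsum_measurable)
  have Um: "U j \<in> borel_measurable M" for j
  proof -
    have "(\<lambda>\<omega>. ennreal (norm (V j b \<omega>) ^ ?p)) \<in> borel_measurable M" if "b \<in> {..K j}" for b
    proof -
      have [measurable]: "V j b \<in> borel_measurable M" using that by (intro Vm) simp
      show ?thesis by measurable
    qed
    then show ?thesis unfolding U_def[abs_def] by (intro borel_measurable_SUP) auto
  qed
  have Qm: "Q j \<in> borel_measurable M" for j
    unfolding Q_def[abs_def]
    by (intro borel_measurable_sum borel_measurable_times borel_measurable_const borel_measurable_power ss.norm_capped_measurable) simp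
  have QB: "Q j \<omega> \<le> R ^ ?p * (t - s)" for j \<omega>
  proof -
    have "Q j \<omega> \<le> (\<Sum>a<K j. (v j (Suc a) - v j a) * R ^ ?p)"
      unfolding Q_def using ss.v_less by (intro sum_mono mult_left_mono power_mono ss.norm_capped_le) (auto simp: less_imp_le)
    also have "\<dots> = (\<Sum>a<K j. (v j (Suc a) - v j a)) * R ^ ?p" by (simp add: sum_distrib_right)
    also have "(\<Sum>a<K j. (v j (Suc a) - v j a)) = t - s" by (simp add: sum_lessThan_telescope ends)
    finally show ?thesis by (simp add: mult.commute)
  qed
  define bi where "bi j x = (SOME b. b \<le> K j \<and> v j b = x)" for j x
  have bi: "bi j x \<le> K j" "v j (bi j x) = x" if "x \<in> X" for j x
  proof -
    have "\<exists>b. b \<le> K j \<and> v j b = x" using XV[of j] that by fastforce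
    then show "bi j x \<le> K j" "v j (bi j x) = x"
      unfolding bi_def by (metis (mono_tags, lifting) someI_ex)+
  qed
  \<comment> \<open>The integrals of the gated excesses have second moments of order \<open>4\<^sup>-\<^sup>j\<close> and disappear in the limit.\<close>
  have Z: "AE \<omega> in M. \<forall>x\<in>X. (\<lambda>j. (norm (ss.gated_sum j (4 * \<kappa> j) (bi j x) \<omega>))\<^sup>2) \<longlonglongrightarrow> 0"
  proof (rule AE_finite_allI[OF X(1)])
    fix x assume x: "x \<in> X"
    let ?v = "vec_const (CARD('n) * CARD('m)) 1"
    show "AE \<omega> in M. (\<lambda>j. (norm (ss.gated_sum j (4 * \<kappa> j) (bi j x) \<omega>))\<^sup>2) \<longlonglongrightarrow> 0"
    proof (rule AE_tendsto_zero[where c = "?v * (4 * \<bar>c\<bar>)" and q = "1 / 4"])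
      show "(\<lambda>\<omega>. (norm (ss.gated_sum j (4 * \<kappa> j) (bi j x) \<omega>))\<^sup>2) \<in> borel_measurable M" for j
        by (intro borel_measurable_power measurable_compose[OF ss.gated_sum_measurable borel_measurable_norm] bi x)
      show "(\<integral>\<^sup>+\<omega>. ennreal ((norm (ss.gated_sum j (4 * \<kappa> j) (bi j x) \<omega>))\<^sup>2) \<partial>M) \<le> ennreal (?v * (4 * \<bar>c\<bar>) * (1 / 4) ^ j)" for j
        using ss.gated_sum_L2[of "4 * \<kappa> j" "bi j x" j, OF _ bi(1)[OF x]] \<kappa>0[of j] unfolding \<kappa>_def by (simp add: mult.assoc)
    qed (auto simp: vec_const_nonneg)
  qed
  \<comment> \<open>The error in \<open>truncated_energy\<close> for \<open>\<epsilon> = 2\<^sup>-\<^sup>j\<close>, which balances \<open>\<epsilon>\<close> and \<open>\<kappa> / \<epsilon>\<close>.\<close>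
  define \<delta> where "\<delta> j = real ?p * R ^ (?p - 1) * ((1 / 2) ^ j * T + \<kappa> j / (1 / 2) ^ j) + R ^ ?p * ((t - s) / real (Suc j))" for j
  have \<delta>0: "\<delta> \<longlonglongrightarrow> 0"
  proof -
    have k: "\<kappa> j / (1 / 2) ^ j = \<bar>c\<bar> * (1 / 2) ^ j" for j
    proof -
      have "(1 / 4 :: real) ^ j = (1 / 2) ^ j * (1 / 2) ^ j" by (simp flip: power_mult_distrib)
      then show ?thesis by (simp add: \<kappa>_def)
    qed
    have h: "(\<lambda>j. (1 / 2 :: real) ^ j) \<longlonglongrightarrow> 0" by (rule LIMSEQ_power_zero) simp
    have n: "(\<lambda>j. (t - s) / real (Suc j)) \<longlonglongrightarrow> 0"
      using LIMSEQ_Suc[OF lim_const_over_n[of "t - s"]] by simp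
    have "\<delta> \<longlonglongrightarrow> real ?p * R ^ (?p - 1) * (0 * T + \<bar>c\<bar> * 0) + R ^ ?p * 0"
      unfolding \<delta>_def[abs_def] k by (intro tendsto_intros h n)
    then show ?thesis by simp
  qed
  have main: "AE \<omega> in M. (SUP x\<in>X. indicator {\<omega>. alive x \<omega>} \<omega> * ennreal (norm (I x \<omega> - I s \<omega>) ^ ?p)) \<le> liminf (\<lambda>j. U j \<omega>)
      \<and> limsup (\<lambda>j. ennreal ?C * ennreal (Q j \<omega>)) \<le> ennreal ?C * J \<omega>"
    using AE_space HR en' conv J Z
  proof eventually_elim
    fix \<omega> assume \<omega>: "\<omega> \<in> space M"
      and HR: "\<forall>u\<in>{0..T}. alive u \<omega> \<longrightarrow> norm (H u \<omega>) \<le> R"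
      and en: "\<forall>\<^sub>F j in sequentially.
        (\<integral>\<^sup>+u\<in>{0..T}. ennreal ((norm (E j u \<omega> - H u \<omega>))\<^sup>2) \<partial>lborel) \<le> ennreal (\<kappa> j)"
      and conv: "\<forall>u\<in>{0..T}. (\<lambda>j. S j u \<omega>) \<longlonglongrightarrow> I u \<omega>"
      and J: "(\<integral>\<^sup>+u\<in>{s..t}. indicator {u. alive u \<omega>} u * ennreal (norm (H u \<omega>) ^ ?p) \<partial>lborel) \<le> J \<omega>"
      and Z: "\<forall>x\<in>X. (\<lambda>j. (norm (ss.gated_sum j (4 * \<kappa> j) (bi j x) \<omega>))\<^sup>2) \<longlonglongrightarrow> 0"
    have HR': "norm (H u \<omega>) \<le> R" if "u \<in> {0..T}" "alive u \<omega>" for u using HR that by blast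
    have "(SUP x\<in>X. indicator {\<omega>. alive x \<omega>} \<omega> * ennreal (norm (I x \<omega> - I s \<omega>) ^ ?p)) \<le> liminf (\<lambda>j. U j \<omega>)"
    proof (rule SUP_least)
      fix x assume x: "x \<in> X"
      show "indicator {\<omega>. alive x \<omega>} \<omega> * ennreal (norm (I x \<omega> - I s \<omega>) ^ ?p) \<le> liminf (\<lambda>j. U j \<omega>)"
      proof (cases "alive x \<omega>")
        case True
        have xT: "x \<in> {0..T}" and sT: "s \<in> {0..T}" using x X(2) s0 tT st by auto
        have "(\<lambda>j. sqrt ((norm (ss.gated_sum j (4 * \<kappa> j) (bi j x) \<omega>))\<^sup>2)) \<longlonglongrightarrow> sqrt 0"
          using Z x by (intro tendsto_real_sqrt) blast
        then have gz: "(\<lambda>j. ss.gated_sum j (4 * \<kappa> j) (bi j x) \<omega>) \<longlonglongrightarrow> 0"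
          by (simp add: tendsto_norm_zero_iff)
        have "(\<lambda>j. S j x \<omega> - S j s \<omega> - ss.gated_sum j (4 * \<kappa> j) (bi j x) \<omega>) \<longlonglongrightarrow> I x \<omega> - I s \<omega> - 0"
          using conv xT sT by (intro tendsto_diff gz) blast+
        moreover have "\<forall>\<^sub>F j in sequentially. S j x \<omega> - S j s \<omega> - ss.gated_sum j (4 * \<kappa> j) (bi j x) \<omega> = V j (bi j x) \<omega>"
          using en
        proof eventually_elim
          fix j assume j: "(\<integral>\<^sup>+u\<in>{0..T}. ennreal ((norm (E j u \<omega> - H u \<omega>))\<^sup>2) \<partial>lborel) \<le> ennreal (\<kappa> j)"
          have al: "alive (v j (bi j x)) \<omega>" using True bi(2)[OF x] by simp
          have "S j (v j (bi j x)) \<omega> - S j s \<omega> = V j (bi j x) \<omega> + ss.gated_sum j (4 * \<kappa> j) (bi j x) \<omega>"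
            unfolding V_def by (rule ss.decomposition[OF bi(1)[OF x] al HR' Hm[OF \<omega>] j \<kappa>0])
          then show "S j x \<omega> - S j s \<omega> - ss.gated_sum j (4 * \<kappa> j) (bi j x) \<omega> = V j (bi j x) \<omega>"
            unfolding bi(2)[OF x] by simp
        qed
        ultimately have "(\<lambda>j. V j (bi j x) \<omega>) \<longlonglongrightarrow> I x \<omega> - I s \<omega> - 0"
          by (rule Lim_transform_eventually)
        then have "(\<lambda>j. ennreal (norm (V j (bi j x) \<omega>) ^ ?p)) \<longlonglongrightarrow> ennreal (norm (I x \<omega> - I s \<omega>) ^ ?p)"
          by (intro tendsto_ennrealI tendsto_power tendsto_norm) simp
        then have "ennreal (norm (I x \<omega> - I s \<omega>) ^ ?p) = liminf (\<lambda>j. ennreal (norm (V j (bi j x) \<omega>) ^ ?p))"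
          by (rule lim_imp_Liminf[OF sequentially_bot, symmetric])
        also have "\<dots> \<le> liminf (\<lambda>j. U j \<omega>)"
          unfolding U_def by (intro Liminf_mono always_eventually allI SUP_upper) (simp add: bi(1)[OF x])
        finally show ?thesis using True by simp
      qed simp
    qed
    moreover have "limsup (\<lambda>j. ennreal ?C * ennreal (Q j \<omega>)) \<le> ennreal ?C * J \<omega>"
    proof -
      have "\<forall>\<^sub>F j in sequentially. ennreal ?C * ennreal (Q j \<omega>) \<le> ennreal ?C * (J \<omega> + ennreal (\<delta> j))"
        using en
      proof eventually_elim
        fix j assume j: "(\<integral>\<^sup>+u\<in>{0..T}. ennreal ((norm (E j u \<omega> - H u \<omega>))\<^sup>2) \<partial>lborel) \<le> ennreal (\<kappa> j)"
        have "ennreal (Q j \<omega>) \<le> (\<integral>\<^sup>+u\<in>{s..t}. indicator {u. alive u \<omega>} u * ennreal (norm (H u \<omega>) ^ ?p) \<partial>lborel) + ennreal (\<delta> j)"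
          unfolding Q_def \<delta>_def
          by (rule ss.truncated_energy[OF HR' Hm[OF \<omega>] j \<kappa>0 _ _ mesh]) (use r in auto)
        also have "\<dots> \<le> J \<omega> + ennreal (\<delta> j)" by (rule add_right_mono[OF J])
        finally show "ennreal ?C * ennreal (Q j \<omega>) \<le> ennreal ?C * (J \<omega> + ennreal (\<delta> j))"
          by (rule mult_left_mono) simp
      qed
      then have "limsup (\<lambda>j. ennreal ?C * ennreal (Q j \<omega>)) \<le> limsup (\<lambda>j. ennreal ?C * (J \<omega> + ennreal (\<delta> j)))"
        by (rule Limsup_mono)
      also have "(\<lambda>j. ennreal ?C * (J \<omega> + ennreal (\<delta> j))) \<longlonglongrightarrow> ennreal ?C * (J \<omega> + ennreal 0)"
        by (intro ennreal_tendsto_cmult tendsto_add tendsto_const tendsto_ennrealI \<delta>0) simp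
      then have "limsup (\<lambda>j. ennreal ?C * (J \<omega> + ennreal (\<delta> j))) = ennreal ?C * J \<omega>"
        by (simp add: lim_imp_Limsup)
      finally show ?thesis .
    qed
    ultimately show "(SUP x\<in>X. indicator {\<omega>. alive x \<omega>} \<omega> * ennreal (norm (I x \<omega> - I s \<omega>) ^ ?p)) \<le> liminf (\<lambda>j. U j \<omega>)
      \<and> limsup (\<lambda>j. ennreal ?C * ennreal (Q j \<omega>)) \<le> ennreal ?C * J \<omega>" ..
  qed
  have "(\<integral>\<^sup>+\<omega>. (SUP x\<in>X. indicator {\<omega>. alive x \<omega>} \<omega> * ennreal (norm (I x \<omega> - I s \<omega>) ^ ?p)) \<partial>M)
    \<le> (\<integral>\<^sup>+\<omega>. liminf (\<lambda>j. U j \<omega>) \<partial>M)"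
    using main by (intro nn_integral_mono_AE) auto
  also have "\<dots> \<le> liminf (\<lambda>j. \<integral>\<^sup>+\<omega>. U j \<omega> \<partial>M)" by (rule nn_integral_liminf[OF Um])
  also have "\<dots> \<le> liminf (\<lambda>j. \<integral>\<^sup>+\<omega>. ennreal ?C * ennreal (Q j \<omega>) \<partial>M)"
  proof (intro Liminf_mono always_eventually allI)
    fix j
    have "(\<integral>\<^sup>+\<omega>. ennreal ?C * ennreal (Q j \<omega>) \<partial>M) = ennreal ?C * (\<integral>\<^sup>+\<omega>. ennreal (Q j \<omega>) \<partial>M)"
      using Qm[of j] by (intro nn_integral_cmult) simp
    then show "(\<integral>\<^sup>+\<omega>. U j \<omega> \<partial>M) \<le> (\<integral>\<^sup>+\<omega>. ennreal ?C * ennreal (Q j \<omega>) \<partial>M)" using U1[of j] by simp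
  qed
  also have "\<dots> \<le> limsup (\<lambda>j. \<integral>\<^sup>+\<omega>. ennreal ?C * ennreal (Q j \<omega>) \<partial>M)"
    by (rule Liminf_le_Limsup) simp
  also have "\<dots> \<le> (\<integral>\<^sup>+\<omega>. limsup (\<lambda>j. ennreal ?C * ennreal (Q j \<omega>)) \<partial>M)"
  proof (rule nn_integral_limsup[where w = "\<lambda>_. ennreal ?C * ennreal (R ^ ?p * (t - s))"])
    show "(\<lambda>\<omega>. ennreal ?C * ennreal (Q j \<omega>)) \<in> borel_measurable M" for j
      using Qm[of j] by measurable
    show "AE \<omega> in M. ennreal ?C * ennreal (Q j \<omega>) \<le> ennreal ?C * ennreal (R ^ ?p * (t - s))" for j
      by (intro AE_I2 mult_left_mono ennreal_leI QB) simp
    show "(\<integral>\<^sup>+\<omega>. ennreal ?C * ennreal (R ^ ?p * (t - s)) \<partial>M) < \<infinity>"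
      by (simp add: emeasure_space_1 ennreal_mult_less_top)
  qed simp
  also have "\<dots> \<le> (\<integral>\<^sup>+\<omega>. ennreal ?C * J \<omega> \<partial>M)"
    using main by (intro nn_integral_mono_AE) auto
  also have "\<dots> = ennreal ?C * (\<integral>\<^sup>+\<omega>. J \<omega> \<partial>M)" by (rule nn_integral_cmult[OF Jm])
  finally show ?thesis .
qed

end

section \<open>Localisation\<close>

lemma closure_rat_interval:
  assumes "a < (b::real)" shows "closure (\<rat> \<inter> {a..b}) = {a..b}"
proof
  have "closure (\<rat> \<inter> {a..b}) \<subseteq> closure {a..b}" by (intro closure_mono) auto
  then show "closure (\<rat> \<inter> {a..b}) \<subseteq> {a..b}" by simp
  show "{a..b} \<subseteq> closure (\<rat> \<inter> {a..b})"
  proof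
    fix x assume x: "x \<in> {a..b}"
    show "x \<in> closure (\<rat> \<inter> {a..b})" unfolding closure_approachable
    proof (intro allI impI)
      fix e :: real assume e: "0 < e"
      have "max a (x - e) < min b (x + e)" using x e assms by auto
      then obtain q where "q \<in> \<rat>" "max a (x - e) < q" "q < min b (x + e)" using Rats_dense_in_real by blast
      then show "\<exists>y\<in>\<rat> \<inter> {a..b}. dist y x < e" by (intro bexI[of _ q]) (auto simp: dist_real_def)
    qed
  qed
qed

lemma le_of_rat:
  fixes f :: "real \<Rightarrow> real"
  assumes "a < b" "continuous_on {a..b} f" "\<And>q. q \<in> \<rat> \<Longrightarrow> q \<in> {a..b} \<Longrightarrow> f q \<le> B" "x \<in> {a..b}"
  shows "f x \<le> B"
  using continuous_le_on_closure[of "\<rat> \<inter> {a..b}" f x B] assms by (simp add: closure_rat_interval)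

lemma le_SUP_rat:
  fixes f :: "real \<Rightarrow> real"
  assumes "a < b" "continuous_on {a..b} f" "x \<in> {a..b}"
  shows "ennreal (f x) \<le> (SUP q\<in>\<rat> \<inter> {a..b}. ennreal (f q))"
proof (cases "SUP q\<in>\<rat> \<inter> {a..b}. ennreal (f q)")
  case (real B)
  have "f q \<le> B" if "q \<in> \<rat>" "q \<in> {a..b}" for q
  proof -
    have "ennreal (f q) \<le> (SUP q\<in>\<rat> \<inter> {a..b}. ennreal (f q))" by (rule SUP_upper) (use that in simp)
    then show ?thesis unfolding real(2) using real(1) by (simp add: ennreal_le_iff)
  qed
  then have "f x \<le> B" by (rule le_of_rat[OF assms(1,2) _ assms(3)])
  then show ?thesis unfolding real(2) by (rule ennreal_leI)
next
  case top
  show ?thesis unfolding top by (rule top_greatest)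
qed

text \<open>For a continuous path this says that \<open>N\<close> has not exceeded \<open>R\<close> up to time \<open>u\<close>.  With rational times it is
an event in \<open>F u\<close>.\<close>

definition alive_below :: "real \<Rightarrow> (real \<Rightarrow> 'a \<Rightarrow> real) \<Rightarrow> real \<Rightarrow> real \<Rightarrow> 'a \<Rightarrow> bool" where
  "alive_below T N R u \<omega> \<longleftrightarrow> (\<forall>q\<in>\<rat> \<inter> {0..min u T}. N q \<omega> \<le> R)"

lemma alive_below_antimono: "u \<le> u' \<Longrightarrow> alive_below T N R u' \<omega> \<Longrightarrow> alive_below T N R u \<omega>"
  by (auto simp: alive_below_def)

lemma alive_below_mono: "R \<le> R' \<Longrightarrow> alive_below T N R u \<omega> \<Longrightarrow> alive_below T N R' u \<omega>"
  by (force simp: alive_below_def)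

lemma alive_belowD:
  assumes "alive_below T N R u \<omega>" "continuous_on {0..T} (\<lambda>u. N u \<omega>)" "u \<in> {0..T}" "y \<in> {0..u}"
  shows "N y \<omega> \<le> R"
proof (cases "u = 0")
  case True
  then have y: "y = 0" using assms by simp
  have "(0::real) \<in> \<rat> \<inter> {0..min u T}" using assms(3) by simp
  then show ?thesis using assms(1) unfolding y alive_below_def by blast
next
  case False
  then have u: "0 < u" using assms(3) by simp
  have c: "continuous_on {0..u} (\<lambda>u. N u \<omega>)" using assms(2) by (rule continuous_on_subset) (use assms(3) in auto)
  show ?thesis
    by (rule le_of_rat[OF u c _ assms(4)]) (use assms(1,3) in \<open>auto simp: alive_below_def\<close>)
qed

lemma eventually_alive:
  assumes "continuous_on {0..T} (\<lambda>u. N u \<omega>)"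
  shows "\<exists>n::nat. \<forall>k\<ge>n. \<forall>u. alive_below T N (real k) u \<omega>"
proof -
  have "bounded ((\<lambda>u. N u \<omega>) ` {0..T})"
    by (intro compact_imp_bounded compact_continuous_image assms) simp
  then obtain B where B: "\<forall>u\<in>{0..T}. \<bar>N u \<omega>\<bar> \<le> B" by (auto simp: bounded_iff)
  obtain n :: nat where n: "B \<le> real n" using real_arch_simple by blast
  have "alive_below T N (real k) u \<omega>" if "n \<le> k" for k u
    unfolding alive_below_def
  proof
    fix q assume "q \<in> \<rat> \<inter> {0..min u T}"
    then have "\<bar>N q \<omega>\<bar> \<le> B" using B by simp
    then show "N q \<omega> \<le> real k" using n that by linarith
  qed
  then show ?thesis by blast
qed

text \<open>An Ito integral whose integrand is bounded for as long as the continuous adapted process \<open>N\<close> is bounded.\<close>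

locale controlled_ito = brownian_motion M F W
  for M :: "'a measure" and F and W :: "real \<Rightarrow> 'a \<Rightarrow> real ^ 'm" +
  fixes T :: real and H :: "real \<Rightarrow> 'a \<Rightarrow> real ^ 'm ^ 'n" and I :: "real \<Rightarrow> 'a \<Rightarrow> real ^ 'n"
    and N :: "real \<Rightarrow> 'a \<Rightarrow> real"
  assumes T_pos: "0 < T"
    and lim: "ito_limit M F W T H I"
    and N_adapted: "\<And>u. u \<in> {0..T} \<Longrightarrow> N u \<in> borel_measurable (F u)"
    and N_continuous: "AE \<omega> in M. continuous_on {0..T} (\<lambda>u. N u \<omega>)"
    and H_controlled: "\<And>R. \<exists>B. AE \<omega> in M. \<forall>u\<in>{0..T}. (\<forall>y\<in>{0..u}. N y \<omega> \<le> R) \<longrightarrow> norm (H u \<omega>) \<le> B"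
begin

abbreviation alive :: "real \<Rightarrow> real \<Rightarrow> 'a \<Rightarrow> bool" where
  "alive \<equiv> alive_below T N"

lemma alive_measurable: assumes "0 \<le> u" shows "Measurable.pred (F u) (alive R u)"
proof -
  have "Measurable.pred (F u) (\<lambda>\<omega>. N q \<omega> \<le> R)" if "q \<in> \<rat> \<inter> {0..min u T}" for q
  proof -
    have "N q \<in> borel_measurable (F u)"
      by (rule measurable_F_mono[OF N_adapted]) (use that in auto)
    then show ?thesis unfolding pred_def by (rule borel_measurable_le) simp
  qed
  moreover have "countable (\<rat> \<inter> {0..min u T})" by (simp add: countable_rat)
  ultimately show ?thesis
    unfolding alive_below_def pred_def by (intro sets.sets_Collect_countable_All') auto
qed

lemma alive_measurable_M: assumes "0 \<le> u" shows "Measurable.pred M (alive R u)"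
  by (rule measurable_from_subalg[OF subalgebra_F alive_measurable[OF assms]])

lemma I_measurable: "u \<in> {0..T} \<Longrightarrow> I u \<in> borel_measurable M"
  and I_continuous: "AE \<omega> in M. continuous_on {0..T} (\<lambda>u. I u \<omega>)"
  using lim by (auto simp: ito_limit_def)

lemma H_bounded_alive: "\<exists>B\<ge>0. AE \<omega> in M. \<forall>u\<in>{0..T}. alive R u \<omega> \<longrightarrow> norm (H u \<omega>) \<le> B"
proof -
  obtain B where B: "AE \<omega> in M. \<forall>u\<in>{0..T}. (\<forall>y\<in>{0..u}. N y \<omega> \<le> R) \<longrightarrow> norm (H u \<omega>) \<le> B"
    using H_controlled[of R] by blast
  have "AE \<omega> in M. \<forall>u\<in>{0..T}. alive R u \<omega> \<longrightarrow> norm (H u \<omega>) \<le> \<bar>B\<bar>"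
    using B N_continuous
  proof eventually_elim
    fix \<omega> assume B: "\<forall>u\<in>{0..T}. (\<forall>y\<in>{0..u}. N y \<omega> \<le> R) \<longrightarrow> norm (H u \<omega>) \<le> B"
      and c: "continuous_on {0..T} (\<lambda>u. N u \<omega>)"
    show "\<forall>u\<in>{0..T}. alive R u \<omega> \<longrightarrow> norm (H u \<omega>) \<le> \<bar>B\<bar>"
    proof (intro ballI impI)
      fix u assume u: "u \<in> {0..T}" "alive R u \<omega>"
      have "norm (H u \<omega>) \<le> B" using B u alive_belowD[OF u(2) c u(1)] by blast
      then show "norm (H u \<omega>) \<le> \<bar>B\<bar>" by linarith
    qed
  qed
  then show ?thesis by (intro exI[of _ "\<bar>B\<bar>"]) simp
qed

text \<open>Monotone convergence from finite to countable sets of sample points.\<close>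

lemma stopped_maximal:
  assumes s0: "0 \<le> s" and st: "s < t" and tT: "t \<le> T"
    and r: "even r" "1 \<le> r"
    and Jm: "J \<in> borel_measurable M"
    and J: "AE \<omega> in M. (\<integral>\<^sup>+u\<in>{s..t}. indicator {u. alive R u \<omega>} u * ennreal (norm (H u \<omega>) ^ (2 * r)) \<partial>lborel) \<le> J \<omega>"
    and X: "countable X" "X \<subseteq> {s..t}"
  shows "(\<integral>\<^sup>+\<omega>. (SUP x\<in>X. indicator {\<omega>. alive R x \<omega>} \<omega> * ennreal (norm (I x \<omega> - I s \<omega>) ^ (2 * r))) \<partial>M)
    \<le> ennreal (vec_const (CARD('n) * CARD('m)) r * (t - s) ^ (r - 1)) * (\<integral>\<^sup>+\<omega>. J \<omega> \<partial>M)" (is "_ \<le> ?rhs")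
proof (cases "X = {}")
  case False
  obtain B where B: "0 \<le> B" "AE \<omega> in M. \<forall>u\<in>{0..T}. alive R u \<omega> \<longrightarrow> norm (H u \<omega>) \<le> B"
    using H_bounded_alive by blast
  define g where "g x \<omega> = indicator {\<omega>. alive R x \<omega>} \<omega> * ennreal (norm (I x \<omega> - I s \<omega>) ^ (2 * r))" for x \<omega>
  define e where "e = from_nat_into X"
  have re: "range e = X" using X(1) False by (simp add: e_def range_from_nat_into)
  have eX: "e n \<in> X" for n using re by blast
  have gm: "g x \<in> borel_measurable M" if "x \<in> X" for x
  proof -
    have xs: "x \<in> {0..T}" "s \<in> {0..T}" using that X(2) s0 tT st by auto
    note [measurable] = I_measurable[OF xs(1)] I_measurable[OF xs(2)]
    have [measurable]: "Measurable.pred M (alive R x)" using xs by (intro alive_measurable_M) simp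
    show ?thesis unfolding g_def[abs_def] by measurable
  qed
  have "(SUP x\<in>X. g x \<omega>) = (SUP n. SUP x\<in>e ` {..n}. g x \<omega>)" for \<omega>
  proof (rule antisym)
    show "(SUP x\<in>X. g x \<omega>) \<le> (SUP n. SUP x\<in>e ` {..n}. g x \<omega>)"
    proof (rule SUP_least)
      fix x assume "x \<in> X"
      then obtain n where n: "x = e n" using re by blast
      have "g x \<omega> \<le> (SUP x\<in>e ` {..n}. g x \<omega>)" unfolding n by (rule SUP_upper) simp
      also have "\<dots> \<le> (SUP n. SUP x\<in>e ` {..n}. g x \<omega>)" by (rule SUP_upper) simp
      finally show "g x \<omega> \<le> (SUP n. SUP x\<in>e ` {..n}. g x \<omega>)" .
    qed
    show "(SUP n. SUP x\<in>e ` {..n}. g x \<omega>) \<le> (SUP x\<in>X. g x \<omega>)"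
      by (intro SUP_least SUP_upper) (use eX in blast)
  qed
  then have "(\<integral>\<^sup>+\<omega>. (SUP x\<in>X. g x \<omega>) \<partial>M) = (\<integral>\<^sup>+\<omega>. (SUP n. SUP x\<in>e ` {..n}. g x \<omega>) \<partial>M)" by simp
  also have "\<dots> = (SUP n. \<integral>\<^sup>+\<omega>. (SUP x\<in>e ` {..n}. g x \<omega>) \<partial>M)"
  proof (rule nn_integral_monotone_convergence_SUP)
    show "incseq (\<lambda>n \<omega>. SUP x\<in>e ` {..n}. g x \<omega>)"
      by (intro monoI le_funI SUP_subset_mono) auto
    show "(\<lambda>\<omega>. SUP x\<in>e ` {..n}. g x \<omega>) \<in> borel_measurable M" for n
      by (intro borel_measurable_SUP gm) (use eX in \<open>auto intro: countable_finite\<close>)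
  qed
  also have "\<dots> \<le> ?rhs"
  proof (rule SUP_least)
    fix n
    show "(\<integral>\<^sup>+\<omega>. (SUP x\<in>e ` {..n}. g x \<omega>) \<partial>M) \<le> ?rhs"
      unfolding g_def
      by (rule stopped_maximal_finite[OF lim s0 st tT B(1) alive_measurable alive_below_antimono B(2) r Jm J])
         (use eX X(2) in auto)
  qed
  finally show ?thesis unfolding g_def .
qed (simp add: bot_ennreal)

text \<open>At a single time the stopping is removed by letting the level tend to infinity.\<close>

lemma increment_moment:
  assumes s0: "0 \<le> s" and st: "s < t" and tT: "t \<le> T"
    and r: "even r" "1 \<le> r"
    and Jm: "J \<in> borel_measurable M"
    and J: "AE \<omega> in M. (\<integral>\<^sup>+u\<in>{s..t}. ennreal (norm (H u \<omega>) ^ (2 * r)) \<partial>lborel) \<le> J \<omega>"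
  shows "(\<integral>\<^sup>+\<omega>. ennreal (norm (I t \<omega> - I s \<omega>) ^ (2 * r)) \<partial>M)
    \<le> ennreal (vec_const (CARD('n) * CARD('m)) r * (t - s) ^ (r - 1)) * (\<integral>\<^sup>+\<omega>. J \<omega> \<partial>M)" (is "_ \<le> ?rhs")
proof -
  define g where "g k \<omega> = indicator {\<omega>. alive (real k) t \<omega>} \<omega> * ennreal (norm (I t \<omega> - I s \<omega>) ^ (2 * r))" for k :: nat and \<omega>
  have ts: "t \<in> {0..T}" "s \<in> {0..T}" using s0 tT st by auto
  have gm: "g k \<in> borel_measurable M" for k
  proof -
    note [measurable] = I_measurable[OF ts(1)] I_measurable[OF ts(2)]
    have [measurable]: "Measurable.pred M (alive (real k) t)" using ts by (intro alive_measurable_M) simp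
    show ?thesis unfolding g_def[abs_def] by measurable
  qed
  have "AE \<omega> in M. ennreal (norm (I t \<omega> - I s \<omega>) ^ (2 * r)) \<le> (SUP k. g k \<omega>)"
    using N_continuous
  proof eventually_elim
    fix \<omega> assume "continuous_on {0..T} (\<lambda>u. N u \<omega>)"
    from eventually_alive[of T N \<omega>, OF this] obtain n where "\<forall>k\<ge>n. \<forall>u. alive (real k) u \<omega>" ..
    then have "alive (real n) t \<omega>" by blast
    then have "g n \<omega> = ennreal (norm (I t \<omega> - I s \<omega>) ^ (2 * r))" by (simp add: g_def)
    moreover have "g n \<omega> \<le> (SUP k. g k \<omega>)" by (rule SUP_upper) simp
    ultimately show "ennreal (norm (I t \<omega> - I s \<omega>) ^ (2 * r)) \<le> (SUP k. g k \<omega>)" by (simp only:)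
  qed
  then have "(\<integral>\<^sup>+\<omega>. ennreal (norm (I t \<omega> - I s \<omega>) ^ (2 * r)) \<partial>M) \<le> (\<integral>\<^sup>+\<omega>. (SUP k. g k \<omega>) \<partial>M)"
    by (rule nn_integral_mono_AE)
  also have "\<dots> = (SUP k. \<integral>\<^sup>+\<omega>. g k \<omega> \<partial>M)"
  proof (rule nn_integral_monotone_convergence_SUP[OF _ gm])
    show "incseq g"
    proof (intro monoI le_funI)
      fix k k' :: nat and \<omega> assume "k \<le> k'"
      then have "alive (real k) t \<omega> \<Longrightarrow> alive (real k') t \<omega>" using alive_below_mono[of "real k" "real k'"] by simp
      then show "g k \<omega> \<le> g k' \<omega>" by (auto simp: g_def indicator_def)
    qed
  qed
  also have "\<dots> \<le> ?rhs"
  proof (rule SUP_least)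
    fix k
    have J': "AE \<omega> in M. (\<integral>\<^sup>+u\<in>{s..t}. indicator {u. alive (real k) u \<omega>} u * ennreal (norm (H u \<omega>) ^ (2 * r)) \<partial>lborel) \<le> J \<omega>"
      using J
    proof eventually_elim
      fix \<omega> assume "(\<integral>\<^sup>+u\<in>{s..t}. ennreal (norm (H u \<omega>) ^ (2 * r)) \<partial>lborel) \<le> J \<omega>"
      then show "(\<integral>\<^sup>+u\<in>{s..t}. indicator {u. alive (real k) u \<omega>} u * ennreal (norm (H u \<omega>) ^ (2 * r)) \<partial>lborel) \<le> J \<omega>"
        by (rule order_trans[rotated]) (intro nn_integral_mono, auto simp: indicator_def)
    qed
    have "(\<integral>\<^sup>+\<omega>. g k \<omega> \<partial>M) = (\<integral>\<^sup>+\<omega>. (SUP x\<in>{t}. indicator {\<omega>. alive (real k) x \<omega>} \<omega> * ennreal (norm (I x \<omega> - I s \<omega>) ^ (2 * r))) \<partial>M)"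
      by (simp add: g_def)
    also have "\<dots> \<le> ?rhs" by (rule stopped_maximal[OF s0 st tT r Jm J']) (use st in auto)
    finally show "(\<integral>\<^sup>+\<omega>. g k \<omega> \<partial>M) \<le> ?rhs" .
  qed
  finally show ?thesis .
qed

end

section \<open>A Gronwall estimate for moments\<close>

text \<open>A substitute for Jensen's inequality: integrate \<open>x \<le> \<mu> + x\<^sup>p / \<mu>\<^sup>p\<^sup>-\<^sup>1\<close> with \<open>\<mu> = q\<^sup>1\<^sup>/\<^sup>p\<close>.\<close>

lemma nn_integral_le_root:
  fixes g :: "real \<Rightarrow> real"
  assumes m: "(\<lambda>u. indicator A u * g u) \<in> borel_measurable lborel" and A: "A \<in> sets lborel" "emeasure lborel A \<le> 1"
    and g0: "\<And>u. 0 \<le> g u" and p: "1 \<le> p" and q0: "0 \<le> q"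
    and q: "(\<integral>\<^sup>+u\<in>A. ennreal (g u ^ p) \<partial>lborel) \<le> ennreal q"
  shows "(\<integral>\<^sup>+u\<in>A. ennreal (g u) \<partial>lborel) \<le> ennreal (2 * root p q)"
proof -
  \<comment> \<open>The bound for every \<open>\<mu>\<close>; for \<open>q = 0\<close> there is no optimal one and \<open>\<mu>\<close> tends to \<open>0\<close>.\<close>
  have young: "(\<integral>\<^sup>+u\<in>A. ennreal (g u) \<partial>lborel) \<le> ennreal (\<mu> + q / \<mu> ^ (p - 1))" if \<mu>: "0 < \<mu>" for \<mu>
  proof -
    have pw: "x \<le> \<mu> + x ^ p / \<mu> ^ (p - 1)" if x: "0 \<le> x" for x
    proof (cases "x \<le> \<mu>")
      case True
      have "0 \<le> x ^ p / \<mu> ^ (p - 1)" using x \<mu> by simp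
      then show ?thesis using True by linarith
    next
      case False
      have "x * \<mu> ^ (p - 1) \<le> x * x ^ (p - 1)"
        using False \<mu> x by (intro mult_left_mono power_mono) auto
      also have "\<dots> = x ^ p" using p by (cases p) auto
      finally have "x \<le> x ^ p / \<mu> ^ (p - 1)" using \<mu> by (simp add: pos_le_divide_eq)
      then show ?thesis using \<mu> by linarith
    qed
    have gm: "(\<lambda>u. ennreal (g u ^ p) * indicator A u) \<in> borel_measurable lborel"
    proof -
      have "(\<lambda>u. ennreal ((indicator A u * g u) ^ p)) \<in> borel_measurable lborel" using m by measurable
      also have "(\<lambda>u. ennreal ((indicator A u * g u) ^ p)) = (\<lambda>u. ennreal (g u ^ p) * indicator A u)"
        using p by (auto simp: indicator_def fun_eq_iff)
      finally show ?thesis .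
    qed
    have "(\<integral>\<^sup>+u\<in>A. ennreal (g u) \<partial>lborel)
      \<le> (\<integral>\<^sup>+u. ennreal \<mu> * indicator A u + ennreal (1 / \<mu> ^ (p - 1)) * (ennreal (g u ^ p) * indicator A u) \<partial>lborel)"
    proof (rule nn_integral_mono)
      fix u
      have "ennreal (g u) \<le> ennreal (\<mu> + 1 / \<mu> ^ (p - 1) * g u ^ p)"
        using pw[OF g0] by (intro ennreal_leI) simp
      also have "\<dots> = ennreal \<mu> + ennreal (1 / \<mu> ^ (p - 1)) * ennreal (g u ^ p)"
        using \<mu> g0[of u] by (subst ennreal_plus) (simp_all only: ennreal_mult zero_le_power zero_le_divide_1_iff less_imp_le mult_nonneg_nonneg)
      finally show "ennreal (g u) * indicator A u \<le> ennreal \<mu> * indicator A u + ennreal (1 / \<mu> ^ (p - 1)) * (ennreal (g u ^ p) * indicator A u)"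
        by (simp add: indicator_def)
    qed
    also have "\<dots> = ennreal \<mu> * emeasure lborel A + ennreal (1 / \<mu> ^ (p - 1)) * (\<integral>\<^sup>+u\<in>A. ennreal (g u ^ p) \<partial>lborel)"
      using gm A(1) by (subst nn_integral_add) (simp_all add: nn_integral_cmult nn_integral_cmult_indicator)
    also have "\<dots> \<le> ennreal \<mu> * 1 + ennreal (1 / \<mu> ^ (p - 1)) * ennreal q"
      by (intro add_mono mult_left_mono A(2) q) simp_all
    also have "\<dots> = ennreal (\<mu> + q / \<mu> ^ (p - 1))"
    proof -
      have "0 \<le> 1 / \<mu> ^ (p - 1)" using \<mu> by simp
      then have "ennreal (1 / \<mu> ^ (p - 1)) * ennreal q = ennreal (1 / \<mu> ^ (p - 1) * q)"
        using q0 by (intro ennreal_mult[symmetric])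
      moreover have "0 \<le> q / \<mu> ^ (p - 1)" using \<mu> q0 by simp
      ultimately show ?thesis using \<mu> by (simp add: ennreal_plus)
    qed
    finally show ?thesis .
  qed
  show ?thesis
  proof (cases "q = 0")
    case True
    have "(\<integral>\<^sup>+u\<in>A. ennreal (g u) \<partial>lborel) \<le> 0"
    proof (rule ennreal_le_epsilon)
      fix \<mu> :: real assume "0 < \<mu>"
      from young[OF this] True show "(\<integral>\<^sup>+u\<in>A. ennreal (g u) \<partial>lborel) \<le> 0 + ennreal \<mu>" by simp
    qed
    then show ?thesis using True by simp
  next
    case False
    then have qp: "0 < q" using q0 by simp
    let ?\<mu> = "root p q"
    have \<mu>: "0 < ?\<mu>" using p qp by simp
    have "q = ?\<mu> ^ p" using p qp by simp
    also have "\<dots> = ?\<mu> * ?\<mu> ^ (p - 1)" using p by (cases p) auto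
    finally have "q / ?\<mu> ^ (p - 1) = ?\<mu>" using \<mu> by (simp add: divide_eq_eq)
    then show ?thesis using young[OF \<mu>] by simp
  qed
qed

lemma norm_set_integral_le:
  fixes f :: "real \<Rightarrow> 'b::euclidean_space"
  shows "ennreal (norm (LINT u:A|lborel. f u)) \<le> (\<integral>\<^sup>+u\<in>A. ennreal (norm (f u)) \<partial>lborel)"
proof (cases "set_integrable lborel A f")
  case True
  have "ennreal (norm (LINT u:A|lborel. f u)) \<le> (\<integral>\<^sup>+u. ennreal (norm (indicator A u *\<^sub>R f u)) \<partial>lborel)"
    using True unfolding set_lebesgue_integral_def set_integrable_def by (rule integral_norm_bound_ennreal)
  also have "\<dots> = (\<integral>\<^sup>+u\<in>A. ennreal (norm (f u)) \<partial>lborel)"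
    by (intro nn_integral_cong) (auto simp: indicator_def)
  finally show ?thesis .
next
  case False
  then show ?thesis by (simp add: set_lebesgue_integral_def set_integrable_def not_integrable_integral_eq)
qed

lemma add_power_le: "0 \<le> a \<Longrightarrow> 0 \<le> b \<Longrightarrow> (a + b :: real) ^ p \<le> 2 ^ p * (a ^ p + b ^ p)"
proof -
  assume *: "0 \<le> a" "0 \<le> b"
  have "(a + b) ^ p \<le> (2 * max a b) ^ p" using * by (intro power_mono) auto
  also have "\<dots> = 2 ^ p * max a b ^ p" by (rule power_mult_distrib)
  also have "\<dots> \<le> 2 ^ p * (a ^ p + b ^ p)" using * by (intro mult_left_mono) (auto simp: max_def)
  finally show ?thesis .
qed

lemma add3_power_le: "0 \<le> a \<Longrightarrow> 0 \<le> b \<Longrightarrow> 0 \<le> d \<Longrightarrow> (a + b + d :: real) ^ p \<le> 3 ^ p * (a ^ p + b ^ p + d ^ p)"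
proof -
  assume *: "0 \<le> a" "0 \<le> b" "0 \<le> d"
  let ?m = "max a (max b d)"
  have "(a + b + d) ^ p \<le> (3 * ?m) ^ p" using * by (intro power_mono) auto
  also have "\<dots> = 3 ^ p * ?m ^ p" by (rule power_mult_distrib)
  also have "\<dots> \<le> 3 ^ p * (a ^ p + b ^ p + d ^ p)" using * by (intro mult_left_mono) (auto simp: max_def)
  finally show ?thesis .
qed

definition gronwall_factor :: "nat \<Rightarrow> nat \<Rightarrow> real \<Rightarrow> real" where
  "gronwall_factor d r c = 12 ^ (2 * r) * (1 + vec_const d r) * (1 + c ^ (2 * r))"

text \<open>The interval is divided into steps of length at most \<open>1 / (2 * gronwall_factor)\<close>, and each of them multiplies the bound by at most
\<open>5 * gronwall_factor\<close>.\<close>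

definition gronwall_const :: "nat \<Rightarrow> nat \<Rightarrow> real \<Rightarrow> real \<Rightarrow> real" where
  "gronwall_const d r c T = (5 * gronwall_factor d r c) ^ nat \<lceil>2 * gronwall_factor d r c * T\<rceil>"

lemma gronwall_factor_ge_1: assumes "0 \<le> c" shows "1 \<le> gronwall_factor d r c"
proof -
  have "1 * 1 * 1 \<le> 12 ^ (2 * r) * (1 + vec_const d r) * (1 + c ^ (2 * r))"
    using vec_const_nonneg[of d r] assms by (intro mult_mono) auto
  then show ?thesis by (simp add: gronwall_factor_def)
qed

lemma gronwall_const_nonneg: "0 \<le> c \<Longrightarrow> 0 \<le> gronwall_const d r c T"
  unfolding gronwall_const_def using gronwall_factor_ge_1[of c d r] by (intro zero_le_power) simp

definition ito_increments :: "real \<Rightarrow> (real \<Rightarrow> 'a \<Rightarrow> real ^ 'n) \<Rightarrow> (real \<Rightarrow> 'a \<Rightarrow> real ^ 'n) \<Rightarrow>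
    (real \<Rightarrow> 'a \<Rightarrow> real ^ 'n) \<Rightarrow> 'a \<Rightarrow> bool" where
  "ito_increments T Z f I \<omega> \<longleftrightarrow> (\<forall>s t. 0 \<le> s \<longrightarrow> s \<le> t \<longrightarrow> t \<le> T \<longrightarrow>
    Z t \<omega> = Z s \<omega> + (LINT u:{s..t}|lborel. f u \<omega>) + (I t \<omega> - I s \<omega>))"

lemma ito_incrementsD:
  assumes "ito_increments T Z f I \<omega>" "0 \<le> s" "s \<le> t" "t \<le> T"
  shows "Z t \<omega> = Z s \<omega> + (LINT u:{s..t}|lborel. f u \<omega>) + (I t \<omega> - I s \<omega>)"
  using assms unfolding ito_increments_def by blast

text \<open>The bound \<open>c * sup |e| + P\<close> for both coefficients, where the running supremum of \<open>|e|\<close> is replaced by an arbitrary upper bound.\<close>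

definition linear_growth :: "real \<Rightarrow> real \<Rightarrow> (real \<Rightarrow> 'a \<Rightarrow> real ^ 'n) \<Rightarrow> (real \<Rightarrow> 'a \<Rightarrow> real ^ 'n) \<Rightarrow>
    (real \<Rightarrow> 'a \<Rightarrow> real ^ 'm ^ 'n) \<Rightarrow> (real \<Rightarrow> 'a \<Rightarrow> real) \<Rightarrow> 'a \<Rightarrow> bool" where
  "linear_growth T c e f H P \<omega> \<longleftrightarrow> (\<forall>u\<in>{0..T}. \<forall>B. (\<forall>y\<in>{0..u}. norm (e y \<omega>) \<le> B) \<longrightarrow>
    norm (f u \<omega>) \<le> c * B + P u \<omega> \<and> norm (H u \<omega>) \<le> c * B + P u \<omega>)"

text \<open>The process \<open>e\<close> has drift \<open>f\<close> and integrand \<open>H\<close>, both bounded by its own running supremum and a forcing term \<open>P\<close>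
whose energy is at most \<open>Q\<close>.  The horizon \<open>T'\<close> may be shorter than \<open>T\<close>.\<close>

locale ito_gronwall = controlled_ito M F W T H I N
  for M :: "'a measure" and F and W :: "real \<Rightarrow> 'a \<Rightarrow> real ^ 'm" and T
    and H :: "real \<Rightarrow> 'a \<Rightarrow> real ^ 'm ^ 'n" and I :: "real \<Rightarrow> 'a \<Rightarrow> real ^ 'n" and N +
  fixes e f :: "real \<Rightarrow> 'a \<Rightarrow> real ^ 'n" and P :: "real \<Rightarrow> 'a \<Rightarrow> real" and Q :: "'a \<Rightarrow> ennreal"
    and c T' :: real and r :: nat
  assumes T': "0 < T'" "T' \<le> T"
    and r: "even r" "1 \<le> r"
    and c0: "0 \<le> c"
    and e_measurable: "\<And>u. u \<in> {0..T} \<Longrightarrow> e u \<in> borel_measurable M"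
    and e_continuous: "AE \<omega> in M. continuous_on {0..T} (\<lambda>u. e u \<omega>)"
    and e_le_N: "\<And>u \<omega>. u \<in> {0..T} \<Longrightarrow> \<omega> \<in> space M \<Longrightarrow> norm (e u \<omega>) \<le> N u \<omega>"
    and e_increment: "AE \<omega> in M. ito_increments T e f I \<omega>"
    and growth: "AE \<omega> in M. linear_growth T' c e f H P \<omega>"
    and P0: "\<And>u \<omega>. 0 \<le> P u \<omega>"
    and P_measurable: "\<And>\<omega>. \<omega> \<in> space M \<Longrightarrow> (\<lambda>u. indicator {0..T'} u * P u \<omega>) \<in> borel_measurable borel"
    and Q_measurable: "Q \<in> borel_measurable M"
    and Q: "AE \<omega> in M. (\<integral>\<^sup>+u\<in>{0..T'}. ennreal (P u \<omega> ^ (2 * r)) \<partial>lborel) \<le> Q \<omega>"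
begin

definition stopped_sup :: "real \<Rightarrow> real \<Rightarrow> 'a \<Rightarrow> ennreal" where
  "stopped_sup R t \<omega> = (SUP q\<in>\<rat> \<inter> {0..t}. indicator {\<omega>. alive R q \<omega>} \<omega> * ennreal (norm (e q \<omega>) ^ (2 * r)))"

lemma stopped_sup_measurable [measurable]: assumes "t \<le> T" shows "stopped_sup R t \<in> borel_measurable M"
  unfolding stopped_sup_def[abs_def]
proof (rule borel_measurable_SUP)
  show "countable (\<rat> \<inter> {0..t})" by (simp add: countable_rat)
  fix q assume "q \<in> \<rat> \<inter> {0..t}"
  then have q: "q \<in> {0..T}" using assms by simp
  have [measurable]: "Measurable.pred M (alive R q)" using q by (intro alive_measurable_M) simp
  note [measurable] = e_measurable[OF q]
  show "(\<lambda>\<omega>. indicator {\<omega>. alive R q \<omega>} \<omega> * ennreal (norm (e q \<omega>) ^ (2 * r))) \<in> borel_measurable M"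
    by measurable
qed

lemma stopped_sup_mono: "s \<le> t \<Longrightarrow> stopped_sup R s \<omega> \<le> stopped_sup R t \<omega>"
  unfolding stopped_sup_def by (rule SUP_subset_mono) auto

lemma stopped_sup_bounded: assumes "\<omega> \<in> space M" "t \<le> T" "0 \<le> R" shows "stopped_sup R t \<omega> \<le> ennreal (R ^ (2 * r))"
  unfolding stopped_sup_def
proof (rule SUP_least)
  fix q assume q: "q \<in> \<rat> \<inter> {0..t}"
  show "indicator {\<omega>. alive R q \<omega>} \<omega> * ennreal (norm (e q \<omega>) ^ (2 * r)) \<le> ennreal (R ^ (2 * r))"
  proof (cases "alive R q \<omega>")
    case True
    then have "N q \<omega> \<le> R" using q assms(2) unfolding alive_below_def by auto
    then have "norm (e q \<omega>) \<le> R" using e_le_N[of q \<omega>] q assms by simp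
    then show ?thesis using True by (auto intro!: ennreal_leI power_mono)
  qed simp
qed

lemma le_stopped_sup:
  assumes c: "continuous_on {0..T} (\<lambda>u. e u \<omega>)" and x: "alive R x \<omega>" "x \<in> {0..T}" and y: "y \<in> {0..x}"
  shows "ennreal (norm (e y \<omega>) ^ (2 * r)) \<le> stopped_sup R y \<omega>"
proof -
  have al: "alive R z \<omega>" if "z \<le> y" for z using alive_below_antimono[OF _ x(1), of z] that y by simp
  show ?thesis
  proof (cases "y = 0")
    case True
    have "indicator {\<omega>. alive R 0 \<omega>} \<omega> * ennreal (norm (e 0 \<omega>) ^ (2 * r)) \<le> stopped_sup R y \<omega>"
      unfolding stopped_sup_def by (rule SUP_upper) (use True in simp)
    then show ?thesis using al[of 0] True by simp
  next
    case False
    then have y0: "0 < y" using y by simp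
    have "continuous_on {0..y} (\<lambda>u. e u \<omega>)" using c by (rule continuous_on_subset) (use x y in auto)
    then have "continuous_on {0..y} (\<lambda>u. norm (e u \<omega>) ^ (2 * r))" by (intro continuous_intros)
    then have "ennreal (norm (e y \<omega>) ^ (2 * r)) \<le> (SUP q\<in>\<rat> \<inter> {0..y}. ennreal (norm (e q \<omega>) ^ (2 * r)))"
      using y0 by (intro le_SUP_rat) auto
    also have "\<dots> = stopped_sup R y \<omega>" unfolding stopped_sup_def
      by (rule SUP_cong) (use al in auto)
    finally show ?thesis .
  qed
qed

text \<open>Stopping makes the running supremum finite, and its root is a bound \<open>B\<close> as required in \<open>linear_growth\<close> at all
times up to \<open>t\<close> at which the process is alive.\<close>

lemma growth_alive:
  assumes \<omega>: "\<omega> \<in> space M" and cont: "continuous_on {0..T} (\<lambda>u. e u \<omega>)" and R0: "0 \<le> R"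
    and gr: "linear_growth T' c e f H P \<omega>"
    and t: "t \<le> T'"
  obtains B where "0 \<le> B" "ennreal (B ^ (2 * r)) = stopped_sup R t \<omega>"
    "\<And>u. u \<in> {0..t} \<Longrightarrow> alive R u \<omega> \<Longrightarrow> norm (f u \<omega>) \<le> c * B + P u \<omega>"
    "\<And>u. u \<in> {0..t} \<Longrightarrow> alive R u \<omega> \<Longrightarrow> norm (H u \<omega>) \<le> c * B + P u \<omega>"
proof -
  have p: "0 < 2 * r" using r by simp
  have "stopped_sup R t \<omega> \<le> ennreal (R ^ (2 * r))" using stopped_sup_bounded[OF \<omega>] t T' R0 by simp
  then have "stopped_sup R t \<omega> < \<top>" by (rule order.strict_trans1) simp
  then obtain a where a: "0 \<le> a" "stopped_sup R t \<omega> = ennreal a" by (cases "stopped_sup R t \<omega>") auto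
  define B where "B = root (2 * r) a"
  have B0: "0 \<le> B" using a p by (simp add: B_def real_root_ge_zero)
  have Bp: "B ^ (2 * r) = a" unfolding B_def using a p by (simp add: real_root_pow_pos2)
  have *: "norm (f u \<omega>) \<le> c * B + P u \<omega> \<and> norm (H u \<omega>) \<le> c * B + P u \<omega>" if u: "u \<in> {0..t}" "alive R u \<omega>" for u
  proof -
    have "norm (e y \<omega>) \<le> B" if y: "y \<in> {0..u}" for y
    proof -
      have "ennreal (norm (e y \<omega>) ^ (2 * r)) \<le> stopped_sup R y \<omega>"
        by (rule le_stopped_sup[OF cont u(2) _ y]) (use u t T' in auto)
      also have "\<dots> \<le> ennreal (B ^ (2 * r))" unfolding Bp a(2)[symmetric] by (rule stopped_sup_mono) (use y u in auto)
      finally have "norm (e y \<omega>) ^ (2 * r) \<le> B ^ (2 * r)" using B0 by (simp add: ennreal_le_iff)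
      then show ?thesis using B0 p by (simp add: power_mono_iff)
    qed
    then show ?thesis using gr u t unfolding linear_growth_def by auto
  qed
  show thesis by (rule that[OF B0]) (use * Bp a in auto)
qed

definition noise_sup :: "real \<Rightarrow> real \<Rightarrow> real \<Rightarrow> 'a \<Rightarrow> ennreal" where
  "noise_sup R s t \<omega> = (SUP q\<in>\<rat> \<inter> {s..t}. indicator {\<omega>. alive R q \<omega>} \<omega> * ennreal (norm (I q \<omega> - I s \<omega>) ^ (2 * r)))"

text \<open>On a step, \<open>e\<close> is the sum of its initial value, the drift and the noise.  The drift is bounded by the supremum at the
end of the step, but with the length of the step as a factor.\<close>

lemma step_pathwise:
  assumes R0: "0 \<le> R" and s: "0 \<le> s" "s < t" "t \<le> T'" "t - s \<le> 1"
  shows "AE \<omega> in M. stopped_sup R t \<omega> \<le> stopped_sup R s \<omega> + 3 ^ (2 * r) * (stopped_sup R s \<omega> +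
    (ennreal (2 ^ (2 * r) * c ^ (2 * r) * (t - s)) * stopped_sup R t \<omega> + 4 ^ (2 * r) * Q \<omega>) + noise_sup R s t \<omega>)"
  using AE_space e_continuous e_increment growth Q
proof eventually_elim
  fix \<omega> assume \<omega>: "\<omega> \<in> space M" and cont: "continuous_on {0..T} (\<lambda>u. e u \<omega>)"
    and inc: "ito_increments T e f I \<omega>"
    and gr: "linear_growth T' c e f H P \<omega>"
    and Q: "(\<integral>\<^sup>+u\<in>{0..T'}. ennreal (P u \<omega> ^ (2 * r)) \<partial>lborel) \<le> Q \<omega>"
  let ?p = "2 * r"
  let ?D = "ennreal (2 ^ ?p * c ^ ?p * (t - s)) * stopped_sup R t \<omega> + 4 ^ ?p * Q \<omega>"
  let ?rhs = "stopped_sup R s \<omega> + 3 ^ ?p * (stopped_sup R s \<omega> + ?D + noise_sup R s t \<omega>)"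
  show "stopped_sup R t \<omega> \<le> ?rhs"
  proof (cases "Q \<omega>")
    case top
    have "?D = \<top>" unfolding top by (simp add: ennreal_mult_eq_top_iff)
    then have "?rhs = \<top>" by (simp only: add_top_right_ennreal add_top_left_ennreal) (simp add: ennreal_mult_eq_top_iff)
    then show ?thesis by (simp only: top_greatest)
  next
    case (real q0)
    have drift: "ennreal (norm (LINT u:{s..q}|lborel. f u \<omega>) ^ ?p) \<le> ?D"
      if q: "q \<in> {s..t}" "alive R q \<omega>" for q
    proof -
      obtain B where B: "0 \<le> B" "ennreal (B ^ ?p) = stopped_sup R t \<omega>"
        "\<And>u. u \<in> {0..t} \<Longrightarrow> alive R u \<omega> \<Longrightarrow> norm (f u \<omega>) \<le> c * B + P u \<omega>"
        using growth_alive[OF \<omega> cont R0 gr s(3)] by metis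
      have qs: "0 \<le> q - s" "q - s \<le> t - s" using q by auto
      have rt: "0 \<le> root ?p q0" using real(1) by (rule real_root_ge_zero)
      have Pm: "(\<lambda>u. indicator {s..q} u * P u \<omega>) \<in> borel_measurable lborel"
      proof -
        note [measurable] = P_measurable[OF \<omega>]
        have "(\<lambda>u. indicator {s..q} u * (indicator {0..T'} u * P u \<omega>)) \<in> borel_measurable lborel" by measurable
        also have "(\<lambda>u. indicator {s..q} u * (indicator {0..T'} u * P u \<omega>)) = (\<lambda>u. indicator {s..q} u * P u \<omega>)"
          using s q by (auto simp: indicator_def fun_eq_iff)
        finally show ?thesis .
      qed
      have Pr: "(\<integral>\<^sup>+u\<in>{s..q}. ennreal (P u \<omega>) \<partial>lborel) \<le> ennreal (2 * root ?p q0)"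
      proof (rule nn_integral_le_root[OF Pm])
        show "emeasure lborel {s..q} \<le> 1" using qs s(4) by simp
        have "(\<integral>\<^sup>+u\<in>{s..q}. ennreal (P u \<omega> ^ ?p) \<partial>lborel) \<le> (\<integral>\<^sup>+u\<in>{0..T'}. ennreal (P u \<omega> ^ ?p) \<partial>lborel)"
          by (intro nn_integral_mono) (use s q in \<open>auto simp: indicator_def\<close>)
        then show "(\<integral>\<^sup>+u\<in>{s..q}. ennreal (P u \<omega> ^ ?p) \<partial>lborel) \<le> ennreal q0" using Q real(2) by simp
      qed (use P0 r real in auto)
      have "ennreal (norm (LINT u:{s..q}|lborel. f u \<omega>)) \<le> (\<integral>\<^sup>+u\<in>{s..q}. ennreal (norm (f u \<omega>)) \<partial>lborel)"
        by (rule norm_set_integral_le)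
      also have "\<dots> \<le> (\<integral>\<^sup>+u. ennreal (c * B) * indicator {s..q} u + ennreal (P u \<omega>) * indicator {s..q} u \<partial>lborel)"
      proof (rule nn_integral_mono)
        fix u
        show "ennreal (norm (f u \<omega>)) * indicator {s..q} u \<le> ennreal (c * B) * indicator {s..q} u + ennreal (P u \<omega>) * indicator {s..q} u"
        proof (cases "u \<in> {s..q}")
          case True
          then have "norm (f u \<omega>) \<le> c * B + P u \<omega>"
            using alive_below_antimono[OF _ q(2), of u] q s by (intro B(3)) auto
          then have "ennreal (norm (f u \<omega>)) \<le> ennreal (c * B + P u \<omega>)" by (rule ennreal_leI)
          then show ?thesis using True c0 B(1) P0[of u \<omega>] by (simp add: ennreal_plus)
        qed simp
      qed
      also have "\<dots> = ennreal (c * B) * emeasure lborel {s..q} + (\<integral>\<^sup>+u\<in>{s..q}. ennreal (P u \<omega>) \<partial>lborel)"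
      proof -
        have "(\<lambda>u. ennreal (indicator {s..q} u * P u \<omega>)) \<in> borel_measurable lborel" using Pm by measurable
        also have "(\<lambda>u. ennreal (indicator {s..q} u * P u \<omega>)) = (\<lambda>u. ennreal (P u \<omega>) * indicator {s..q} u)"
          by (auto simp: indicator_def fun_eq_iff)
        finally show ?thesis by (subst nn_integral_add) (simp_all add: nn_integral_cmult_indicator)
      qed
      also have "\<dots> \<le> ennreal (c * B) * ennreal (t - s) + ennreal (2 * root ?p q0)"
        using qs by (intro add_mono mult_left_mono Pr) (auto intro!: ennreal_leI)
      also have "\<dots> = ennreal (c * B * (t - s) + 2 * root ?p q0)"
      proof -
        have nn: "0 \<le> c * B" "0 \<le> t - s" "0 \<le> 2 * root ?p q0" using c0 B(1) s rt by auto
        show ?thesis using nn by (simp only: ennreal_plus ennreal_mult mult_nonneg_nonneg)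
      qed
      finally have "ennreal (norm (LINT u:{s..q}|lborel. f u \<omega>)) \<le> ennreal (c * B * (t - s) + 2 * root ?p q0)" .
      moreover have "0 \<le> c * B * (t - s) + 2 * root ?p q0" using c0 B(1) s rt by simp
      ultimately have le: "norm (LINT u:{s..q}|lborel. f u \<omega>) \<le> c * B * (t - s) + 2 * root ?p q0"
        by (simp only: ennreal_le_iff)
      have "norm (LINT u:{s..q}|lborel. f u \<omega>) ^ ?p \<le> (c * B * (t - s) + 2 * root ?p q0) ^ ?p"
        by (rule power_mono[OF le]) simp
      also have "\<dots> \<le> 2 ^ ?p * ((c * B * (t - s)) ^ ?p + (2 * root ?p q0) ^ ?p)"
        by (rule add_power_le) (use c0 B(1) s rt in auto)
      also have "\<dots> = 2 ^ ?p * (c ^ ?p * B ^ ?p * (t - s) ^ ?p + 2 ^ ?p * q0)"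
      proof -
        have "root ?p q0 ^ ?p = q0" using r real by (intro real_root_pow_pos2) auto
        then show ?thesis by (simp only: power_mult_distrib)
      qed
      also have "\<dots> \<le> 2 ^ ?p * (c ^ ?p * B ^ ?p * (t - s) + 2 ^ ?p * q0)"
      proof -
        have "(t - s) ^ ?p \<le> (t - s) ^ 1" using s r by (intro power_decreasing) auto
        then show ?thesis using c0 B(1) by (intro mult_left_mono add_mono) auto
      qed
      also have "\<dots> = 2 ^ ?p * c ^ ?p * (t - s) * B ^ ?p + 4 ^ ?p * q0"
      proof -
        have "(4::real) ^ ?p = 2 ^ ?p * 2 ^ ?p" unfolding power_mult_distrib[symmetric] by simp
        then show ?thesis by (simp only: distrib_left mult_ac)
      qed
      finally have "ennreal (norm (LINT u:{s..q}|lborel. f u \<omega>) ^ ?p) \<le> ennreal (2 ^ ?p * c ^ ?p * (t - s) * B ^ ?p + 4 ^ ?p * q0)"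
        by (rule ennreal_leI)
      also have "\<dots> = ennreal (2 ^ ?p * c ^ ?p * (t - s)) * ennreal (B ^ ?p) + ennreal (4 ^ ?p) * ennreal q0"
      proof -
        have nn: "0 \<le> 2 ^ ?p * c ^ ?p * (t - s)" "0 \<le> B ^ ?p" "(0::real) \<le> 4 ^ ?p" using c0 s B(1) by auto
        show ?thesis using nn real(1) by (simp only: ennreal_plus ennreal_mult mult_nonneg_nonneg)
      qed
      also have "\<dots> = ?D" unfolding B(2) real(2) by (simp flip: ennreal_power)
      finally show ?thesis .
    qed
    have "(SUP q\<in>\<rat> \<inter> {0..t}. indicator {\<omega>. alive R q \<omega>} \<omega> * ennreal (norm (e q \<omega>) ^ ?p)) \<le> ?rhs"
    proof (rule SUP_least)
      fix q assume q: "q \<in> \<rat> \<inter> {0..t}"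
      show "indicator {\<omega>. alive R q \<omega>} \<omega> * ennreal (norm (e q \<omega>) ^ ?p) \<le> ?rhs"
      proof (cases "alive R q \<omega>")
        case True
        show ?thesis
        proof (cases "q \<le> s")
          case True
          have "indicator {\<omega>. alive R q \<omega>} \<omega> * ennreal (norm (e q \<omega>) ^ ?p) \<le> stopped_sup R s \<omega>"
            unfolding stopped_sup_def by (rule SUP_upper) (use q True in simp)
          also have "\<dots> \<le> ?rhs" by simp
          finally show ?thesis .
        next
          case False
          then have qs: "q \<in> {s..t}" "s \<in> {0..q}" "q \<in> {0..T}" using q s T' by auto
          let ?a = "norm (e s \<omega>)" and ?b = "norm (LINT u:{s..q}|lborel. f u \<omega>)" and ?d = "norm (I q \<omega> - I s \<omega>)"
          have "e q \<omega> = e s \<omega> + (LINT u:{s..q}|lborel. f u \<omega>) + (I q \<omega> - I s \<omega>)"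
            using ito_incrementsD[OF inc, of s q] qs s by simp
          then have "norm (e q \<omega>) \<le> ?a + ?b + ?d" by (simp add: norm_triangle_le)
          then have "norm (e q \<omega>) ^ ?p \<le> (?a + ?b + ?d) ^ ?p" by (rule power_mono) simp
          also have "\<dots> \<le> 3 ^ ?p * (?a ^ ?p + ?b ^ ?p + ?d ^ ?p)" by (rule add3_power_le) auto
          finally have "ennreal (norm (e q \<omega>) ^ ?p) \<le> ennreal (3 ^ ?p * (?a ^ ?p + ?b ^ ?p + ?d ^ ?p))"
            by (rule ennreal_leI)
          also have "\<dots> = 3 ^ ?p * (ennreal (?a ^ ?p) + ennreal (?b ^ ?p) + ennreal (?d ^ ?p))"
          proof -
            have "ennreal (3 ^ ?p) = 3 ^ ?p" by (simp flip: ennreal_power)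
            then show ?thesis by (simp only: ennreal_plus ennreal_mult zero_le_power norm_ge_zero add_nonneg_nonneg zero_le_numeral)
          qed
          also have "\<dots> \<le> 3 ^ ?p * (stopped_sup R s \<omega> + ?D + noise_sup R s t \<omega>)"
          proof (intro mult_left_mono add_mono)
            show "ennreal (?a ^ ?p) \<le> stopped_sup R s \<omega>" by (rule le_stopped_sup[OF cont True qs(3) qs(2)])
            show "ennreal (?b ^ ?p) \<le> ?D" by (rule drift[OF qs(1) True])
            have "indicator {\<omega>. alive R q \<omega>} \<omega> * ennreal (?d ^ ?p) \<le> noise_sup R s t \<omega>"
              unfolding noise_sup_def by (rule SUP_upper) (use q qs in auto)
            then show "ennreal (?d ^ ?p) \<le> noise_sup R s t \<omega>" using True by simp
          qed simp
          also have "\<dots> \<le> ?rhs" by simp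
          finally show ?thesis using True by simp
        qed
      qed simp
    qed
    then show ?thesis unfolding stopped_sup_def .
  qed
qed

lemma noise_sup_measurable: assumes s: "0 \<le> s" "t \<le> T" shows "noise_sup R s t \<in> borel_measurable M"
  unfolding noise_sup_def[abs_def]
proof (rule borel_measurable_SUP)
  show "countable (\<rat> \<inter> {s..t})" by (simp add: countable_rat)
  fix q assume "q \<in> \<rat> \<inter> {s..t}"
  then have q: "q \<in> {0..T}" and sT: "s \<in> {0..T}" using s by auto
  have [measurable]: "Measurable.pred M (alive R q)" using q by (intro alive_measurable_M) simp
  note [measurable] = I_measurable[OF q] I_measurable[OF sT]
  show "(\<lambda>\<omega>. indicator {\<omega>. alive R q \<omega>} \<omega> * ennreal (norm (I q \<omega> - I s \<omega>) ^ (2 * r))) \<in> borel_measurable M"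
    by measurable
qed

text \<open>The maximal inequality, where the growth of \<open>H\<close> again leads to the supremum at the end of the step times
the length of the step.\<close>

lemma noise_sup_moment:
  assumes R0: "0 \<le> R" and s: "0 \<le> s" "s < t" "t \<le> T'" "t - s \<le> 1"
  shows "(\<integral>\<^sup>+\<omega>. noise_sup R s t \<omega> \<partial>M) \<le> ennreal (vec_const (CARD('n) * CARD('m)) r) *
    (2 ^ (2 * r) * (ennreal (c ^ (2 * r) * (t - s)) * (\<integral>\<^sup>+\<omega>. stopped_sup R t \<omega> \<partial>M) + (\<integral>\<^sup>+\<omega>. Q \<omega> \<partial>M)))"
proof -
  let ?p = "2 * r" and ?V = "vec_const (CARD('n) * CARD('m)) r"
  let ?J = "\<lambda>\<omega>. 2 ^ ?p * (ennreal (c ^ ?p * (t - s)) * stopped_sup R t \<omega> + Q \<omega>)"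
  have tT: "t \<le> T" using s T' by simp
  have Am: "stopped_sup R t \<in> borel_measurable M" by (rule stopped_sup_measurable[OF tT])
  have AQm: "(\<lambda>\<omega>. ennreal (c ^ ?p * (t - s)) * stopped_sup R t \<omega> + Q \<omega>) \<in> borel_measurable M"
    using Am Q_measurable by measurable
  have J: "AE \<omega> in M. (\<integral>\<^sup>+u\<in>{s..t}. indicator {u. alive R u \<omega>} u * ennreal (norm (H u \<omega>) ^ ?p) \<partial>lborel) \<le> ?J \<omega>"
    using AE_space e_continuous growth Q
  proof eventually_elim
    fix \<omega> assume \<omega>: "\<omega> \<in> space M" and cont: "continuous_on {0..T} (\<lambda>u. e u \<omega>)"
      and gr: "linear_growth T' c e f H P \<omega>"
      and Q: "(\<integral>\<^sup>+u\<in>{0..T'}. ennreal (P u \<omega> ^ ?p) \<partial>lborel) \<le> Q \<omega>"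
    obtain B where B: "0 \<le> B" "ennreal (B ^ ?p) = stopped_sup R t \<omega>"
      "\<And>u. u \<in> {0..t} \<Longrightarrow> alive R u \<omega> \<Longrightarrow> norm (H u \<omega>) \<le> c * B + P u \<omega>"
      using growth_alive[OF \<omega> cont R0 gr s(3)] by metis
    have Pm: "(\<lambda>u. ennreal (P u \<omega> ^ ?p) * indicator {s..t} u) \<in> borel_measurable lborel"
    proof -
      note [measurable] = P_measurable[OF \<omega>]
      have "(\<lambda>u. ennreal ((indicator {0..T'} u * P u \<omega>) ^ ?p) * indicator {s..t} u) \<in> borel_measurable lborel" by measurable
      also have "(\<lambda>u. ennreal ((indicator {0..T'} u * P u \<omega>) ^ ?p) * indicator {s..t} u) = (\<lambda>u. ennreal (P u \<omega> ^ ?p) * indicator {s..t} u)"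
        using s by (auto simp: indicator_def fun_eq_iff)
      finally show ?thesis .
    qed
    have "(\<integral>\<^sup>+u\<in>{s..t}. indicator {u. alive R u \<omega>} u * ennreal (norm (H u \<omega>) ^ ?p) \<partial>lborel)
      \<le> (\<integral>\<^sup>+u. 2 ^ ?p * (ennreal (c ^ ?p * B ^ ?p) * indicator {s..t} u + ennreal (P u \<omega> ^ ?p) * indicator {s..t} u) \<partial>lborel)"
    proof (rule nn_integral_mono)
      fix u
      show "indicator {u. alive R u \<omega>} u * ennreal (norm (H u \<omega>) ^ ?p) * indicator {s..t} u
        \<le> 2 ^ ?p * (ennreal (c ^ ?p * B ^ ?p) * indicator {s..t} u + ennreal (P u \<omega> ^ ?p) * indicator {s..t} u)"
      proof (cases "u \<in> {s..t} \<and> alive R u \<omega>")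
        case True
        have "norm (H u \<omega>) \<le> c * B + P u \<omega>" by (rule B(3)) (use True s in auto)
        then have "norm (H u \<omega>) ^ ?p \<le> (c * B + P u \<omega>) ^ ?p" by (rule power_mono) simp
        also have "\<dots> \<le> 2 ^ ?p * ((c * B) ^ ?p + P u \<omega> ^ ?p)" by (rule add_power_le) (use c0 B(1) P0 in auto)
        finally have "norm (H u \<omega>) ^ ?p \<le> 2 ^ ?p * (c ^ ?p * B ^ ?p + P u \<omega> ^ ?p)" unfolding power_mult_distrib .
        then have "ennreal (norm (H u \<omega>) ^ ?p) \<le> ennreal (2 ^ ?p * (c ^ ?p * B ^ ?p + P u \<omega> ^ ?p))" by (rule ennreal_leI)
        also have "\<dots> = 2 ^ ?p * (ennreal (c ^ ?p * B ^ ?p) + ennreal (P u \<omega> ^ ?p))"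
        proof -
          have "ennreal (2 ^ ?p) = 2 ^ ?p" by (simp flip: ennreal_power)
          moreover have "0 \<le> c ^ ?p * B ^ ?p" "0 \<le> P u \<omega> ^ ?p" using c0 B(1) P0 by auto
          ultimately show ?thesis by (simp only: ennreal_plus ennreal_mult zero_le_power zero_le_numeral add_nonneg_nonneg)
        qed
        finally show ?thesis using True by simp
      qed (auto simp: indicator_def)
    qed
    also have "\<dots> = 2 ^ ?p * (ennreal (c ^ ?p * B ^ ?p) * emeasure lborel {s..t} + (\<integral>\<^sup>+u\<in>{s..t}. ennreal (P u \<omega> ^ ?p) \<partial>lborel))"
      using Pm by (subst nn_integral_cmult) (simp_all add: nn_integral_add nn_integral_cmult_indicator)
    also have "\<dots> \<le> 2 ^ ?p * (ennreal (c ^ ?p * (t - s)) * stopped_sup R t \<omega> + Q \<omega>)"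
    proof (intro mult_left_mono add_mono)
      have "ennreal (c ^ ?p * B ^ ?p) * emeasure lborel {s..t} = ennreal (c ^ ?p * (t - s)) * ennreal (B ^ ?p)"
      proof -
        have nn: "0 \<le> c ^ ?p" "0 \<le> B ^ ?p" "0 \<le> t - s" using c0 B(1) s by auto
        have "emeasure lborel {s..t} = ennreal (t - s)" using s by simp
        then show ?thesis using nn by (simp only: ennreal_mult mult_nonneg_nonneg mult_ac)
      qed
      then show "ennreal (c ^ ?p * B ^ ?p) * emeasure lborel {s..t} \<le> ennreal (c ^ ?p * (t - s)) * stopped_sup R t \<omega>"
        by (simp only: B(2) order_refl)
      have "(\<integral>\<^sup>+u\<in>{s..t}. ennreal (P u \<omega> ^ ?p) \<partial>lborel) \<le> (\<integral>\<^sup>+u\<in>{0..T'}. ennreal (P u \<omega> ^ ?p) \<partial>lborel)"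
        by (intro nn_integral_mono) (use s in \<open>auto simp: indicator_def\<close>)
      then show "(\<integral>\<^sup>+u\<in>{s..t}. ennreal (P u \<omega> ^ ?p) \<partial>lborel) \<le> Q \<omega>" using Q by (rule order_trans)
    qed simp
    finally show "(\<integral>\<^sup>+u\<in>{s..t}. indicator {u. alive R u \<omega>} u * ennreal (norm (H u \<omega>) ^ ?p) \<partial>lborel) \<le> ?J \<omega>" .
  qed
  have "(\<integral>\<^sup>+\<omega>. noise_sup R s t \<omega> \<partial>M) \<le> ennreal (?V * (t - s) ^ (r - 1)) * (\<integral>\<^sup>+\<omega>. ?J \<omega> \<partial>M)"
    unfolding noise_sup_def
  proof (rule stopped_maximal[OF s(1,2) tT r _ J])
    show "?J \<in> borel_measurable M" using AQm by measurable
  qed (auto simp: countable_rat)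
  also have "\<dots> \<le> ennreal ?V * (\<integral>\<^sup>+\<omega>. ?J \<omega> \<partial>M)"
  proof (intro mult_right_mono ennreal_leI)
    have "(t - s) ^ (r - 1) \<le> 1" using s by (intro power_le_one) auto
    then show "?V * (t - s) ^ (r - 1) \<le> ?V" using vec_const_nonneg mult_left_le by blast
  qed simp
  also have "(\<integral>\<^sup>+\<omega>. ?J \<omega> \<partial>M) = 2 ^ ?p * (ennreal (c ^ ?p * (t - s)) * (\<integral>\<^sup>+\<omega>. stopped_sup R t \<omega> \<partial>M) + (\<integral>\<^sup>+\<omega>. Q \<omega> \<partial>M))"
    using Am Q_measurable AQm by (simp add: nn_integral_cmult nn_integral_add)
  finally show ?thesis .
qed

text \<open>On a short step the terms with the supremum at the end point are at most half of the left side and can be absorbed there,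
because the stopped supremum has finite expectation.\<close>

lemma step_moment:
  assumes R0: "0 \<le> R" and s: "0 \<le> s" "s < t" "t \<le> T'" and small: "gronwall_factor (CARD('n) * CARD('m)) r c * (t - s) \<le> 1 / 2"
  shows "(\<integral>\<^sup>+\<omega>. stopped_sup R t \<omega> \<partial>M) \<le> ennreal (4 * gronwall_factor (CARD('n) * CARD('m)) r c) *
    ((\<integral>\<^sup>+\<omega>. stopped_sup R s \<omega> \<partial>M) + (\<integral>\<^sup>+\<omega>. Q \<omega> \<partial>M))"
proof -
  let ?p = "2 * r"
  define V where "V = vec_const (CARD('n) * CARD('m)) r"
  define k where "k = gronwall_factor (CARD('n) * CARD('m)) r c"
  have V0: "0 \<le> V" by (simp add: V_def vec_const_nonneg)
  have k: "k = 12 ^ ?p * (1 + V) * (1 + c ^ ?p)" by (simp add: k_def V_def gronwall_factor_def)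
  have k1: "1 \<le> k" unfolding k_def by (rule gronwall_factor_ge_1[OF c0])
  have "1 * (t - s) \<le> k * (t - s)" using k1 s by (intro mult_right_mono) auto
  then have h1: "t - s \<le> 1" using small unfolding k_def[symmetric] by simp
  have tT: "t \<le> T" "s \<le> T" using s T' by auto
  note [measurable] = stopped_sup_measurable[OF tT(1)] stopped_sup_measurable[OF tT(2)] noise_sup_measurable[OF s(1) tT(1)] Q_measurable
  show ?thesis
  proof (cases "\<integral>\<^sup>+\<omega>. Q \<omega> \<partial>M")
    case top
    have "0 < 4 * k" using k1 by simp
    then show ?thesis unfolding top k_def[symmetric] by (simp add: ennreal_mult_eq_top_iff ennreal_eq_0_iff)
  next
    case (real q)
    have fin: "\<exists>x\<ge>0. (\<integral>\<^sup>+\<omega>. stopped_sup R u \<omega> \<partial>M) = ennreal x" if "u \<le> T" for u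
    proof -
      have "(\<integral>\<^sup>+\<omega>. stopped_sup R u \<omega> \<partial>M) \<le> (\<integral>\<^sup>+\<omega>. ennreal (R ^ ?p) \<partial>M)"
        by (intro nn_integral_mono stopped_sup_bounded that R0)
      also have "\<dots> < \<top>" by (simp add: emeasure_space_1)
      finally show ?thesis by (cases "\<integral>\<^sup>+\<omega>. stopped_sup R u \<omega> \<partial>M") auto
    qed
    obtain x where x: "0 \<le> x" "(\<integral>\<^sup>+\<omega>. stopped_sup R t \<omega> \<partial>M) = ennreal x" using fin[OF tT(1)] by blast
    obtain y where y: "0 \<le> y" "(\<integral>\<^sup>+\<omega>. stopped_sup R s \<omega> \<partial>M) = ennreal y" using fin[OF tT(2)] by blast
    have e2: "ennreal (2 ^ ?p) = 2 ^ ?p" and e3: "ennreal (3 ^ ?p) = 3 ^ ?p" and e4: "ennreal (4 ^ ?p) = 4 ^ ?p"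
      by (simp_all flip: ennreal_power)
    let ?h = "t - s"
    have h0: "0 \<le> ?h" using s by simp
    have cp: "0 \<le> c ^ ?p" using c0 by simp
    have "(\<integral>\<^sup>+\<omega>. stopped_sup R t \<omega> \<partial>M) \<le> (\<integral>\<^sup>+\<omega>. stopped_sup R s \<omega> + 3 ^ ?p * (stopped_sup R s \<omega> +
      (ennreal (2 ^ ?p * c ^ ?p * ?h) * stopped_sup R t \<omega> + 4 ^ ?p * Q \<omega>) + noise_sup R s t \<omega>) \<partial>M)"
      by (rule nn_integral_mono_AE[OF step_pathwise[OF R0 s h1]])
    also have "\<dots> = (\<integral>\<^sup>+\<omega>. stopped_sup R s \<omega> \<partial>M) + 3 ^ ?p * ((\<integral>\<^sup>+\<omega>. stopped_sup R s \<omega> \<partial>M) +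
      (ennreal (2 ^ ?p * c ^ ?p * ?h) * (\<integral>\<^sup>+\<omega>. stopped_sup R t \<omega> \<partial>M) + 4 ^ ?p * (\<integral>\<^sup>+\<omega>. Q \<omega> \<partial>M)) + (\<integral>\<^sup>+\<omega>. noise_sup R s t \<omega> \<partial>M))"
      by (simp add: nn_integral_add nn_integral_cmult)
    also have "\<dots> \<le> ennreal y + ennreal (3 ^ ?p) * (ennreal y +
      (ennreal (2 ^ ?p * c ^ ?p * ?h) * ennreal x + ennreal (4 ^ ?p) * ennreal q) +
        ennreal V * (ennreal (2 ^ ?p) * (ennreal (c ^ ?p * ?h) * ennreal x + ennreal q)))"
      using noise_sup_moment[OF R0 s h1] unfolding x y real e2 e3 e4 V_def
      by (intro add_mono mult_left_mono order_refl) simp_all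
    also have "\<dots> = ennreal (y + 3 ^ ?p * (y + (2 ^ ?p * c ^ ?p * ?h * x + 4 ^ ?p * q) + V * (2 ^ ?p * (c ^ ?p * ?h * x + q))))"
      using x(1) y(1) real(1) V0 h0 cp
      by (simp only: ennreal_plus ennreal_mult add_nonneg_nonneg mult_nonneg_nonneg zero_le_power zero_le_numeral)
    finally have "ennreal x \<le> \<dots>" unfolding x .
    then have le: "x \<le> y + 3 ^ ?p * (y + (2 ^ ?p * c ^ ?p * ?h * x + 4 ^ ?p * q) + V * (2 ^ ?p * (c ^ ?p * ?h * x + q)))"
      using x(1) y(1) real(1) V0 h0 cp by (subst (asm) ennreal_le_iff) auto
    have x_le: "x \<le> 4 * k * (y + q)"
    proof -
      define a :: real where "a = 3 ^ ?p"
      define b :: real where "b = 2 ^ ?p"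
      define g where "g = c ^ ?p"
      have ab: "1 \<le> a" "1 \<le> b" "0 \<le> g" by (simp_all add: a_def b_def g_def c0)
      have four: "(4::real) ^ ?p = b * b" and twelve: "(12::real) ^ ?p = a * (b * b)"
        unfolding a_def b_def power_mult_distrib[symmetric] by simp_all
      have kk: "k = a * (b * b) * (1 + V) * (1 + g)" unfolding k twelve g_def ..
      have ab1: "a * b \<le> a * (b * b)" using ab by simp
      have 1: "(1 + a) * y \<le> 2 * k * y"
      proof (rule mult_right_mono[OF _ y(1)])
        have "a * 1 \<le> a * (b * b)" using ab by (intro mult_left_mono) (auto intro: order_trans[OF _ mult_mono[of 1 b 1 b]])
        also have "a * (b * b) = a * (b * b) * 1 * 1" by simp
        also have "\<dots> \<le> k" unfolding kk using ab V0 by (intro mult_mono) auto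
        finally have "a \<le> k" by simp
        then show "1 + a \<le> 2 * k" using k1 by simp
      qed
      have 2: "a * b * g * (1 + V) * ?h * x \<le> x / 2"
      proof -
        have "a * b * (1 + V) * g \<le> a * (b * b) * (1 + V) * (1 + g)"
          using ab ab1 V0 by (intro mult_mono) auto
        then have "a * b * g * (1 + V) \<le> k" unfolding kk by (simp only: mult_ac)
        then have "a * b * g * (1 + V) * (?h * x) \<le> k * (?h * x)" using h0 x(1) by (intro mult_right_mono) auto
        also have "\<dots> = k * ?h * x" by simp
        also have "\<dots> \<le> 1 / 2 * x" using small x(1) unfolding k_def[symmetric] by (intro mult_right_mono)
        finally show ?thesis by (simp add: mult.assoc)
      qed
      have 3: "a * (b * b + V * b) * q \<le> k * q"
      proof (rule mult_right_mono[OF _ real(1)])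
        have "b * b + V * b \<le> b * b + V * (b * b)" using ab V0 by (intro add_left_mono mult_left_mono) auto
        then have "a * (b * b + V * b) \<le> a * (b * b + V * (b * b))" using ab by (intro mult_left_mono) auto
        also have "\<dots> = a * (b * b) * (1 + V) * 1" by (simp add: algebra_simps)
        also have "\<dots> \<le> k" unfolding kk using ab V0 by (intro mult_left_mono) auto
        finally show "a * (b * b + V * b) \<le> k" .
      qed
      have "y + a * (y + (b * g * ?h * x + b * b * q) + V * (b * (g * ?h * x + q)))
         = (1 + a) * y + a * b * g * (1 + V) * ?h * x + a * (b * b + V * b) * q"
        by (simp add: algebra_simps)
      then have "x \<le> (1 + a) * y + a * b * g * (1 + V) * ?h * x + a * (b * b + V * b) * q"
        using le unfolding four a_def[symmetric] b_def[symmetric] g_def[symmetric] by simp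
      then have "x \<le> 2 * k * y + x / 2 + k * q" using 1 2 3 by linarith
      then have "x \<le> 4 * k * y + 2 * k * q" by simp
      moreover have "0 \<le> k * q" using k1 real(1) by simp
      ultimately show ?thesis by (simp add: algebra_simps)
    qed
    show ?thesis unfolding x y real k_def[symmetric]
      using x_le y(1) real(1) k1 by (simp add: ennreal_mult[symmetric] ennreal_plus[symmetric] ennreal_leI del: ennreal_plus)
  qed
qed

lemma stopped_bound:
  assumes R0: "0 \<le> R"
  shows "(\<integral>\<^sup>+\<omega>. stopped_sup R T' \<omega> \<partial>M) \<le> ennreal (gronwall_const (CARD('n) * CARD('m)) r c T) *
    ((\<integral>\<^sup>+\<omega>. ennreal (norm (e 0 \<omega>) ^ (2 * r)) \<partial>M) + (\<integral>\<^sup>+\<omega>. Q \<omega> \<partial>M))"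
proof -
  define k where "k = gronwall_factor (CARD('n) * CARD('m)) r c"
  \<comment> \<open>Steps of length \<open>T' / n\<close>, short enough for \<open>step_moment\<close>.\<close>
  define n where "n = nat \<lceil>2 * k * T\<rceil>"
  have k1: "1 \<le> k" unfolding k_def by (rule gronwall_factor_ge_1[OF c0])
  have kT: "0 < 2 * k * T" using k1 T_pos by simp
  have n: "2 * k * T \<le> real n" unfolding n_def by (rule real_nat_ceiling_ge)
  have n0: "0 < real n" using n kT by linarith
  let ?q = "\<integral>\<^sup>+\<omega>. Q \<omega> \<partial>M"
  let ?t = "\<lambda>j. real j * (T' / real n)"
  have "(\<integral>\<^sup>+\<omega>. stopped_sup R (?t j) \<omega> \<partial>M) + ?q \<le> ennreal ((5 * k) ^ j) * ((\<integral>\<^sup>+\<omega>. stopped_sup R 0 \<omega> \<partial>M) + ?q)" if "j \<le> n" for j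
    using that
  proof (induction j)
    case 0
    then show ?case by simp
  next
    case (Suc j)
    have step: "?t (Suc j) - ?t j = T' / real n" by (simp add: algebra_simps add_divide_distrib)
    have hp: "0 < T' / real n" using T' n0 by simp
    have "?t (Suc j) \<le> real n * (T' / real n)" using Suc.prems hp by (intro mult_right_mono) auto
    then have tS: "?t (Suc j) \<le> T'" using n0 by simp
    have "k * (T' / real n) \<le> k * (T / real n)" using T' k1 n0 by (intro mult_left_mono divide_right_mono) auto
    also have "\<dots> \<le> 1 / 2" using n n0 by (simp add: field_simps)
    finally have small: "k * (?t (Suc j) - ?t j) \<le> 1 / 2" unfolding step .
    have "(\<integral>\<^sup>+\<omega>. stopped_sup R (?t (Suc j)) \<omega> \<partial>M) \<le> ennreal (4 * k) * ((\<integral>\<^sup>+\<omega>. stopped_sup R (?t j) \<omega> \<partial>M) + ?q)"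
      unfolding k_def
    proof (rule step_moment[OF R0 _ _ tS])
      show "0 \<le> ?t j" using T' n0 by simp
      show "?t j < ?t (Suc j)" using hp step by linarith
    qed (use small in \<open>simp only: k_def\<close>)
    then have "(\<integral>\<^sup>+\<omega>. stopped_sup R (?t (Suc j)) \<omega> \<partial>M) + ?q \<le> ennreal (4 * k) * ((\<integral>\<^sup>+\<omega>. stopped_sup R (?t j) \<omega> \<partial>M) + ?q) + ?q"
      by (rule add_right_mono)
    also have "\<dots> \<le> ennreal (4 * k) * ((\<integral>\<^sup>+\<omega>. stopped_sup R (?t j) \<omega> \<partial>M) + ?q) + ennreal k * ((\<integral>\<^sup>+\<omega>. stopped_sup R (?t j) \<omega> \<partial>M) + ?q)"
    proof (rule add_left_mono)
      have "1 * ?q \<le> ennreal k * ((\<integral>\<^sup>+\<omega>. stopped_sup R (?t j) \<omega> \<partial>M) + ?q)"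
        using k1 by (intro mult_mono) (auto simp: ennreal_1[symmetric] simp del: ennreal_1 intro: ennreal_leI)
      then show "?q \<le> ennreal k * ((\<integral>\<^sup>+\<omega>. stopped_sup R (?t j) \<omega> \<partial>M) + ?q)" by simp
    qed
    also have "\<dots> = ennreal (5 * k) * ((\<integral>\<^sup>+\<omega>. stopped_sup R (?t j) \<omega> \<partial>M) + ?q)"
    proof -
      have "ennreal (5 * k) = ennreal (4 * k) + ennreal k" using k1 by (simp add: ennreal_plus[symmetric] del: ennreal_plus)
      then show ?thesis by (simp only: distrib_right)
    qed
    also have "\<dots> \<le> ennreal (5 * k) * (ennreal ((5 * k) ^ j) * ((\<integral>\<^sup>+\<omega>. stopped_sup R 0 \<omega> \<partial>M) + ?q))"
      using Suc by (intro mult_left_mono) auto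
    also have "\<dots> = ennreal ((5 * k) ^ Suc j) * ((\<integral>\<^sup>+\<omega>. stopped_sup R 0 \<omega> \<partial>M) + ?q)"
      using k1 by (simp add: ennreal_mult mult.assoc)
    finally show ?case .
  qed
  from this[of n] have "(\<integral>\<^sup>+\<omega>. stopped_sup R T' \<omega> \<partial>M) + ?q \<le> ennreal ((5 * k) ^ n) * ((\<integral>\<^sup>+\<omega>. stopped_sup R 0 \<omega> \<partial>M) + ?q)"
    using n0 by simp
  also have "\<dots> \<le> ennreal ((5 * k) ^ n) * ((\<integral>\<^sup>+\<omega>. ennreal (norm (e 0 \<omega>) ^ (2 * r)) \<partial>M) + ?q)"
  proof (intro mult_left_mono add_right_mono nn_integral_mono)
    fix \<omega>
    have "\<rat> \<inter> {0..0::real} = {0}" by auto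
    then show "stopped_sup R 0 \<omega> \<le> ennreal (norm (e 0 \<omega>) ^ (2 * r))" by (simp add: stopped_sup_def indicator_def)
  qed simp
  finally show ?thesis
    unfolding gronwall_const_def k_def[symmetric] n_def[symmetric] by (rule order_trans[rotated]) simp
qed

text \<open>The bound for the stopped supremum does not depend on the level \<open>R\<close>, which tends to infinity.\<close>

theorem moment_bound:
  "(\<integral>\<^sup>+\<omega>. (SUP u\<in>{0..T'}. ennreal (norm (e u \<omega>) ^ (2 * r))) \<partial>M)
    \<le> ennreal (gronwall_const (CARD('n) * CARD('m)) r c T) *
    ((\<integral>\<^sup>+\<omega>. ennreal (norm (e 0 \<omega>) ^ (2 * r)) \<partial>M) + (\<integral>\<^sup>+\<omega>. Q \<omega> \<partial>M))" (is "_ \<le> ?rhs")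
proof -
  have "AE \<omega> in M. (SUP u\<in>{0..T'}. ennreal (norm (e u \<omega>) ^ (2 * r))) \<le> (SUP k. stopped_sup (real k) T' \<omega>)"
    using N_continuous e_continuous
  proof eventually_elim
    fix \<omega> assume "continuous_on {0..T} (\<lambda>u. N u \<omega>)" and cont: "continuous_on {0..T} (\<lambda>u. e u \<omega>)"
    from eventually_alive[of T N \<omega>, OF this(1)] obtain n where "\<forall>k\<ge>n. \<forall>u. alive (real k) u \<omega>" ..
    then have al: "alive (real n) u \<omega>" for u by blast
    show "(SUP u\<in>{0..T'}. ennreal (norm (e u \<omega>) ^ (2 * r))) \<le> (SUP k. stopped_sup (real k) T' \<omega>)"
    proof (rule SUP_least)
      fix u assume u: "u \<in> {0..T'}"
      have "ennreal (norm (e u \<omega>) ^ (2 * r)) \<le> stopped_sup (real n) u \<omega>"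
        by (rule le_stopped_sup[OF cont al[of T]]) (use u T' T_pos in auto)
      also have "\<dots> \<le> stopped_sup (real n) T' \<omega>" by (rule stopped_sup_mono) (use u in simp)
      also have "\<dots> \<le> (SUP k. stopped_sup (real k) T' \<omega>)" by (rule SUP_upper) simp
      finally show "ennreal (norm (e u \<omega>) ^ (2 * r)) \<le> (SUP k. stopped_sup (real k) T' \<omega>)" .
    qed
  qed
  then have "(\<integral>\<^sup>+\<omega>. (SUP u\<in>{0..T'}. ennreal (norm (e u \<omega>) ^ (2 * r))) \<partial>M) \<le> (\<integral>\<^sup>+\<omega>. (SUP k. stopped_sup (real k) T' \<omega>) \<partial>M)"
    by (rule nn_integral_mono_AE)
  also have "\<dots> = (SUP k. \<integral>\<^sup>+\<omega>. stopped_sup (real k) T' \<omega> \<partial>M)"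
  proof (rule nn_integral_monotone_convergence_SUP[OF _ stopped_sup_measurable[OF T'(2)]])
    show "incseq (\<lambda>k. stopped_sup (real k) T')"
    proof (intro monoI le_funI)
      fix k k' :: nat and \<omega> assume kk: "k \<le> k'"
      show "stopped_sup (real k) T' \<omega> \<le> stopped_sup (real k') T' \<omega>" unfolding stopped_sup_def
      proof (rule SUP_mono)
        fix q assume q: "q \<in> \<rat> \<inter> {0..T'}"
        have "alive (real k) q \<omega> \<Longrightarrow> alive (real k') q \<omega>" using alive_below_mono[of "real k" "real k'"] kk by simp
        then have "indicator {\<omega>. alive (real k) q \<omega>} \<omega> * ennreal (norm (e q \<omega>) ^ (2 * r))
            \<le> indicator {\<omega>. alive (real k') q \<omega>} \<omega> * ennreal (norm (e q \<omega>) ^ (2 * r))"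
          by (auto simp: indicator_def)
        then show "\<exists>q'\<in>\<rat> \<inter> {0..T'}. indicator {\<omega>. alive (real k) q \<omega>} \<omega> * ennreal (norm (e q \<omega>) ^ (2 * r))
            \<le> indicator {\<omega>. alive (real k') q' \<omega>} \<omega> * ennreal (norm (e q' \<omega>) ^ (2 * r))"
          using q by blast
      qed
    qed
  qed
  also have "\<dots> \<le> ?rhs" by (intro SUP_least stopped_bound) simp
  finally show ?thesis .
qed

end

section \<open>Running suprema\<close>

text \<open>Rational times make this measurable.  On a continuous path it is the maximum of the norm (\<open>rsup_attained\<close>), so the
value \<open>0\<close> that \<open>enn2real\<close> assigns to \<open>\<infinity>\<close> occurs on a null set only.\<close>

definition rsup :: "real \<Rightarrow> (real \<Rightarrow> 'a \<Rightarrow> 'b::real_normed_vector) \<Rightarrow> 'a \<Rightarrow> real" where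
  "rsup a Z \<omega> = enn2real (SUP q\<in>\<rat> \<inter> {0..a}. ennreal (norm (Z q \<omega>)))"

lemma rsup_nonneg: "0 \<le> rsup a Z \<omega>"
  by (simp add: rsup_def)

lemma rsup_measurable:
  assumes "\<And>u. u \<in> {0..a} \<Longrightarrow> Z u \<in> borel_measurable M"
  shows "rsup a Z \<in> borel_measurable M"
proof -
  have "(\<lambda>\<omega>. ennreal (norm (Z q \<omega>))) \<in> borel_measurable M" if "q \<in> \<rat> \<inter> {0..a}" for q
  proof -
    have "q \<in> {0..a}" using that by simp
    note [measurable] = assms[OF this]
    show ?thesis by measurable
  qed
  then have "(\<lambda>\<omega>. SUP q\<in>\<rat> \<inter> {0..a}. ennreal (norm (Z q \<omega>))) \<in> borel_measurable M"
    by (intro borel_measurable_SUP) (auto simp: countable_rat)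
  then show ?thesis unfolding rsup_def[abs_def] by measurable
qed

lemma rsup_attained:
  assumes a: "0 \<le> a" and cont: "continuous_on {0..a} (\<lambda>u. Z u \<omega>)"
  shows "\<exists>u\<in>{0..a}. rsup a Z \<omega> = norm (Z u \<omega>)" "\<And>u. u \<in> {0..a} \<Longrightarrow> norm (Z u \<omega>) \<le> rsup a Z \<omega>"
proof -
  have cn: "continuous_on {0..a} (\<lambda>u. norm (Z u \<omega>))" using cont by (intro continuous_intros)
  obtain x where x: "x \<in> {0..a}" "\<And>u. u \<in> {0..a} \<Longrightarrow> norm (Z u \<omega>) \<le> norm (Z x \<omega>)"
    using continuous_attains_sup[OF compact_Icc _ cn] a by auto
  let ?S = "SUP q\<in>\<rat> \<inter> {0..a}. ennreal (norm (Z q \<omega>))"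
  have S: "?S = ennreal (norm (Z x \<omega>))"
  proof (rule antisym)
    show "?S \<le> ennreal (norm (Z x \<omega>))" by (intro SUP_least ennreal_leI x(2)) simp
    show "ennreal (norm (Z x \<omega>)) \<le> ?S"
    proof (cases "a = 0")
      case True
      then have "x = 0" using x by simp
      moreover have "(0::real) \<in> \<rat> \<inter> {0..a}" using a by simp
      ultimately show ?thesis by (metis (no_types, lifting) SUP_upper)
    next
      case False
      then have "0 < a" using a by simp
      then show ?thesis using cn x(1) by (rule le_SUP_rat)
    qed
  qed
  have r: "rsup a Z \<omega> = norm (Z x \<omega>)" by (simp add: rsup_def S)
  then show "\<exists>u\<in>{0..a}. rsup a Z \<omega> = norm (Z u \<omega>)" using x(1) by blast
  show "norm (Z u \<omega>) \<le> rsup a Z \<omega>" if "u \<in> {0..a}" for u using x(2)[OF that] r by simp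
qed

lemma rsup_power_le:
  assumes "0 \<le> a" "continuous_on {0..a} (\<lambda>u. Z u \<omega>)"
  shows "ennreal (rsup a Z \<omega> ^ p) \<le> (SUP u\<in>{0..a}. ennreal (norm (Z u \<omega>) ^ p))"
proof -
  obtain u where u: "u \<in> {0..a}" "rsup a Z \<omega> = norm (Z u \<omega>)" using rsup_attained(1)[of a Z \<omega>, OF assms] by blast
  have "ennreal (norm (Z u \<omega>) ^ p) \<le> (SUP u\<in>{0..a}. ennreal (norm (Z u \<omega>) ^ p))" using u(1) by (rule SUP_upper)
  then show ?thesis unfolding u(2) .
qed

lemma nn_integral_poly_le:
  fixes m :: "'a \<Rightarrow> real"
  assumes M: "prob_space M" and m: "m \<in> borel_measurable M" "\<And>\<omega>. 0 \<le> m \<omega>" and B: "0 \<le> B" and C: "0 \<le> C"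
    and le: "(\<integral>\<^sup>+\<omega>. ennreal (m \<omega> ^ (p * D)) \<partial>M) \<le> ennreal C"
  shows "(\<integral>\<^sup>+\<omega>. ennreal ((1 + (B + m \<omega>) ^ D) ^ p) \<partial>M) \<le> ennreal (2 ^ p * (1 + 2 ^ (p * D) * (B ^ (p * D) + C)))"
proof -
  interpret prob_space M by (rule M)
  let ?e = "p * D"
  have pw: "ennreal ((1 + (B + m \<omega>) ^ D) ^ p) \<le> ennreal (2 ^ p) * (ennreal 1 + ennreal (2 ^ ?e) * (ennreal (B ^ ?e) + ennreal (m \<omega> ^ ?e)))" for \<omega>
  proof -
    have "(1 + (B + m \<omega>) ^ D) ^ p \<le> 2 ^ p * (1 ^ p + ((B + m \<omega>) ^ D) ^ p)"
      using B m(2)[of \<omega>] by (intro add_power_le) auto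
    also have "((B + m \<omega>) ^ D) ^ p = (B + m \<omega>) ^ ?e" by (simp only: power_mult[symmetric] mult.commute)
    also have "2 ^ p * (1 ^ p + (B + m \<omega>) ^ ?e) \<le> 2 ^ p * (1 + 2 ^ ?e * (B ^ ?e + m \<omega> ^ ?e))"
      using add_power_le[OF B m(2)[of \<omega>], of ?e] unfolding power_one by (intro mult_left_mono add_left_mono) auto
    finally have "ennreal ((1 + (B + m \<omega>) ^ D) ^ p) \<le> ennreal (2 ^ p * (1 + 2 ^ ?e * (B ^ ?e + m \<omega> ^ ?e)))" by (rule ennreal_leI)
    also have "\<dots> = ennreal (2 ^ p) * (ennreal 1 + ennreal (2 ^ ?e) * (ennreal (B ^ ?e) + ennreal (m \<omega> ^ ?e)))"
      using B m(2)[of \<omega>]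
      by (simp only: ennreal_mult ennreal_plus add_nonneg_nonneg mult_nonneg_nonneg zero_le_power zero_le_one zero_le_numeral)
    finally show ?thesis .
  qed
  have "(\<integral>\<^sup>+\<omega>. ennreal ((1 + (B + m \<omega>) ^ D) ^ p) \<partial>M)
    \<le> (\<integral>\<^sup>+\<omega>. ennreal (2 ^ p) * (ennreal 1 + ennreal (2 ^ ?e) * (ennreal (B ^ ?e) + ennreal (m \<omega> ^ ?e))) \<partial>M)"
    by (rule nn_integral_mono[OF pw])
  also have "\<dots> = ennreal (2 ^ p) * (ennreal 1 + ennreal (2 ^ ?e) * (ennreal (B ^ ?e) + (\<integral>\<^sup>+\<omega>. ennreal (m \<omega> ^ ?e) \<partial>M)))"
    using m(1) by (simp add: nn_integral_cmult nn_integral_add emeasure_space_1)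
  also have "\<dots> \<le> ennreal (2 ^ p) * (ennreal 1 + ennreal (2 ^ ?e) * (ennreal (B ^ ?e) + ennreal C))"
    by (intro mult_left_mono add_left_mono le) simp_all
  also have "\<dots> = ennreal (2 ^ p * (1 + 2 ^ ?e * (B ^ ?e + C)))"
    using B C
    by (simp only: ennreal_mult ennreal_plus add_nonneg_nonneg mult_nonneg_nonneg zero_le_power zero_le_one zero_le_numeral)
  finally show ?thesis .
qed

section \<open>Stochastic delay equations with coefficients of polynomial growth in the delay\<close>

lemma set_integral_Icc_diff:
  fixes f :: "real \<Rightarrow> 'b::euclidean_space"
  assumes f: "set_integrable lborel {0..T} f" and st: "0 \<le> s" "s \<le> t" "t \<le> T"
  shows "(LINT u:{0..t}|lborel. f u) = (LINT u:{0..s}|lborel. f u) + (LINT u:{s..t}|lborel. f u)"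
    and "set_integrable lborel {s..t} f"
proof -
  have i1: "set_integrable lborel {0..s} f" by (rule set_integrable_subset[OF f]) (use st in auto)
  show i2: "set_integrable lborel {s..t} f" by (rule set_integrable_subset[OF f]) (use st in auto)
  have eq: "{0..t} = {0..s} \<union> {s..t}" using st by auto
  have ae: "AE x in lborel. \<not> (x \<in> {0..s} \<and> x \<in> {s..t})"
    using AE_lborel_singleton[of s] by eventually_elim auto
  show "(LINT u:{0..t}|lborel. f u) = (LINT u:{0..s}|lborel. f u) + (LINT u:{s..t}|lborel. f u)"
    unfolding eq by (rule set_integral_Un_AE[OF ae _ _ i1 i2]) auto
qed

context brownian_motion
begin

lemma ito_processD:
  fixes Z :: "real \<Rightarrow> 'a \<Rightarrow> real ^ 'n"
  assumes "ito_process M F W \<tau> T \<xi> f H Z" and T: "0 < T" and \<tau>: "0 < \<tau>"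
  obtains I where "ito_limit M F W T H I"
    "\<And>u. u \<in> {0..T} \<Longrightarrow> Z u \<in> borel_measurable (F u)"
    "AE \<omega> in M. continuous_on {0..T} (\<lambda>u. Z u \<omega>)"
    "AE \<omega> in M. \<forall>\<theta>\<in>{-\<tau>..0}. Z \<theta> \<omega> = \<xi> \<theta> \<omega>"
    "AE \<omega> in M. set_integrable lborel {0..T} (\<lambda>u. f u \<omega>)"
    "AE \<omega> in M. ito_increments T Z f I \<omega>"
proof -
  obtain I where I: "has_ito_integral M F W T H I"
    and eq: "AE \<omega> in M. \<forall>t\<in>{0..T}. Z t \<omega> = \<xi> 0 \<omega> + (LINT s:{0..t}|lborel. f s \<omega>) + I t \<omega>"
    using assms(1) unfolding ito_process_def by blast
  have m: "Z u \<in> borel_measurable (F u)" if "u \<in> {0..T}" for u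
  proof -
    have "\<forall>t\<in>{-\<tau>..T}. Z t \<in> borel_measurable (F (max 0 t))" using assms(1) unfolding ito_process_def by (rule conjunct1)
    then have "Z u \<in> borel_measurable (F (max 0 u))" by (rule bspec) (use that \<tau> in auto)
    moreover have "max 0 u = u" using that by simp
    ultimately show ?thesis by simp
  qed
  have c: "AE \<omega> in M. continuous_on {-\<tau>..T} (\<lambda>u. Z u \<omega>)" and x: "AE \<omega> in M. \<forall>\<theta>\<in>{-\<tau>..0}. Z \<theta> \<omega> = \<xi> \<theta> \<omega>"
    and i: "AE \<omega> in M. set_integrable lborel {0..T} (\<lambda>u. f u \<omega>)"
    using assms(1) unfolding ito_process_def by blast+
  have c': "AE \<omega> in M. continuous_on {0..T} (\<lambda>u. Z u \<omega>)"
    using c by eventually_elim (erule continuous_on_subset, use \<tau> in auto)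
  have "AE \<omega> in M. ito_increments T Z f I \<omega>"
    using eq i
  proof eventually_elim
    fix \<omega> assume eq: "\<forall>t\<in>{0..T}. Z t \<omega> = \<xi> 0 \<omega> + (LINT s:{0..t}|lborel. f s \<omega>) + I t \<omega>"
      and i: "set_integrable lborel {0..T} (\<lambda>u. f u \<omega>)"
    show "ito_increments T Z f I \<omega>" unfolding ito_increments_def
    proof (intro allI impI)
      fix s t assume st: "0 \<le> s" "s \<le> t" "t \<le> T"
      have "Z t \<omega> = \<xi> 0 \<omega> + (LINT s:{0..t}|lborel. f s \<omega>) + I t \<omega>" "Z s \<omega> = \<xi> 0 \<omega> + (LINT s:{0..s}|lborel. f s \<omega>) + I s \<omega>"
        by (rule bspec[OF eq], use st in simp)+
      then show "Z t \<omega> = Z s \<omega> + (LINT u:{s..t}|lborel. f u \<omega>) + (I t \<omega> - I s \<omega>)"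
        using set_integral_Icc_diff(1)[OF i st] by simp
    qed
  qed
  from that[OF has_ito_integral_imp_limit[OF I T] m c' x i this] show thesis .
qed

end

text \<open>Both weights \<open>V\<^sub>1\<close>, \<open>V\<^sub>2\<close> are dominated by a single one of the form \<open>L (1 + |y1|\<^sup>d + |y2|\<^sup>d)\<close> with an integer exponent.\<close>

locale sdde_coefficients = brownian_motion M F W
  for M :: "'a measure" and F and W :: "real \<Rightarrow> 'a \<Rightarrow> real ^ 'm" +
  fixes b :: "real ^ 'n \<Rightarrow> real ^ 'n \<Rightarrow> real ^ 'n" and \<sigma> :: "real ^ 'n \<Rightarrow> real ^ 'n \<Rightarrow> real ^ 'm ^ 'n"
    and \<tau> T L G B\<xi> :: real and d :: nat and \<xi> :: "real \<Rightarrow> 'a \<Rightarrow> real ^ 'n"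
  assumes \<tau>0: "0 < \<tau>" and T0: "0 < T" and L0: "0 \<le> L" and G0: "0 \<le> G" and B\<xi>0: "0 \<le> B\<xi>" and d1: "1 \<le> d"
    and b_lipschitz: "\<And>x1 x2 y1 y2. norm (b x1 y1 - b x2 y2) \<le> L * norm (x1 - x2) + L * (1 + norm y1 ^ d + norm y2 ^ d) * norm (y1 - y2)"
    and \<sigma>_lipschitz: "\<And>x1 x2 y1 y2. norm (\<sigma> x1 y1 - \<sigma> x2 y2) \<le> L * norm (x1 - x2) + L * (1 + norm y1 ^ d + norm y2 ^ d) * norm (y1 - y2)"
    and b_growth: "\<And>x y. norm (b x y) \<le> L * norm x + G * (1 + norm y ^ (d + 1))"
    and \<sigma>_growth: "\<And>x y. norm (\<sigma> x y) \<le> L * norm x + G * (1 + norm y ^ (d + 1))"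
    and \<xi>_bounded: "\<And>\<omega> \<theta>. \<omega> \<in> space M \<Longrightarrow> \<theta> \<in> {-\<tau>..0} \<Longrightarrow> norm (\<xi> \<theta> \<omega>) \<le> B\<xi>"
begin

text \<open>A common description of the solution and of the schemes for all step sizes: the coefficients are evaluated at some value of the path up to time \<open>t\<close> and at some
value up to time \<open>t - \<tau>\<close>.  Constants that are valid for all admissible processes are therefore independent of the step size.\<close>

definition admissible :: "(real \<Rightarrow> 'a \<Rightarrow> real ^ 'n) \<Rightarrow> (real \<Rightarrow> 'a \<Rightarrow> real ^ 'm ^ 'n) \<Rightarrow> (real \<Rightarrow> 'a \<Rightarrow> real ^ 'n) \<Rightarrow> bool" where
  "admissible f H Z \<longleftrightarrow> ito_process M F W \<tau> T \<xi> f H Z \<and>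
    (AE \<omega> in M. \<forall>t\<in>{0..T}. \<exists>u\<in>{0..t}. \<exists>w\<in>{-\<tau>..t - \<tau>}.
      f t \<omega> = b (Z u \<omega>) (Z w \<omega>) \<and> H t \<omega> = \<sigma> (Z u \<omega>) (Z w \<omega>))"

definition delay_growth :: "(real \<Rightarrow> 'a \<Rightarrow> real ^ 'n) \<Rightarrow> (real \<Rightarrow> 'a \<Rightarrow> real ^ 'm ^ 'n) \<Rightarrow> (real \<Rightarrow> 'a \<Rightarrow> real ^ 'n) \<Rightarrow> 'a \<Rightarrow> bool" where
  "delay_growth f H Z \<omega> \<longleftrightarrow> (\<forall>t\<in>{0..T}. \<forall>B D. (\<forall>u\<in>{0..t}. norm (Z u \<omega>) \<le> B) \<longrightarrow>
    (\<forall>w\<in>{0..t - \<tau>}. norm (Z w \<omega>) \<le> D) \<longrightarrow> 0 \<le> D \<longrightarrow>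
    norm (f t \<omega>) \<le> L * B + G * (1 + (B\<xi> + D) ^ (d + 1)) \<and> norm (H t \<omega>) \<le> L * B + G * (1 + (B\<xi> + D) ^ (d + 1)))"

lemma admissible_growth:
  assumes adm: "admissible f H Z"
  shows "AE \<omega> in M. delay_growth f H Z \<omega>"
proof -
  have a: "AE \<omega> in M. \<forall>t\<in>{0..T}. \<exists>u\<in>{0..t}. \<exists>w\<in>{-\<tau>..t - \<tau>}.
      f t \<omega> = b (Z u \<omega>) (Z w \<omega>) \<and> H t \<omega> = \<sigma> (Z u \<omega>) (Z w \<omega>)"
    using adm unfolding admissible_def by (rule conjunct2)
  have x: "AE \<omega> in M. \<forall>\<theta>\<in>{-\<tau>..0}. Z \<theta> \<omega> = \<xi> \<theta> \<omega>"
    using adm unfolding admissible_def ito_process_def by blast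
  from AE_space a x show ?thesis
  proof eventually_elim
    fix \<omega> assume \<omega>: "\<omega> \<in> space M"
      and a: "\<forall>t\<in>{0..T}. \<exists>u\<in>{0..t}. \<exists>w\<in>{-\<tau>..t - \<tau>}. f t \<omega> = b (Z u \<omega>) (Z w \<omega>) \<and> H t \<omega> = \<sigma> (Z u \<omega>) (Z w \<omega>)"
      and x: "\<forall>\<theta>\<in>{-\<tau>..0}. Z \<theta> \<omega> = \<xi> \<theta> \<omega>"
    show "delay_growth f H Z \<omega>" unfolding delay_growth_def
    proof (intro ballI allI impI)
      fix t B D assume t: "t \<in> {0..T}" and B: "\<forall>u\<in>{0..t}. norm (Z u \<omega>) \<le> B"
        and D: "\<forall>w\<in>{0..t - \<tau>}. norm (Z w \<omega>) \<le> D" "0 \<le> D"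
      obtain u w where uw: "u \<in> {0..t}" "w \<in> {-\<tau>..t - \<tau>}" "f t \<omega> = b (Z u \<omega>) (Z w \<omega>)" "H t \<omega> = \<sigma> (Z u \<omega>) (Z w \<omega>)"
        using bspec[OF a t] by blast
      have Zu: "norm (Z u \<omega>) \<le> B" using B uw(1) by blast
      have Zw: "norm (Z w \<omega>) \<le> B\<xi> + D"
      proof (cases "w \<le> 0")
        case True
        then have w0: "w \<in> {-\<tau>..0}" using uw(2) by simp
        have "norm (Z w \<omega>) \<le> B\<xi>" using bspec[OF x w0] \<xi>_bounded[OF \<omega> w0] by simp
        then show ?thesis using D(2) by linarith
      next
        case False
        then have "w \<in> {0..t - \<tau>}" using uw(2) by simp
        then have "norm (Z w \<omega>) \<le> D" using D(1) by blast
        then show ?thesis using B\<xi>0 by linarith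
      qed
      have "L * norm (Z u \<omega>) + G * (1 + norm (Z w \<omega>) ^ (d + 1)) \<le> L * B + G * (1 + (B\<xi> + D) ^ (d + 1))"
        by (intro add_mono mult_left_mono power_mono Zu Zw order_refl L0 G0) simp
      then show "norm (f t \<omega>) \<le> L * B + G * (1 + (B\<xi> + D) ^ (d + 1)) \<and> norm (H t \<omega>) \<le> L * B + G * (1 + (B\<xi> + D) ^ (d + 1))"
        using b_growth[of "Z u \<omega>" "Z w \<omega>"] \<sigma>_growth[of "Z u \<omega>" "Z w \<omega>"] unfolding uw(3,4) by linarith
    qed
  qed
qed

lemma admissible_H_controlled:
  assumes adm: "admissible f H Z"
  shows "\<exists>B. AE \<omega> in M. \<forall>u\<in>{0..T}. (\<forall>y\<in>{0..u}. norm (Z y \<omega>) \<le> R) \<longrightarrow> norm (H u \<omega>) \<le> B"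
proof (rule exI)
  show "AE \<omega> in M. \<forall>u\<in>{0..T}. (\<forall>y\<in>{0..u}. norm (Z y \<omega>) \<le> R) \<longrightarrow> norm (H u \<omega>) \<le> L * R + G * (1 + (B\<xi> + \<bar>R\<bar>) ^ (d + 1))"
    using admissible_growth[OF adm]
  proof eventually_elim
    fix \<omega> assume g: "delay_growth f H Z \<omega>"
    show "\<forall>u\<in>{0..T}. (\<forall>y\<in>{0..u}. norm (Z y \<omega>) \<le> R) \<longrightarrow> norm (H u \<omega>) \<le> L * R + G * (1 + (B\<xi> + \<bar>R\<bar>) ^ (d + 1))"
    proof (intro ballI impI)
      fix u assume u: "u \<in> {0..T}" and R: "\<forall>y\<in>{0..u}. norm (Z y \<omega>) \<le> R"
      have "\<forall>w\<in>{0..u - \<tau>}. norm (Z w \<omega>) \<le> \<bar>R\<bar>"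
      proof
        fix w assume "w \<in> {0..u - \<tau>}"
        then have "w \<in> {0..u}" using \<tau>0 by simp
        then have "norm (Z w \<omega>) \<le> R" using R by blast
        then show "norm (Z w \<omega>) \<le> \<bar>R\<bar>" by linarith
      qed
      then show "norm (H u \<omega>) \<le> L * R + G * (1 + (B\<xi> + \<bar>R\<bar>) ^ (d + 1))"
        using g[unfolded delay_growth_def, rule_format, OF u, of R "\<bar>R\<bar>"] R by simp
    qed
  qed
qed

lemma admissible_controlled:
  assumes adm: "admissible f H Z" and lim: "ito_limit M F W T H I"
  shows "controlled_ito M F W T H I (\<lambda>u \<omega>. norm (Z u \<omega>))"
proof -
  obtain I' :: "real \<Rightarrow> 'a \<Rightarrow> real ^ 'n" where lim': "ito_limit M F W T H I'"
    and mF: "\<And>u. u \<in> {0..T} \<Longrightarrow> Z u \<in> borel_measurable (F u)"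
    and cont: "AE \<omega> in M. continuous_on {0..T} (\<lambda>u. Z u \<omega>)"
    and x: "AE \<omega> in M. \<forall>\<theta>\<in>{-\<tau>..0}. Z \<theta> \<omega> = \<xi> \<theta> \<omega>"
    and int: "AE \<omega> in M. set_integrable lborel {0..T} (\<lambda>u. f u \<omega>)"
    and inc: "AE \<omega> in M. ito_increments T Z f I' \<omega>"
    by (rule ito_processD[OF conjunct1[OF adm[unfolded admissible_def]] T0 \<tau>0], rule that; assumption)
  show ?thesis
  proof
    show "0 < T" by (rule T0)
    show "ito_limit M F W T H I" by (rule lim)
    show "(\<lambda>\<omega>. norm (Z u \<omega>)) \<in> borel_measurable (F u)" if "u \<in> {0..T}" for u
      by (rule measurable_compose[OF mF[OF that] borel_measurable_norm])
    show "AE \<omega> in M. continuous_on {0..T} (\<lambda>u. norm (Z u \<omega>))"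
      using cont by eventually_elim (intro continuous_intros)
    show "\<exists>B. AE \<omega> in M. \<forall>u\<in>{0..T}. (\<forall>y\<in>{0..u}. norm (Z y \<omega>) \<le> R) \<longrightarrow> norm (H u \<omega>) \<le> B" for R
      by (rule admissible_H_controlled[OF adm])
  qed
qed

definition horizon :: "nat \<Rightarrow> real" where "horizon i = min T (real i * \<tau>)"

lemma horizon: "0 \<le> horizon i" "horizon i \<le> T" "0 < horizon (Suc i)" "horizon 0 = 0"
  "u \<le> horizon (Suc i) \<Longrightarrow> u - \<tau> \<le> horizon i"
proof -
  have S: "real (Suc i) * \<tau> = real i * \<tau> + \<tau>" by (simp add: algebra_simps)
  have i0: "0 \<le> real i * \<tau>" using \<tau>0 by simp
  show "0 \<le> horizon i" "horizon i \<le> T" "horizon 0 = 0" using i0 T0 by (simp_all add: horizon_def)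
  have "0 < real i * \<tau> + \<tau>" using i0 \<tau>0 by linarith
  then show "0 < horizon (Suc i)" using T0 unfolding horizon_def S by simp
  assume "u \<le> horizon (Suc i)"
  then have "u \<le> T" "u \<le> real i * \<tau> + \<tau>" unfolding horizon_def S by simp_all
  then show "u - \<tau> \<le> horizon i" using \<tau>0 unfolding horizon_def by simp
qed

lemma horizon_eventually: "\<exists>i. horizon i = T"
proof -
  obtain i :: nat where "T / \<tau> \<le> real i" using real_arch_simple by blast
  then have "T \<le> real i * \<tau>" using \<tau>0 by (simp add: pos_divide_le_eq)
  then show ?thesis by (intro exI[of _ i]) (simp add: horizon_def)
qed

text \<open>Up to \<open>horizon (Suc i)\<close> the delayed values occur before \<open>horizon i\<close>.  They enter the growth bound with the power \<open>d + 1\<close>, so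
the \<open>2 r\<close>-th moment here rests on the moment of order \<open>2 r (d + 1)\<close> there.\<close>

lemma admissible_moments_horizon:
  "\<forall>r. even r \<longrightarrow> 1 \<le> r \<longrightarrow> (\<exists>C. \<forall>f H Z. admissible f H Z \<longrightarrow>
    (\<integral>\<^sup>+\<omega>. ennreal (rsup (horizon i) Z \<omega> ^ (2 * r)) \<partial>M) \<le> ennreal C)"
proof (induction i)
  case 0
  show ?case
  proof (intro allI impI)
    fix r :: nat assume r: "even r" "1 \<le> r"
    have "(\<integral>\<^sup>+\<omega>. ennreal (rsup (horizon 0) Z \<omega> ^ (2 * r)) \<partial>M) \<le> ennreal (B\<xi> ^ (2 * r))" if adm: "admissible f H Z" for f H Z
    proof -
      have x: "AE \<omega> in M. \<forall>\<theta>\<in>{-\<tau>..0}. Z \<theta> \<omega> = \<xi> \<theta> \<omega>"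
        using adm unfolding admissible_def ito_process_def by blast
      have "(\<integral>\<^sup>+\<omega>. ennreal (rsup (horizon 0) Z \<omega> ^ (2 * r)) \<partial>M) \<le> (\<integral>\<^sup>+\<omega>. ennreal (B\<xi> ^ (2 * r)) \<partial>M)"
      proof (rule nn_integral_mono_AE)
        show "AE \<omega> in M. ennreal (rsup (horizon 0) Z \<omega> ^ (2 * r)) \<le> ennreal (B\<xi> ^ (2 * r))"
          using AE_space x
        proof eventually_elim
          fix \<omega> assume \<omega>: "\<omega> \<in> space M" and x: "\<forall>\<theta>\<in>{-\<tau>..0}. Z \<theta> \<omega> = \<xi> \<theta> \<omega>"
          have z: "(0::real) \<in> {-\<tau>..0}" using \<tau>0 by simp
          have "norm (Z 0 \<omega>) \<le> B\<xi>" using bspec[OF x z] \<xi>_bounded[OF \<omega> z] by simp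
          moreover obtain u where "u \<in> {0..0::real}" "rsup (horizon 0) Z \<omega> = norm (Z u \<omega>)"
            using rsup_attained(1)[of 0 Z \<omega>] unfolding horizon(4) by auto
          ultimately show "ennreal (rsup (horizon 0) Z \<omega> ^ (2 * r)) \<le> ennreal (B\<xi> ^ (2 * r))"
            by (auto intro!: ennreal_leI power_mono)
        qed
      qed
      then show ?thesis by (simp add: emeasure_space_1)
    qed
    then show "\<exists>C. \<forall>f H Z. admissible f H Z \<longrightarrow>
      (\<integral>\<^sup>+\<omega>. ennreal (rsup (horizon 0) Z \<omega> ^ (2 * r)) \<partial>M) \<le> ennreal C" by blast
  qed
next
  case (Suc i)
  show ?case
  proof (intro allI impI)
    fix r :: nat assume r: "even r" "1 \<le> r"
    let ?p = "2 * r"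
    let ?r' = "r * (d + 1)"
    have r': "even ?r'" "1 \<le> ?r'" using r by auto
    obtain C where C: "\<And>f H Z. admissible f H Z \<Longrightarrow>
      (\<integral>\<^sup>+\<omega>. ennreal (rsup (horizon i) Z \<omega> ^ (2 * ?r')) \<partial>M) \<le> ennreal C"
      using Suc[rule_format, OF r'] by blast
    \<comment> \<open>The bound for the energy of the forcing term from \<open>nn_integral_poly_le\<close>.\<close>
    define C' where "C' = T * G ^ ?p * (2 ^ ?p * (1 + 2 ^ (?p * (d + 1)) * (B\<xi> ^ (?p * (d + 1)) + \<bar>C\<bar>)))"
    have C'0: "0 \<le> C'" using T0 G0 B\<xi>0 by (simp add: C'_def)
    define g where "g = gronwall_const (CARD('n) * CARD('m)) r L T"
    have "(\<integral>\<^sup>+\<omega>. ennreal (rsup (horizon (Suc i)) Z \<omega> ^ ?p) \<partial>M) \<le> ennreal (g * (B\<xi> ^ ?p + C'))"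
      if adm: "admissible f H Z" for f H Z
    proof -
      obtain I where lim: "ito_limit M F W T H I"
        and mF: "\<And>u. u \<in> {0..T} \<Longrightarrow> Z u \<in> borel_measurable (F u)"
        and cont: "AE \<omega> in M. continuous_on {0..T} (\<lambda>u. Z u \<omega>)"
        and x: "AE \<omega> in M. \<forall>\<theta>\<in>{-\<tau>..0}. Z \<theta> \<omega> = \<xi> \<theta> \<omega>"
        and int: "AE \<omega> in M. set_integrable lborel {0..T} (\<lambda>u. f u \<omega>)"
        and inc: "AE \<omega> in M. ito_increments T Z f I \<omega>"
        by (rule ito_processD[OF conjunct1[OF adm[unfolded admissible_def]] T0 \<tau>0], rule that; assumption)
      define m where "m = rsup (horizon i) Z"
      have mm: "m \<in> borel_measurable M"
        unfolding m_def by (rule rsup_measurable, rule measurable_F, rule mF) (use horizon(2)[of i] in auto)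
      have m0: "0 \<le> m \<omega>" for \<omega> by (simp add: m_def rsup_nonneg)
      define P where "P \<omega> = G * (1 + (B\<xi> + m \<omega>) ^ (d + 1))" for \<omega>
      have P0: "0 \<le> P \<omega>" for \<omega> unfolding P_def using G0 B\<xi>0 m0 by (intro mult_nonneg_nonneg add_nonneg_nonneg) auto
      have Pm: "P \<in> borel_measurable M" unfolding P_def[abs_def] using mm by measurable
      define Q where "Q \<omega> = ennreal T * ennreal (P \<omega> ^ ?p)" for \<omega>
      interpret ito_gronwall M F W T H I "\<lambda>u \<omega>. norm (Z u \<omega>)" Z f "\<lambda>u. P" Q L "horizon (Suc i)" r
      proof (intro ito_gronwall.intro ito_gronwall_axioms.intro)
        show "controlled_ito M F W T H I (\<lambda>u \<omega>. norm (Z u \<omega>))" by (rule admissible_controlled[OF adm lim])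
        show "0 < horizon (Suc i)" "horizon (Suc i) \<le> T" by (rule horizon)+
        show "even r" "1 \<le> r" by (rule r)+
        show "0 \<le> L" by (rule L0)
        show "Z u \<in> borel_measurable M" if "u \<in> {0..T}" for u by (rule measurable_F[OF mF[OF that]])
        show "AE \<omega> in M. continuous_on {0..T} (\<lambda>u. Z u \<omega>)" by (rule cont)
        show "AE \<omega> in M. ito_increments T Z f I \<omega>" by (rule inc)
        show "AE \<omega> in M. linear_growth (horizon (Suc i)) L Z f H (\<lambda>u. P) \<omega>"
          using admissible_growth[OF adm] cont
        proof eventually_elim
          fix \<omega> assume g: "delay_growth f H Z \<omega>"
            and cont: "continuous_on {0..T} (\<lambda>u. Z u \<omega>)"
          show "linear_growth (horizon (Suc i)) L Z f H (\<lambda>u. P) \<omega>" unfolding linear_growth_def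
          proof (intro ballI allI impI)
            fix u B assume u: "u \<in> {0..horizon (Suc i)}" and B: "\<forall>y\<in>{0..u}. norm (Z y \<omega>) \<le> B"
            have uT: "u \<in> {0..T}" using u horizon(2)[of "Suc i"] by simp
            have c: "continuous_on {0..horizon i} (\<lambda>u. Z u \<omega>)"
              using cont by (rule continuous_on_subset) (use horizon(2)[of i] in auto)
            have "\<forall>w\<in>{0..u - \<tau>}. norm (Z w \<omega>) \<le> m \<omega>"
            proof
              fix w assume "w \<in> {0..u - \<tau>}"
              then have "w \<in> {0..horizon i}" using horizon(5)[of u i] u by simp
              then show "norm (Z w \<omega>) \<le> m \<omega>" unfolding m_def by (rule rsup_attained(2)[of _ Z \<omega>, OF horizon(1) c])
            qed
            then show "norm (f u \<omega>) \<le> L * B + P \<omega> \<and> norm (H u \<omega>) \<le> L * B + P \<omega>"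
              using g[unfolded delay_growth_def, rule_format, OF uT, of B "m \<omega>"] B m0 unfolding P_def by simp
          qed
        qed
        show "0 \<le> P \<omega>" for \<omega> by (rule P0)
        show "(\<lambda>u. indicator {0..horizon (Suc i)} u * P \<omega>) \<in> borel_measurable borel" for \<omega> by measurable
        show "Q \<in> borel_measurable M" unfolding Q_def[abs_def] using Pm by measurable
        show "AE \<omega> in M. (\<integral>\<^sup>+u\<in>{0..horizon (Suc i)}. ennreal (P \<omega> ^ (2 * r)) \<partial>lborel) \<le> Q \<omega>"
        proof (rule AE_I2)
          fix \<omega>
          have "(\<integral>\<^sup>+u\<in>{0..horizon (Suc i)}. ennreal (P \<omega> ^ (2 * r)) \<partial>lborel) = ennreal (P \<omega> ^ ?p) * ennreal (horizon (Suc i))"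
            using horizon(1)[of "Suc i"] by (simp add: nn_integral_cmult_indicator)
          also have "\<dots> \<le> ennreal (P \<omega> ^ ?p) * ennreal T" by (intro mult_left_mono ennreal_leI horizon) simp
          finally show "(\<integral>\<^sup>+u\<in>{0..horizon (Suc i)}. ennreal (P \<omega> ^ (2 * r)) \<partial>lborel) \<le> Q \<omega>" by (simp add: Q_def mult.commute)
        qed
      qed simp
      have "(\<integral>\<^sup>+\<omega>. ennreal (rsup (horizon (Suc i)) Z \<omega> ^ ?p) \<partial>M) \<le> (\<integral>\<^sup>+\<omega>. (SUP u\<in>{0..horizon (Suc i)}. ennreal (norm (Z u \<omega>) ^ ?p)) \<partial>M)"
      proof (rule nn_integral_mono_AE)
        show "AE \<omega> in M. ennreal (rsup (horizon (Suc i)) Z \<omega> ^ ?p) \<le> (SUP u\<in>{0..horizon (Suc i)}. ennreal (norm (Z u \<omega>) ^ ?p))"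
          using cont
        proof eventually_elim
          fix \<omega> assume "continuous_on {0..T} (\<lambda>u. Z u \<omega>)"
          then have "continuous_on {0..horizon (Suc i)} (\<lambda>u. Z u \<omega>)"
            by (rule continuous_on_subset) (use horizon(2)[of "Suc i"] in auto)
          then show "ennreal (rsup (horizon (Suc i)) Z \<omega> ^ ?p) \<le> (SUP u\<in>{0..horizon (Suc i)}. ennreal (norm (Z u \<omega>) ^ ?p))"
            by (rule rsup_power_le[OF horizon(1)])
        qed
      qed
      also have "\<dots> \<le> ennreal g * ((\<integral>\<^sup>+\<omega>. ennreal (norm (Z 0 \<omega>) ^ ?p) \<partial>M) + (\<integral>\<^sup>+\<omega>. Q \<omega> \<partial>M))"
        unfolding g_def by (rule moment_bound)
      also have "\<dots> \<le> ennreal g * (ennreal (B\<xi> ^ ?p) + ennreal C')"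
      proof (intro mult_left_mono add_mono)
        have "(\<integral>\<^sup>+\<omega>. ennreal (norm (Z 0 \<omega>) ^ ?p) \<partial>M) \<le> (\<integral>\<^sup>+\<omega>. ennreal (B\<xi> ^ ?p) \<partial>M)"
        proof (rule nn_integral_mono_AE)
          show "AE \<omega> in M. ennreal (norm (Z 0 \<omega>) ^ ?p) \<le> ennreal (B\<xi> ^ ?p)"
            using AE_space x
          proof eventually_elim
            fix \<omega> assume \<omega>: "\<omega> \<in> space M" and x: "\<forall>\<theta>\<in>{-\<tau>..0}. Z \<theta> \<omega> = \<xi> \<theta> \<omega>"
            have z: "(0::real) \<in> {-\<tau>..0}" using \<tau>0 by simp
            have "norm (Z 0 \<omega>) \<le> B\<xi>" using bspec[OF x z] \<xi>_bounded[OF \<omega> z] by simp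
            then show "ennreal (norm (Z 0 \<omega>) ^ ?p) \<le> ennreal (B\<xi> ^ ?p)" by (intro ennreal_leI power_mono) auto
          qed
        qed
        then show "(\<integral>\<^sup>+\<omega>. ennreal (norm (Z 0 \<omega>) ^ ?p) \<partial>M) \<le> ennreal (B\<xi> ^ ?p)" by (simp add: emeasure_space_1)
        let ?X = "\<lambda>\<omega>. (1 + (B\<xi> + m \<omega>) ^ (d + 1)) ^ ?p"
        have X0: "0 \<le> ?X \<omega>" for \<omega> using B\<xi>0 m0[of \<omega>] by (intro zero_le_power add_nonneg_nonneg) auto
        have TG: "0 \<le> T" "0 \<le> G ^ ?p" using T0 G0 by simp_all
        have mC: "(\<integral>\<^sup>+\<omega>. ennreal (m \<omega> ^ (?p * (d + 1))) \<partial>M) \<le> ennreal \<bar>C\<bar>"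
          using C[OF adm] unfolding m_def mult.assoc[symmetric] by (rule order_trans) (rule ennreal_leI, simp)
        have "(\<integral>\<^sup>+\<omega>. Q \<omega> \<partial>M) = (\<integral>\<^sup>+\<omega>. ennreal (T * G ^ ?p) * ennreal (?X \<omega>) \<partial>M)"
          by (rule nn_integral_cong)
             (simp only: Q_def P_def power_mult_distrib ennreal_mult TG X0 mult_nonneg_nonneg mult.assoc)
        also have "\<dots> = ennreal (T * G ^ ?p) * (\<integral>\<^sup>+\<omega>. ennreal (?X \<omega>) \<partial>M)"
          using mm by (intro nn_integral_cmult) measurable
        also have "\<dots> \<le> ennreal (T * G ^ ?p) * ennreal (2 ^ ?p * (1 + 2 ^ (?p * (d + 1)) * (B\<xi> ^ (?p * (d + 1)) + \<bar>C\<bar>)))"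
          by (intro mult_left_mono nn_integral_poly_le[OF prob_space_axioms mm m0 B\<xi>0 abs_ge_zero mC]) simp
        also have "\<dots> = ennreal C'"
          unfolding C'_def using TG B\<xi>0 by (intro ennreal_mult[symmetric]) auto
        finally show "(\<integral>\<^sup>+\<omega>. Q \<omega> \<partial>M) \<le> ennreal C'" .
      qed simp
      also have "\<dots> = ennreal (g * (B\<xi> ^ ?p + C'))"
      proof -
        have "0 \<le> g" unfolding g_def by (rule gronwall_const_nonneg[OF L0])
        moreover note C'0
        moreover have "0 \<le> B\<xi> ^ ?p" using B\<xi>0 by simp
        ultimately show ?thesis by (simp only: ennreal_mult ennreal_plus add_nonneg_nonneg)
      qed
      finally show ?thesis .
    qed
    then show "\<exists>C. \<forall>f H Z. admissible f H Z \<longrightarrow>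
      (\<integral>\<^sup>+\<omega>. ennreal (rsup (horizon (Suc i)) Z \<omega> ^ (2 * r)) \<partial>M) \<le> ennreal C" by blast
  qed
qed

lemma admissible_moments:
  assumes "even r" "1 \<le> r"
  obtains C where "0 \<le> C" "\<And>f H Z. admissible f H Z \<Longrightarrow> (\<integral>\<^sup>+\<omega>. ennreal (rsup T Z \<omega> ^ (2 * r)) \<partial>M) \<le> ennreal C"
proof -
  obtain i where i: "horizon i = T" using horizon_eventually by blast
  obtain C where C: "\<And>f H Z. admissible f H Z \<Longrightarrow> (\<integral>\<^sup>+\<omega>. ennreal (rsup T Z \<omega> ^ (2 * r)) \<partial>M) \<le> ennreal C"
    using admissible_moments_horizon[of i, rule_format, OF assms] unfolding i by blast
  show thesis
  proof (rule that[of "\<bar>C\<bar>"])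
    show "(\<integral>\<^sup>+\<omega>. ennreal (rsup T Z \<omega> ^ (2 * r)) \<partial>M) \<le> ennreal \<bar>C\<bar>" if "admissible f H Z" for f H Z
      using C[OF that] by (rule order_trans) (rule ennreal_leI, simp)
  qed simp
qed

end

section \<open>Increments\<close>

context sdde_coefficients
begin

lemma rsup_admissible_measurable:
  assumes adm: "admissible f H Z" shows "rsup T Z \<in> borel_measurable M"
proof (rule rsup_measurable)
  fix u assume u: "u \<in> {0..T}"
  have "\<forall>t\<in>{-\<tau>..T}. Z t \<in> borel_measurable (F (max 0 t))"
    using adm unfolding admissible_def ito_process_def by (elim conjE)
  then have "Z u \<in> borel_measurable (F (max 0 u))" by (rule bspec) (use u \<tau>0 in auto)
  then show "Z u \<in> borel_measurable M" by (rule measurable_F)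
qed

lemma admissible_poly_moments:
  assumes r: "even r" "1 \<le> r" and D: "1 \<le> D"
  obtains C where "0 \<le> C" "\<And>f H Z. admissible f H Z \<Longrightarrow> (\<integral>\<^sup>+\<omega>. ennreal ((1 + (B\<xi> + rsup T Z \<omega>) ^ D) ^ (2 * r)) \<partial>M) \<le> ennreal C"
proof -
  have r': "even (r * D)" "1 \<le> r * D" using r D by auto
  obtain C where C: "0 \<le> C" "\<And>f H Z. admissible f H Z \<Longrightarrow> (\<integral>\<^sup>+\<omega>. ennreal (rsup T Z \<omega> ^ (2 * (r * D))) \<partial>M) \<le> ennreal C"
    using admissible_moments[OF r'] by blast
  show thesis
  proof (rule that)
    show "0 \<le> (2::real) ^ (2 * r) * (1 + 2 ^ (2 * r * D) * (B\<xi> ^ (2 * r * D) + C))"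
      using C(1) B\<xi>0 by simp
    show "(\<integral>\<^sup>+\<omega>. ennreal ((1 + (B\<xi> + rsup T Z \<omega>) ^ D) ^ (2 * r)) \<partial>M) \<le> ennreal (2 ^ (2 * r) * (1 + 2 ^ (2 * r * D) * (B\<xi> ^ (2 * r * D) + C)))"
      if adm: "admissible f H Z" for f H Z
      using C(2)[OF adm] unfolding mult.assoc[symmetric]
      by (intro nn_integral_poly_le[OF prob_space_axioms rsup_admissible_measurable[OF adm] rsup_nonneg B\<xi>0 C(1)])
  qed
qed

text \<open>Both coefficients are bounded by a random variable \<open>\<Phi>\<close> that does not depend on time and has moments of all orders.  Over an interval of length
\<open>h\<close> the drift then contributes \<open>h\<^sup>2\<^sup>r\<close> and the noise \<open>h\<^sup>r\<^sup>-\<^sup>1 h\<close>.\<close>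

lemma admissible_increments:
  assumes r: "even r" "1 \<le> r"
  obtains C where "0 \<le> C" "\<And>f H Z s t. admissible f H Z \<Longrightarrow> 0 \<le> s \<Longrightarrow> s \<le> t \<Longrightarrow> t \<le> T \<Longrightarrow> t - s \<le> 1 \<Longrightarrow>
    (\<integral>\<^sup>+\<omega>. ennreal (norm (Z t \<omega> - Z s \<omega>) ^ (2 * r)) \<partial>M) \<le> ennreal (C * (t - s) ^ r)"
proof -
  let ?p = "2 * r"
  define V where "V = vec_const (CARD('n) * CARD('m)) r"
  have V0: "0 \<le> V" by (simp add: V_def vec_const_nonneg)
  obtain C where C: "0 \<le> C" "\<And>f H Z. admissible f H Z \<Longrightarrow> (\<integral>\<^sup>+\<omega>. ennreal ((1 + (B\<xi> + rsup T Z \<omega>) ^ (d + 1)) ^ ?p) \<partial>M) \<le> ennreal C"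
    using admissible_poly_moments[OF r, of "d + 1"] by auto
  define C' where "C' = (L + G) ^ ?p * C"
  have C'0: "0 \<le> C'" using L0 G0 C by (simp add: C'_def)
  have main: "(\<integral>\<^sup>+\<omega>. ennreal (norm (Z t \<omega> - Z s \<omega>) ^ ?p) \<partial>M) \<le> ennreal (2 ^ ?p * (C' + V * C') * (t - s) ^ r)"
    if adm: "admissible f H Z" and s: "0 \<le> s" "s \<le> t" "t \<le> T" "t - s \<le> 1" for f H Z s t
  proof (cases "s = t")
    case True
    obtain r' where "r = Suc r'" using r by (cases r) auto
    then show ?thesis using True by simp
  next
    case False
    then have st: "s < t" using s by simp
    obtain I where lim: "ito_limit M F W T H I"
      and mF: "\<And>u. u \<in> {0..T} \<Longrightarrow> Z u \<in> borel_measurable (F u)"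
      and cont: "AE \<omega> in M. continuous_on {0..T} (\<lambda>u. Z u \<omega>)"
      and x: "AE \<omega> in M. \<forall>\<theta>\<in>{-\<tau>..0}. Z \<theta> \<omega> = \<xi> \<theta> \<omega>"
      and int: "AE \<omega> in M. set_integrable lborel {0..T} (\<lambda>u. f u \<omega>)"
      and inc: "AE \<omega> in M. ito_increments T Z f I \<omega>"
      by (rule ito_processD[OF conjunct1[OF adm[unfolded admissible_def]] T0 \<tau>0], rule that; assumption)
    interpret controlled_ito M F W T H I "\<lambda>u \<omega>. norm (Z u \<omega>)" by (rule admissible_controlled[OF adm lim])
    let ?m = "rsup T Z"
    define \<Phi> where "\<Phi> \<omega> = (L + G) * (1 + (B\<xi> + ?m \<omega>) ^ (d + 1))" for \<omega>
    have \<Phi>0: "0 \<le> \<Phi> \<omega>" for \<omega>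
      unfolding \<Phi>_def using L0 G0 B\<xi>0 rsup_nonneg[of T Z \<omega>] by (intro mult_nonneg_nonneg add_nonneg_nonneg zero_le_power) auto
    have \<Phi>m: "\<Phi> \<in> borel_measurable M"
      unfolding \<Phi>_def[abs_def] using rsup_admissible_measurable[OF adm] by measurable
    have \<Phi>C: "(\<integral>\<^sup>+\<omega>. ennreal (\<Phi> \<omega> ^ ?p) \<partial>M) \<le> ennreal C'"
    proof -
      have "(\<integral>\<^sup>+\<omega>. ennreal (\<Phi> \<omega> ^ ?p) \<partial>M) = (\<integral>\<^sup>+\<omega>. ennreal ((L + G) ^ ?p) * ennreal ((1 + (B\<xi> + ?m \<omega>) ^ (d + 1)) ^ ?p) \<partial>M)"
        by (rule nn_integral_cong) (simp add: \<Phi>_def power_mult_distrib ennreal_mult L0 G0 B\<xi>0 rsup_nonneg)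
      also have "\<dots> = ennreal ((L + G) ^ ?p) * (\<integral>\<^sup>+\<omega>. ennreal ((1 + (B\<xi> + ?m \<omega>) ^ (d + 1)) ^ ?p) \<partial>M)"
        using rsup_admissible_measurable[OF adm] by (intro nn_integral_cmult) measurable
      also have "\<dots> \<le> ennreal ((L + G) ^ ?p) * ennreal C" by (intro mult_left_mono C(2)[OF adm]) simp
      also have "\<dots> = ennreal C'" unfolding C'_def using L0 G0 C by (intro ennreal_mult[symmetric]) auto
      finally show ?thesis .
    qed
    have bd: "AE \<omega> in M. \<forall>u\<in>{0..T}. norm (f u \<omega>) \<le> \<Phi> \<omega> \<and> norm (H u \<omega>) \<le> \<Phi> \<omega>"
      using admissible_growth[OF adm] cont
    proof eventually_elim
      fix \<omega> assume g: "delay_growth f H Z \<omega>"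
        and cont: "continuous_on {0..T} (\<lambda>u. Z u \<omega>)"
      have le: "norm (Z u \<omega>) \<le> ?m \<omega>" if "u \<in> {0..T}" for u
        using T0 cont that by (intro rsup_attained(2)) auto
      have "?m \<omega> \<le> 1 + (B\<xi> + ?m \<omega>) ^ (d + 1)"
      proof (cases "B\<xi> + ?m \<omega> \<le> 1")
        case True
        have "0 \<le> (B\<xi> + ?m \<omega>) ^ (d + 1)" using B\<xi>0 rsup_nonneg[of T Z \<omega>] by (intro zero_le_power) simp
        then show ?thesis using True B\<xi>0 by linarith
      next
        case False
        then have "(B\<xi> + ?m \<omega>) ^ 1 \<le> (B\<xi> + ?m \<omega>) ^ (d + 1)" by (intro power_increasing) auto
        then show ?thesis using B\<xi>0 by simp
      qed
      then have Lm: "L * ?m \<omega> + G * (1 + (B\<xi> + ?m \<omega>) ^ (d + 1)) \<le> \<Phi> \<omega>"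
        using L0 unfolding \<Phi>_def distrib_right by (intro add_right_mono mult_left_mono)
      show "\<forall>u\<in>{0..T}. norm (f u \<omega>) \<le> \<Phi> \<omega> \<and> norm (H u \<omega>) \<le> \<Phi> \<omega>"
      proof
        fix u assume u: "u \<in> {0..T}"
        have "norm (f u \<omega>) \<le> L * ?m \<omega> + G * (1 + (B\<xi> + ?m \<omega>) ^ (d + 1)) \<and> norm (H u \<omega>) \<le> L * ?m \<omega> + G * (1 + (B\<xi> + ?m \<omega>) ^ (d + 1))"
          by (rule g[unfolded delay_growth_def, rule_format, OF u]) (use le u \<tau>0 rsup_nonneg in auto)
        then show "norm (f u \<omega>) \<le> \<Phi> \<omega> \<and> norm (H u \<omega>) \<le> \<Phi> \<omega>" using Lm by linarith
      qed
    qed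
    let ?h = "t - s"
    have h0: "0 \<le> ?h" using s by simp
    have hr: "?h ^ (r - 1) * ?h = ?h ^ r" using r by (cases r) auto
    have Im: "I t \<in> borel_measurable M" "I s \<in> borel_measurable M" using s by (auto intro!: I_measurable)
    have "(\<integral>\<^sup>+\<omega>. ennreal (norm (I t \<omega> - I s \<omega>) ^ ?p) \<partial>M) \<le> ennreal (V * ?h ^ (r - 1)) * (\<integral>\<^sup>+\<omega>. ennreal ?h * ennreal (\<Phi> \<omega> ^ ?p) \<partial>M)"
      unfolding V_def
    proof (rule increment_moment[OF s(1) st s(3) r])
      show "(\<lambda>\<omega>. ennreal ?h * ennreal (\<Phi> \<omega> ^ ?p)) \<in> borel_measurable M" using \<Phi>m by measurable
      show "AE \<omega> in M. (\<integral>\<^sup>+u\<in>{s..t}. ennreal (norm (H u \<omega>) ^ ?p) \<partial>lborel) \<le> ennreal ?h * ennreal (\<Phi> \<omega> ^ ?p)"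
        using bd
      proof eventually_elim
        fix \<omega> assume b: "\<forall>u\<in>{0..T}. norm (f u \<omega>) \<le> \<Phi> \<omega> \<and> norm (H u \<omega>) \<le> \<Phi> \<omega>"
        have "(\<integral>\<^sup>+u\<in>{s..t}. ennreal (norm (H u \<omega>) ^ ?p) \<partial>lborel) \<le> (\<integral>\<^sup>+u. ennreal (\<Phi> \<omega> ^ ?p) * indicator {s..t} u \<partial>lborel)"
          by (rule nn_integral_mono) (use b s in \<open>auto simp: indicator_def intro!: ennreal_leI power_mono\<close>)
        also have "\<dots> = ennreal (\<Phi> \<omega> ^ ?p) * ennreal ?h" using s by (subst nn_integral_cmult_indicator) auto
        finally show "(\<integral>\<^sup>+u\<in>{s..t}. ennreal (norm (H u \<omega>) ^ ?p) \<partial>lborel) \<le> ennreal ?h * ennreal (\<Phi> \<omega> ^ ?p)" by (simp only: mult.commute)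
      qed
    qed
    also have "(\<integral>\<^sup>+\<omega>. ennreal ?h * ennreal (\<Phi> \<omega> ^ ?p) \<partial>M) = ennreal ?h * (\<integral>\<^sup>+\<omega>. ennreal (\<Phi> \<omega> ^ ?p) \<partial>M)"
      using \<Phi>m by (intro nn_integral_cmult) measurable
    also have "ennreal (V * ?h ^ (r - 1)) * (ennreal ?h * (\<integral>\<^sup>+\<omega>. ennreal (\<Phi> \<omega> ^ ?p) \<partial>M)) \<le> ennreal (V * ?h ^ (r - 1)) * (ennreal ?h * ennreal C')"
      by (intro mult_left_mono \<Phi>C) simp_all
    also have "\<dots> = ennreal (V * ?h ^ (r - 1) * (?h * C'))"
      using V0 h0 C'0 by (simp only: ennreal_mult mult_nonneg_nonneg zero_le_power)
    also have "V * ?h ^ (r - 1) * (?h * C') = V * C' * ?h ^ r" unfolding hr[symmetric] by (simp only: mult_ac)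
    finally have noise: "(\<integral>\<^sup>+\<omega>. ennreal (norm (I t \<omega> - I s \<omega>) ^ ?p) \<partial>M) \<le> ennreal (V * C' * ?h ^ r)" .
    have "AE \<omega> in M. ennreal (norm (Z t \<omega> - Z s \<omega>) ^ ?p) \<le> ennreal (2 ^ ?p) * (ennreal (?h ^ r) * ennreal (\<Phi> \<omega> ^ ?p) + ennreal (norm (I t \<omega> - I s \<omega>) ^ ?p))"
      using bd inc
    proof eventually_elim
      fix \<omega> assume b: "\<forall>u\<in>{0..T}. norm (f u \<omega>) \<le> \<Phi> \<omega> \<and> norm (H u \<omega>) \<le> \<Phi> \<omega>"
        and inc: "ito_increments T Z f I \<omega>"
      let ?a = "norm (LINT u:{s..t}|lborel. f u \<omega>)" and ?d = "norm (I t \<omega> - I s \<omega>)"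
      have "ennreal ?a \<le> (\<integral>\<^sup>+u\<in>{s..t}. ennreal (norm (f u \<omega>)) \<partial>lborel)" by (rule norm_set_integral_le)
      also have "\<dots> \<le> (\<integral>\<^sup>+u. ennreal (\<Phi> \<omega>) * indicator {s..t} u \<partial>lborel)"
        by (rule nn_integral_mono) (use b s in \<open>auto simp: indicator_def intro!: ennreal_leI\<close>)
      also have "\<dots> = ennreal (\<Phi> \<omega>) * ennreal ?h" using s by (subst nn_integral_cmult_indicator) auto
      also have "\<dots> = ennreal (\<Phi> \<omega> * ?h)" using \<Phi>0 h0 by (intro ennreal_mult[symmetric])
      finally have a: "?a \<le> \<Phi> \<omega> * ?h" using \<Phi>0[of \<omega>] h0 by (subst (asm) ennreal_le_iff) auto
      have "?a ^ ?p \<le> (\<Phi> \<omega> * ?h) ^ ?p" by (rule power_mono[OF a]) simp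
      also have "\<dots> = ?h ^ ?p * \<Phi> \<omega> ^ ?p" by (simp only: power_mult_distrib mult.commute)
      also have "\<dots> \<le> ?h ^ r * \<Phi> \<omega> ^ ?p"
        using h0 s(4) \<Phi>0[of \<omega>] by (intro mult_right_mono power_decreasing zero_le_power) auto
      finally have ap: "?a ^ ?p \<le> ?h ^ r * \<Phi> \<omega> ^ ?p" .
      have "Z t \<omega> - Z s \<omega> = (LINT u:{s..t}|lborel. f u \<omega>) + (I t \<omega> - I s \<omega>)"
        using ito_incrementsD[OF inc, of s t] s by simp
      then have "norm (Z t \<omega> - Z s \<omega>) \<le> ?a + ?d" using norm_triangle_ineq by metis
      then have "norm (Z t \<omega> - Z s \<omega>) ^ ?p \<le> (?a + ?d) ^ ?p" by (rule power_mono) simp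
      also have "\<dots> \<le> 2 ^ ?p * (?a ^ ?p + ?d ^ ?p)" by (rule add_power_le) auto
      also have "\<dots> \<le> 2 ^ ?p * (?h ^ r * \<Phi> \<omega> ^ ?p + ?d ^ ?p)" using ap by (intro mult_left_mono add_right_mono) auto
      finally have "ennreal (norm (Z t \<omega> - Z s \<omega>) ^ ?p) \<le> ennreal (2 ^ ?p * (?h ^ r * \<Phi> \<omega> ^ ?p + ?d ^ ?p))" by (rule ennreal_leI)
      also have "\<dots> = ennreal (2 ^ ?p) * (ennreal (?h ^ r) * ennreal (\<Phi> \<omega> ^ ?p) + ennreal (?d ^ ?p))"
        using h0 \<Phi>0[of \<omega>] by (simp only: ennreal_mult ennreal_plus mult_nonneg_nonneg add_nonneg_nonneg zero_le_power zero_le_numeral norm_ge_zero)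
      finally show "ennreal (norm (Z t \<omega> - Z s \<omega>) ^ ?p) \<le> ennreal (2 ^ ?p) * (ennreal (?h ^ r) * ennreal (\<Phi> \<omega> ^ ?p) + ennreal (?d ^ ?p))" .
    qed
    then have "(\<integral>\<^sup>+\<omega>. ennreal (norm (Z t \<omega> - Z s \<omega>) ^ ?p) \<partial>M)
      \<le> (\<integral>\<^sup>+\<omega>. ennreal (2 ^ ?p) * (ennreal (?h ^ r) * ennreal (\<Phi> \<omega> ^ ?p) + ennreal (norm (I t \<omega> - I s \<omega>) ^ ?p)) \<partial>M)"
      by (rule nn_integral_mono_AE)
    also have "\<dots> = ennreal (2 ^ ?p) * (ennreal (?h ^ r) * (\<integral>\<^sup>+\<omega>. ennreal (\<Phi> \<omega> ^ ?p) \<partial>M) + (\<integral>\<^sup>+\<omega>. ennreal (norm (I t \<omega> - I s \<omega>) ^ ?p) \<partial>M))"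
      using \<Phi>m Im by (simp add: nn_integral_cmult nn_integral_add)
    also have "\<dots> \<le> ennreal (2 ^ ?p) * (ennreal (?h ^ r) * ennreal C' + ennreal (V * C' * ?h ^ r))"
      by (intro mult_left_mono add_mono \<Phi>C noise) simp_all
    also have "\<dots> = ennreal (2 ^ ?p * (?h ^ r * C' + V * C' * ?h ^ r))"
      using V0 h0 C'0 by (simp only: ennreal_mult ennreal_plus mult_nonneg_nonneg add_nonneg_nonneg zero_le_power zero_le_numeral)
    also have "2 ^ ?p * (?h ^ r * C' + V * C' * ?h ^ r) = 2 ^ ?p * (C' + V * C') * ?h ^ r" by (simp add: algebra_simps)
    finally show ?thesis .
  qed
  show thesis
  proof (rule that)
    show "0 \<le> 2 ^ ?p * (C' + V * C')" using C'0 V0 by simp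
  qed (rule main)
qed

end

section \<open>Measurability of the discretisation error\<close>

definition clip :: "real \<Rightarrow> real \<Rightarrow> real" where "clip T u = max 0 (min T u)"

lemma clip: "0 \<le> T \<Longrightarrow> clip T u \<in> {0..T}" "u \<in> {0..T} \<Longrightarrow> clip T u = u"
  by (auto simp: clip_def)

lemma continuous_modification:
  fixes Z :: "real \<Rightarrow> 'a \<Rightarrow> 'b::euclidean_space"
  assumes m: "\<And>u. u \<in> {0..T} \<Longrightarrow> Z u \<in> borel_measurable M"
    and c: "AE \<omega> in M. continuous_on {0..T} (\<lambda>u. Z u \<omega>)"
  obtains Z' :: "real \<Rightarrow> 'a \<Rightarrow> 'b" where "\<And>u. u \<in> {0..T} \<Longrightarrow> Z' u \<in> borel_measurable M"
    "\<And>\<omega>. \<omega> \<in> space M \<Longrightarrow> continuous_on {0..T} (\<lambda>u. Z' u \<omega>)"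
    "AE \<omega> in M. \<forall>u. Z' u \<omega> = Z u \<omega>"
proof -
  obtain E where E: "{\<omega> \<in> space M. \<not> continuous_on {0..T} (\<lambda>u. Z u \<omega>)} \<subseteq> E" "E \<in> sets M" "emeasure M E = 0"
    using AE_E[OF c] by metis
  define Z' where "Z' u \<omega> = (if \<omega> \<in> E then 0 else Z u \<omega>)" for u \<omega>
  show thesis
  proof (rule that)
    show "Z' u \<in> borel_measurable M" if "u \<in> {0..T}" for u
    proof -
      note [measurable] = m[OF that] E(2)
      show ?thesis unfolding Z'_def[abs_def] by measurable
    qed
    show "continuous_on {0..T} (\<lambda>u. Z' u \<omega>)" if "\<omega> \<in> space M" for \<omega>
      using E(1) that by (cases "\<omega> \<in> E") (auto simp: Z'_def)
    have "AE \<omega> in M. \<omega> \<notin> E" by (rule AE_not_in) (use E in \<open>auto simp: null_sets_def\<close>)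
    then show "AE \<omega> in M. \<forall>u. Z' u \<omega> = Z u \<omega>" by eventually_elim (simp add: Z'_def)
  qed
qed

lemma floor_grid_measurable:
  fixes Z :: "real \<Rightarrow> 'a \<Rightarrow> 'b::euclidean_space"
  assumes m: "\<And>i::int. Z (g i) \<in> borel_measurable M" and h: "h \<in> borel_measurable borel"
  shows "(\<lambda>(\<omega>, u). Z (g \<lfloor>h u :: real\<rfloor>) \<omega>) \<in> borel_measurable (M \<Otimes>\<^sub>M lborel)"
proof -
  have "(\<lambda>z. (\<lambda>i z. Z (g i) (fst z)) ((\<lambda>z. \<lfloor>h (snd z)\<rfloor>) z) z) \<in> borel_measurable (M \<Otimes>\<^sub>M lborel)"
  proof (rule measurable_compose_countable)
    show "(\<lambda>z. Z (g i) (fst z)) \<in> borel_measurable (M \<Otimes>\<^sub>M lborel)" for i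
      by (rule measurable_compose[OF measurable_fst m])
    show "(\<lambda>z. \<lfloor>h (snd z)\<rfloor>) \<in> (M \<Otimes>\<^sub>M lborel) \<rightarrow>\<^sub>M count_space UNIV"
      using h by measurable
  qed
  then show ?thesis by (simp add: case_prod_beta)
qed

text \<open>The path is the limit of its values at the times \<open>\<lfloor>n u\<rfloor> / n\<close>, which are countably many for each \<open>n\<close>.\<close>

lemma continuous_process_measurable:
  fixes Z :: "real \<Rightarrow> 'a \<Rightarrow> 'b::euclidean_space"
  assumes T: "0 \<le> T" and m: "\<And>u. u \<in> {0..T} \<Longrightarrow> Z u \<in> borel_measurable M"
    and c: "\<And>\<omega>. \<omega> \<in> space M \<Longrightarrow> continuous_on {0..T} (\<lambda>u. Z u \<omega>)"
  shows "(\<lambda>(\<omega>, u). Z (clip T u) \<omega>) \<in> borel_measurable (M \<Otimes>\<^sub>M lborel)"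
proof (rule borel_measurable_LIMSEQ_metric)
  fix n :: nat
  show "(\<lambda>(\<omega>, u). Z (clip T (of_int \<lfloor>real (Suc n) * u\<rfloor> / real (Suc n))) \<omega>) \<in> borel_measurable (M \<Otimes>\<^sub>M lborel)"
    by (rule floor_grid_measurable[where g = "\<lambda>i. clip T (of_int i / real (Suc n))"]) (use m clip(1)[OF T] in auto)
next
  fix z :: "'a \<times> real" assume "z \<in> space (M \<Otimes>\<^sub>M lborel)"
  then obtain \<omega> u where z: "z = (\<omega>, u)" and \<omega>: "\<omega> \<in> space M" by (auto simp: space_pair_measure)
  have "(\<lambda>n. of_int \<lfloor>real (Suc n) * u\<rfloor> / real (Suc n)) \<longlonglongrightarrow> u"
  proof (rule tendsto_sandwich)
    show "\<forall>\<^sub>F n in sequentially. u - 1 / real (Suc n) \<le> of_int \<lfloor>real (Suc n) * u\<rfloor> / real (Suc n)"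
    proof (intro always_eventually allI)
      fix n
      have "real (Suc n) * u - 1 \<le> of_int \<lfloor>real (Suc n) * u\<rfloor>" by linarith
      then have "(real (Suc n) * u - 1) / real (Suc n) \<le> of_int \<lfloor>real (Suc n) * u\<rfloor> / real (Suc n)" by (rule divide_right_mono) simp
      then show "u - 1 / real (Suc n) \<le> of_int \<lfloor>real (Suc n) * u\<rfloor> / real (Suc n)" by (simp add: diff_divide_distrib)
    qed
    show "\<forall>\<^sub>F n in sequentially. of_int \<lfloor>real (Suc n) * u\<rfloor> / real (Suc n) \<le> u"
    proof (intro always_eventually allI)
      fix n
      have "of_int \<lfloor>real (Suc n) * u\<rfloor> \<le> real (Suc n) * u" by linarith
      then have "of_int \<lfloor>real (Suc n) * u\<rfloor> / real (Suc n) \<le> (real (Suc n) * u) / real (Suc n)" by (rule divide_right_mono) simp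
      then show "of_int \<lfloor>real (Suc n) * u\<rfloor> / real (Suc n) \<le> u" by simp
    qed
    have "(\<lambda>n. u - 1 / real (Suc n)) \<longlonglongrightarrow> u - 0"
      by (intro tendsto_diff tendsto_const) (rule LIMSEQ_Suc[OF lim_const_over_n])
    then show "(\<lambda>n. u - 1 / real (Suc n)) \<longlonglongrightarrow> u" by simp
  qed simp
  then have "(\<lambda>n. clip T (of_int \<lfloor>real (Suc n) * u\<rfloor> / real (Suc n))) \<longlonglongrightarrow> clip T u"
    unfolding clip_def by (intro tendsto_max tendsto_min tendsto_const)
  then have "(\<lambda>n. Z (clip T (of_int \<lfloor>real (Suc n) * u\<rfloor> / real (Suc n))) \<omega>) \<longlonglongrightarrow> Z (clip T u) \<omega>"
    using clip(1)[OF T] by (intro continuous_on_tendsto_compose[OF c[OF \<omega>]]) auto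
  then show "(\<lambda>n. case z of (\<omega>, u) \<Rightarrow> Z (clip T (of_int \<lfloor>real (Suc n) * u\<rfloor> / real (Suc n))) \<omega>)
      \<longlonglongrightarrow> (case z of (\<omega>, u) \<Rightarrow> Z (clip T u) \<omega>)" by (simp add: z)
qed

section \<open>The error of the Euler--Maruyama scheme\<close>

lemma floor_grid_bounds:
  assumes "0 \<le> v" "0 < (\<delta>::real)"
  shows "0 \<le> of_int \<lfloor>v / \<delta>\<rfloor> * \<delta>" "of_int \<lfloor>v / \<delta>\<rfloor> * \<delta> \<le> v" "v - of_int \<lfloor>v / \<delta>\<rfloor> * \<delta> \<le> \<delta>"
proof -
  have "0 \<le> v / \<delta>" using assms by simp
  then show "0 \<le> of_int \<lfloor>v / \<delta>\<rfloor> * \<delta>" using assms by simp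
  have "of_int \<lfloor>v / \<delta>\<rfloor> * \<delta> \<le> v / \<delta> * \<delta>"
    using assms(2) by (intro mult_right_mono of_int_floor_le) simp
  then show "of_int \<lfloor>v / \<delta>\<rfloor> * \<delta> \<le> v" using assms(2) by simp
  have "v / \<delta> \<le> of_int \<lfloor>v / \<delta>\<rfloor> + 1" by linarith
  then show "v - of_int \<lfloor>v / \<delta>\<rfloor> * \<delta> \<le> \<delta>"
    using assms(2) by (simp add: field_simps)
qed

lemma mult_le_weighted_squares:
  fixes x y \<epsilon> :: real
  assumes "0 < \<epsilon>"
  shows "x * y \<le> \<epsilon> * x\<^sup>2 + y\<^sup>2 / \<epsilon>"
proof -
  have "0 \<le> (\<epsilon> * x - y)\<^sup>2" by simp
  then have "2 * (\<epsilon> * (x * y)) \<le> (\<epsilon> * x)\<^sup>2 + y\<^sup>2" by (simp add: power2_diff algebra_simps)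
  moreover have "0 \<le> (\<epsilon> * x)\<^sup>2 + y\<^sup>2" by simp
  ultimately have "\<epsilon> * (x * y) \<le> (\<epsilon> * x)\<^sup>2 + y\<^sup>2" by linarith
  then show ?thesis using assms by (simp add: field_simps power2_eq_square)
qed

context sdde_coefficients
begin

lemma solution_admissible:
  assumes "sdde_solution M F W \<tau> T b \<sigma> \<xi> X"
  shows "admissible (\<lambda>t \<omega>. b (X t \<omega>) (X (t - \<tau>) \<omega>)) (\<lambda>t \<omega>. \<sigma> (X t \<omega>) (X (t - \<tau>) \<omega>)) X"
  unfolding admissible_def
proof (intro conjI AE_I2 ballI)
  show "ito_process M F W \<tau> T \<xi> (\<lambda>t \<omega>. b (X t \<omega>) (X (t - \<tau>) \<omega>)) (\<lambda>t \<omega>. \<sigma> (X t \<omega>) (X (t - \<tau>) \<omega>)) X"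
    using assms by (simp only: sdde_solution_def)
  fix \<omega> t assume "t \<in> {0..T}"
  then show "\<exists>u\<in>{0..t}. \<exists>w\<in>{-\<tau>..t - \<tau>}. b (X t \<omega>) (X (t - \<tau>) \<omega>) = b (X u \<omega>) (X w \<omega>) \<and> \<sigma> (X t \<omega>) (X (t - \<tau>) \<omega>) = \<sigma> (X u \<omega>) (X w \<omega>)"
    by (intro bexI[of _ t] bexI[of _ "t - \<tau>"]) auto
qed

lemma em_step_on_grid:
  assumes "0 < \<delta>" "0 \<le> v" "Y 0 \<omega> = \<xi> 0 \<omega>"
  shows "em_step \<delta> \<xi> Y v \<omega> = Y (of_int \<lfloor>v / \<delta>\<rfloor> * \<delta>) \<omega>"
  using assms by (cases "v = 0") (simp_all add: em_step_def)

lemma em_admissible: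
  assumes em: "euler_maruyama M F W \<tau> T b \<sigma> \<xi> \<delta> Y" and \<delta>: "0 < \<delta>"
  shows "admissible (\<lambda>t \<omega>. b (em_step \<delta> \<xi> Y t \<omega>) (em_step \<delta> \<xi> Y (t - \<tau>) \<omega>))
    (\<lambda>t \<omega>. \<sigma> (em_step \<delta> \<xi> Y t \<omega>) (em_step \<delta> \<xi> Y (t - \<tau>) \<omega>)) Y" (is "admissible ?f ?H Y")
  unfolding admissible_def
proof
  show ip: "ito_process M F W \<tau> T \<xi> ?f ?H Y" using em by (simp only: euler_maruyama_def)
  have x: "AE \<omega> in M. \<forall>\<theta>\<in>{-\<tau>..0}. Y \<theta> \<omega> = \<xi> \<theta> \<omega>" using ip unfolding ito_process_def by blast
  then show "AE \<omega> in M. \<forall>t\<in>{0..T}. \<exists>u\<in>{0..t}. \<exists>w\<in>{-\<tau>..t - \<tau>}. ?f t \<omega> = b (Y u \<omega>) (Y w \<omega>) \<and> ?H t \<omega> = \<sigma> (Y u \<omega>) (Y w \<omega>)"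
  proof eventually_elim
    fix \<omega> assume x: "\<forall>\<theta>\<in>{-\<tau>..0}. Y \<theta> \<omega> = \<xi> \<theta> \<omega>"
    have Y0: "Y 0 \<omega> = \<xi> 0 \<omega>" by (rule bspec[OF x]) (use \<tau>0 in simp)
    note on_grid = em_step_on_grid[of \<delta> _ Y \<omega>, OF \<delta> _ Y0]
    show "\<forall>t\<in>{0..T}. \<exists>u\<in>{0..t}. \<exists>w\<in>{-\<tau>..t - \<tau>}. ?f t \<omega> = b (Y u \<omega>) (Y w \<omega>) \<and> ?H t \<omega> = \<sigma> (Y u \<omega>) (Y w \<omega>)"
    proof
      fix t assume t: "t \<in> {0..T}"
      have 1: "\<exists>u\<in>{0..t}. em_step \<delta> \<xi> Y t \<omega> = Y u \<omega>"
        using on_grid[of t] floor_grid_bounds[OF _ \<delta>, of t] t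
        by (intro bexI[of _ "of_int \<lfloor>t / \<delta>\<rfloor> * \<delta>"]) auto
      have 2: "\<exists>w\<in>{-\<tau>..t - \<tau>}. em_step \<delta> \<xi> Y (t - \<tau>) \<omega> = Y w \<omega>"
      proof (cases "t - \<tau> \<le> 0")
        case True
        have "Y (t - \<tau>) \<omega> = \<xi> (t - \<tau>) \<omega>" by (rule bspec[OF x]) (use True t in simp)
        then show ?thesis using True t by (intro bexI[of _ "t - \<tau>"]) (auto simp: em_step_def)
      next
        case False
        then have w0: "0 \<le> t - \<tau>" by simp
        have "of_int \<lfloor>(t - \<tau>) / \<delta>\<rfloor> * \<delta> \<in> {-\<tau>..t - \<tau>}"
          using floor_grid_bounds(1,2)[OF w0 \<delta>] \<tau>0 unfolding atLeastAtMost_iff by linarith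
        then show ?thesis using on_grid[OF w0] by blast
      qed
      obtain u w where uw: "u \<in> {0..t}" "em_step \<delta> \<xi> Y t \<omega> = Y u \<omega>" "w \<in> {-\<tau>..t - \<tau>}" "em_step \<delta> \<xi> Y (t - \<tau>) \<omega> = Y w \<omega>"
        using 1 2 by blast
      show "\<exists>u\<in>{0..t}. \<exists>w\<in>{-\<tau>..t - \<tau>}. ?f t \<omega> = b (Y u \<omega>) (Y w \<omega>) \<and> ?H t \<omega> = \<sigma> (Y u \<omega>) (Y w \<omega>)"
        unfolding uw(2,4) using uw(1,3) by blast
    qed
  qed
qed

text \<open>The paths of \<open>Y\<close> are continuous only almost surely, and the integral over time of the distance to the step process is to be treated with
Fubini's theorem.  The jointly measurable process \<open>D\<close> agrees with this distance outside a null set; it is obtained from a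
continuous modification.  Its moments are bounded for every real \<open>u\<close>, since times outside \<open>[0, T]\<close> are
replaced by the nearer end point; this allows arguments \<open>u - \<tau>\<close> that are negative.\<close>

lemma discretisation_error:
  assumes em: "euler_maruyama M F W \<tau> T b \<sigma> \<xi> \<delta> Y" and \<delta>: "0 < \<delta>" "\<delta> < 1"
  obtains D :: "'a \<Rightarrow> real \<Rightarrow> real" where "case_prod D \<in> borel_measurable (M \<Otimes>\<^sub>M lborel)" "\<And>\<omega> u. 0 \<le> D \<omega> u"
    "AE \<omega> in M. \<forall>u\<in>{0..T}. norm (Y u \<omega> - em_step \<delta> \<xi> Y u \<omega>) = D \<omega> u"
    "\<And>C r u. 0 \<le> C \<Longrightarrow> (\<And>s t. 0 \<le> s \<Longrightarrow> s \<le> t \<Longrightarrow> t \<le> T \<Longrightarrow> t - s \<le> 1 \<Longrightarrow>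
       (\<integral>\<^sup>+\<omega>. ennreal (norm (Y t \<omega> - Y s \<omega>) ^ (2 * r)) \<partial>M) \<le> ennreal (C * (t - s) ^ r)) \<Longrightarrow>
       (\<integral>\<^sup>+\<omega>. ennreal (D \<omega> u ^ (2 * r)) \<partial>M) \<le> ennreal (C * \<delta> ^ r)"
proof -
  note adm = em_admissible[OF em \<delta>(1)]
  obtain I :: "real \<Rightarrow> 'a \<Rightarrow> real ^ 'n" where mF: "\<And>u. u \<in> {0..T} \<Longrightarrow> Y u \<in> borel_measurable (F u)"
    and cont: "AE \<omega> in M. continuous_on {0..T} (\<lambda>u. Y u \<omega>)"
    and x: "AE \<omega> in M. \<forall>\<theta>\<in>{-\<tau>..0}. Y \<theta> \<omega> = \<xi> \<theta> \<omega>"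
    by (rule ito_processD[OF conjunct1[OF adm[unfolded admissible_def]] T0 \<tau>0], rule that; assumption)
  obtain Y' :: "real \<Rightarrow> 'a \<Rightarrow> real ^ 'n" where Y': "\<And>u. u \<in> {0..T} \<Longrightarrow> Y' u \<in> borel_measurable M"
    "\<And>\<omega>. \<omega> \<in> space M \<Longrightarrow> continuous_on {0..T} (\<lambda>u. Y' u \<omega>)"
    and YY: "AE \<omega> in M. \<forall>u. Y' u \<omega> = Y u \<omega>"
    by (rule continuous_modification[OF measurable_F[OF mF] cont], assumption, rule that; assumption)
  define h where "h u = clip T u" for u
  have T0': "0 \<le> T" using T0 by simp
  have h: "h u \<in> {0..T}" for u unfolding h_def by (rule clip(1)[OF T0'])
  have hm: "(\<lambda>u. h u / \<delta>) \<in> borel_measurable borel" unfolding h_def clip_def by measurable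
  have hg: "of_int \<lfloor>h u / \<delta>\<rfloor> * \<delta> \<in> {0..T}" for u
    using floor_grid_bounds[OF _ \<delta>(1), of "h u"] h[of u] by auto
  define D where "D \<omega> u = norm (Y' (h u) \<omega> - Y' (clip T (of_int \<lfloor>h u / \<delta>\<rfloor> * \<delta>)) \<omega>)" for \<omega> u
  have D: "D \<omega> u = norm (Y' (h u) \<omega> - Y' (of_int \<lfloor>h u / \<delta>\<rfloor> * \<delta>) \<omega>)" for \<omega> u
    unfolding D_def clip(2)[OF hg] ..
  have "(\<lambda>(\<omega>, u). Y' (h u) \<omega>) \<in> borel_measurable (M \<Otimes>\<^sub>M lborel)"
    unfolding h_def by (rule continuous_process_measurable[OF T0' Y'])
  moreover have "(\<lambda>(\<omega>, u). Y' (clip T (of_int \<lfloor>h u / \<delta>\<rfloor> * \<delta>)) \<omega>) \<in> borel_measurable (M \<Otimes>\<^sub>M lborel)"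
    by (rule floor_grid_measurable[where g = "\<lambda>i. clip T (of_int i * \<delta>)" and h = "\<lambda>u. h u / \<delta>", OF _ hm])
       (rule Y'(1)[OF clip(1)[OF T0']])
  ultimately have "(\<lambda>z. norm ((\<lambda>(\<omega>, u). Y' (h u) \<omega>) z - (\<lambda>(\<omega>, u). Y' (clip T (of_int \<lfloor>h u / \<delta>\<rfloor> * \<delta>)) \<omega>) z)) \<in> borel_measurable (M \<Otimes>\<^sub>M lborel)"
    by measurable
  then have Dm: "case_prod D \<in> borel_measurable (M \<Otimes>\<^sub>M lborel)" by (simp add: case_prod_beta' D_def)
  show thesis
  proof (rule that[OF Dm])
    show "0 \<le> D \<omega> u" for \<omega> u by (simp add: D_def)
    show "AE \<omega> in M. \<forall>u\<in>{0..T}. norm (Y u \<omega> - em_step \<delta> \<xi> Y u \<omega>) = D \<omega> u"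
      using YY x
    proof eventually_elim
      fix \<omega> assume YY: "\<forall>u. Y' u \<omega> = Y u \<omega>" and x: "\<forall>\<theta>\<in>{-\<tau>..0}. Y \<theta> \<omega> = \<xi> \<theta> \<omega>"
      have Y0: "Y 0 \<omega> = \<xi> 0 \<omega>" by (rule bspec[OF x]) (use \<tau>0 in simp)
      show "\<forall>u\<in>{0..T}. norm (Y u \<omega> - em_step \<delta> \<xi> Y u \<omega>) = D \<omega> u"
      proof
        fix u assume u: "u \<in> {0..T}"
        have hu: "h u = u" unfolding h_def by (rule clip(2)[OF u])
        show "norm (Y u \<omega> - em_step \<delta> \<xi> Y u \<omega>) = D \<omega> u"
          using em_step_on_grid[of \<delta> u Y \<omega>, OF \<delta>(1) _ Y0] u YY unfolding D hu by simp
      qed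
    qed
    fix C :: real and r :: nat and u :: real
    assume C: "0 \<le> C" and inc: "\<And>s t. 0 \<le> s \<Longrightarrow> s \<le> t \<Longrightarrow> t \<le> T \<Longrightarrow> t - s \<le> 1 \<Longrightarrow>
       (\<integral>\<^sup>+\<omega>. ennreal (norm (Y t \<omega> - Y s \<omega>) ^ (2 * r)) \<partial>M) \<le> ennreal (C * (t - s) ^ r)"
    let ?s = "of_int \<lfloor>h u / \<delta>\<rfloor> * \<delta>"
    have b: "0 \<le> ?s" "?s \<le> h u" "h u - ?s \<le> \<delta>" "h u \<le> T"
      using floor_grid_bounds[OF _ \<delta>(1), of "h u"] h[of u] by auto
    have "(\<integral>\<^sup>+\<omega>. ennreal (D \<omega> u ^ (2 * r)) \<partial>M) = (\<integral>\<^sup>+\<omega>. ennreal (norm (Y (h u) \<omega> - Y ?s \<omega>) ^ (2 * r)) \<partial>M)"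
    proof (rule nn_integral_cong_AE)
      show "AE \<omega> in M. ennreal (D \<omega> u ^ (2 * r)) = ennreal (norm (Y (h u) \<omega> - Y ?s \<omega>) ^ (2 * r))"
        using YY by eventually_elim (simp add: D)
    qed
    also have "\<dots> \<le> ennreal (C * (h u - ?s) ^ r)" using b \<delta> by (intro inc) auto
    also have "\<dots> \<le> ennreal (C * \<delta> ^ r)" using b C by (intro ennreal_leI mult_left_mono power_mono) auto
    finally show "(\<integral>\<^sup>+\<omega>. ennreal (D \<omega> u ^ (2 * r)) \<partial>M) \<le> ennreal (C * \<delta> ^ r)" .
  qed
qed

text \<open>Before time \<open>\<tau>\<close> the delayed arguments of \<open>X\<close> and of the scheme coincide.  Later, at time \<open>u\<close>, their distance is at most the error on the previous horizon
plus the discretisation error at time \<open>u - \<tau>\<close>.  Thus the error satisfies the hypotheses of the Gronwall estimate with a forcing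
term that is of order \<open>\<delta>\<^sup>1\<^sup>/\<^sup>2\<close> by the induction hypothesis and the bounds on increments, and it vanishes at time \<open>0\<close>.\<close>

lemma em_error_horizon:
  assumes sol: "sdde_solution M F W \<tau> T b \<sigma> \<xi> X"
  shows "\<forall>r. even r \<longrightarrow> 1 \<le> r \<longrightarrow> (\<exists>C\<ge>0. \<forall>\<delta> Y. 0 < \<delta> \<longrightarrow> \<delta> < 1 \<longrightarrow> euler_maruyama M F W \<tau> T b \<sigma> \<xi> \<delta> Y \<longrightarrow>
    (\<integral>\<^sup>+\<omega>. (SUP u\<in>{0..horizon i}. ennreal (norm (X u \<omega> - Y u \<omega>) ^ (2 * r))) \<partial>M) \<le> ennreal (C * \<delta> ^ r))"
proof (induction i)
  note admX = solution_admissible[OF sol]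
  have xX: "AE \<omega> in M. \<forall>\<theta>\<in>{-\<tau>..0}. X \<theta> \<omega> = \<xi> \<theta> \<omega>"
    using admX unfolding admissible_def ito_process_def by blast
  have init: "AE \<omega> in M. X 0 \<omega> = Y 0 \<omega>" if em: "euler_maruyama M F W \<tau> T b \<sigma> \<xi> \<delta> Y" for \<delta> Y
  proof -
    have xY: "AE \<omega> in M. \<forall>\<theta>\<in>{-\<tau>..0}. Y \<theta> \<omega> = \<xi> \<theta> \<omega>"
      using em unfolding euler_maruyama_def ito_process_def by blast
    from xX xY show ?thesis
    proof eventually_elim
      fix \<omega> assume "\<forall>\<theta>\<in>{-\<tau>..0}. X \<theta> \<omega> = \<xi> \<theta> \<omega>" "\<forall>\<theta>\<in>{-\<tau>..0}. Y \<theta> \<omega> = \<xi> \<theta> \<omega>"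
      moreover have "(0::real) \<in> {-\<tau>..0}" using \<tau>0 by simp
      ultimately show "X 0 \<omega> = Y 0 \<omega>" by (metis (no_types))
    qed
  qed
  {
    case 0
    show ?case
    proof (intro allI impI exI[of _ 0] conjI)
      fix r :: nat and \<delta> Y assume r: "even r" "1 \<le> r" and em: "euler_maruyama M F W \<tau> T b \<sigma> \<xi> \<delta> Y"
      have p: "(0::real) ^ (2 * r) = 0" using r by (cases r) auto
      have "AE \<omega> in M. (SUP u\<in>{0..horizon 0}. ennreal (norm (X u \<omega> - Y u \<omega>) ^ (2 * r))) = 0"
        using init[OF em] by eventually_elim (simp add: horizon(4) p)
      then have "(\<integral>\<^sup>+\<omega>. (SUP u\<in>{0..horizon 0}. ennreal (norm (X u \<omega> - Y u \<omega>) ^ (2 * r))) \<partial>M) = (\<integral>\<^sup>+\<omega>. 0 \<partial>M)"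
        by (rule nn_integral_cong_AE)
      then show "(\<integral>\<^sup>+\<omega>. (SUP u\<in>{0..horizon 0}. ennreal (norm (X u \<omega> - Y u \<omega>) ^ (2 * r))) \<partial>M) \<le> ennreal (0 * \<delta> ^ r)" by simp
    qed simp
  next
    case (Suc i)
    show ?case
    proof (intro allI impI)
      fix r :: nat assume r: "even r" "1 \<le> r"
      let ?p = "2 * r"
      have r2: "even (2 * r)" "1 \<le> 2 * r" using r by auto
      obtain C1 where C1: "0 \<le> C1" "\<And>f H Z s t. admissible f H Z \<Longrightarrow> 0 \<le> s \<Longrightarrow> s \<le> t \<Longrightarrow> t \<le> T \<Longrightarrow> t - s \<le> 1 \<Longrightarrow>
          (\<integral>\<^sup>+\<omega>. ennreal (norm (Z t \<omega> - Z s \<omega>) ^ (2 * r)) \<partial>M) \<le> ennreal (C1 * (t - s) ^ r)"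
        by (rule admissible_increments[OF r], rule that; assumption)
      obtain C2 where C2: "0 \<le> C2" "\<And>f H Z s t. admissible f H Z \<Longrightarrow> 0 \<le> s \<Longrightarrow> s \<le> t \<Longrightarrow> t \<le> T \<Longrightarrow> t - s \<le> 1 \<Longrightarrow>
          (\<integral>\<^sup>+\<omega>. ennreal (norm (Z t \<omega> - Z s \<omega>) ^ (2 * (2 * r))) \<partial>M) \<le> ennreal (C2 * (t - s) ^ (2 * r))"
        by (rule admissible_increments[OF r2], rule that; assumption)
      obtain C3 where C3: "0 \<le> C3" "\<And>f H Z. admissible f H Z \<Longrightarrow>
          (\<integral>\<^sup>+\<omega>. ennreal ((1 + (B\<xi> + rsup T Z \<omega>) ^ d) ^ (2 * (2 * r))) \<partial>M) \<le> ennreal C3"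
        by (rule admissible_poly_moments[OF r2 d1], rule that; assumption)
      obtain C4 where C4: "0 \<le> C4" "\<And>\<delta> Y. 0 < \<delta> \<Longrightarrow> \<delta> < 1 \<Longrightarrow> euler_maruyama M F W \<tau> T b \<sigma> \<xi> \<delta> Y \<Longrightarrow>
          (\<integral>\<^sup>+\<omega>. (SUP u\<in>{0..horizon i}. ennreal (norm (X u \<omega> - Y u \<omega>) ^ (2 * (2 * r)))) \<partial>M) \<le> ennreal (C4 * \<delta> ^ (2 * r))"
        using Suc[rule_format, OF r2] by blast
      define CG where "CG = L ^ (2 * ?p) * (2 ^ (2 * ?p) * (C3 + C3))"
      have CG0: "0 \<le> CG" using L0 C3(1) by (simp add: CG_def)
      define K where "K = 3 ^ ?p * (L ^ ?p * C1 + (CG + C4) + (CG + C2))"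
      have K0: "0 \<le> K" using L0 C1(1) C2(1) CG0 C4(1) by (simp add: K_def)
      define g where "g = gronwall_const (CARD('n) * CARD('m)) r L T"
      have g0: "0 \<le> g" unfolding g_def by (rule gronwall_const_nonneg[OF L0])
      have main: "(\<integral>\<^sup>+\<omega>. (SUP u\<in>{0..horizon (Suc i)}. ennreal (norm (X u \<omega> - Y u \<omega>) ^ ?p)) \<partial>M) \<le> ennreal (g * (T * K) * \<delta> ^ r)"
        if \<delta>: "0 < \<delta>" "\<delta> < 1" and em: "euler_maruyama M F W \<tau> T b \<sigma> \<xi> \<delta> Y" for \<delta> Y
      proof -
        let ?X' = "\<lambda>u \<omega>. em_step \<delta> \<xi> Y u \<omega>"
        note admY = em_admissible[OF em \<delta>(1)]
        obtain IX where limX: "ito_limit M F W T (\<lambda>t \<omega>. \<sigma> (X t \<omega>) (X (t - \<tau>) \<omega>)) IX"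
          and mX: "\<And>u. u \<in> {0..T} \<Longrightarrow> X u \<in> borel_measurable (F u)"
          and contX: "AE \<omega> in M. continuous_on {0..T} (\<lambda>u. X u \<omega>)"
          and xX: "AE \<omega> in M. \<forall>\<theta>\<in>{-\<tau>..0}. X \<theta> \<omega> = \<xi> \<theta> \<omega>"
          and intX: "AE \<omega> in M. set_integrable lborel {0..T} (\<lambda>u. b (X u \<omega>) (X (u - \<tau>) \<omega>))"
          and incX: "AE \<omega> in M. ito_increments T X (\<lambda>u \<omega>. b (X u \<omega>) (X (u - \<tau>) \<omega>)) IX \<omega>"
          by (rule ito_processD[OF conjunct1[OF admX[unfolded admissible_def]] T0 \<tau>0], rule that; assumption)
        obtain IY where limY: "ito_limit M F W T (\<lambda>t \<omega>. \<sigma> (?X' t \<omega>) (?X' (t - \<tau>) \<omega>)) IY"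
          and mY: "\<And>u. u \<in> {0..T} \<Longrightarrow> Y u \<in> borel_measurable (F u)"
          and contY: "AE \<omega> in M. continuous_on {0..T} (\<lambda>u. Y u \<omega>)"
          and xY: "AE \<omega> in M. \<forall>\<theta>\<in>{-\<tau>..0}. Y \<theta> \<omega> = \<xi> \<theta> \<omega>"
          and intY: "AE \<omega> in M. set_integrable lborel {0..T} (\<lambda>u. b (?X' u \<omega>) (?X' (u - \<tau>) \<omega>))"
          and incY: "AE \<omega> in M. ito_increments T Y (\<lambda>u \<omega>. b (?X' u \<omega>) (?X' (u - \<tau>) \<omega>)) IY \<omega>"
          by (rule ito_processD[OF conjunct1[OF admY[unfolded admissible_def]] T0 \<tau>0], rule that; assumption)
        obtain D :: "'a \<Rightarrow> real \<Rightarrow> real" where Dm: "case_prod D \<in> borel_measurable (M \<Otimes>\<^sub>M lborel)" and D0: "\<And>\<omega> u. 0 \<le> D \<omega> u"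
          and De: "AE \<omega> in M. \<forall>u\<in>{0..T}. norm (Y u \<omega> - ?X' u \<omega>) = D \<omega> u"
          and DC: "\<And>C r u. 0 \<le> C \<Longrightarrow> (\<And>s t. 0 \<le> s \<Longrightarrow> s \<le> t \<Longrightarrow> t \<le> T \<Longrightarrow> t - s \<le> 1 \<Longrightarrow>
             (\<integral>\<^sup>+\<omega>. ennreal (norm (Y t \<omega> - Y s \<omega>) ^ (2 * r)) \<partial>M) \<le> ennreal (C * (t - s) ^ r)) \<Longrightarrow>
             (\<integral>\<^sup>+\<omega>. ennreal (D \<omega> u ^ (2 * r)) \<partial>M) \<le> ennreal (C * \<delta> ^ r)"
          using discretisation_error[OF em \<delta>] by blast
        have D1: "(\<integral>\<^sup>+\<omega>. ennreal (D \<omega> u ^ ?p) \<partial>M) \<le> ennreal (C1 * \<delta> ^ r)" for u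
          by (rule DC[OF C1(1) C1(2)[OF admY]])
        have D2: "(\<integral>\<^sup>+\<omega>. ennreal (D \<omega> u ^ (2 * ?p)) \<partial>M) \<le> ennreal (C2 * \<delta> ^ ?p)" for u
          by (rule DC[OF C2(1) C2(2)[OF admY]])
        let ?e = "\<lambda>u \<omega>. X u \<omega> - Y u \<omega>"
        let ?f = "\<lambda>u \<omega>. b (X u \<omega>) (X (u - \<tau>) \<omega>) - b (?X' u \<omega>) (?X' (u - \<tau>) \<omega>)"
        let ?H = "\<lambda>u \<omega>. \<sigma> (X u \<omega>) (X (u - \<tau>) \<omega>) - \<sigma> (?X' u \<omega>) (?X' (u - \<tau>) \<omega>)"
        let ?I = "\<lambda>u \<omega>. IX u \<omega> - IY u \<omega>"
        let ?N = "\<lambda>u \<omega>. norm (X u \<omega>) + norm (Y u \<omega>)"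
        have em': "?e u \<in> borel_measurable M" if "u \<in> {0..T}" for u
          by (intro borel_measurable_diff measurable_F[OF mX[OF that]] measurable_F[OF mY[OF that]])
        have contE: "AE \<omega> in M. continuous_on {0..T} (\<lambda>u. ?e u \<omega>)"
          using contX contY by eventually_elim (intro continuous_intros)
        \<comment> \<open>The error on the previous horizon.\<close>
        define m where "m = rsup (horizon i) ?e"
        have m0: "0 \<le> m \<omega>" for \<omega> by (simp add: m_def rsup_nonneg)
        have mm: "m \<in> borel_measurable M"
          unfolding m_def by (rule rsup_measurable, rule em') (use horizon(2)[of i] in auto)
        have mC: "(\<integral>\<^sup>+\<omega>. ennreal (m \<omega> ^ (2 * ?p)) \<partial>M) \<le> ennreal (C4 * \<delta> ^ ?p)"
        proof -
          have "AE \<omega> in M. ennreal (m \<omega> ^ (2 * ?p)) \<le> (SUP u\<in>{0..horizon i}. ennreal (norm (?e u \<omega>) ^ (2 * ?p)))"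
            using contE
          proof eventually_elim
            fix \<omega> assume "continuous_on {0..T} (\<lambda>u. ?e u \<omega>)"
            then have "continuous_on {0..horizon i} (\<lambda>u. ?e u \<omega>)"
              by (rule continuous_on_subset) (use horizon(2)[of i] in auto)
            then show "ennreal (m \<omega> ^ (2 * ?p)) \<le> (SUP u\<in>{0..horizon i}. ennreal (norm (?e u \<omega>) ^ (2 * ?p)))"
              unfolding m_def by (rule rsup_power_le[of _ ?e \<omega>, OF horizon(1)])
          qed
          then have "(\<integral>\<^sup>+\<omega>. ennreal (m \<omega> ^ (2 * ?p)) \<partial>M) \<le> (\<integral>\<^sup>+\<omega>. (SUP u\<in>{0..horizon i}. ennreal (norm (?e u \<omega>) ^ (2 * ?p))) \<partial>M)"
            by (rule nn_integral_mono_AE)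
          also have "\<dots> \<le> ennreal (C4 * \<delta> ^ ?p)" by (rule C4(2)[OF \<delta> em])
          finally show ?thesis .
        qed
        \<comment> \<open>Bounds for the powers of the delayed arguments of \<open>X\<close> and of the scheme.\<close>
        define a where "a \<omega> = 1 + (B\<xi> + rsup T X \<omega>) ^ d" for \<omega>
        define a' where "a' \<omega> = 1 + (B\<xi> + rsup T Y \<omega>) ^ d" for \<omega>
        have a0: "0 \<le> a \<omega>" "0 \<le> a' \<omega>" for \<omega>
          unfolding a_def a'_def using B\<xi>0 rsup_nonneg[of T X \<omega>] rsup_nonneg[of T Y \<omega>] by (intro add_nonneg_nonneg zero_le_power; simp)+
        have am: "a \<in> borel_measurable M" "a' \<in> borel_measurable M"
          unfolding a_def[abs_def] a'_def[abs_def]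
          using rsup_admissible_measurable[OF admX] rsup_admissible_measurable[OF admY] by measurable
        define \<Gamma> where "\<Gamma> \<omega> = L * (a \<omega> + a' \<omega>)" for \<omega>
        have \<Gamma>0: "0 \<le> \<Gamma> \<omega>" for \<omega> unfolding \<Gamma>_def using L0 a0[of \<omega>] by simp
        have \<Gamma>m: "\<Gamma> \<in> borel_measurable M" unfolding \<Gamma>_def[abs_def] using am by measurable
        have \<Gamma>C: "(\<integral>\<^sup>+\<omega>. ennreal (\<Gamma> \<omega> ^ (2 * ?p)) \<partial>M) \<le> ennreal CG"
        proof -
          have "(\<integral>\<^sup>+\<omega>. ennreal (\<Gamma> \<omega> ^ (2 * ?p)) \<partial>M)
            \<le> (\<integral>\<^sup>+\<omega>. ennreal (L ^ (2 * ?p)) * (ennreal (2 ^ (2 * ?p)) * (ennreal (a \<omega> ^ (2 * ?p)) + ennreal (a' \<omega> ^ (2 * ?p)))) \<partial>M)"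
          proof (rule nn_integral_mono)
            fix \<omega>
            have "\<Gamma> \<omega> ^ (2 * ?p) = L ^ (2 * ?p) * (a \<omega> + a' \<omega>) ^ (2 * ?p)" by (simp only: \<Gamma>_def power_mult_distrib)
            also have "\<dots> \<le> L ^ (2 * ?p) * (2 ^ (2 * ?p) * (a \<omega> ^ (2 * ?p) + a' \<omega> ^ (2 * ?p)))"
              using L0 a0[of \<omega>] by (intro mult_left_mono add_power_le zero_le_power)
            finally have "ennreal (\<Gamma> \<omega> ^ (2 * ?p)) \<le> ennreal (L ^ (2 * ?p) * (2 ^ (2 * ?p) * (a \<omega> ^ (2 * ?p) + a' \<omega> ^ (2 * ?p))))" by (rule ennreal_leI)
            also have "\<dots> = ennreal (L ^ (2 * ?p)) * (ennreal (2 ^ (2 * ?p)) * (ennreal (a \<omega> ^ (2 * ?p)) + ennreal (a' \<omega> ^ (2 * ?p))))"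
              using L0 a0[of \<omega>] by (simp only: ennreal_mult ennreal_plus mult_nonneg_nonneg add_nonneg_nonneg zero_le_power zero_le_numeral)
            finally show "ennreal (\<Gamma> \<omega> ^ (2 * ?p)) \<le> ennreal (L ^ (2 * ?p)) * (ennreal (2 ^ (2 * ?p)) * (ennreal (a \<omega> ^ (2 * ?p)) + ennreal (a' \<omega> ^ (2 * ?p))))" .
          qed
          also have "\<dots> = ennreal (L ^ (2 * ?p)) * (ennreal (2 ^ (2 * ?p)) * ((\<integral>\<^sup>+\<omega>. ennreal (a \<omega> ^ (2 * ?p)) \<partial>M) + (\<integral>\<^sup>+\<omega>. ennreal (a' \<omega> ^ (2 * ?p)) \<partial>M)))"
            using am by (simp add: nn_integral_cmult nn_integral_add)
          also have "\<dots> \<le> ennreal (L ^ (2 * ?p)) * (ennreal (2 ^ (2 * ?p)) * (ennreal C3 + ennreal C3))"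
            unfolding a_def a'_def by (intro mult_left_mono add_mono C3(2)[OF admX] C3(2)[OF admY]) simp_all
          also have "\<dots> = ennreal CG"
            unfolding CG_def using L0 C3(1) by (simp only: ennreal_mult ennreal_plus mult_nonneg_nonneg add_nonneg_nonneg zero_le_power zero_le_numeral)
          finally show ?thesis .
        qed
        \<comment> \<open>Present discretisation error, then the two contributions of the delayed argument, each weighted with \<open>\<Gamma>\<close>.\<close>
        define P where "P u \<omega> = L * D \<omega> u + \<Gamma> \<omega> * m \<omega> + \<Gamma> \<omega> * D \<omega> (u - \<tau>)" for u \<omega>
        \<comment> \<open>With this weight in \<open>mult_le_weighted_squares\<close> both squares have expectation of order \<open>\<delta>\<^sup>r\<close>.\<close>
        define \<epsilon> where "\<epsilon> = \<delta> ^ r"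
        have \<epsilon>: "0 < \<epsilon>" using \<delta> by (simp add: \<epsilon>_def)
        have \<epsilon>2: "\<delta> ^ ?p = \<epsilon> * \<epsilon>" by (simp only: \<epsilon>_def mult_2 power_add)
        \<comment> \<open>An upper bound for \<open>P\<^sup>2\<^sup>r\<close> without products of random variables.\<close>
        define q where "q \<omega> u = 3 ^ ?p * (L ^ ?p * D \<omega> u ^ ?p + (\<epsilon> * \<Gamma> \<omega> ^ (2 * ?p) + 1 / \<epsilon> * m \<omega> ^ (2 * ?p))
          + (\<epsilon> * \<Gamma> \<omega> ^ (2 * ?p) + 1 / \<epsilon> * D \<omega> (u - \<tau>) ^ (2 * ?p)))" for \<omega> u
        have P0: "0 \<le> P u \<omega>" for u \<omega>
          unfolding P_def using L0 \<Gamma>0[of \<omega>] m0[of \<omega>] D0[of \<omega>] by simp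
        have Pq: "P u \<omega> ^ ?p \<le> q \<omega> u" for u \<omega>
        proof -
          have w: "(x * y) ^ ?p \<le> \<epsilon> * x ^ (2 * ?p) + 1 / \<epsilon> * y ^ (2 * ?p)" for x y :: real
          proof -
            have sq: "(z ^ ?p)\<^sup>2 = z ^ (2 * ?p)" for z :: real by (simp only: power_mult[symmetric] mult.commute)
            show ?thesis using mult_le_weighted_squares[OF \<epsilon>, of "x ^ ?p" "y ^ ?p"] unfolding sq power_mult_distrib by simp
          qed
          have "P u \<omega> ^ ?p \<le> 3 ^ ?p * ((L * D \<omega> u) ^ ?p + (\<Gamma> \<omega> * m \<omega>) ^ ?p + (\<Gamma> \<omega> * D \<omega> (u - \<tau>)) ^ ?p)"
            unfolding P_def using L0 \<Gamma>0[of \<omega>] m0[of \<omega>] D0[of \<omega>] by (intro add3_power_le mult_nonneg_nonneg)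
          also have "\<dots> \<le> q \<omega> u"
            unfolding q_def power_mult_distrib[of L] by (intro mult_left_mono add_mono w order_refl) simp
          finally show ?thesis .
        qed
        have q0: "0 \<le> q \<omega> u" for \<omega> u
          using Pq[of u \<omega>] zero_le_power[OF P0[of u \<omega>], of ?p] by linarith
        have Dm': "(\<lambda>z. D (fst z) (snd z - \<tau>)) \<in> borel_measurable (M \<Otimes>\<^sub>M lborel)"
        proof -
          have "(\<lambda>z. (fst z, snd z - \<tau>)) \<in> (M \<Otimes>\<^sub>M lborel) \<rightarrow>\<^sub>M (M \<Otimes>\<^sub>M lborel)" by measurable
          from measurable_compose[OF this Dm] show ?thesis by simp
        qed
        have Dm1: "(\<lambda>z. D (fst z) (snd z)) \<in> borel_measurable (M \<Otimes>\<^sub>M lborel)"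
          using Dm by (simp add: case_prod_beta')
        have qm: "(\<lambda>z. q (fst z) (snd z)) \<in> borel_measurable (M \<Otimes>\<^sub>M lborel)"
        proof -
          have [measurable]: "(\<lambda>z. \<Gamma> (fst z)) \<in> borel_measurable (M \<Otimes>\<^sub>M lborel)" "(\<lambda>z. m (fst z)) \<in> borel_measurable (M \<Otimes>\<^sub>M lborel)"
            by (rule measurable_compose[OF measurable_fst \<Gamma>m], rule measurable_compose[OF measurable_fst mm])
          note [measurable] = Dm1 Dm'
          show ?thesis unfolding q_def by measurable
        qed
        have Du: "(\<lambda>\<omega>. D \<omega> u) \<in> borel_measurable M" for u
          using measurable_compose[OF measurable_Pair2'[of u lborel M] Dm1] by simp
        define Q where "Q \<omega> = (\<integral>\<^sup>+u\<in>{0..T}. ennreal (q \<omega> u) \<partial>lborel)" for \<omega>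
        have Qpm: "(\<lambda>z. ennreal (q (fst z) (snd z)) * indicator {0..T} (snd z)) \<in> borel_measurable (M \<Otimes>\<^sub>M lborel)"
          using qm by measurable
        have Qm: "Q \<in> borel_measurable M"
          unfolding Q_def[abs_def] using Qpm by (intro lborel.borel_measurable_nn_integral) (simp add: case_prod_beta')
        have qC: "(\<integral>\<^sup>+\<omega>. ennreal (q \<omega> u) \<partial>M) \<le> ennreal (K * \<epsilon>)" for u
        proof -
          have "(\<integral>\<^sup>+\<omega>. ennreal (q \<omega> u) \<partial>M) = (\<integral>\<^sup>+\<omega>. ennreal (3 ^ ?p) * (ennreal (L ^ ?p) * ennreal (D \<omega> u ^ ?p)
              + (ennreal \<epsilon> * ennreal (\<Gamma> \<omega> ^ (2 * ?p)) + ennreal (1 / \<epsilon>) * ennreal (m \<omega> ^ (2 * ?p)))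
              + (ennreal \<epsilon> * ennreal (\<Gamma> \<omega> ^ (2 * ?p)) + ennreal (1 / \<epsilon>) * ennreal (D \<omega> (u - \<tau>) ^ (2 * ?p)))) \<partial>M)"
          proof (rule nn_integral_cong)
            fix \<omega>
            have nn: "0 \<le> \<epsilon>" "0 \<le> 1 / \<epsilon>" using \<epsilon> by auto
            show "ennreal (q \<omega> u) = ennreal (3 ^ ?p) * (ennreal (L ^ ?p) * ennreal (D \<omega> u ^ ?p)
              + (ennreal \<epsilon> * ennreal (\<Gamma> \<omega> ^ (2 * ?p)) + ennreal (1 / \<epsilon>) * ennreal (m \<omega> ^ (2 * ?p)))
              + (ennreal \<epsilon> * ennreal (\<Gamma> \<omega> ^ (2 * ?p)) + ennreal (1 / \<epsilon>) * ennreal (D \<omega> (u - \<tau>) ^ (2 * ?p))))"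
              unfolding q_def using nn L0 \<Gamma>0[of \<omega>] m0[of \<omega>] D0[of \<omega> u] D0[of \<omega> "u - \<tau>"]
              by (simp only: ennreal_mult ennreal_plus mult_nonneg_nonneg add_nonneg_nonneg zero_le_power zero_le_numeral)
          qed
          also have "\<dots> = ennreal (3 ^ ?p) * (ennreal (L ^ ?p) * (\<integral>\<^sup>+\<omega>. ennreal (D \<omega> u ^ ?p) \<partial>M)
              + (ennreal \<epsilon> * (\<integral>\<^sup>+\<omega>. ennreal (\<Gamma> \<omega> ^ (2 * ?p)) \<partial>M) + ennreal (1 / \<epsilon>) * (\<integral>\<^sup>+\<omega>. ennreal (m \<omega> ^ (2 * ?p)) \<partial>M))
              + (ennreal \<epsilon> * (\<integral>\<^sup>+\<omega>. ennreal (\<Gamma> \<omega> ^ (2 * ?p)) \<partial>M) + ennreal (1 / \<epsilon>) * (\<integral>\<^sup>+\<omega>. ennreal (D \<omega> (u - \<tau>) ^ (2 * ?p)) \<partial>M)))"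
            using Du[of u] Du[of "u - \<tau>"] \<Gamma>m mm by (simp add: nn_integral_cmult nn_integral_add)
          also have "\<dots> \<le> ennreal (3 ^ ?p) * (ennreal (L ^ ?p) * ennreal (C1 * \<epsilon>)
              + (ennreal \<epsilon> * ennreal CG + ennreal (1 / \<epsilon>) * ennreal (C4 * (\<epsilon> * \<epsilon>)))
              + (ennreal \<epsilon> * ennreal CG + ennreal (1 / \<epsilon>) * ennreal (C2 * (\<epsilon> * \<epsilon>))))"
            using D1[of u] \<Gamma>C mC D2[of "u - \<tau>"] unfolding \<epsilon>2 \<epsilon>_def[symmetric]
            by (intro mult_left_mono add_mono) simp_all
          also have "\<dots> = ennreal (3 ^ ?p * (L ^ ?p * (C1 * \<epsilon>) + (\<epsilon> * CG + 1 / \<epsilon> * (C4 * (\<epsilon> * \<epsilon>))) + (\<epsilon> * CG + 1 / \<epsilon> * (C2 * (\<epsilon> * \<epsilon>)))))"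
          proof -
            have nn: "0 \<le> \<epsilon>" "0 \<le> 1 / \<epsilon>" using \<epsilon> by auto
            show ?thesis using nn L0 C1(1) C2(1) C4(1) CG0
              by (simp only: ennreal_mult ennreal_plus mult_nonneg_nonneg add_nonneg_nonneg zero_le_power zero_le_numeral)
          qed
          also have "3 ^ ?p * (L ^ ?p * (C1 * \<epsilon>) + (\<epsilon> * CG + 1 / \<epsilon> * (C4 * (\<epsilon> * \<epsilon>))) + (\<epsilon> * CG + 1 / \<epsilon> * (C2 * (\<epsilon> * \<epsilon>)))) = K * \<epsilon>"
          proof -
            have c: "1 / \<epsilon> * (x * (\<epsilon> * \<epsilon>)) = x * \<epsilon>" for x using \<epsilon> by simp
            show ?thesis unfolding c K_def by (simp only: distrib_left distrib_right mult_ac add_ac)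
          qed
          finally show ?thesis .
        qed
        have QC: "(\<integral>\<^sup>+\<omega>. Q \<omega> \<partial>M) \<le> ennreal (T * (K * \<epsilon>))"
        proof -
          interpret pair_sigma_finite M lborel ..
          have "(\<integral>\<^sup>+\<omega>. Q \<omega> \<partial>M) = (\<integral>\<^sup>+u. (\<integral>\<^sup>+\<omega>. ennreal (q \<omega> u) * indicator {0..T} u \<partial>M) \<partial>lborel)"
            unfolding Q_def using Qpm by (intro Fubini'[symmetric]) (simp add: case_prod_beta')
          also have "\<dots> \<le> (\<integral>\<^sup>+u. ennreal (K * \<epsilon>) * indicator {0..T} u \<partial>lborel)"
            by (rule nn_integral_mono) (use qC in \<open>auto simp: indicator_def\<close>)
          also have "\<dots> = ennreal (K * \<epsilon>) * ennreal T" using T0 by (subst nn_integral_cmult_indicator) auto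
          also have "\<dots> = ennreal (T * (K * \<epsilon>))" using T0 K0 \<epsilon> by (subst ennreal_mult) (auto simp: mult.commute)
          finally show ?thesis .
        qed
        interpret ito_gronwall M F W T ?H ?I ?N ?e ?f P Q L "horizon (Suc i)" r
        proof (intro ito_gronwall.intro ito_gronwall_axioms.intro)
          show "controlled_ito M F W T ?H ?I ?N"
          proof
            show "0 < T" by (rule T0)
            show "ito_limit M F W T ?H ?I" by (rule ito_limit_diff[OF limX limY])
            show "?N u \<in> borel_measurable (F u)" if "u \<in> {0..T}" for u
              by (intro borel_measurable_add measurable_compose[OF mX[OF that] borel_measurable_norm] measurable_compose[OF mY[OF that] borel_measurable_norm])
            show "AE \<omega> in M. continuous_on {0..T} (\<lambda>u. ?N u \<omega>)"
              using contX contY by eventually_elim (intro continuous_intros)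
            fix R
            obtain BX where BX: "AE \<omega> in M. \<forall>u\<in>{0..T}. (\<forall>y\<in>{0..u}. norm (X y \<omega>) \<le> R) \<longrightarrow> norm (\<sigma> (X u \<omega>) (X (u - \<tau>) \<omega>)) \<le> BX"
              using admissible_H_controlled[OF admX, of R] by blast
            obtain BY where BY: "AE \<omega> in M. \<forall>u\<in>{0..T}. (\<forall>y\<in>{0..u}. norm (Y y \<omega>) \<le> R) \<longrightarrow> norm (\<sigma> (?X' u \<omega>) (?X' (u - \<tau>) \<omega>)) \<le> BY"
              using admissible_H_controlled[OF admY, of R] by blast
            have "AE \<omega> in M. \<forall>u\<in>{0..T}. (\<forall>y\<in>{0..u}. ?N y \<omega> \<le> R) \<longrightarrow> norm (?H u \<omega>) \<le> BX + BY"
              using BX BY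
            proof eventually_elim
              fix \<omega> assume BX: "\<forall>u\<in>{0..T}. (\<forall>y\<in>{0..u}. norm (X y \<omega>) \<le> R) \<longrightarrow> norm (\<sigma> (X u \<omega>) (X (u - \<tau>) \<omega>)) \<le> BX"
                and BY: "\<forall>u\<in>{0..T}. (\<forall>y\<in>{0..u}. norm (Y y \<omega>) \<le> R) \<longrightarrow> norm (\<sigma> (?X' u \<omega>) (?X' (u - \<tau>) \<omega>)) \<le> BY"
              show "\<forall>u\<in>{0..T}. (\<forall>y\<in>{0..u}. ?N y \<omega> \<le> R) \<longrightarrow> norm (?H u \<omega>) \<le> BX + BY"
              proof (intro ballI impI)
                fix u assume u: "u \<in> {0..T}" and N: "\<forall>y\<in>{0..u}. ?N y \<omega> \<le> R"
                have "norm (X y \<omega>) \<le> R \<and> norm (Y y \<omega>) \<le> R" if "y \<in> {0..u}" for y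
                  using bspec[OF N that] norm_ge_zero[of "X y \<omega>"] norm_ge_zero[of "Y y \<omega>"] by linarith
                then have "norm (\<sigma> (X u \<omega>) (X (u - \<tau>) \<omega>)) \<le> BX" "norm (\<sigma> (?X' u \<omega>) (?X' (u - \<tau>) \<omega>)) \<le> BY"
                  using BX BY u by blast+
                then show "norm (?H u \<omega>) \<le> BX + BY" by (intro norm_triangle_le_diff add_mono)
              qed
            qed
            then show "\<exists>B. AE \<omega> in M. \<forall>u\<in>{0..T}. (\<forall>y\<in>{0..u}. ?N y \<omega> \<le> R) \<longrightarrow> norm (?H u \<omega>) \<le> B" by blast
          qed
          show "0 < horizon (Suc i)" "horizon (Suc i) \<le> T" by (rule horizon)+
          show "even r" "1 \<le> r" by (rule r)+
          show "0 \<le> L" by (rule L0)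
          show "?e u \<in> borel_measurable M" if "u \<in> {0..T}" for u by (rule em'[OF that])
          show "AE \<omega> in M. continuous_on {0..T} (\<lambda>u. ?e u \<omega>)" by (rule contE)
          show "norm (?e u \<omega>) \<le> ?N u \<omega>" for u \<omega> by (rule norm_triangle_ineq4)
          show "AE \<omega> in M. ito_increments T ?e ?f ?I \<omega>"
            using incX incY intX intY
          proof eventually_elim
            fix \<omega> assume incX: "ito_increments T X (\<lambda>u \<omega>. b (X u \<omega>) (X (u - \<tau>) \<omega>)) IX \<omega>"
              and incY: "ito_increments T Y (\<lambda>u \<omega>. b (?X' u \<omega>) (?X' (u - \<tau>) \<omega>)) IY \<omega>"
              and intX: "set_integrable lborel {0..T} (\<lambda>u. b (X u \<omega>) (X (u - \<tau>) \<omega>))"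
              and intY: "set_integrable lborel {0..T} (\<lambda>u. b (?X' u \<omega>) (?X' (u - \<tau>) \<omega>))"
            show "ito_increments T ?e ?f ?I \<omega>" unfolding ito_increments_def
            proof (intro allI impI)
              fix s t assume st: "0 \<le> s" "s \<le> t" "t \<le> T"
              have i: "(LINT u:{s..t}|lborel. ?f u \<omega>) = (LINT u:{s..t}|lborel. b (X u \<omega>) (X (u - \<tau>) \<omega>)) - (LINT u:{s..t}|lborel. b (?X' u \<omega>) (?X' (u - \<tau>) \<omega>))"
                by (rule set_integral_diff(2)[OF set_integral_Icc_diff(2)[OF intX st] set_integral_Icc_diff(2)[OF intY st]])
              show "?e t \<omega> = ?e s \<omega> + (LINT u:{s..t}|lborel. ?f u \<omega>) + (?I t \<omega> - ?I s \<omega>)"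
              proof -
                have eX: "X t \<omega> - X s \<omega> = (LINT u:{s..t}|lborel. b (X u \<omega>) (X (u - \<tau>) \<omega>)) + (IX t \<omega> - IX s \<omega>)"
                  using ito_incrementsD[OF incX st] by simp
                have eY: "Y t \<omega> - Y s \<omega> = (LINT u:{s..t}|lborel. b (?X' u \<omega>) (?X' (u - \<tau>) \<omega>)) + (IY t \<omega> - IY s \<omega>)"
                  using ito_incrementsD[OF incY st] by simp
                have "?e t \<omega> = ?e s \<omega> + ((X t \<omega> - X s \<omega>) - (Y t \<omega> - Y s \<omega>))" by simp
                then show ?thesis unfolding i eX eY by (simp add: algebra_simps)
              qed
            qed
          qed
          show "AE \<omega> in M. linear_growth (horizon (Suc i)) L ?e ?f ?H P \<omega>"
            using AE_space contX contY xX xY De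
          proof eventually_elim
            fix \<omega> assume \<omega>: "\<omega> \<in> space M"
              and contX: "continuous_on {0..T} (\<lambda>u. X u \<omega>)" and contY: "continuous_on {0..T} (\<lambda>u. Y u \<omega>)"
              and xX: "\<forall>\<theta>\<in>{-\<tau>..0}. X \<theta> \<omega> = \<xi> \<theta> \<omega>" and xY: "\<forall>\<theta>\<in>{-\<tau>..0}. Y \<theta> \<omega> = \<xi> \<theta> \<omega>"
              and De: "\<forall>u\<in>{0..T}. norm (Y u \<omega> - ?X' u \<omega>) = D \<omega> u"
            have Y0: "Y 0 \<omega> = \<xi> 0 \<omega>" by (rule bspec[OF xY]) (use \<tau>0 in simp)
            have Xle: "norm (X u \<omega>) \<le> rsup T X \<omega>" if "u \<in> {0..T}" for u
              by (rule rsup_attained(2)[of T X \<omega>, OF _ contX that]) (use T0 in simp)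
            have Yle: "norm (Y u \<omega>) \<le> rsup T Y \<omega>" if "u \<in> {0..T}" for u
              by (rule rsup_attained(2)[of T Y \<omega>, OF _ contY that]) (use T0 in simp)
            have "continuous_on {0..T} (\<lambda>u. ?e u \<omega>)" using contX contY by (intro continuous_intros)
            then have ce: "continuous_on {0..horizon i} (\<lambda>u. ?e u \<omega>)"
              by (rule continuous_on_subset) (use horizon(2)[of i] in auto)
            have ele: "norm (?e w \<omega>) \<le> m \<omega>" if "w \<in> {0..horizon i}" for w
              unfolding m_def by (rule rsup_attained(2)[of _ ?e \<omega>, OF horizon(1) ce that])
            show "linear_growth (horizon (Suc i)) L ?e ?f ?H P \<omega>" unfolding linear_growth_def
            proof (intro ballI allI impI)
              fix u B assume u: "u \<in> {0..horizon (Suc i)}" and B: "\<forall>y\<in>{0..u}. norm (?e y \<omega>) \<le> B"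
              have uT: "u \<in> {0..T}" using u horizon(2)[of "Suc i"] by simp
              let ?w = "u - \<tau>"
              let ?x1 = "X u \<omega>" and ?x2 = "?X' u \<omega>" and ?y1 = "X ?w \<omega>" and ?y2 = "?X' ?w \<omega>"
              have "norm (?x1 - ?x2) \<le> norm (?e u \<omega>) + norm (Y u \<omega> - ?x2)"
                using norm_triangle_ineq[of "?e u \<omega>" "Y u \<omega> - ?x2"] by simp
              also have "\<dots> \<le> B + D \<omega> u"
              proof (rule add_mono)
                show "norm (?e u \<omega>) \<le> B" by (rule bspec[OF B]) (use u in simp)
                show "norm (Y u \<omega> - ?x2) \<le> D \<omega> u" using bspec[OF De uT] by simp
              qed
              finally have x12: "norm (?x1 - ?x2) \<le> B + D \<omega> u" .
              have y: "norm ?y1 \<le> B\<xi> + rsup T X \<omega> \<and> norm ?y2 \<le> B\<xi> + rsup T Y \<omega> \<and> norm (?y1 - ?y2) \<le> m \<omega> + D \<omega> ?w"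
              proof (cases "?w \<le> 0")
                case True
                then have w: "?w \<in> {-\<tau>..0}" using u by simp
                have e1: "?y1 = \<xi> ?w \<omega>" by (rule bspec[OF xX w])
                have e2: "?y2 = \<xi> ?w \<omega>" using True by (simp add: em_step_def)
                show ?thesis unfolding e1 e2
                  using \<xi>_bounded[OF \<omega> w] rsup_nonneg[of T X \<omega>] rsup_nonneg[of T Y \<omega>] m0[of \<omega>] D0[of \<omega> ?w] by simp
              next
                case False
                have wh: "?w \<in> {0..horizon i}" using False horizon(5)[of u i] u by simp
                have wT: "?w \<in> {0..T}" using wh horizon(2)[of i] by simp
                have e2: "?y2 = Y (of_int \<lfloor>?w / \<delta>\<rfloor> * \<delta>) \<omega>" using False by (intro em_step_on_grid[of \<delta> _ Y \<omega>, OF \<delta>(1) _ Y0]) simp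
                have gT: "of_int \<lfloor>?w / \<delta>\<rfloor> * \<delta> \<in> {0..T}"
                  using floor_grid_bounds[OF _ \<delta>(1), of ?w] wT by auto
                have "norm ?y2 \<le> rsup T Y \<omega>" unfolding e2 by (rule Yle[OF gT])
                moreover have "norm ?y1 \<le> rsup T X \<omega>" by (rule Xle[OF wT])
                moreover have "norm (?y1 - ?y2) \<le> norm (?e ?w \<omega>) + norm (Y ?w \<omega> - ?y2)"
                  using norm_triangle_ineq[of "?e ?w \<omega>" "Y ?w \<omega> - ?y2"] by simp
                ultimately show ?thesis using ele[OF wh] bspec[OF De wT] B\<xi>0 by linarith
              qed
              have "L * (1 + norm ?y1 ^ d + norm ?y2 ^ d) \<le> \<Gamma> \<omega>"
              proof -
                have "norm ?y1 ^ d \<le> (B\<xi> + rsup T X \<omega>) ^ d" "norm ?y2 ^ d \<le> (B\<xi> + rsup T Y \<omega>) ^ d"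
                  using y by (intro power_mono; simp)+
                then have "1 + norm ?y1 ^ d + norm ?y2 ^ d \<le> a \<omega> + a' \<omega>" unfolding a_def a'_def by linarith
                then show ?thesis unfolding \<Gamma>_def using L0 by (rule mult_left_mono)
              qed
              then have "L * (1 + norm ?y1 ^ d + norm ?y2 ^ d) * norm (?y1 - ?y2) \<le> \<Gamma> \<omega> * (m \<omega> + D \<omega> ?w)"
                using y \<Gamma>0[of \<omega>] by (intro mult_mono) auto
              moreover have "L * norm (?x1 - ?x2) \<le> L * (B + D \<omega> u)" using x12 L0 by (rule mult_left_mono)
              ultimately have "L * norm (?x1 - ?x2) + L * (1 + norm ?y1 ^ d + norm ?y2 ^ d) * norm (?y1 - ?y2) \<le> L * B + P u \<omega>"
                unfolding P_def by (simp add: algebra_simps)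
              then show "norm (?f u \<omega>) \<le> L * B + P u \<omega> \<and> norm (?H u \<omega>) \<le> L * B + P u \<omega>"
                using b_lipschitz[of ?x1 ?y1 ?x2 ?y2] \<sigma>_lipschitz[of ?x1 ?y1 ?x2 ?y2] by linarith
            qed
          qed
          show "0 \<le> P u \<omega>" for u \<omega> by (rule P0)
          show "(\<lambda>u. indicator {0..horizon (Suc i)} u * P u \<omega>) \<in> borel_measurable borel" if \<omega>: "\<omega> \<in> space M" for \<omega>
          proof -
            have [measurable]: "(\<lambda>u. D \<omega> u) \<in> borel_measurable borel"
              using measurable_compose[OF measurable_Pair1'[OF \<omega>, of lborel] Dm1] by simp
            show ?thesis unfolding P_def by measurable
          qed
          show "Q \<in> borel_measurable M" by (rule Qm)
          show "AE \<omega> in M. (\<integral>\<^sup>+u\<in>{0..horizon (Suc i)}. ennreal (P u \<omega> ^ (2 * r)) \<partial>lborel) \<le> Q \<omega>"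
            unfolding Q_def
            by (intro AE_I2 nn_integral_mono) (use Pq horizon(2)[of "Suc i"] in \<open>auto simp: indicator_def intro!: ennreal_leI\<close>)
        qed
        have e00: "(\<integral>\<^sup>+\<omega>. ennreal (norm (?e 0 \<omega>) ^ ?p) \<partial>M) = 0"
        proof -
          have p: "(0::real) ^ ?p = 0" using r by (cases r) auto
          have "(\<integral>\<^sup>+\<omega>. ennreal (norm (?e 0 \<omega>) ^ ?p) \<partial>M) = (\<integral>\<^sup>+\<omega>. 0 \<partial>M)"
            by (rule nn_integral_cong_AE) (use init[OF em] in \<open>eventually_elim, simp add: p\<close>)
          then show ?thesis by simp
        qed
        have "(\<integral>\<^sup>+\<omega>. (SUP u\<in>{0..horizon (Suc i)}. ennreal (norm (?e u \<omega>) ^ ?p)) \<partial>M)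
          \<le> ennreal g * ((\<integral>\<^sup>+\<omega>. ennreal (norm (?e 0 \<omega>) ^ ?p) \<partial>M) + (\<integral>\<^sup>+\<omega>. Q \<omega> \<partial>M))"
          unfolding g_def by (rule moment_bound)
        also have "\<dots> \<le> ennreal g * ennreal (T * (K * \<epsilon>))"
          unfolding e00 using QC by (intro mult_left_mono) simp_all
        also have "\<dots> = ennreal (g * (T * K) * \<delta> ^ r)"
          using g0 T0 K0 \<epsilon> unfolding \<epsilon>_def[symmetric] by (subst ennreal_mult[symmetric]) (auto simp: mult.assoc)
        finally show ?thesis .
      qed
      show "\<exists>C\<ge>0. \<forall>\<delta> Y. 0 < \<delta> \<longrightarrow> \<delta> < 1 \<longrightarrow> euler_maruyama M F W \<tau> T b \<sigma> \<xi> \<delta> Y \<longrightarrow>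
        (\<integral>\<^sup>+\<omega>. (SUP u\<in>{0..horizon (Suc i)}. ennreal (norm (X u \<omega> - Y u \<omega>) ^ (2 * r))) \<partial>M) \<le> ennreal (C * \<delta> ^ r)"
        by (rule exI[of _ "g * (T * K)"]) (use main g0 T0 K0 in auto)
    qed
  }
qed

text \<open>For \<open>p \<le> 2 r\<close> one has \<open>z\<^sup>p \<le> \<delta>\<^sup>p\<^sup>/\<^sup>2 (1 + z\<^sup>2\<^sup>r / \<delta>\<^sup>r)\<close>, as is seen by comparing \<open>z\<close> with \<open>\<delta>\<^sup>1\<^sup>/\<^sup>2\<close>.\<close>

theorem em_error:
  assumes sol: "sdde_solution M F W \<tau> T b \<sigma> \<xi> X" and p: "0 \<le> p"
  obtains C where "0 < C" "\<And>\<delta> Y. 0 < \<delta> \<Longrightarrow> \<delta> < 1 \<Longrightarrow> euler_maruyama M F W \<tau> T b \<sigma> \<xi> \<delta> Y \<Longrightarrow>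
    (\<integral>\<^sup>+\<omega>. (SUP s\<in>{0..T}. ennreal (norm (X s \<omega> - Y s \<omega>) powr p)) \<partial>M) \<le> ennreal (C * \<delta> powr (p / 2))"
proof -
  define r where "r = 2 * (nat \<lceil>p\<rceil> + 1)"
  have r: "even r" "1 \<le> r" by (simp_all add: r_def)
  have pr: "p \<le> real (2 * r)" using real_nat_ceiling_ge[of p] by (simp add: r_def)
  obtain i where i: "horizon i = T" using horizon_eventually by blast
  obtain C where C: "0 \<le> C" "\<And>\<delta> Y. 0 < \<delta> \<Longrightarrow> \<delta> < 1 \<Longrightarrow> euler_maruyama M F W \<tau> T b \<sigma> \<xi> \<delta> Y \<Longrightarrow>
    (\<integral>\<^sup>+\<omega>. (SUP u\<in>{0..T}. ennreal (norm (X u \<omega> - Y u \<omega>) ^ (2 * r))) \<partial>M) \<le> ennreal (C * \<delta> ^ r)"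
    using em_error_horizon[OF sol, of i, rule_format, OF r] unfolding i by blast
  note admX = solution_admissible[OF sol]
  have main: "(\<integral>\<^sup>+\<omega>. (SUP s\<in>{0..T}. ennreal (norm (X s \<omega> - Y s \<omega>) powr p)) \<partial>M) \<le> ennreal ((1 + C) * \<delta> powr (p / 2))"
    if \<delta>: "0 < \<delta>" "\<delta> < 1" and em: "euler_maruyama M F W \<tau> T b \<sigma> \<xi> \<delta> Y" for \<delta> Y
  proof -
    note admY = em_admissible[OF em \<delta>(1)]
    obtain IX :: "real \<Rightarrow> 'a \<Rightarrow> real ^ 'n" where mX: "\<And>u. u \<in> {0..T} \<Longrightarrow> X u \<in> borel_measurable (F u)"
      and contX: "AE \<omega> in M. continuous_on {0..T} (\<lambda>u. X u \<omega>)"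
      by (rule ito_processD[OF conjunct1[OF admX[unfolded admissible_def]] T0 \<tau>0], rule that; assumption)
    obtain IY :: "real \<Rightarrow> 'a \<Rightarrow> real ^ 'n" where mY: "\<And>u. u \<in> {0..T} \<Longrightarrow> Y u \<in> borel_measurable (F u)"
      and contY: "AE \<omega> in M. continuous_on {0..T} (\<lambda>u. Y u \<omega>)"
      by (rule ito_processD[OF conjunct1[OF admY[unfolded admissible_def]] T0 \<tau>0], rule that; assumption)
    let ?e = "\<lambda>u \<omega>. X u \<omega> - Y u \<omega>"
    define m where "m = rsup T ?e"
    have mm: "m \<in> borel_measurable M"
      unfolding m_def by (rule rsup_measurable) (intro borel_measurable_diff measurable_F[OF mX] measurable_F[OF mY])
    have contE: "AE \<omega> in M. continuous_on {0..T} (\<lambda>u. ?e u \<omega>)"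
      using contX contY by eventually_elim (intro continuous_intros)
    have m0: "0 \<le> m \<omega>" for \<omega> by (simp add: m_def rsup_nonneg)
    define c where "c = \<delta> powr (p / 2)"
    have c0: "0 \<le> c" by (simp add: c_def)
    have \<delta>r: "0 \<le> 1 / \<delta> ^ r" using \<delta> by simp
    have pw: "z powr p \<le> c * (1 + 1 / \<delta> ^ r * z ^ (2 * r))" if z: "0 \<le> z" for z
    proof -
      define x where "x = z / sqrt \<delta>"
      have s: "0 < sqrt \<delta>" using \<delta> by simp
      have x0: "0 \<le> x" using z s by (simp add: x_def)
      have "x powr p \<le> 1 + x ^ (2 * r)"
      proof (cases "x \<le> 1")
        case True
        then have "x powr p \<le> 1" using x0 p by (intro powr_le1) auto
        then show ?thesis using x0 by (simp add: add_increasing2)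
      next
        case False
        then have "x powr p \<le> x powr real (2 * r)" by (intro powr_mono pr) simp
        also have "\<dots> = x ^ (2 * r)" using False by (intro powr_realpow) simp
        finally show ?thesis by simp
      qed
      moreover have "z powr p = sqrt \<delta> powr p * x powr p"
        using s x0 by (simp add: x_def powr_mult[symmetric])
      moreover have "sqrt \<delta> powr p = c" using \<delta> by (simp add: c_def powr_half_sqrt[symmetric] powr_powr)
      moreover have "x ^ (2 * r) = 1 / \<delta> ^ r * z ^ (2 * r)"
      proof -
        have "sqrt \<delta> ^ (2 * r) = \<delta> ^ r" using \<delta> by (simp add: power_mult)
        then show ?thesis by (simp add: x_def power_divide)
      qed
      ultimately show ?thesis using c0 mult_left_mono by metis
    qed
    have "(\<integral>\<^sup>+\<omega>. (SUP s\<in>{0..T}. ennreal (norm (?e s \<omega>) powr p)) \<partial>M)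
      \<le> (\<integral>\<^sup>+\<omega>. ennreal c * (ennreal 1 + ennreal (1 / \<delta> ^ r) * ennreal (m \<omega> ^ (2 * r))) \<partial>M)"
    proof (rule nn_integral_mono_AE)
      show "AE \<omega> in M. (SUP s\<in>{0..T}. ennreal (norm (?e s \<omega>) powr p)) \<le> ennreal c * (ennreal 1 + ennreal (1 / \<delta> ^ r) * ennreal (m \<omega> ^ (2 * r)))"
        using contE
      proof eventually_elim
        fix \<omega> assume cont: "continuous_on {0..T} (\<lambda>u. ?e u \<omega>)"
        show "(SUP s\<in>{0..T}. ennreal (norm (?e s \<omega>) powr p)) \<le> ennreal c * (ennreal 1 + ennreal (1 / \<delta> ^ r) * ennreal (m \<omega> ^ (2 * r)))"
        proof (rule SUP_least)
          fix s assume s: "s \<in> {0..T}"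
          have "norm (?e s \<omega>) \<le> m \<omega>"
            unfolding m_def by (rule rsup_attained(2)[of T ?e \<omega>, OF _ cont s]) (use T0 in simp)
          then have "norm (?e s \<omega>) powr p \<le> m \<omega> powr p" using p by (intro powr_mono2) auto
          also have "\<dots> \<le> c * (1 + 1 / \<delta> ^ r * m \<omega> ^ (2 * r))" by (rule pw[OF m0])
          finally have "ennreal (norm (?e s \<omega>) powr p) \<le> ennreal (c * (1 + 1 / \<delta> ^ r * m \<omega> ^ (2 * r)))" by (rule ennreal_leI)
          also have "\<dots> = ennreal c * (ennreal 1 + ennreal (1 / \<delta> ^ r) * ennreal (m \<omega> ^ (2 * r)))"
            using c0 \<delta>r m0[of \<omega>] by (simp only: ennreal_mult ennreal_plus mult_nonneg_nonneg add_nonneg_nonneg zero_le_power zero_le_one)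
          finally show "ennreal (norm (?e s \<omega>) powr p) \<le> ennreal c * (ennreal 1 + ennreal (1 / \<delta> ^ r) * ennreal (m \<omega> ^ (2 * r)))" .
        qed
      qed
    qed
    also have "\<dots> = ennreal c * (ennreal 1 + ennreal (1 / \<delta> ^ r) * (\<integral>\<^sup>+\<omega>. ennreal (m \<omega> ^ (2 * r)) \<partial>M))"
      using mm by (simp add: nn_integral_cmult nn_integral_add emeasure_space_1)
    also have "\<dots> \<le> ennreal c * (ennreal 1 + ennreal (1 / \<delta> ^ r) * ennreal (C * \<delta> ^ r))"
    proof (intro mult_left_mono add_left_mono)
      have "AE \<omega> in M. ennreal (m \<omega> ^ (2 * r)) \<le> (SUP u\<in>{0..T}. ennreal (norm (?e u \<omega>) ^ (2 * r)))"
        using contE by eventually_elim (unfold m_def, rule rsup_power_le[of T ?e], use T0 in simp, assumption)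
      then have "(\<integral>\<^sup>+\<omega>. ennreal (m \<omega> ^ (2 * r)) \<partial>M) \<le> (\<integral>\<^sup>+\<omega>. (SUP u\<in>{0..T}. ennreal (norm (?e u \<omega>) ^ (2 * r))) \<partial>M)"
        by (rule nn_integral_mono_AE)
      also have "\<dots> \<le> ennreal (C * \<delta> ^ r)" by (rule C(2)[OF \<delta> em])
      finally show "(\<integral>\<^sup>+\<omega>. ennreal (m \<omega> ^ (2 * r)) \<partial>M) \<le> ennreal (C * \<delta> ^ r)" .
    qed simp_all
    also have "\<dots> = ennreal (c * (1 + 1 / \<delta> ^ r * (C * \<delta> ^ r)))"
    proof -
      have "0 \<le> C * \<delta> ^ r" using C(1) \<delta> by simp
      then show ?thesis
        using c0 \<delta>r by (simp only: ennreal_mult ennreal_plus mult_nonneg_nonneg add_nonneg_nonneg zero_le_one)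
    qed
    also have "c * (1 + 1 / \<delta> ^ r * (C * \<delta> ^ r)) = (1 + C) * \<delta> powr (p / 2)" using \<delta> by (simp add: c_def)
    finally show ?thesis .
  qed
  show thesis by (rule that[of "1 + C"]) (use main C(1) in auto)
qed

end

section \<open>The convergence rate\<close>

lemma powr_le_1_plus_power:
  assumes "0 \<le> (x::real)" "0 \<le> q" "q \<le> real d" shows "x powr q \<le> 1 + x ^ d"
proof (cases "x \<le> 1")
  case True
  then have "x powr q \<le> 1" using assms by (intro powr_le1) auto
  then show ?thesis using assms by (simp add: add_increasing2)
next
  case False
  then have "x powr q \<le> x powr real d" using assms by (intro powr_mono) auto
  also have "\<dots> = x ^ d" using False by (intro powr_realpow) simp
  finally show ?thesis by simp
qed

lemma polynomial_weight_le:
  fixes x y :: "'b::real_normed_vector"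
  assumes V: "V \<le> K * (1 + norm x powr q + norm y powr q)" and q: "0 \<le> q" "q \<le> real d" and K: "0 \<le> K" "3 * K \<le> L"
  shows "V \<le> L * (1 + norm x ^ d + norm y ^ d)"
proof -
  note V
  also have "K * (1 + norm x powr q + norm y powr q) \<le> K * (3 * (1 + norm x ^ d + norm y ^ d))"
  proof (rule mult_left_mono[OF _ K(1)])
    have *: "1 + s + t \<le> 3 * (1 + a + b)" if "0 \<le> a" "0 \<le> b" "s \<le> 1 + a" "t \<le> 1 + b" for s t a b :: real
    proof -
      have "1 + s + t \<le> 1 + (1 + a) + (1 + b)" using that(3,4) by (intro add_mono order_refl)
      also have "\<dots> \<le> 3 * (1 + a + b)" using that(1,2) by simp
      finally show ?thesis .
    qed
    show "1 + norm x powr q + norm y powr q \<le> 3 * (1 + norm x ^ d + norm y ^ d)"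
      by (rule *) (simp_all add: powr_le_1_plus_power[OF norm_ge_zero q])
  qed
  also have "\<dots> = 3 * K * (1 + norm x ^ d + norm y ^ d)" by simp
  also have "\<dots> \<le> L * (1 + norm x ^ d + norm y ^ d)" using K(2) by (rule mult_right_mono) simp
  finally show ?thesis .
qed

lemma growth_of_lipschitz:
  fixes c :: "'x::real_normed_vector \<Rightarrow> 'y::real_normed_vector \<Rightarrow> 'z::real_normed_vector"
  assumes lip: "\<And>x1 x2 y1 y2. norm (c x1 y1 - c x2 y2) \<le> L * norm (x1 - x2) + L * (1 + norm y1 ^ d + norm y2 ^ d) * norm (y1 - y2)"
    and L: "0 \<le> L" and d: "1 \<le> d" and G: "norm (c 0 0) + 2 * L \<le> G"
  shows "norm (c x y) \<le> L * norm x + G * (1 + norm y ^ (d + 1))"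
proof -
  let ?z = "norm y ^ (d + 1)"
  have z0: "0 \<le> ?z" by simp
  have "norm y \<le> 1 + ?z"
  proof (cases "norm y \<le> 1")
    case False
    then have "norm y ^ 1 \<le> norm y ^ (d + 1)" by (intro power_increasing) auto
    then show ?thesis by simp
  qed (use z0 in linarith)
  then have "(1 + norm y ^ d) * norm y \<le> 2 * (1 + ?z)" using z0 by (simp add: algebra_simps)
  then have y: "L * ((1 + norm y ^ d) * norm y) \<le> L * (2 * (1 + ?z))" using L by (rule mult_left_mono)
  have d0: "(0::real) ^ d = 0" using d by (cases d) auto
  have "norm (c x y) \<le> norm (c 0 0) + norm (c x y - c 0 0)" using norm_triangle_ineq[of "c 0 0" "c x y - c 0 0"] by simp
  also have "\<dots> \<le> norm (c 0 0) + (L * norm x + L * ((1 + norm y ^ d) * norm y))"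
    using lip[of x y 0 0] d0 by (simp add: mult.assoc)
  also have "\<dots> \<le> norm (c 0 0) * (1 + ?z) + (L * norm x + L * (2 * (1 + ?z)))"
    using y mult_left_mono[of 1 "1 + ?z" "norm (c 0 0)"] z0 by simp
  also have "\<dots> = L * norm x + (norm (c 0 0) + 2 * L) * (1 + ?z)" by (simp add: algebra_simps)
  also have "\<dots> \<le> L * norm x + G * (1 + ?z)" using G z0 by (intro add_left_mono mult_right_mono) auto
  finally show ?thesis .
qed

theorem theorem2p2:
  fixes M :: "'a measure" and F :: "real \<Rightarrow> 'a measure" and W :: "real \<Rightarrow> 'a \<Rightarrow> real ^ 'm"
    and b :: "real ^ 'n \<Rightarrow> real ^ 'n \<Rightarrow> real ^ 'n"
    and \<sigma> :: "real ^ 'n \<Rightarrow> real ^ 'n \<Rightarrow> real ^ 'm ^ 'n"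
    and V\<^sub>1 V\<^sub>2 :: "real ^ 'n \<Rightarrow> real ^ 'n \<Rightarrow> real"
    and \<tau> T L\<^sub>1 L\<^sub>2 K\<^sub>1 K\<^sub>2 q\<^sub>1 q\<^sub>2 p :: real
    and \<xi> X :: "real \<Rightarrow> 'a \<Rightarrow> real ^ 'n"
  assumes "brownian_motion M F W"
    and "0 < \<tau>" and "0 < T"
    and "0 < L\<^sub>1" and "0 < L\<^sub>2" and "0 < K\<^sub>1" and "0 < K\<^sub>2" and "1 \<le> q\<^sub>1" and "1 \<le> q\<^sub>2"
    and "\<And>x y. 0 \<le> V\<^sub>1 x y" and "\<And>x y. 0 \<le> V\<^sub>2 x y"
    and "\<And>x\<^sub>1 x\<^sub>2 y\<^sub>1 y\<^sub>2. norm (b x\<^sub>1 y\<^sub>1 - b x\<^sub>2 y\<^sub>2)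
           \<le> L\<^sub>1 * norm (x\<^sub>1 - x\<^sub>2) + V\<^sub>1 y\<^sub>1 y\<^sub>2 * norm (y\<^sub>1 - y\<^sub>2)"
    and "\<And>x\<^sub>1 x\<^sub>2 y\<^sub>1 y\<^sub>2. hs_norm (\<sigma> x\<^sub>1 y\<^sub>1 - \<sigma> x\<^sub>2 y\<^sub>2)
           \<le> L\<^sub>2 * norm (x\<^sub>1 - x\<^sub>2) + V\<^sub>2 y\<^sub>1 y\<^sub>2 * norm (y\<^sub>1 - y\<^sub>2)"
    and "\<And>x y. V\<^sub>1 x y \<le> K\<^sub>1 * (1 + norm x powr q\<^sub>1 + norm y powr q\<^sub>1)"
    and "\<And>x y. V\<^sub>2 x y \<le> K\<^sub>2 * (1 + norm x powr q\<^sub>2 + norm y powr q\<^sub>2)"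
    and "bounded_initial_segment M F \<tau> \<xi>"
    and "sdde_solution M F W \<tau> T b \<sigma> \<xi> X"
    and "2 \<le> p"
  shows "\<exists>C>0. \<forall>(k::nat) (l::nat) (\<delta>::real) Y.
           0 < k \<longrightarrow> 0 < l \<longrightarrow> \<delta> = \<tau> / real k \<longrightarrow> \<delta> = T / real l \<longrightarrow> \<delta> < 1 \<longrightarrow>
           euler_maruyama M F W \<tau> T b \<sigma> \<xi> \<delta> Y \<longrightarrow>
           (\<integral>\<^sup>+\<omega>. (SUP s\<in>{0..T}. ennreal (norm (X s \<omega> - Y s \<omega>) powr p)) \<partial>M)
             \<le> ennreal (C * \<delta> powr (p / 2))"
proof -
  define d where "d = nat \<lceil>max q\<^sub>1 q\<^sub>2\<rceil>"
  have q: "q\<^sub>1 \<le> real d" "q\<^sub>2 \<le> real d" unfolding d_def by linarith+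
  have "0 < real d" using q assms(8) by linarith
  then have d1: "1 \<le> d" by simp
  \<comment> \<open>The factor \<open>3\<close> absorbs the replacement of real by integer exponents in \<open>polynomial_weight_le\<close>.\<close>
  define L where "L = L\<^sub>1 + L\<^sub>2 + 3 * K\<^sub>1 + 3 * K\<^sub>2"
  have L: "0 \<le> L" "L\<^sub>1 \<le> L" "L\<^sub>2 \<le> L" "3 * K\<^sub>1 \<le> L" "3 * K\<^sub>2 \<le> L" using assms(4-7) by (simp_all add: L_def)
  define G where "G = norm (b 0 0) + norm (\<sigma> 0 0) + 2 * L"
  have G0: "0 \<le> G" using L(1) by (simp add: G_def)
  obtain B where B: "\<And>\<omega> \<theta>. \<omega> \<in> space M \<Longrightarrow> \<theta> \<in> {-\<tau>..0} \<Longrightarrow> norm (\<xi> \<theta> \<omega>) \<le> B"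
    using assms(16) unfolding bounded_initial_segment_def by blast
  have b: "norm (b x1 y1 - b x2 y2) \<le> L * norm (x1 - x2) + L * (1 + norm y1 ^ d + norm y2 ^ d) * norm (y1 - y2)" for x1 x2 y1 y2
  proof -
    have "V\<^sub>1 y1 y2 \<le> L * (1 + norm y1 ^ d + norm y2 ^ d)"
      using assms(6,8) L q by (intro polynomial_weight_le[OF assms(14)]) auto
    then show ?thesis
      using assms(12)[of x1 y1 x2 y2] L(2) by (meson add_mono mult_right_mono norm_ge_zero order_trans)
  qed
  have s: "norm (\<sigma> x1 y1 - \<sigma> x2 y2) \<le> L * norm (x1 - x2) + L * (1 + norm y1 ^ d + norm y2 ^ d) * norm (y1 - y2)" for x1 x2 y1 y2
  proof -
    have "V\<^sub>2 y1 y2 \<le> L * (1 + norm y1 ^ d + norm y2 ^ d)"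
      using assms(7,9) L q by (intro polynomial_weight_le[OF assms(15)]) auto
    then show ?thesis
      using assms(13)[of x1 y1 x2 y2] L(3) unfolding hs_norm_eq_norm by (meson add_mono mult_right_mono norm_ge_zero order_trans)
  qed
  interpret brownian_motion M F W by (rule assms(1))
  interpret sdde_coefficients M F W b \<sigma> \<tau> T L G "\<bar>B\<bar>" d \<xi>
  proof
    show "norm (b x y) \<le> L * norm x + G * (1 + norm y ^ (d + 1))" for x y
      by (rule growth_of_lipschitz[OF b L(1) d1]) (simp add: G_def)
    show "norm (\<sigma> x y) \<le> L * norm x + G * (1 + norm y ^ (d + 1))" for x y
      by (rule growth_of_lipschitz[OF s L(1) d1]) (simp add: G_def)
    show "norm (\<xi> \<theta> \<omega>) \<le> \<bar>B\<bar>" if "\<omega> \<in> space M" "\<theta> \<in> {-\<tau>..0}" for \<omega> \<theta>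
      using B[OF that] by linarith
  qed (fact assms(2) assms(3) L(1) G0 abs_ge_zero d1 b s)+
  have p0: "0 \<le> p" using assms(18) by simp
  obtain C where C: "0 < C" "\<And>\<delta> Y. 0 < \<delta> \<Longrightarrow> \<delta> < 1 \<Longrightarrow> euler_maruyama M F W \<tau> T b \<sigma> \<xi> \<delta> Y \<Longrightarrow>
    (\<integral>\<^sup>+\<omega>. (SUP s\<in>{0..T}. ennreal (norm (X s \<omega> - Y s \<omega>) powr p)) \<partial>M) \<le> ennreal (C * \<delta> powr (p / 2))"
    by (rule em_error[OF assms(17) p0], rule that; assumption)
  show ?thesis
  proof (intro exI[of _ C] conjI allI impI)
    fix k l :: nat and \<delta> :: real and Y
    assume "0 < k" "\<delta> = \<tau> / real k" "\<delta> < 1" and em: "euler_maruyama M F W \<tau> T b \<sigma> \<xi> \<delta> Y"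
    then show "(\<integral>\<^sup>+\<omega>. (SUP s\<in>{0..T}. ennreal (norm (X s \<omega> - Y s \<omega>) powr p)) \<partial>M) \<le> ennreal (C * \<delta> powr (p / 2))"
      using assms(2) by (intro C(2)) simp_all
  qed (rule C(1))
qed

end
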